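(* Let $X\subset \mathbb P^n$ be a curve such that $\operatorname{Trop}(X)\subset \mathbb T^n$ is a tropical complete intersection of tropically smooth hypersurfaces (i.e. $X\cap T$ is the intersection of tropically smooth hypersurfaces $X_1,\dots,X_{n-1}\subset T$ forming a tropical complete intersection). Fix a point $\alpha\in\operatorname{Trop}(X)$, and let $\Lambda\subset \mathbb T^n$ denote the affine tangent space to $\operatorname{Trop}(X)$ at $\alpha$. Assume that $\langle \Lambda \rangle$ is not contained in any $\langle J \rangle$ with $J\subset\{0,\dots,n\}$, $|J|=n-1$. (1) If $\alpha$ is in the relative interior of an edge of $\operatorname{Trop}(X)$, then there is a unique tropical tangent $\beta$ to $\alpha$, and its tropical Plücker coordinates are $$\beta_I=\sum_{j\notin I} -\alpha_j,\qquad I\subset \{0,\ldots,n\},\ |I|=2.$$ (2) Suppose that $\alpha$ is a vertex of $\operatorname{Trop}(X)$, and $\langle \Lambda\rangle \cap (\langle e_i+e_j\rangle + \langle J'\rangle)=\{0\}$ for all $i,j$ and all $J'\subset\{0,\dots,n\}$ with $|J'|=n-3$. Then $\beta$ is a tropical tangent to $\alpha$ if and only if $$\beta_I=\lambda_I+\sum_{j\notin I} -\alpha_j,\qquad I\subset \{0,\ldots,n\},\ |I|=2,$$ with all $\lambda_I\geq 0$, at most one $\lambda_I\neq 0$, and $\lambda_I=0$ if $\langle E \rangle \subset \langle \{0,\ldots,n\}\setminus I \rangle$ for an edge $E$ of $\operatorname{Trop}(X)$ at $\alpha$.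
   Context: $\mathbb K$ is an algebraically closed field of characteristic zero with a nontrivial non-Archimedean valuation $\operatorname{val}:\mathbb K\to\mathbb R\cup\{\infty\}$, $\operatorname{val}(0)=\infty$, with $\operatorname{val}(m)=0$ for every nonzero integer $m$. $T\subset\mathbb P^n$ is the torus where all homogeneous coordinates are nonzero, with character lattice $M=\{w\in\mathbb Z^{n+1}:\sum w_i=0\}$. $\mathbb T^n=\mathbb R^{n+1}/\mathbb R(1,\dots,1)$, and $e_0,\dots,e_n$ are the images of the standard basis vectors. $\operatorname{Trop}:T\to\mathbb T^n$ takes coordinatewise valuations; for $Y\subset\mathbb P^n$ (or $Y\subset T$), $\operatorname{Trop}(Y)$ is the closure of the image of $Y\cap T$. For $J\subset\{0,\dots,n\}$, $\langle J\rangle=\operatorname{span}\{e_i: i\in J\}\subset\mathbb T^n$. For a subset $\Lambda\subset\mathbb T^n$, $\langle\Lambda\rangle$ is the linear span of all differences of elements of $\Lambda$; $\langle e_i+e_j\rangle$ is the span of the vector $e_i+e_j$. The affine tangent space of $\operatorname{Trop}(X)$ at $\alpha$ is the affine span of $\operatorname{Trop}(X)$ in a small neighborhood of $\alpha$. A hypersurface $V(f)\subset T$, $f=\sum_{u\in\mathcal A}c_ux^u$ with $\mathcal A\subset M$ finite and all $c_u\neq0$, has $\operatorname{Trop}(V(f))=\{\alpha: \alpha\cdot u+\operatorname{val}(c_u)\text{ attains its minimum for at least two }u\in\mathcal A\}$, a polyhedral complex in which two points lie in the relative interior of the same cell iff the minimum is attained for the same set of $u$. It is tropically smooth if the regular subdivision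 of $\operatorname{conv}\mathcal A$ induced by the heights $\operatorname{val}(c_u)$ is a unimodular triangulation. Hypersurfaces $Y_1,\dots,Y_k$ form a tropical complete intersection if for all cells $E_i\subset\operatorname{Trop}(Y_i)$, the intersection $E_1\cap\dots\cap E_k$ is empty or has codimension $\sum_i\operatorname{codim}E_i$. In this case $\operatorname{Trop}(Y_1\cap\dots\cap Y_k)=\bigcap\operatorname{Trop}(Y_i)$, with cells the intersections of cells. Tropical tangent: the Grassmannian $\operatorname{Gr}(2,n+1)$ is tropicalized via its Plücker embedding (Plücker coordinates vanishing identically on the image of the Gauss map $P\mapsto T_PX$ are omitted). $\beta\in\operatorname{Trop}(\operatorname{Gr}(2,n+1))$ is a tropical tangent to $\alpha$ if there is a smooth point $P\in X$ with $\operatorname{Trop}(P)=\alpha$ and $\operatorname{Trop}(T_PX)=\beta$, i.e. $\beta_I=\operatorname{val}(p_I(T_PX))$ up to a common additive constant, where $p_I$ are the Plücker coordinates.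
   Formalization: As val need not be onto R, existence in (1) is claimed only when all differences α_i−α_j lie in the value group val(K^* ), and in (2) the λ_I range over that group; otherwise no point P with Trop(P)=α, or no tangent with that λ_I, exists. *)

theory Defs
  imports
    "HOL-Analysis.Analysis"
    "HOL-Library.Poly_Mapping"
    "HOL-Library.Extended_Nat"
    "HOL-Computational_Algebra.Polynomial"
begin

text \<open>
  Conventions. The homogeneous coordinates are indexed by a finite type \<open>'n\<close> with \<open>n + 1\<close>
  elements. A subset of projective space \<open>P\<^sup>n\<close> over \<open>'k\<close> is represented by the set of all its
  homogeneous coordinate vectors, a set of nonzero vectors of \<open>'k ^ 'n\<close>. Similarly a point of
  the tropical torus, the quotient of real \<open>(n + 1)\<close>-space by the line of the all-ones vector, is represented by any of its lifts to \<open>real ^ 'n\<close>, and a subset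
  by its full preimage. So a linear subspace of the quotient is a linear subspace of
  \<open>real ^ 'n\<close> containing the all-ones vector \<open>1\<close>, the zero subspace is the line spanned by \<open>1\<close>,
  dimensions in \<open>real ^ 'n\<close> are one larger than in the quotient, and codimensions agree.
\<close>

definition nonarch_valuation :: "('k::field \<Rightarrow> ereal) \<Rightarrow> bool" where
  "nonarch_valuation val \<longleftrightarrow>
     (\<forall>x. val x \<noteq> -\<infinity>) \<and>
     (\<forall>x. val x = \<infinity> \<longleftrightarrow> x = 0) \<and>
     (\<forall>x y. val (x * y) = val x + val y) \<and>
     (\<forall>x y. min (val x) (val y) \<le> val (x + y))"

definition nontrivial_valuation :: "('k::field \<Rightarrow> ereal) \<Rightarrow> bool" where
  "nontrivial_valuation val \<longleftrightarrow> (\<exists>x. x \<noteq> 0 \<and> val x \<noteq> 0)"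

definition rval :: "('k::zero \<Rightarrow> ereal) \<Rightarrow> 'k \<Rightarrow> real" where
  "rval val x = real_of_ereal (val x)"

definition value_group :: "('k::zero \<Rightarrow> ereal) \<Rightarrow> real set" where
  "value_group val = {rval val x | x. x \<noteq> 0}"

text \<open>The points of the tropical torus that are coordinatewise valuations of points of the torus
  over \<open>'k\<close>. This is all of the tropical torus if \<open>val\<close> is onto the reals; in general only such points
  lie under a point of a curve, and tropical Pluecker vectors of its tangent lines have differences
  in the value group.\<close>

definition val_rational :: "('k::zero \<Rightarrow> ereal) \<Rightarrow> real ^ 'n \<Rightarrow> bool" where
  "val_rational val \<alpha> \<longleftrightarrow> (\<forall>i j. \<alpha> $ i - \<alpha> $ j \<in> value_group val)"


section \<open>Projective algebraic sets, tangent lines and Pluecker coordinates\<close>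

definition mpoly_eval :: "((nat ^ 'n) \<Rightarrow>\<^sub>0 'k) \<Rightarrow> 'k ^ 'n \<Rightarrow> 'k::field" where
  "mpoly_eval F x = (\<Sum>m\<in>Poly_Mapping.keys F. Poly_Mapping.lookup F m * (\<Prod>i\<in>UNIV. x $ i ^ (m $ i)))"

text \<open>The value at \<open>x\<close> of the formal partial derivative with respect to the \<open>i\<close>-th variable.\<close>

definition mpoly_partial :: "'n \<Rightarrow> ((nat ^ 'n) \<Rightarrow>\<^sub>0 'k) \<Rightarrow> 'k ^ 'n \<Rightarrow> 'k::field" where
  "mpoly_partial i F x =
     (\<Sum>m\<in>Poly_Mapping.keys F. Poly_Mapping.lookup F m * of_nat (m $ i) *
        (\<Prod>j\<in>UNIV. x $ j ^ (if j = i then m $ j - 1 else m $ j)))"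

definition homogeneous :: "((nat ^ 'n) \<Rightarrow>\<^sub>0 'k::zero) \<Rightarrow> bool" where
  "homogeneous F \<longleftrightarrow> (\<exists>d. \<forall>m\<in>Poly_Mapping.keys F. (\<Sum>i\<in>UNIV. m $ i) = d)"

definition proj_closed :: "('k::field ^ 'n) set \<Rightarrow> bool" where
  "proj_closed X \<longleftrightarrow>
     (\<exists>S. (\<forall>F\<in>S. homogeneous F) \<and> X = {x. x \<noteq> 0 \<and> (\<forall>F\<in>S. mpoly_eval F x = 0)})"

definition proj_irreducible :: "('k::field ^ 'n) set \<Rightarrow> bool" where
  "proj_irreducible Z \<longleftrightarrow>
     proj_closed Z \<and> Z \<noteq> {} \<and>
     (\<forall>A B. proj_closed A \<and> proj_closed B \<and> Z \<subseteq> A \<union> B \<longrightarrow> Z \<subseteq> A \<or> Z \<subseteq> B)"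

definition irreducible_component :: "('k::field ^ 'n) set \<Rightarrow> ('k ^ 'n) set \<Rightarrow> bool" where
  "irreducible_component X Z \<longleftrightarrow>
     proj_irreducible Z \<and> Z \<subseteq> X \<and> (\<forall>Z'. proj_irreducible Z' \<and> Z \<subseteq> Z' \<and> Z' \<subseteq> X \<longrightarrow> Z' = Z)"

text \<open>Krull dimension: the supremum of the lengths of chains of irreducible closed subsets.\<close>

definition proj_dim :: "('k::field ^ 'n) set \<Rightarrow> enat" where
  "proj_dim X =
     Sup {enat k | k. \<exists>Z :: nat \<Rightarrow> ('k ^ 'n) set.
            (\<forall>i\<le>k. proj_irreducible (Z i) \<and> Z i \<subseteq> X) \<and> (\<forall>i<k. Z i \<subset> Z (Suc i))}"

definition proj_curve :: "('k::field ^ 'n) set \<Rightarrow> bool" where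
  "proj_curve X \<longleftrightarrow>
     proj_closed X \<and> X \<noteq> {} \<and> (\<forall>Z. irreducible_component X Z \<longrightarrow> proj_dim Z = 1)"

text \<open>The linear subspace of \<open>'k ^ 'n\<close> whose projectivization is the embedded projective tangent
  space of \<open>X\<close> at \<open>P\<close>.\<close>

definition tangent_space :: "('k::field ^ 'n) set \<Rightarrow> 'k ^ 'n \<Rightarrow> ('k ^ 'n) set" where
  "tangent_space X P =
     {y. \<forall>F. homogeneous F \<and> (\<forall>x\<in>X. mpoly_eval F x = 0) \<longrightarrow>
             (\<Sum>i\<in>UNIV. mpoly_partial i F P * y $ i) = 0}"

text \<open>Intended for \<open>X\<close> with \<open>proj_curve X\<close>, which has dimension one at each of its points; so \<open>P\<close> is
  smooth iff the projective tangent space is a line.\<close>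

definition curve_smooth_at :: "('k::field ^ 'n) set \<Rightarrow> 'k ^ 'n \<Rightarrow> bool" where
  "curve_smooth_at X P \<longleftrightarrow> P \<in> X \<and> vec.dim (tangent_space X P) = 2"

text \<open>The Pluecker coordinate of the line spanned by \<open>y\<close> and \<open>z\<close> with index \<open>{i, j}\<close>. Exchanging
  \<open>i\<close> and \<open>j\<close> changes its sign, which affects neither its vanishing nor its valuation.\<close>

definition pluecker :: "'k::field ^ 'n \<Rightarrow> 'k ^ 'n \<Rightarrow> 'n \<Rightarrow> 'n \<Rightarrow> 'k" where
  "pluecker y z i j = y $ i * z $ j - y $ j * z $ i"

definition gauss_vanishing :: "('k::field ^ 'n) set \<Rightarrow> 'n \<Rightarrow> 'n \<Rightarrow> bool" where
  "gauss_vanishing X i j \<longleftrightarrow>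
     (\<forall>P y z. curve_smooth_at X P \<and> tangent_space X P = vec.span {y, z} \<longrightarrow> pluecker y z i j = 0)"


section \<open>Tropicalization\<close>

definition torus :: "('k::zero ^ 'n) set" where
  "torus = {x. \<forall>i. x $ i \<noteq> 0}"

definition trop_point :: "('k::zero \<Rightarrow> ereal) \<Rightarrow> 'k ^ 'n \<Rightarrow> real ^ 'n" where
  "trop_point val x = (\<chi> i. rval val (x $ i))"

definition trop_eq :: "real ^ 'n \<Rightarrow> real ^ 'n \<Rightarrow> bool" where
  "trop_eq a b \<longleftrightarrow> (\<exists>t. a = b + t *\<^sub>R 1)"

definition Trop :: "('k::zero \<Rightarrow> ereal) \<Rightarrow> ('k ^ 'n) set \<Rightarrow> (real ^ 'n) set" where
  "Trop val Y = closure {\<alpha>. \<exists>x \<in> Y \<inter> torus. trop_eq \<alpha> (trop_point val x)}"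

text \<open>A tropical Pluecker vector \<open>\<beta>\<close> is a real function on the two-element subsets of \<open>'n\<close>, up to
  a common additive constant; its values on other sets are irrelevant. It has only finite
  entries, so all coordinates of the tangent line that are not omitted must be nonzero.\<close>

definition tropical_tangent ::
  "('k::field \<Rightarrow> ereal) \<Rightarrow> ('k ^ 'n) set \<Rightarrow> real ^ 'n \<Rightarrow> ('n set \<Rightarrow> real) \<Rightarrow> bool" where
  "tropical_tangent val X \<alpha> \<beta> \<longleftrightarrow>
     (\<exists>P y z c. P \<in> torus \<and> curve_smooth_at X P \<and> trop_eq \<alpha> (trop_point val P) \<and>
        tangent_space X P = vec.span {y, z} \<and>
        (\<forall>i j. i \<noteq> j \<and> \<not> gauss_vanishing X i j \<longrightarrow>
           pluecker y z i j \<noteq> 0 \<and> \<beta> {i, j} = rval val (pluecker y z i j) + c))"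


section \<open>Laurent polynomials and tropical hypersurfaces\<close>

text \<open>A Laurent polynomial on the torus is a finitely supported function on the lattice of integer
  vectors, with support contained in \<open>char_lattice\<close>.\<close>

definition char_lattice :: "(int ^ 'n) set" where
  "char_lattice = {w. (\<Sum>i\<in>UNIV. w $ i) = 0}"

definition lattice_vec :: "int ^ 'n \<Rightarrow> real ^ 'n" where
  "lattice_vec u = (\<chi> i. real_of_int (u $ i))"

definition laurent_eval :: "((int ^ 'n) \<Rightarrow>\<^sub>0 'k) \<Rightarrow> 'k ^ 'n \<Rightarrow> 'k::field" where
  "laurent_eval f x =
     (\<Sum>u\<in>Poly_Mapping.keys f. Poly_Mapping.lookup f u * (\<Prod>i\<in>UNIV. x $ i powi (u $ i)))"

definition torus_hypersurface :: "((int ^ 'n) \<Rightarrow>\<^sub>0 'k) \<Rightarrow> ('k::field ^ 'n) set" where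
  "torus_hypersurface f = {x \<in> torus. laurent_eval f x = 0}"

definition term_val :: "('k::zero \<Rightarrow> ereal) \<Rightarrow> ((int ^ 'n) \<Rightarrow>\<^sub>0 'k) \<Rightarrow> real ^ 'n \<Rightarrow> int ^ 'n \<Rightarrow> real" where
  "term_val val f \<alpha> u = \<alpha> \<bullet> lattice_vec u + rval val (Poly_Mapping.lookup f u)"

definition min_terms :: "('k::zero \<Rightarrow> ereal) \<Rightarrow> ((int ^ 'n) \<Rightarrow>\<^sub>0 'k) \<Rightarrow> real ^ 'n \<Rightarrow> (int ^ 'n) set" where
  "min_terms val f \<alpha> =
     {u \<in> Poly_Mapping.keys f. \<forall>w\<in>Poly_Mapping.keys f. term_val val f \<alpha> u \<le> term_val val f \<alpha> w}"

definition trop_hypersurface :: "('k::zero \<Rightarrow> ereal) \<Rightarrow> ((int ^ 'n) \<Rightarrow>\<^sub>0 'k) \<Rightarrow> (real ^ 'n) set" where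
  "trop_hypersurface val f = {\<alpha>. card (min_terms val f \<alpha>) \<ge> 2}"

text \<open>The closed cells. The one listed for \<open>\<alpha>\<close> is the cell that has \<open>\<alpha>\<close> in its relative interior,
  i.e. the closure of the set of points with the same minimal terms as \<open>\<alpha>\<close>.\<close>

definition hypersurface_cells ::
  "('k::zero \<Rightarrow> ereal) \<Rightarrow> ((int ^ 'n) \<Rightarrow>\<^sub>0 'k) \<Rightarrow> (real ^ 'n) set set" where
  "hypersurface_cells val f =
     {{\<gamma>. min_terms val f \<alpha> \<subseteq> min_terms val f \<gamma>} | \<alpha>. \<alpha> \<in> trop_hypersurface val f}"

text \<open>All cells (of all dimensions) of the subdivision of the Newton polytope given by the lower
  faces of the lifted polytope: the vector \<open>\<alpha>\<close> selects the lower face on which the functional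
  \<open>(\<alpha>, 1)\<close> is minimal.\<close>

definition regular_subdivision ::
  "('k::zero \<Rightarrow> ereal) \<Rightarrow> ((int ^ 'n) \<Rightarrow>\<^sub>0 'k) \<Rightarrow> (real ^ 'n) set set" where
  "regular_subdivision val f = {convex hull (lattice_vec ` min_terms val f \<alpha>) | \<alpha>. True}"

text \<open>Unimodularity is relative to the lattice points in the affine span of the simplex, so it makes
  sense for simplices of any dimension.\<close>

definition unimodular_simplex :: "(real ^ 'n) set \<Rightarrow> bool" where
  "unimodular_simplex S \<longleftrightarrow>
     (\<exists>C \<subseteq> char_lattice. finite C \<and>
        \<not> affine_dependent (lattice_vec ` C) \<and> S = convex hull (lattice_vec ` C) \<and>
        (\<forall>w\<in>char_lattice. lattice_vec w \<in> affine hull (lattice_vec ` C) \<longrightarrow>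
           (\<exists>a :: int ^ 'n \<Rightarrow> int. (\<Sum>u\<in>C. a u) = 1 \<and> w = (\<Sum>u\<in>C. a u *s u))))"

definition tropically_smooth :: "('k::zero \<Rightarrow> ereal) \<Rightarrow> ((int ^ 'n) \<Rightarrow>\<^sub>0 'k) \<Rightarrow> bool" where
  "tropically_smooth val f \<longleftrightarrow>
     triangulation (regular_subdivision val f) \<and>
     (\<forall>S \<in> regular_subdivision val f. unimodular_simplex S)"

definition codim :: "(real ^ 'n) set \<Rightarrow> int" where
  "codim E = int CARD('n) - aff_dim E"

definition tropical_complete_intersection ::
  "('k::zero \<Rightarrow> ereal) \<Rightarrow> nat set \<Rightarrow> (nat \<Rightarrow> (int ^ 'n) \<Rightarrow>\<^sub>0 'k) \<Rightarrow> bool" where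
  "tropical_complete_intersection val K f \<longleftrightarrow>
     (\<forall>E. (\<forall>k\<in>K. E k \<in> hypersurface_cells val (f k)) \<longrightarrow>
        (\<Inter>k\<in>K. E k) = {} \<or> codim (\<Inter>k\<in>K. E k) = (\<Sum>k\<in>K. codim (E k)))"

definition intersection_cells ::
  "('k::zero \<Rightarrow> ereal) \<Rightarrow> nat set \<Rightarrow> (nat \<Rightarrow> (int ^ 'n) \<Rightarrow>\<^sub>0 'k) \<Rightarrow> (real ^ 'n) set set" where
  "intersection_cells val K f =
     {(\<Inter>k\<in>K. E k) | E. (\<forall>k\<in>K. E k \<in> hypersurface_cells val (f k)) \<and> (\<Inter>k\<in>K. E k) \<noteq> {}}"

text \<open>Vertices and edges have dimension zero and one in the quotient by the all-ones vector.\<close>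

definition trop_vertices ::
  "('k::zero \<Rightarrow> ereal) \<Rightarrow> nat set \<Rightarrow> (nat \<Rightarrow> (int ^ 'n) \<Rightarrow>\<^sub>0 'k) \<Rightarrow> (real ^ 'n) set set" where
  "trop_vertices val K f = {V \<in> intersection_cells val K f. aff_dim V = 1}"

definition trop_edges ::
  "('k::zero \<Rightarrow> ereal) \<Rightarrow> nat set \<Rightarrow> (nat \<Rightarrow> (int ^ 'n) \<Rightarrow>\<^sub>0 'k) \<Rightarrow> (real ^ 'n) set set" where
  "trop_edges val K f = {E \<in> intersection_cells val K f. aff_dim E = 2}"


section \<open>Linear subspaces of the tropical torus\<close>

definition tspan :: "(real ^ 'n) set \<Rightarrow> (real ^ 'n) set" where
  "tspan S = span (insert 1 S)"

definition coord_span :: "'n set \<Rightarrow> (real ^ 'n) set" where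
  "coord_span J = tspan ((\<lambda>i. axis i 1) ` J)"

definition direction_span :: "(real ^ 'n) set \<Rightarrow> (real ^ 'n) set" where
  "direction_span L = tspan {x - y | x y. x \<in> L \<and> y \<in> L}"

text \<open>The affine hulls below decrease with \<open>\<epsilon>\<close>, hence are constant for small \<open>\<epsilon>\<close>.\<close>

definition affine_tangent_space :: "(real ^ 'n) set \<Rightarrow> real ^ 'n \<Rightarrow> (real ^ 'n) set" where
  "affine_tangent_space S \<alpha> = (\<Inter>\<epsilon>\<in>{0<..}. affine hull (S \<inter> ball \<alpha> \<epsilon>))"

end

theory Submission
  imports Defs "HOL-Library.FuncSet"
begin

text \<open>
  In logarithmic coordinates the tangent line at a point \<open>P\<close> of the curve is the kernel of the
  matrix of logarithmic gradients \<open>\<Sum>u. c u * P^u * u\<close> of the equations. After rescaling, this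
  matrix reduces modulo the maximal ideal of the valuation ring to a matrix built from the
  exponents of minimal valuation, which is invertible once two normalizing rows are added. Over an
  edge it is an integer matrix. At a vertex one equation has three minimal terms, and the kernel is
  \<open>\<omega>1 - \<theta> \<omega>2\<close> for rational vectors \<open>\<omega>1\<close>, \<open>\<omega>2\<close> and a unit \<open>\<theta>\<close> with \<open>1 - \<theta>\<close> a unit, which is
  essentially free: the Pluecker coordinate \<open>a - \<theta> b\<close> has positive valuation iff \<open>\<theta>\<close> reduces to
  the rational number \<open>a / b\<close>, and the values \<open>0\<close>, \<open>1\<close>, \<open>\<infinity>\<close> excluded for \<open>\<theta>\<close> are the edges.

  The points needed come from a multivariate Hensel lemma over the field itself, which is neither
  complete nor assumed to be: the Newton iterates converge because their coordinates
  approximately solve nonzero polynomial equations in one variable, obtained from Canny's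
  generalized characteristic polynomial. Moving along the curve by this lemma also shows that the
  kernel is contained in the tangent space, so no dimension theory is used.
\<close>

text \<open>Invertibility of the reduced matrix rests on two inputs. Unimodularity makes the minimal
  exponents of one equation affinely independent, and the complete intersection condition adds up
  the codimensions of different equations; the count leaves two minimal terms per equation on an
  edge and one extra term at a vertex. Residue characteristic zero then turns an inverse over the
  rationals into one over the valuation ring and keeps distinct rationals distinct after reduction.
  The genericity hypotheses enter separately: the first forbids that two coordinates agree on all of
  \<open>\<Lambda>\<close>, so no Pluecker coordinate has a vanishing leading form; the second keeps
  the critical values of \<open>\<theta>\<close> for different pairs apart, so at most one
  coordinate is special. Giving that one a prescribed positive valuation is beyond what reduction
  can see. The first-order dependence of the frame vector on \<open>\<theta>\<close> is therefore
  controlled to higher precision, and a second Newton iteration runs in \<open>\<theta>\<close>. In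
  Hensel's lemma the system may have positive-dimensional solution sets far from the ball, where
  plain elimination would return the zero polynomial; this is why it is deformed.\<close>

lemma homogeneous_system_nontrivial:
  fixes a :: "'e \<Rightarrow> 'v \<Rightarrow> 'a::idom"
  assumes "finite E" and "finite V" and "card E < card V"
  shows "\<exists>c. (\<exists>v\<in>V. c v \<noteq> 0) \<and> (\<forall>e\<in>E. (\<Sum>v\<in>V. c v * a e v) = 0)"
  using assms
proof (induction E arbitrary: V a rule: finite_induct)
  case empty
  then have "V \<noteq> {}" by auto
  then show ?case by (intro exI[of _ "\<lambda>_. 1"]) auto
next
  case (insert e E)
  show ?case
  proof (cases "\<forall>v\<in>V. a e v = 0")
    case True
    from insert.IH[of V a] insert.prems insert.hyps
    obtain c where "\<exists>v\<in>V. c v \<noteq> 0" "\<forall>e\<in>E. (\<Sum>v\<in>V. c v * a e v) = 0" by auto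
    with True show ?thesis by (intro exI[of _ c]) auto
  next
    case False
    then obtain v0 where v0: "v0 \<in> V" "a e v0 \<noteq> 0" by auto
    define W where "W = V - {v0}"
    \<comment> \<open>Fraction-free elimination with pivot \<open>a e v0\<close>. The ring is only
      an integral domain because the coefficients will be polynomials in the deformation
      parameter.\<close>
    define a' where "a' = (\<lambda>e' v. a e v0 * a e' v - a e' v0 * a e v)"
    have W: "finite W" "card E < card W"
      using insert.prems insert.hyps v0 by (auto simp: W_def)
    from insert.IH[OF W, of a'] obtain c where
      c: "\<exists>v\<in>W. c v \<noteq> 0" "\<And>e'. e'\<in>E \<Longrightarrow> (\<Sum>v\<in>W. c v * a' e' v) = 0" by auto
    define d where "d = (\<lambda>v. if v = v0 then - (\<Sum>v\<in>W. c v * a e v) else a e v0 * c v)"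
    have split: "(\<Sum>v\<in>V. d v * a e' v) =
        - (\<Sum>v\<in>W. c v * a e v) * a e' v0 + (\<Sum>v\<in>W. a e v0 * c v * a e' v)" for e'
    proof -
      have "(\<Sum>v\<in>V. d v * a e' v) = d v0 * a e' v0 + (\<Sum>v\<in>W. d v * a e' v)"
        unfolding W_def using insert.prems v0 by (simp add: sum.remove)
      moreover have "(\<Sum>v\<in>W. d v * a e' v) = (\<Sum>v\<in>W. a e v0 * c v * a e' v)"
        by (intro sum.cong) (auto simp: d_def W_def)
      ultimately show ?thesis by (simp add: d_def)
    qed
    have "(\<Sum>v\<in>V. d v * a e v) = 0"
      unfolding split by (simp add: sum_distrib_left sum_distrib_right algebra_simps)
    moreover have "(\<Sum>v\<in>V. d v * a e' v) = 0" if "e' \<in> E" for e'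
    proof -
      have "(\<Sum>v\<in>V. d v * a e' v) = (\<Sum>v\<in>W. c v * a' e' v)"
        unfolding split a'_def
        by (simp add: sum_distrib_left sum_distrib_right algebra_simps sum_subtractf)
      with c(2)[OF that] show ?thesis by simp
    qed
    moreover have "\<exists>v\<in>V. d v \<noteq> 0"
      using c(1) v0 by (auto simp: d_def W_def intro!: bexI)
    ultimately show ?thesis by (intro exI[of _ d]) auto
  qed
qed

section \<open>Valuations\<close>

locale nonarch_valued =
  fixes val :: "'k::field \<Rightarrow> ereal"
  assumes nonarch: "nonarch_valuation val"
begin

text \<open>Bounds are phrased with this predicate because \<open>rval\<close> is real-valued and
  sends 0 to 0; here 0 satisfies every bound, as it must in ultrametric estimates.\<close>

definition vge :: "real \<Rightarrow> 'k \<Rightarrow> bool" where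
  "vge r x \<longleftrightarrow> ereal r \<le> val x"

abbreviation v :: "'k \<Rightarrow> real" where "v \<equiv> rval val"

lemma val_zero [simp]: "val 0 = \<infinity>"
  and val_eq_infinity [simp]: "val x = \<infinity> \<longleftrightarrow> x = 0"
  and val_mult: "val (x * y) = val x + val y"
  and val_add: "min (val x) (val y) \<le> val (x + y)"
  using nonarch by (auto simp: nonarch_valuation_def)

lemma val_rval: "x \<noteq> 0 \<Longrightarrow> val x = ereal (v x)"
  using nonarch by (cases "val x") (auto simp: nonarch_valuation_def rval_def)

lemma vge_iff: "x \<noteq> 0 \<Longrightarrow> vge r x \<longleftrightarrow> r \<le> v x"
  by (simp add: vge_def val_rval)

lemma rval_mult: "x \<noteq> 0 \<Longrightarrow> y \<noteq> 0 \<Longrightarrow> v (x * y) = v x + v y"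
  using val_mult[of x y] by (simp add: val_rval)

lemma rval_one [simp]: "v 1 = 0"
  using rval_mult[of 1 1] by simp

lemma rval_minus [simp]: "v (- x) = v x"
proof (cases "x = 0")
  case False
  have "v (-1 * -1) = v (-1) + v (-1)" by (rule rval_mult) auto
  then have "v (-1) = 0" by simp
  then show ?thesis using rval_mult[of "-1" x] False by simp
qed simp

lemma rval_inverse: "x \<noteq> 0 \<Longrightarrow> v (inverse x) = - v x"
  using rval_mult[of x "inverse x"] by simp

lemma rval_divide: "x \<noteq> 0 \<Longrightarrow> y \<noteq> 0 \<Longrightarrow> v (x / y) = v x - v y"
  by (simp add: divide_inverse rval_mult rval_inverse)

lemma rval_power: "x \<noteq> 0 \<Longrightarrow> v (x ^ m) = of_nat m * v x"
  by (induction m) (auto simp: rval_mult algebra_simps)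

lemma rval_powi: "x \<noteq> 0 \<Longrightarrow> v (x powi m) = of_int m * v x"
  by (auto simp: power_int_def rval_power rval_inverse)

lemma rval_prod: "(\<And>i. i \<in> S \<Longrightarrow> f i \<noteq> 0) \<Longrightarrow> v (prod f S) = (\<Sum>i\<in>S. v (f i))"
  by (induction S rule: infinite_finite_induct) (auto simp: rval_mult)

lemma vge_zero [simp]: "vge r 0"
  by (simp add: vge_def)

lemma vge_one [simp]: "vge 0 1"
  by (simp add: vge_iff)

lemma vge_uminus [simp]: "vge r (- x) \<longleftrightarrow> vge r x"
  by (cases "x = 0") (auto simp: vge_iff)

lemma vge_mono: "vge r x \<Longrightarrow> s \<le> r \<Longrightarrow> vge s x"
  unfolding vge_def by (meson ereal_less_eq(3) order_trans)

lemma vge_add: "vge r x \<Longrightarrow> vge r y \<Longrightarrow> vge r (x + y)"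
  unfolding vge_def using val_add[of x y] by (metis min.boundedI order_trans)

lemma vge_diff: "vge r x \<Longrightarrow> vge r y \<Longrightarrow> vge r (x - y)"
  using vge_add[of r x "- y"] by simp

lemma vge_diff_commute: "vge r (x - y) \<longleftrightarrow> vge r (y - x)"
  using vge_uminus[of r "x - y"] by simp

lemma vge_mult: "vge r x \<Longrightarrow> vge s y \<Longrightarrow> vge (r + s) (x * y)"
  by (cases "x = 0 \<or> y = 0") (auto simp: vge_iff rval_mult)

lemma vge_mult_left: "vge 0 x \<Longrightarrow> vge s y \<Longrightarrow> vge s (x * y)"
  using vge_mult[of 0 x s y] by simp

lemma vge_mult_right: "vge r x \<Longrightarrow> vge 0 y \<Longrightarrow> vge r (x * y)"
  using vge_mult[of r x 0 y] by simp

lemma vge_sum: "(\<And>i. i \<in> S \<Longrightarrow> vge r (f i)) \<Longrightarrow> vge r (sum f S)"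
  by (induction S rule: infinite_finite_induct) (auto simp: vge_add)

lemma vge_power: "vge 0 x \<Longrightarrow> vge 0 (x ^ m)"
  by (induction m) (auto intro: vge_mult_left)

lemma vge_prod: "(\<And>i. i \<in> S \<Longrightarrow> vge 0 (f i)) \<Longrightarrow> vge 0 (prod f S)"
  by (induction S rule: infinite_finite_induct) (auto intro: vge_mult_left)

lemma vge_of_nat [simp]: "vge 0 (of_nat m)"
  by (induction m) (auto intro: vge_add)

lemma vge_of_int [simp]: "vge 0 (of_int m)"
  by (cases m) (auto simp del: of_nat_Suc)

lemma vge_exists: "\<exists>r. vge r x"
  by (cases "x = 0") (auto simp: vge_iff)

lemma vge_all_imp_zero: "(\<And>r. vge r x) \<Longrightarrow> x = 0"
  by (metis vge_iff gt_ex not_less)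

lemma vge_trans: "vge r (x - y) \<Longrightarrow> vge r (y - z) \<Longrightarrow> vge r (x - z)"
  using vge_add[of r "x - y" "y - z"] by simp

text \<open>When the error is smaller than \<open>x\<close>, the minimum in the ultrametric
  inequality is attained only once. This is how valuations are read off from leading terms.\<close>

lemma rval_eq_if_close:
  assumes "x \<noteq> 0" and "vge r (y - x)" and "v x < r"
  shows "y \<noteq> 0" and "v y = v x"
proof -
  show "y \<noteq> 0" using assms by (auto simp: vge_iff)
  have "vge (v x) y"
    using vge_add[of "v x" "y - x" x] vge_mono[OF assms(2), of "v x"] assms(1,3)
    by (simp add: vge_iff)
  moreover have "v y \<le> v x"
  proof (rule ccontr)
    assume "\<not> v y \<le> v x"
    moreover have "vge (min r (v y)) y" "vge (min r (v y)) (y - x)"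
      using \<open>y \<noteq> 0\<close> assms(2) by (auto simp: vge_iff intro: vge_mono)
    then have "vge (min r (v y)) x" using vge_diff[of _ y "y - x"] by simp
    ultimately show False using assms by (auto simp: vge_iff min_def split: if_splits)
  qed
  ultimately show "v y = v x" using \<open>y \<noteq> 0\<close> by (auto simp: vge_iff)
qed

lemma rval_one_plus: "vge r x \<Longrightarrow> r > 0 \<Longrightarrow> 1 + x \<noteq> 0 \<and> v (1 + x) = 0"
  using rval_eq_if_close[of 1 r "1 + x"] by auto

lemma vge_divide_unit: "y \<noteq> 0 \<Longrightarrow> v y = 0 \<Longrightarrow> vge r (x / y) \<longleftrightarrow> vge r x"
  by (cases "x = 0") (auto simp: vge_iff rval_divide)

lemma vge_divide: "y \<noteq> 0 \<Longrightarrow> vge r x \<Longrightarrow> vge (r - v y) (x / y)"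
  by (cases "x = 0") (auto simp: vge_iff rval_divide)

text \<open>The valuation of \<open>x\<close> is below \<open>s\<close>, so cancelling this factor
  costs at most \<open>s\<close>.\<close>

lemma vge_le_bounded_factor:
  assumes "vge r (x * y)" and "\<not> vge s x"
  shows "vge (r - s) y"
  using assms by (cases "x = 0 \<or> y = 0") (auto simp: vge_iff rval_mult)

lemma vge_poly: "\<exists>C. \<forall>e. vge 0 e \<longrightarrow> vge C (poly p e)"
proof (induction p)
  case 0
  then show ?case by auto
next
  case (pCons a p)
  then obtain C where C: "\<And>e. vge 0 e \<Longrightarrow> vge C (poly p e)" by auto
  obtain r where "vge r a" using vge_exists by auto
  then show ?case
    by (intro exI[of _ "min r C"])
       (auto intro!: vge_add vge_mult_left intro: vge_mono[of r] vge_mono[OF C])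
qed

text \<open>The difference is \<open>e\<close> times a polynomial in \<open>e\<close>, whose values
  on the valuation ring have valuations bounded below.\<close>

lemma vge_poly_diff_at_0: "\<exists>C. \<forall>e r. vge 0 e \<and> vge r e \<longrightarrow> vge (r + C) (poly p e - coeff p 0)"
proof (cases p)
  case (pCons a q)
  obtain C where C: "\<And>e. vge 0 e \<Longrightarrow> vge C (poly q e)" using vge_poly by auto
  show ?thesis unfolding pCons
    by (intro exI[of _ C]) (auto intro!: vge_mult C)
qed

definition vconverges :: "(nat \<Rightarrow> 'k) \<Rightarrow> 'k \<Rightarrow> bool" where
  "vconverges y a \<longleftrightarrow> (\<forall>r. \<exists>J. \<forall>j\<ge>J. vge r (y j - a))"

end

locale alg_closed_valued = nonarch_valued val
  for val :: "'k::{alg_closed_field, field_char_0} \<Rightarrow> ereal" +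
  assumes nontrivial: "nontrivial_valuation val"
    and val_of_int: "\<And>m :: int. m \<noteq> 0 \<Longrightarrow> val (of_int m) = 0"
begin

text \<open>Numerator and denominator are nonzero integers, hence units. The case
  \<open>q = 0\<close> rests on the convention that \<open>rval\<close> of 0 is 0.\<close>

lemma rval_of_rat: "v (of_rat q) = 0"
proof (cases "q = 0")
  case True
  then show ?thesis by (simp add: rval_def)
next
  case False
  obtain a b where q: "q = Rat.Fract a b" "b > 0" by (cases q) auto
  with False have "a \<noteq> 0" by (auto simp: rat_number_collapse)
  then have "v (of_int a) = 0" "v (of_int b) = 0"
    using val_of_int[of a] val_of_int[of b] q by (auto simp: rval_def)
  then show ?thesis using q \<open>a \<noteq> 0\<close>
    by (simp add: of_rat_rat rval_divide)
qed

lemma vge_of_rat [simp]: "vge 0 (of_rat q)"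
  by (cases "q = 0") (auto simp: vge_iff rval_of_rat)

text \<open>The rationals embed into the residue field, so congruent rationals are equal. This
  separates the critical values of the parameter at a vertex.\<close>

lemma of_rat_small_imp_zero: "vge r (of_rat q) \<Longrightarrow> r > 0 \<Longrightarrow> q = 0"
  by (metis of_rat_eq_0_iff rval_of_rat vge_iff not_less)

lemma ex_pos_val: "\<exists>x. x \<noteq> 0 \<and> v x > 0"
proof -
  obtain x where x: "x \<noteq> 0" "val x \<noteq> 0"
    using nontrivial by (auto simp: nontrivial_valuation_def)
  have "v x \<noteq> 0" using x val_rval[of x] by (auto simp: zero_ereal_def)
  show ?thesis
  proof (cases "v x > 0")
    case False
    with \<open>v x \<noteq> 0\<close> x rval_inverse[of x] have "inverse x \<noteq> 0" "v (inverse x) > 0" by auto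
    then show ?thesis by blast
  qed (use x in blast)
qed

text \<open>Substitute for completeness. Split off a root \<open>a\<close> of \<open>p\<close>:
  either the sequence converges to \<open>a\<close>, or by the Cauchy property it eventually keeps a
  fixed distance from \<open>a\<close>. Then the linear factor can be cancelled, leaving small
  values of a polynomial of lower degree.\<close>

lemma polynomial_cauchy_converges:
  assumes "p \<noteq> 0"
    and small: "\<And>r. \<exists>J. \<forall>j\<ge>J. vge r (poly p (y j))"
    and cauchy: "\<And>r. \<exists>J. \<forall>j\<ge>J. \<forall>k\<ge>J. vge r (y j - y k)"
  shows "\<exists>a. vconverges y a"
  using assms(1,2)
proof (induction "degree p" arbitrary: p rule: less_induct)
  case less
  show ?case
  proof (cases "degree p = 0")
    case True
    then obtain c where c: "p = [:c:]" by (meson degree_eq_zeroE)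
    have "vge r c" for r using less.prems(2)[of r] c by auto
    then have "c = 0" by (rule vge_all_imp_zero)
    with c less.prems(1) show ?thesis by simp
  next
    case False
    then obtain a where "poly p a = 0" using alg_closed_imp_poly_has_root[of p] by auto
    then obtain q where q: "p = [:- a, 1:] * q" by (auto simp: poly_eq_0_iff_dvd)
    with less.prems(1) have "q \<noteq> 0" by auto
    then have deg: "degree q < degree p" unfolding q by (subst degree_mult_eq) auto
    show ?thesis
    proof (cases "vconverges y a")
      case False
      then obtain r where r: "\<And>J. \<exists>j\<ge>J. \<not> vge r (y j - a)" by (auto simp: vconverges_def)
      obtain J where J: "\<And>j k. j \<ge> J \<Longrightarrow> k \<ge> J \<Longrightarrow> vge r (y j - y k)" using cauchy[of r] by auto
      obtain j0 where j0: "j0 \<ge> J" "\<not> vge r (y j0 - a)" using r by auto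
      have far: "\<not> vge r (y j - a)" if "j \<ge> J" for j
        using J[OF j0(1) that] j0(2) vge_trans by blast
      have "\<exists>J. \<forall>j\<ge>J. vge s (poly q (y j))" for s
      proof -
        obtain J' where J': "\<And>j. j \<ge> J' \<Longrightarrow> vge (s + r) (poly p (y j))" using less.prems(2) by blast
        have "vge s (poly q (y j))" if "j \<ge> max J J'" for j
        proof -
          have "vge (s + r) ((y j - a) * poly q (y j))"
            using J'[of j] that q by (simp add: algebra_simps)
          from vge_le_bounded_factor[OF this far[of j]] that show ?thesis by simp
        qed
        then show ?thesis by blast
      qed
      with less.hyps[OF deg \<open>q \<noteq> 0\<close>] show ?thesis by blast
    qed auto
  qed
qed

end

section \<open>The generalized characteristic polynomial\<close>

definition monomial_fun :: "('n::finite \<Rightarrow> nat) \<Rightarrow> 'a::comm_ring_1 ^ 'n \<Rightarrow> 'a" where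
  "monomial_fun a x = (\<Prod>i\<in>UNIV. x $ i ^ a i)"

text \<open>Degree bounds are attached to functions through the way they are built from monomials,
  so formal polynomials in several variables are avoided and cancellation is ignored.\<close>

inductive poly_deg :: "nat \<Rightarrow> ('a::comm_ring_1 ^ 'n::finite \<Rightarrow> 'a) \<Rightarrow> bool" where
  monom: "sum a UNIV \<le> d \<Longrightarrow> poly_deg d (monomial_fun a)"
| add: "poly_deg d g \<Longrightarrow> poly_deg d h \<Longrightarrow> poly_deg d (\<lambda>x. g x + h x)"
| scale: "poly_deg d g \<Longrightarrow> poly_deg d (\<lambda>x. c * g x)"

lemma monomial_fun_0 [simp]: "monomial_fun (\<lambda>_. 0) x = 1"
  by (simp add: monomial_fun_def)

lemma monomial_fun_add: "monomial_fun a x * monomial_fun b x = monomial_fun (\<lambda>i. a i + b i) x"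
  by (simp add: monomial_fun_def power_add prod.distrib)

lemma monomial_fun_single: "monomial_fun (\<lambda>i. if i = l then m else 0) x = x $ l ^ m"
proof -
  have "monomial_fun (\<lambda>i. if i = l then m else 0) x = (\<Prod>i\<in>UNIV. if i = l then x $ l ^ m else 1)"
    unfolding monomial_fun_def by (intro prod.cong) auto
  then show ?thesis by simp
qed

lemma poly_deg_mono: "poly_deg d g \<Longrightarrow> d \<le> e \<Longrightarrow> poly_deg e g"
  by (induction rule: poly_deg.induct) (auto intro: poly_deg.intros order_trans)

lemma poly_deg_const: "poly_deg d (\<lambda>x. c)"
proof -
  have "poly_deg d (\<lambda>x. c * monomial_fun (\<lambda>_. 0) x)" by (intro poly_deg.intros) auto
  then show ?thesis by simp
qed

lemma poly_deg_coord: "poly_deg 1 (\<lambda>x :: 'a::comm_ring_1 ^ 'n::finite. x $ i)"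
proof -
  have "poly_deg 1 (monomial_fun (\<lambda>j. if j = i then 1 else 0) :: 'a ^ 'n \<Rightarrow> 'a)"
    by (intro poly_deg.intros) auto
  moreover have "monomial_fun (\<lambda>j. if j = i then 1 else 0) = (\<lambda>x :: 'a ^ 'n. x $ i)"
    by (rule ext) (simp add: monomial_fun_single)
  ultimately show ?thesis by (simp only:)
qed

lemma poly_deg_monomial_mult:
  "poly_deg e h \<Longrightarrow> sum a UNIV \<le> d \<Longrightarrow> poly_deg (d + e) (\<lambda>x. monomial_fun a x * h x)"
proof (induction rule: poly_deg.induct)
  case (monom b e)
  have "poly_deg (d + e) (monomial_fun (\<lambda>i. a i + b i))"
    using monom by (intro poly_deg.monom) (auto simp: sum.distrib)
  then show ?case by (simp add: monomial_fun_add)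
next
  case (add e g h)
  then have "poly_deg (d + e) (\<lambda>x. monomial_fun a x * g x + monomial_fun a x * h x)"
    by (intro poly_deg.add) auto
  then show ?case by (simp add: algebra_simps)
next
  case (scale e g c)
  then have "poly_deg (d + e) (\<lambda>x. c * (monomial_fun a x * g x))"
    by (intro poly_deg.scale) auto
  then show ?case by (simp add: algebra_simps)
qed

lemma poly_deg_mult: "poly_deg d g \<Longrightarrow> poly_deg e h \<Longrightarrow> poly_deg (d + e) (\<lambda>x. g x * h x)"
proof (induction rule: poly_deg.induct)
  case (monom b e)
  then show ?case by (intro poly_deg_monomial_mult)
next
  case (add d g h')
  then have "poly_deg (d + e) (\<lambda>x. g x * h x + h' x * h x)" by (intro poly_deg.add) auto
  then show ?case by (simp add: algebra_simps)
next
  case (scale d g c)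
  then have "poly_deg (d + e) (\<lambda>x. c * (g x * h x))" by (intro poly_deg.scale) auto
  then show ?case by (simp add: algebra_simps)
qed

definition poly_fun :: "('a::comm_ring_1 ^ 'n::finite \<Rightarrow> 'a) \<Rightarrow> bool" where
  "poly_fun g \<longleftrightarrow> (\<exists>d. poly_deg d g)"

lemma poly_fun_const [intro]: "poly_fun (\<lambda>x. c)"
  and poly_fun_coord [intro]: "poly_fun (\<lambda>x. x $ i)"
  using poly_deg_const poly_deg_coord by (auto simp: poly_fun_def)

lemma poly_fun_add [intro]: "poly_fun g \<Longrightarrow> poly_fun h \<Longrightarrow> poly_fun (\<lambda>x. g x + h x)"
  proof -
  assume "poly_fun g" "poly_fun h"
  then obtain d e where "poly_deg d g" "poly_deg e h" by (auto simp: poly_fun_def)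
  then have "poly_deg (max d e) (\<lambda>x. g x + h x)"
    by (intro poly_deg.add) (auto elim: poly_deg_mono)
  then show ?thesis by (auto simp: poly_fun_def)
qed

lemma poly_fun_mult [intro]: "poly_fun g \<Longrightarrow> poly_fun h \<Longrightarrow> poly_fun (\<lambda>x. g x * h x)"
  unfolding poly_fun_def using poly_deg_mult by blast

lemma poly_fun_sum [intro]: "(\<And>j. j \<in> S \<Longrightarrow> poly_fun (g j)) \<Longrightarrow> poly_fun (\<lambda>x. \<Sum>j\<in>S. g j x)"
  by (induction S rule: infinite_finite_induct) auto

lemma poly_fun_prod [intro]: "(\<And>j. j \<in> S \<Longrightarrow> poly_fun (g j)) \<Longrightarrow> poly_fun (\<lambda>x. \<Prod>j\<in>S. g j x)"
  by (induction S rule: infinite_finite_induct) auto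

lemma poly_fun_power [intro]: "poly_fun g \<Longrightarrow> poly_fun (\<lambda>x. g x ^ m)"
  by (induction m) auto

lemma poly_fun_common_degree:
  fixes F :: "'a::comm_ring_1 ^ 'n::finite \<Rightarrow> 'a ^ 'n"
  assumes "\<And>l. poly_fun (\<lambda>x. F x $ l)"
  shows "\<exists>d. \<forall>l. poly_deg d (\<lambda>x. F x $ l)"
proof -
  from assms obtain d where d: "\<And>l. poly_deg (d l) (\<lambda>x. F x $ l)"
    unfolding poly_fun_def by metis
  have "poly_deg (Max (range d)) (\<lambda>x. F x $ l)" for l
    by (rule poly_deg_mono[OF d]) auto
  then show ?thesis by blast
qed

text \<open>Exponents of the monomials that survive once every power \<open>x_l ^ D\<close> has been
  rewritten.\<close>

definition exponent_box :: "nat \<Rightarrow> ('n::finite \<Rightarrow> nat) set" where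
  "exponent_box D = {b. \<forall>i. b i < D}"

lemma finite_exponent_box: "finite (exponent_box D :: ('n::finite \<Rightarrow> nat) set)"
proof -
  have "(exponent_box D :: ('n \<Rightarrow> nat) set) = PiE UNIV (\<lambda>_. {..<D})" by (auto simp: exponent_box_def)
  then show ?thesis using finite_PiE[of "UNIV :: 'n set" "\<lambda>_. {..<D}"] by simp
qed

context alg_closed_valued
begin

text \<open>Quantitative stand-in for membership in the ideal generated by the components of
  \<open>G\<close>: for integral arguments \<open>h\<close> is as small as \<open>G\<close>, up to a
  loss \<open>C\<close> independent of \<open>e\<close>, \<open>x\<close> and \<open>r\<close>. It
  suits approximate zeros, which are all that is available before a limit is known to exist.\<close>

definition small_modulo ::
  "('k \<Rightarrow> 'k ^ 'n::finite \<Rightarrow> 'k ^ 'n) \<Rightarrow> ('k \<Rightarrow> 'k ^ 'n \<Rightarrow> 'k) \<Rightarrow> bool" where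
  "small_modulo G h \<longleftrightarrow>
     (\<exists>C. \<forall>e x r. vge 0 e \<longrightarrow> (\<forall>i. vge 0 (x $ i)) \<longrightarrow> (\<forall>l. vge r (G e x $ l)) \<longrightarrow> vge (r - C) (h e x))"

lemma small_modulo_add:
  assumes "small_modulo G g" and "small_modulo G h"
  shows "small_modulo G (\<lambda>e x. g e x + h e x)"
proof -
  obtain C where C: "\<And>e x r. vge 0 e \<Longrightarrow> \<forall>i. vge 0 (x $ i) \<Longrightarrow> \<forall>l. vge r (G e x $ l) \<Longrightarrow> vge (r - C) (g e x)"
    using assms(1) unfolding small_modulo_def by metis
  obtain C' where C': "\<And>e x r. vge 0 e \<Longrightarrow> \<forall>i. vge 0 (x $ i) \<Longrightarrow> \<forall>l. vge r (G e x $ l) \<Longrightarrow> vge (r - C') (h e x)"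
    using assms(2) unfolding small_modulo_def by metis
  show ?thesis unfolding small_modulo_def
    by (intro exI[of _ "max C C'"] allI impI vge_add)
       (auto intro: vge_mono[OF C] vge_mono[OF C'])
qed

lemma small_modulo_0 [simp]: "small_modulo G (\<lambda>e x. 0)"
  by (auto simp: small_modulo_def)

lemma small_modulo_sum:
  "(\<And>j. j \<in> S \<Longrightarrow> small_modulo G (h j)) \<Longrightarrow> small_modulo G (\<lambda>e x. \<Sum>j\<in>S. h j e x)"
  by (induction S rule: infinite_finite_induct) (auto intro: small_modulo_add)

lemma small_modulo_mult:
  assumes "small_modulo G h" and "\<And>e x. vge 0 e \<Longrightarrow> \<forall>i. vge 0 (x $ i) \<Longrightarrow> vge B (k e x)"
  shows "small_modulo G (\<lambda>e x. k e x * h e x)"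
proof -
  obtain C where C: "\<And>e x r. vge 0 e \<Longrightarrow> \<forall>i. vge 0 (x $ i) \<Longrightarrow> \<forall>l. vge r (G e x $ l) \<Longrightarrow> vge (r - C) (h e x)"
    using assms(1) unfolding small_modulo_def by metis
  show ?thesis unfolding small_modulo_def
  proof (intro exI[of _ "C - B"] allI impI)
    fix e x r
    assume "vge 0 e" "\<forall>i. vge 0 (x $ i)" "\<forall>l. vge r (G e x $ l)"
    then have "vge (B + (r - C)) (k e x * h e x)" by (intro vge_mult assms C) auto
    then show "vge (r - (C - B)) (k e x * h e x)" by (simp add: algebra_simps)
  qed
qed

lemma small_modulo_power_mult: "small_modulo G h \<Longrightarrow> small_modulo G (\<lambda>e x. e ^ m * h e x)"
  by (rule small_modulo_mult[where B = 0]) (auto intro: vge_power)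

lemma small_modulo_scale: "small_modulo G h \<Longrightarrow> small_modulo G (\<lambda>e x. c * h e x)"
  using vge_exists[of c] by (auto intro: small_modulo_mult)

text \<open>A normal form modulo \<open>G\<close>. The power of \<open>e\<close> pays for the
  rewriting steps, because \<open>x_l ^ D\<close> will carry the coefficient \<open>e\<close> in
  \<open>G\<close>; the coefficients of the normal form are polynomials in \<open>e\<close>
  alone.\<close>

definition box_reducible ::
  "('k \<Rightarrow> 'k ^ 'n::finite \<Rightarrow> 'k ^ 'n) \<Rightarrow> nat \<Rightarrow> ('k \<Rightarrow> 'k ^ 'n \<Rightarrow> 'k) \<Rightarrow> bool" where
  "box_reducible G D h \<longleftrightarrow>
     (\<exists>m p. small_modulo G (\<lambda>e x. e ^ m * h e x - (\<Sum>b\<in>exponent_box D. poly (p b) e * monomial_fun b x)))"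

lemma box_reducible_add:
  assumes "box_reducible G D g" and "box_reducible G D h"
  shows "box_reducible G D (\<lambda>e x. g e x + h e x)"
proof -
  obtain m p where 1: "small_modulo G (\<lambda>e x. e ^ m * g e x - (\<Sum>b\<in>exponent_box D. poly (p b) e * monomial_fun b x))"
    using assms(1) by (auto simp: box_reducible_def)
  obtain m' p' where 2: "small_modulo G (\<lambda>e x. e ^ m' * h e x - (\<Sum>b\<in>exponent_box D. poly (p' b) e * monomial_fun b x))"
    using assms(2) by (auto simp: box_reducible_def)
  have "small_modulo G (\<lambda>e x.
      e ^ m' * (e ^ m * g e x - (\<Sum>b\<in>exponent_box D. poly (p b) e * monomial_fun b x)) +
      e ^ m * (e ^ m' * h e x - (\<Sum>b\<in>exponent_box D. poly (p' b) e * monomial_fun b x)))"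
    by (intro small_modulo_add small_modulo_power_mult 1 2)
  also have "(\<lambda>e x.
      e ^ m' * (e ^ m * g e x - (\<Sum>b\<in>exponent_box D. poly (p b) e * monomial_fun b x)) +
      e ^ m * (e ^ m' * h e x - (\<Sum>b\<in>exponent_box D. poly (p' b) e * monomial_fun b x))) =
     (\<lambda>e x. e ^ (m + m') * (g e x + h e x) -
       (\<Sum>b\<in>exponent_box D. poly (monom 1 m' * p b + monom 1 m * p' b) e * monomial_fun b x))"
    by (intro ext)
       (simp add: algebra_simps power_add sum.distrib sum_distrib_left poly_monom)
  finally show ?thesis unfolding box_reducible_def
    by (intro exI[of _ "m + m'"] exI[of _ "\<lambda>b. monom 1 m' * p b + monom 1 m * p' b"])
qed

lemma box_reducible_scale:
  assumes "box_reducible G D g"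
  shows "box_reducible G D (\<lambda>e x. c * g e x)"
proof -
  obtain m p where 1: "small_modulo G (\<lambda>e x. e ^ m * g e x - (\<Sum>b\<in>exponent_box D. poly (p b) e * monomial_fun b x))"
    using assms(1) by (auto simp: box_reducible_def)
  have "small_modulo G (\<lambda>e x. c * (e ^ m * g e x - (\<Sum>b\<in>exponent_box D. poly (p b) e * monomial_fun b x)))"
    by (intro small_modulo_scale 1)
  also have "(\<lambda>e x. c * (e ^ m * g e x - (\<Sum>b\<in>exponent_box D. poly (p b) e * monomial_fun b x))) =
     (\<lambda>e x. e ^ m * (c * g e x) - (\<Sum>b\<in>exponent_box D. poly (smult c (p b)) e * monomial_fun b x))"
    by (intro ext) (simp add: algebra_simps sum_distrib_left)
  finally show ?thesis unfolding box_reducible_def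
    by (intro exI[of _ m] exI[of _ "\<lambda>b. smult c (p b)"])
qed

lemma box_reducible_poly_deg:
  assumes "poly_deg d h" and "\<And>a. sum a UNIV \<le> d \<Longrightarrow> box_reducible G D (\<lambda>e. monomial_fun a)"
  shows "box_reducible G D (\<lambda>e. h)"
  using assms
  by (induction rule: poly_deg.induct) (auto intro: box_reducible_add box_reducible_scale)

lemma box_reducible_step:
  assumes "box_reducible G D h'" and "small_modulo G (\<lambda>e x. e * h e x - h' e x)"
  shows "box_reducible G D h"
proof -
  obtain m p where 1: "small_modulo G (\<lambda>e x. e ^ m * h' e x - (\<Sum>b\<in>exponent_box D. poly (p b) e * monomial_fun b x))"
    using assms(1) by (auto simp: box_reducible_def)
  have "small_modulo G (\<lambda>e x. e ^ m * (e * h e x - h' e x) +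
      (e ^ m * h' e x - (\<Sum>b\<in>exponent_box D. poly (p b) e * monomial_fun b x)))"
    by (intro small_modulo_add small_modulo_power_mult 1 assms)
  also have "(\<lambda>e x. e ^ m * (e * h e x - h' e x) +
      (e ^ m * h' e x - (\<Sum>b\<in>exponent_box D. poly (p b) e * monomial_fun b x))) =
     (\<lambda>e x. e ^ Suc m * h e x - (\<Sum>b\<in>exponent_box D. poly (p b) e * monomial_fun b x))"
    by (intro ext) (simp add: algebra_simps)
  finally show ?thesis unfolding box_reducible_def
    by (intro exI[of _ "Suc m"] exI[of _ p])
qed

lemma vge_monomial_fun: "\<forall>i. vge 0 (x $ i) \<Longrightarrow> vge 0 (monomial_fun a x)"
  unfolding monomial_fun_def by (intro vge_prod vge_power) auto

definition deformation :: "nat \<Rightarrow> ('k ^ 'n::finite \<Rightarrow> 'k ^ 'n) \<Rightarrow> 'k \<Rightarrow> 'k ^ 'n \<Rightarrow> 'k ^ 'n" where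
  "deformation D F e x = (\<chi> l. F x $ l + e * x $ l ^ D)"

text \<open>Induction on total degree: a monomial outside the box contains some
  \<open>x_l ^ Suc d\<close>, which times \<open>e\<close> is \<open>- F_l\<close> modulo the
  system. Since \<open>F_l\<close> has degree at most \<open>d\<close>, every replacement lowers the
  total degree.\<close>

lemma box_reducible_monomial:
  fixes F :: "'k ^ 'n::finite \<Rightarrow> 'k ^ 'n"
  assumes "\<And>l. poly_deg d (\<lambda>x. F x $ l)"
  shows "box_reducible (deformation (Suc d) F) (Suc d) (\<lambda>e. monomial_fun a)"
proof (induction "sum a UNIV" arbitrary: a rule: less_induct)
  case less
  let ?D = "Suc d" let ?G = "deformation ?D F"
  show ?case
  proof (cases "a \<in> exponent_box ?D")
    case True
    have eq: "(\<lambda>e x. e ^ 0 * monomial_fun a x -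
        (\<Sum>b\<in>exponent_box ?D. poly (if b = a then 1 else 0) e * monomial_fun b x)) = (\<lambda>e x. 0)"
      using True
      by (intro ext) (simp add: if_distrib[of "\<lambda>p. poly p _"] if_distrib[of "\<lambda>t. t * _"]
        sum.delta[OF finite_exponent_box] cong: if_cong)
    have "small_modulo ?G (\<lambda>e x. e ^ 0 * monomial_fun a x -
        (\<Sum>b\<in>exponent_box ?D. poly (if b = a then 1 else 0) e * monomial_fun b x))"
      by (subst eq) simp
    then show ?thesis unfolding box_reducible_def
      by (intro exI[of _ 0] exI[of _ "\<lambda>b. if b = a then 1 else 0"])
  next
    case False
    then obtain l where l: "?D \<le> a l" by (auto simp: exponent_box_def not_less)
    define c where "c = a(l := a l - ?D)"
    have a: "a = (\<lambda>i. c i + (if i = l then ?D else 0))" using l by (auto simp: c_def)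
    have sum_a: "sum a UNIV = sum c UNIV + ?D" by (subst a) (simp add: sum.distrib)
    have mono_a: "monomial_fun a x = monomial_fun c x * x $ l ^ ?D" for x :: "'k ^ 'n"
      by (subst a) (simp add: monomial_fun_add[symmetric] monomial_fun_single)
    have "poly_deg (sum c UNIV + d) (\<lambda>x. monomial_fun c x * F x $ l)"
      by (intro poly_deg_monomial_mult assms) simp
    then have "box_reducible ?G ?D (\<lambda>e x. monomial_fun c x * F x $ l)"
      by (rule box_reducible_poly_deg) (use less.hyps sum_a in auto)
    then have "box_reducible ?G ?D (\<lambda>e x. (-1) * (monomial_fun c x * F x $ l))"
      by (rule box_reducible_scale)
    moreover have "small_modulo ?G (\<lambda>e x. monomial_fun c x * ?G e x $ l)"
    proof (rule small_modulo_mult[where B = 0])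
      show "small_modulo ?G (\<lambda>e x. ?G e x $ l)"
        unfolding small_modulo_def by (intro exI[of _ 0]) auto
    qed (rule vge_monomial_fun)
    then have "small_modulo ?G (\<lambda>e x. e * monomial_fun a x - (-1) * (monomial_fun c x * F x $ l))"
      by (simp add: mono_a deformation_def algebra_simps)
    ultimately show ?thesis by (rule box_reducible_step)
  qed
qed

text \<open>This is Canny's generalized characteristic polynomial: the deformed system is a complete
  intersection with finitely many solutions even if \<open>F\<close> is not, and dividing by the power of the
  deformation parameter gives an equation that survives in the limit.\<close>

lemma generalized_characteristic_polynomial:
  fixes F :: "'k ^ 'n::finite \<Rightarrow> 'k ^ 'n"
  assumes "\<And>l. poly_deg d (\<lambda>x. F x $ l)"
  shows "\<exists>q s R. (\<exists>r\<le>R. coeff (q r) 0 \<noteq> 0) \<and>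
    small_modulo (deformation (Suc d) F) (\<lambda>e x. e ^ s * (\<Sum>r\<le>R. poly (q r) e * x $ i ^ r))"
proof -
  let ?D = "Suc d" let ?G = "deformation ?D F"
  \<comment> \<open>The \<open>R + 1\<close> powers of \<open>x_i\<close> up to
    \<open>x_i ^ R\<close> reduce to combinations of only \<open>R\<close> box monomials, so they
    satisfy a nontrivial relation over the polynomials in \<open>e\<close>.\<close>
  define R where "R = card (exponent_box ?D :: ('n \<Rightarrow> nat) set)"
  have "\<exists>m p. small_modulo ?G (\<lambda>e x. e ^ m * x $ i ^ r - (\<Sum>b\<in>exponent_box ?D. poly (p b) e * monomial_fun b x))"
    for r
    using box_reducible_monomial[OF assms, of "\<lambda>j. if j = i then r else 0"]
    by (simp only: box_reducible_def monomial_fun_single)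
  then have "\<forall>r. \<exists>z. small_modulo ?G
      (\<lambda>e x. e ^ fst z * x $ i ^ r - (\<Sum>b\<in>exponent_box ?D. poly (snd z b) e * monomial_fun b x))"
    by (simp only: split_paired_Ex fst_conv snd_conv) blast
  then obtain z where z: "\<forall>r. small_modulo ?G
      (\<lambda>e x. e ^ fst (z r) * x $ i ^ r - (\<Sum>b\<in>exponent_box ?D. poly (snd (z r) b) e * monomial_fun b x))"
    by (rule choice[THEN exE])
  define m where "m = (\<lambda>r. fst (z r))"
  define p where "p = (\<lambda>r. snd (z r))"
  have mp: "small_modulo ?G (\<lambda>e x. e ^ m r * x $ i ^ r - (\<Sum>b\<in>exponent_box ?D. poly (p r b) e * monomial_fun b x))" for r
    unfolding m_def p_def by (rule z[rule_format])
  have "\<exists>c. (\<exists>r\<in>{..R}. c r \<noteq> 0) \<and> (\<forall>b\<in>exponent_box ?D. (\<Sum>r\<in>{..R}. c r * p r b) = 0)"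
    by (rule homogeneous_system_nontrivial) (simp_all add: finite_exponent_box R_def)
  then obtain c where c: "\<exists>r\<in>{..R}. c r \<noteq> 0"
      "\<And>b. b \<in> exponent_box ?D \<Longrightarrow> (\<Sum>r\<in>{..R}. c r * p r b) = 0"
    by blast
  have "small_modulo ?G (\<lambda>e x. \<Sum>r\<le>R. poly (c r) e *
      (e ^ m r * x $ i ^ r - (\<Sum>b\<in>exponent_box ?D. poly (p r b) e * monomial_fun b x)))"
  proof (intro small_modulo_sum)
    fix r
    obtain B where "\<And>e. vge 0 e \<Longrightarrow> vge B (poly (c r) e)" using vge_poly by auto
    then show "small_modulo ?G (\<lambda>e x. poly (c r) e *
        (e ^ m r * x $ i ^ r - (\<Sum>b\<in>exponent_box ?D. poly (p r b) e * monomial_fun b x)))"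
      by (intro small_modulo_mult[OF mp])
  qed
  also have "(\<lambda>e x. \<Sum>r\<le>R. poly (c r) e *
      (e ^ m r * x $ i ^ r - (\<Sum>b\<in>exponent_box ?D. poly (p r b) e * monomial_fun b x))) =
    (\<lambda>e x. \<Sum>r\<le>R. poly (c r * monom 1 (m r)) e * x $ i ^ r)" (is "?L = ?R")
  proof (intro ext)
    fix e and x :: "'k ^ 'n"
    have "(\<Sum>r\<le>R. poly (c r) e * (\<Sum>b\<in>exponent_box ?D. poly (p r b) e * monomial_fun b x)) =
        (\<Sum>r\<le>R. \<Sum>b\<in>exponent_box ?D. poly (c r) e * poly (p r b) e * monomial_fun b x)"
      by (simp add: sum_distrib_left mult.assoc)
    also have "\<dots> = (\<Sum>b\<in>exponent_box ?D. \<Sum>r\<le>R. poly (c r) e * poly (p r b) e * monomial_fun b x)"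
      by (rule sum.swap)
    also have "\<dots> = (\<Sum>b\<in>exponent_box ?D. poly (\<Sum>r\<le>R. c r * p r b) e * monomial_fun b x)"
      by (simp add: poly_sum sum_distrib_right)
    also have "\<dots> = 0" by (intro sum.neutral) (simp add: c(2))
    finally have "?L e x = (\<Sum>r\<le>R. poly (c r) e * (e ^ m r * x $ i ^ r))"
      by (simp only: right_diff_distrib sum_subtractf diff_zero)
    then show "?L e x = ?R e x" by (simp add: poly_monom mult.assoc)
  qed
  finally have sm: "small_modulo ?G (\<lambda>e x. \<Sum>r\<le>R. poly (c r * monom 1 (m r)) e * x $ i ^ r)" .
  define c' where "c' = (\<lambda>r. c r * monom 1 (m r))"
  define A where "A = {r. r \<le> R \<and> c' r \<noteq> 0}"
  have A: "finite A" "A \<noteq> {}" using c(1) by (auto simp: A_def c'_def)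
  \<comment> \<open>The highest power of \<open>e\<close> dividing all coefficients of the relation.
    Once it is removed, some coefficient has a nonzero constant term, and the relation survives at
    \<open>e = 0\<close>.\<close>
  define s where "s = Min ((\<lambda>r. order 0 (c' r)) ` A)"
  have "monom 1 s dvd c' r" if "r \<le> R" for r
    using that A by (cases "c' r = 0") (auto simp: monom_1_dvd_iff s_def A_def intro!: Min_le)
  then obtain q where q: "\<And>r. r \<le> R \<Longrightarrow> c' r = monom 1 s * q r" unfolding dvd_def by metis
  have "s \<in> (\<lambda>r. order 0 (c' r)) ` A" unfolding s_def using A by (intro Min_in) auto
  then obtain r where r: "r \<in> A" "order 0 (c' r) = s" by auto
  have "coeff (q r) 0 \<noteq> 0"
  proof
    assume "coeff (q r) 0 = 0"
    then have "monom 1 1 dvd q r" by (auto simp: monom_1_dvd_iff' less_Suc_eq)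
    then have "monom 1 s * monom 1 1 dvd monom 1 s * q r" by (intro mult_dvd_mono) auto
    then have "monom 1 (Suc s) dvd c' r" using q r(1) by (simp add: mult_monom A_def)
    then show False using r by (simp add: monom_1_dvd_iff A_def)
  qed
  moreover have "(\<lambda>e (x :: 'k ^ 'n). \<Sum>r\<le>R. poly (c r * monom 1 (m r)) e * x $ i ^ r) =
      (\<lambda>e x. e ^ s * (\<Sum>r\<le>R. poly (q r) e * x $ i ^ r))"
  proof (intro ext)
    fix e and x :: "'k ^ 'n"
    have "(\<Sum>r\<le>R. poly (c' r) e * x $ i ^ r) = (\<Sum>r\<le>R. e ^ s * (poly (q r) e * x $ i ^ r))"
      by (intro sum.cong) (auto simp: q poly_monom)
    then show "(\<Sum>r\<le>R. poly (c r * monom 1 (m r)) e * x $ i ^ r) =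
        e ^ s * (\<Sum>r\<le>R. poly (q r) e * x $ i ^ r)"
      by (simp add: c'_def sum_distrib_left)
  qed
  moreover have "r \<le> R" using r by (simp add: A_def)
  ultimately show ?thesis using sm by auto
qed

end

section \<open>Hensel's lemma in several variables\<close>

context alg_closed_valued
begin

text \<open>\<open>p\<close> is the relation at \<open>e = 0\<close>. Of a residual of valuation
  \<open>(s + 1) * v e\<close>, the part \<open>s * v e\<close> is lost to the factor
  \<open>e ^ s\<close>; the remaining \<open>v e\<close> is also the order of the error made by
  replacing coefficients by their constant terms. So approximate zeros of the deformed system are
  approximate roots of \<open>p\<close> in coordinate \<open>i\<close>.\<close>

lemma limit_polynomial:
  fixes F :: "'k ^ 'n::finite \<Rightarrow> 'k ^ 'n"
  assumes "\<And>l. poly_deg d (\<lambda>x. F x $ l)"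
  shows "\<exists>p s C. p \<noteq> 0 \<and> (\<forall>e x. e \<noteq> 0 \<longrightarrow> 0 \<le> v e \<longrightarrow> (\<forall>i. vge 0 (x $ i)) \<longrightarrow>
    (\<forall>l. vge ((real s + 1) * v e) (deformation (Suc d) F e x $ l)) \<longrightarrow> vge (v e - C) (poly p (x $ i)))"
proof -
  obtain q s R where q: "\<exists>r\<le>R. coeff (q r) 0 \<noteq> 0"
    and sm: "small_modulo (deformation (Suc d) F) (\<lambda>e x. e ^ s * (\<Sum>r\<le>R. poly (q r) e * x $ i ^ r))"
    using generalized_characteristic_polynomial[OF assms, of i] by auto
  from sm obtain C where C: "\<And>e x t. vge 0 e \<Longrightarrow> \<forall>i. vge 0 (x $ i) \<Longrightarrow>
      \<forall>l. vge t (deformation (Suc d) F e x $ l) \<Longrightarrow>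
      vge (t - C) (e ^ s * (\<Sum>r\<le>R. poly (q r) e * x $ i ^ r))"
    unfolding small_modulo_def by metis
  have "\<forall>r. \<exists>C. \<forall>e t. vge 0 e \<and> vge t e \<longrightarrow> vge (t + C) (poly (q r) e - coeff (q r) 0)"
    using vge_poly_diff_at_0 by blast
  then obtain B where B: "\<And>r e t. vge 0 e \<Longrightarrow> vge t e \<Longrightarrow> vge (t + B r) (poly (q r) e - coeff (q r) 0)"
    by metis
  define B' where "B' = Min (B ` {..R})"
  define p where "p = (\<Sum>r\<le>R. monom (coeff (q r) 0) r)"
  have "coeff p r = (if r \<le> R then coeff (q r) 0 else 0)" for r
    by (simp add: p_def coeff_sum)
  with q have "p \<noteq> 0" by (metis coeff_0)
  moreover have "vge (v e - max C (- B')) (poly p (x $ i))"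
    if e: "e \<noteq> 0" "0 \<le> v e" and x: "\<forall>i. vge 0 (x $ i)"
      and G: "\<forall>l. vge ((real s + 1) * v e) (deformation (Suc d) F e x $ l)" for e x
  proof -
    let ?Q = "\<Sum>r\<le>R. poly (q r) e * x $ i ^ r"
    have e0: "vge 0 e" using e by (simp add: vge_iff)
    have "vge ((real s + 1) * v e - C - v (e ^ s)) (e ^ s * ?Q / e ^ s)"
      using e by (intro vge_divide C[OF e0 x G]) auto
    then have 1: "vge (v e - C) ?Q"
      using e by (simp add: rval_power algebra_simps)
    have "vge (v e + B') (\<Sum>r\<le>R. (poly (q r) e - coeff (q r) 0) * x $ i ^ r)"
    proof (intro vge_sum vge_mult_right vge_power)
      fix r assume r: "r \<in> {..R}"
      have "B' \<le> B r" unfolding B'_def using r by (intro Min_le) auto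
      moreover have "vge (v e + B r) (poly (q r) e - coeff (q r) 0)"
        using e by (intro B e0) (simp add: vge_iff)
      ultimately show "vge (v e + B') (poly (q r) e - coeff (q r) 0)" by (auto elim: vge_mono)
    qed (use x in auto)
    moreover have "poly p (x $ i) = ?Q - (\<Sum>r\<le>R. (poly (q r) e - coeff (q r) 0) * x $ i ^ r)"
      by (simp add: p_def poly_sum poly_monom left_diff_distrib sum_subtractf)
    ultimately show ?thesis using 1 by (auto intro!: vge_diff elim: vge_mono)
  qed
  ultimately show ?thesis by blast
qed

lemma vge_power_ge: "vge \<rho> x \<Longrightarrow> 0 \<le> \<rho> \<Longrightarrow> vge \<rho> (x ^ Suc m)"
  by (auto intro!: vge_mult_right vge_power elim: vge_mono)

lemma vge_power_diff:
  assumes "vge 0 x" and "vge 0 y" and "vge r (x - y)"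
  shows "vge r (x ^ m - y ^ m)"
proof (induction m)
  case (Suc m)
  have "x ^ Suc m - y ^ Suc m = x * (x ^ m - y ^ m) + (x - y) * y ^ m"
    by (simp add: algebra_simps)
  moreover have "vge r \<dots>"
    using assms Suc by (intro vge_add) (blast intro: vge_mult_left vge_mult_right vge_power)+
  ultimately show ?case by simp
qed simp

lemma ex_nat_mult_ge: "0 < (\<rho>::real) \<Longrightarrow> \<exists>J::nat. \<forall>j\<ge>J. r \<le> real j * \<rho>"
  by (meson ex_less_of_nat_mult less_le_trans less_imp_le mult_right_mono of_nat_mono order_trans)

text \<open>Hypothesis \<open>contr\<close> makes \<open>F\<close> a perturbation of the identity on
  the ball. The convergent sequence is not one Newton iteration: its \<open>j\<close>-th member is
  an approximate zero of the deformation with parameter \<open>e0 ^ j\<close>, precise enough for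
  \<open>limit_polynomial\<close>, and the deformation disappears in the limit.\<close>

theorem hensel:
  fixes F :: "'k ^ 'n::finite \<Rightarrow> 'k ^ 'n"
  assumes poly: "\<And>l. poly_fun (\<lambda>x. F x $ l)" and \<rho>: "\<rho> > 0"
    and contr: "\<And>x y r l. \<forall>i. vge \<rho> (x $ i) \<Longrightarrow> \<forall>i. vge \<rho> (y $ i) \<Longrightarrow> \<forall>i. vge r (x $ i - y $ i) \<Longrightarrow>
      vge (r + \<rho>) ((x $ l - y $ l) - (F x $ l - F y $ l))"
    and zero: "\<And>l. vge \<rho> (F 0 $ l)"
  shows "\<exists>x. (\<forall>i. vge \<rho> (x $ i)) \<and> F x = 0"
proof -
  obtain d0 where d0: "\<And>l. poly_deg d0 (\<lambda>x. F x $ l)"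
    using poly_fun_common_degree[OF poly] by auto
  \<comment> \<open>The extra 1 makes the deformation exponent \<open>Suc d\<close> at least 2, so
    that the added powers contract by \<open>\<rho>\<close> on the ball and do not disturb
    \<open>contr\<close>.\<close>
  define d where "d = Suc d0"
  have d: "poly_deg d (\<lambda>x. F x $ l)" for l by (rule poly_deg_mono[OF d0]) (simp add: d_def)
  let ?G = "deformation (Suc d) F"
  let ?B = "\<lambda>x :: 'k ^ 'n. \<forall>i. vge \<rho> (x $ i)"
  have B0: "\<forall>i. vge 0 (x $ i)" if "?B x" for x using that \<rho> by (meson vge_mono less_imp_le)

  have contrG: "vge (r + \<rho>) ((x $ l - y $ l) - (?G e x $ l - ?G e y $ l))"
    if xy: "?B x" "?B y" "\<forall>i. vge r (x $ i - y $ i)" and e: "vge 0 e" for x y r l e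
  proof -
    have "x $ l ^ Suc d - y $ l ^ Suc d = (x $ l ^ d - y $ l ^ d) * x $ l + (x $ l - y $ l) * y $ l ^ d"
      by (simp add: algebra_simps)
    moreover have "vge (r + \<rho>) \<dots>"
      using xy \<rho> B0 unfolding d_def
      by (intro vge_add vge_mult vge_power_diff vge_power_ge) auto
    ultimately have "vge (r + \<rho>) (e * (x $ l ^ Suc d - y $ l ^ Suc d))"
      using e by (auto intro!: vge_mult_left)
    then have "vge (r + \<rho>) ((x $ l - y $ l) - (F x $ l - F y $ l) - e * (x $ l ^ Suc d - y $ l ^ Suc d))"
      by (intro vge_diff contr xy)
    then show ?thesis by (simp add: deformation_def algebra_simps)
  qed

  \<comment> \<open>Simplified Newton steps from 0: replacing \<open>x\<close> by
    \<open>x - ?G e x\<close> gains \<open>\<rho>\<close> in the residual.\<close>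
  have newton: "\<exists>x. ?B x \<and> (\<forall>l. vge (real (Suc j) * \<rho>) (?G e x $ l))" if e: "vge 0 e" for e j
  proof (induction j)
    case 0
    show ?case using zero by (intro exI[of _ 0]) (auto simp: deformation_def)
  next
    case (Suc j)
    then obtain x where x: "?B x" "\<And>l. vge (real (Suc j) * \<rho>) (?G e x $ l)" by blast
    define y where "y = x - ?G e x"
    have le: "\<rho> \<le> real (Suc j) * \<rho>" using \<rho> by simp
    have y: "?B y"
      unfolding y_def using x(1) vge_mono[OF x(2) le] by (auto intro!: vge_diff)
    have "vge (real (Suc j) * \<rho> + \<rho>) ((x $ l - y $ l) - (?G e x $ l - ?G e y $ l))" for l
      using x by (intro contrG y e) (auto simp: y_def)
    then have "vge (real (Suc (Suc j)) * \<rho>) (?G e y $ l)" for l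
      by (simp add: y_def algebra_simps)
    with y show ?case by blast
  qed

  \<comment> \<open>A bound on \<open>F x - F y\<close> passes to \<open>x - y\<close>: starting
    from the bound \<open>\<rho>\<close> valid on the ball, each use of \<open>contr\<close> gains
    another \<open>\<rho>\<close> until \<open>r\<close> is reached.\<close>
  have dist: "\<forall>i. vge r (x $ i - y $ i)"
    if xy: "?B x" "?B y" "\<forall>l. vge r (F x $ l - F y $ l)" for x y r
  proof -
    have iter: "\<forall>i. vge (min r (real (Suc j) * \<rho>)) (x $ i - y $ i)" for j
    proof (induction j)
      case 0
      have "vge \<rho> (x $ i - y $ i)" for i using xy by (intro vge_diff) auto
      then have "vge (min r \<rho>) (x $ i - y $ i)" for i by (rule vge_mono) simp
      then show ?case by simp
    next
      case (Suc j)
      show ?case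
      proof
        fix l
        have "vge (min r (real (Suc j) * \<rho>) + \<rho>) ((x $ l - y $ l) - (F x $ l - F y $ l))"
          by (rule contr[OF xy(1,2) Suc])
        moreover have "min r (real (Suc (Suc j)) * \<rho>) \<le> min r (real (Suc j) * \<rho>) + \<rho>"
          using \<rho> by (auto simp: algebra_simps min_def)
        ultimately have "vge (min r (real (Suc (Suc j)) * \<rho>))
            ((x $ l - y $ l) - (F x $ l - F y $ l) + (F x $ l - F y $ l))"
          by (intro vge_add vge_mono[OF xy(3)[rule_format]]) (auto elim: vge_mono)
        then show "vge (min r (real (Suc (Suc j)) * \<rho>)) (x $ l - y $ l)" by simp
      qed
    qed
    obtain J where J: "\<forall>j\<ge>J. r \<le> real j * \<rho>" using ex_nat_mult_ge[OF \<rho>] by blast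
    then have "r \<le> real (Suc J) * \<rho>" by (meson le_SucI order_refl)
    then show ?thesis using iter[of J] by (simp add: min_absorb1)
  qed

  have "\<forall>i. \<exists>p s C. p \<noteq> 0 \<and> (\<forall>e x. e \<noteq> 0 \<longrightarrow> 0 \<le> v e \<longrightarrow> (\<forall>i. vge 0 (x $ i)) \<longrightarrow>
    (\<forall>l. vge ((real s + 1) * v e) (?G e x $ l)) \<longrightarrow> vge (v e - C) (poly p (x $ i)))"
    using limit_polynomial[OF d] by blast
  then obtain p s C where psC: "\<And>i. p i \<noteq> 0"
    "\<And>i e x. e \<noteq> 0 \<Longrightarrow> 0 \<le> v e \<Longrightarrow> \<forall>i. vge 0 (x $ i) \<Longrightarrow>
      \<forall>l. vge ((real (s i) + 1) * v e) (?G e x $ l) \<Longrightarrow> vge (v e - C i) (poly (p i) (x $ i))"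
    by metis
  obtain e0 where e0: "e0 \<noteq> 0" "v e0 > 0" using ex_pos_val by blast
  define S where "S = Max (range s)"
  have S: "s i \<le> S" for i unfolding S_def by (intro Max_ge) auto
  have ve: "v (e0 ^ j) = real j * v e0" for j using e0 by (simp add: rval_power)
  have e_vge: "vge 0 (e0 ^ j)" for j using e0 by (simp add: vge_iff ve)

  have "\<exists>x. ?B x \<and> (\<forall>l. vge ((real S + 1) * v (e0 ^ j)) (?G (e0 ^ j) x $ l))" for j
  proof -
    obtain J where "\<forall>m\<ge>J. (real S + 1) * v (e0 ^ j) \<le> real m * \<rho>"
      using ex_nat_mult_ge[OF \<rho>] by blast
    then have "(real S + 1) * v (e0 ^ j) \<le> real (Suc J) * \<rho>" by (meson le_SucI order_refl)
    then show ?thesis using newton[OF e_vge, of J j] by (meson vge_mono)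
  qed
  then obtain x where x: "\<And>j. ?B (x j)"
    "\<And>j l. vge ((real S + 1) * v (e0 ^ j)) (?G (e0 ^ j) (x j) $ l)" by metis
  \<comment> \<open>The deformation term is itself of valuation at least \<open>v (e0 ^ j)\<close>,
    so \<open>F\<close> is almost zero at \<open>x j\<close> as well; with \<open>dist\<close> this
    makes the sequence Cauchy.\<close>
  have Fx: "vge (real j * v e0) (F (x j) $ l)" for j l
  proof -
    have "F (x j) $ l = ?G (e0 ^ j) (x j) $ l - e0 ^ j * x j $ l ^ Suc d"
      by (simp add: deformation_def)
    moreover have "vge (real j * v e0) (?G (e0 ^ j) (x j) $ l)"
      by (rule vge_mono[OF x(2)]) (use e0 in \<open>simp add: ve algebra_simps\<close>)
    moreover have "vge (real j * v e0) (e0 ^ j * x j $ l ^ Suc d)"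
      by (intro vge_mult_right vge_power) (use e0 B0 x ve in \<open>auto simp: vge_iff\<close>)
    ultimately show ?thesis by (auto intro: vge_diff)
  qed
  have cauchy: "vge r (x j $ i - x k $ i)" if "r \<le> real j * v e0" "r \<le> real k * v e0" for r i j k
  proof -
    have "\<forall>l. vge r (F (x j) $ l - F (x k) $ l)"
      by (intro allI vge_diff vge_mono[OF Fx] that)
    with dist x(1) show ?thesis by blast
  qed
  have small: "vge (real j * v e0 - C i) (poly (p i) (x j $ i))" for i j
  proof -
    have "vge (v (e0 ^ j) - C i) (poly (p i) (x j $ i))"
    proof (rule psC(2))
      show "\<forall>l. vge ((real (s i) + 1) * v (e0 ^ j)) (?G (e0 ^ j) (x j) $ l)"
        using S[of i] e0 by (auto intro!: vge_mono[OF x(2)] mult_right_mono simp: ve)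
    qed (use e0 B0 x ve in auto)
    then show ?thesis by (simp add: ve)
  qed
  have "\<exists>a. vconverges (\<lambda>j. x j $ i) a" for i
  proof (rule polynomial_cauchy_converges[OF psC(1)[of i]])
    fix r
    show "\<exists>J. \<forall>j\<ge>J. vge r (poly (p i) (x j $ i))"
      using ex_nat_mult_ge[OF e0(2), of "r + C i"] small by (meson vge_mono le_diff_eq)
    show "\<exists>J. \<forall>j\<ge>J. \<forall>k\<ge>J. vge r (x j $ i - x k $ i)"
      using ex_nat_mult_ge[OF e0(2), of r] cauchy by meson
  qed
  then obtain a where a: "\<And>i. vconverges (\<lambda>j. x j $ i) (a i)" by metis
  define A where "A = vec_lambda a"
  have close: "\<exists>J. \<forall>j\<ge>J. \<forall>i. vge r (x j $ i - A $ i)" for r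
  proof -
    have "\<forall>i. \<exists>J. \<forall>j\<ge>J. vge r (x j $ i - A $ i)" using a by (auto simp: vconverges_def A_def)
    then obtain J where J: "\<And>i j. j \<ge> J i \<Longrightarrow> vge r (x j $ i - A $ i)" by metis
    have "J i \<le> Max (range J)" for i by (intro Max_ge) auto
    then show ?thesis using J by (meson order_trans)
  qed
  have BA: "?B A"
  proof
    fix i
    obtain j where "vge \<rho> (x j $ i - A $ i)" using close[of \<rho>] by blast
    then show "vge \<rho> (A $ i)"
      using x(1)[of j] vge_diff[of \<rho> "x j $ i" "x j $ i - A $ i"] by simp
  qed
  \<comment> \<open>By \<open>contr\<close> the map \<open>F\<close> is Lipschitz with constant 1 on
    the ball, so the small values \<open>F (x j)\<close> pass to the limit.\<close>
  have "F A $ l = 0" for l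
  proof (rule vge_all_imp_zero)
    fix r
    obtain J where J: "\<And>j i. j \<ge> J \<Longrightarrow> vge r (x j $ i - A $ i)" using close[of r] by blast
    obtain J' where J': "\<And>j. j \<ge> J' \<Longrightarrow> r \<le> real j * v e0" using ex_nat_mult_ge[OF e0(2), of r] by blast
    define j where "j = max J J'"
    have 1: "\<forall>i. vge r (x j $ i - A $ i)" using J by (simp add: j_def)
    have 2: "vge r (F (x j) $ l)" using J'[of j] vge_mono[OF Fx[of j l], of r] by (simp add: j_def)
    have "vge (r + \<rho>) ((x j $ l - A $ l) - (F (x j) $ l - F A $ l))"
      by (rule contr[OF x(1) BA 1])
    then have "vge r ((x j $ l - A $ l) - (F (x j) $ l - F A $ l))"
      by (rule vge_mono) (use \<rho> in simp)
    then have "vge r ((x j $ l - A $ l) - (F (x j) $ l - F A $ l) - (x j $ l - A $ l))"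
      by (rule vge_diff) (use 1 in simp)
    then have "vge r ((x j $ l - A $ l) - (F (x j) $ l - F A $ l) - (x j $ l - A $ l) + F (x j) $ l)"
      using 2 by (rule vge_add)
    then show "vge r (F A $ l)" by simp
  qed
  then have "F A = 0" by (simp add: vec_eq_iff)
  with BA show ?thesis by blast
qed

end

section \<open>Systems of Laurent polynomials\<close>

definition laurent_monomial :: "'a::field ^ 'n::finite \<Rightarrow> int ^ 'n \<Rightarrow> 'a" where
  "laurent_monomial x u = (\<Prod>i\<in>UNIV. x $ i powi (u $ i))"

text \<open>Factor for moving a point multiplicatively; for \<open>z\<close> of positive valuation
  it leaves all valuations unchanged.\<close>

definition one_plus :: "'a::comm_ring_1 ^ 'n::finite \<Rightarrow> 'a ^ 'n" where
  "one_plus z = (\<chi> i. 1 + z $ i)"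

lemma laurent_monomial_0 [simp]: "laurent_monomial x 0 = 1"
  by (simp add: laurent_monomial_def)

lemma laurent_monomial_nonzero: "x \<in> torus \<Longrightarrow> laurent_monomial x u \<noteq> 0"
  by (auto simp: laurent_monomial_def torus_def power_int_eq_0_iff)

lemma laurent_monomial_add:
  "x \<in> torus \<Longrightarrow> laurent_monomial x (u + w) = laurent_monomial x u * laurent_monomial x w"
  by (simp add: laurent_monomial_def torus_def power_int_add prod.distrib)

lemma laurent_monomial_diff:
  "x \<in> torus \<Longrightarrow> laurent_monomial x (u - w) = laurent_monomial x u / laurent_monomial x w"
  using laurent_monomial_add[of x "u - w" w] laurent_monomial_nonzero[of x w]
  by (simp add: field_simps)

lemma laurent_monomial_mult:
  "laurent_monomial (\<chi> i. x $ i * y $ i) u = laurent_monomial x u * laurent_monomial y u"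
  by (simp add: laurent_monomial_def power_int_mult_distrib prod.distrib)

lemma laurent_monomial_axis [simp]: "laurent_monomial x (axis i 1) = x $ i"
proof -
  have "laurent_monomial x (axis i 1) = (\<Prod>j\<in>UNIV. if j = i then x $ i else 1)"
    unfolding laurent_monomial_def by (intro prod.cong) (auto simp: axis_def)
  then show ?thesis by simp
qed

lemma laurent_monomial_shift:
  assumes "x \<in> torus" and "\<And>i. 0 \<le> u $ i + int N"
  shows "(\<Prod>i\<in>UNIV. x $ i ^ nat (u $ i + int N)) = laurent_monomial x u * (\<Prod>i\<in>UNIV. x $ i) ^ N"
proof -
  have "(\<Prod>i\<in>UNIV. x $ i ^ nat (u $ i + int N)) = (\<Prod>i\<in>UNIV. x $ i powi (u $ i) * x $ i ^ N)"
    using assms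
    by (intro prod.cong) (auto simp: torus_def power_int_add simp flip: power_int_nonneg_exp)
  then show ?thesis by (simp add: laurent_monomial_def prod.distrib prod_power_distrib)
qed

text \<open>The bound is 1 rather than 0 so that every shifted monomial contains every variable; a
  polynomial cleared in this way vanishes wherever some coordinate is 0.\<close>

lemma ex_exponent_shift:
  fixes U :: "(int ^ 'n::finite) set"
  assumes "finite U"
  shows "\<exists>N::nat. \<forall>u\<in>U. \<forall>i. 1 \<le> u $ i + int N"
proof -
  define S where "S = (\<lambda>(u, i). nat (1 - u $ i)) ` (U \<times> (UNIV :: 'n set))"
  have "finite S" using assms by (simp add: S_def)
  have "1 \<le> u $ i + int (Max S)" if "u \<in> U" for u i
  proof -
    have "nat (1 - u $ i) \<le> Max S"
      using \<open>finite S\<close> that by (intro Max_ge) (auto simp: S_def)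
    then show ?thesis by linarith
  qed
  then show ?thesis by blast
qed

section \<open>Linear expansions of monomials near 1, and matrices invertible over the valuation
  ring\<close>

context nonarch_valued
begin

lemma vge_min_vector: "\<exists>t. \<forall>i. vge t (x $ i)" for x :: "'k ^ 'n::finite"
proof -
  have "\<forall>i. \<exists>r. vge r (x $ i)" using vge_exists by blast
  then obtain t where t: "\<And>i. vge (t i) (x $ i)" by metis
  have "Min (range t) \<le> t i" for i by (intro Min_le) auto
  then show ?thesis using t vge_mono by blast
qed

lemma vge_matrix_vector:
  "(\<And>i. vge r (M $ l $ i)) \<Longrightarrow> (\<And>i. vge s (x $ i)) \<Longrightarrow> vge (r + s) ((M *v x) $ l)"
  by (auto simp: matrix_vector_mult_def intro!: vge_sum vge_mult)

lemma one_plus_torus: "\<forall>i. vge \<rho> (z $ i) \<Longrightarrow> \<rho> > 0 \<Longrightarrow> one_plus z \<in> torus"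
  using rval_one_plus by (auto simp: torus_def one_plus_def)

text \<open>\<open>L\<close> is the differential of \<open>h\<close> on the whole ball up to an
  error of valuation \<open>\<rho>\<close>. As \<open>h\<close> stays close to 1, it is also the
  logarithmic differential, which explains why \<open>L\<close> is additive under products.\<close>

definition unit_expansion :: "real \<Rightarrow> ('k ^ 'n::finite \<Rightarrow> 'k) \<Rightarrow> ('n \<Rightarrow> int) \<Rightarrow> bool" where
  "unit_expansion \<rho> h L \<longleftrightarrow>
     (\<forall>x. (\<forall>i. vge \<rho> (x $ i)) \<longrightarrow> vge \<rho> (h x - 1)) \<and>
     (\<forall>x y r. (\<forall>i. vge \<rho> (x $ i)) \<longrightarrow> (\<forall>i. vge \<rho> (y $ i)) \<longrightarrow> (\<forall>i. vge r (x $ i - y $ i)) \<longrightarrow>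
        vge (r + \<rho>) (h x - h y - (\<Sum>i\<in>UNIV. of_int (L i) * (x $ i - y $ i))))"

lemma unit_expansion_near_1:
  "unit_expansion \<rho> h L \<Longrightarrow> \<forall>i. vge \<rho> (x $ i) \<Longrightarrow> vge \<rho> (h x - 1)"
  by (simp add: unit_expansion_def)

lemma unit_expansion_linear:
  "unit_expansion \<rho> h L \<Longrightarrow> \<forall>i. vge \<rho> (x $ i) \<Longrightarrow> \<forall>i. vge \<rho> (y $ i) \<Longrightarrow>
    \<forall>i. vge r (x $ i - y $ i) \<Longrightarrow>
    vge (r + \<rho>) (h x - h y - (\<Sum>i\<in>UNIV. of_int (L i) * (x $ i - y $ i)))"
  by (simp add: unit_expansion_def)

lemma unit_expansion_lipschitz:
  assumes "unit_expansion \<rho> h L" "\<rho> > 0"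
    "\<forall>i. vge \<rho> (x $ i)" "\<forall>i. vge \<rho> (y $ i)" "\<forall>i. vge r (x $ i - y $ i)"
  shows "vge r (h x - h y)"
proof -
  have "vge r (h x - h y - (\<Sum>i\<in>UNIV. of_int (L i) * (x $ i - y $ i)))"
    by (rule vge_mono[OF unit_expansion_linear[OF assms(1,3-5)]]) (use assms in simp)
  moreover have "vge r (\<Sum>i\<in>UNIV. of_int (L i) * (x $ i - y $ i))"
    using assms by (intro vge_sum vge_mult_left) auto
  ultimately show ?thesis using vge_add by fastforce
qed

lemma unit_expansion_one: "unit_expansion \<rho> (\<lambda>_. 1) (\<lambda>_. 0)"
  by (simp add: unit_expansion_def)

lemma unit_expansion_coord:
  "unit_expansion \<rho> (\<lambda>x :: 'k ^ 'n::finite. 1 + x $ i) (\<lambda>j. if j = i then 1 else 0)"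
proof -
  have "(\<Sum>j\<in>UNIV. of_int (if j = i then 1 else 0) * (x $ j - y $ j)) = x $ i - y $ i"
    for x y :: "'k ^ 'n"
    by (simp add: if_distrib[of of_int] if_distrib[of "\<lambda>c. c * _"] cong: if_cong)
  then show ?thesis by (simp add: unit_expansion_def)
qed

lemma unit_expansion_mult:
  fixes h g :: "'k ^ 'n::finite \<Rightarrow> 'k"
  assumes h: "unit_expansion \<rho> h L" and g: "unit_expansion \<rho> g M" and \<rho>: "\<rho> > 0"
  shows "unit_expansion \<rho> (\<lambda>x. h x * g x) (\<lambda>i. L i + M i)"
  unfolding unit_expansion_def
proof (intro conjI allI impI)
  fix x :: "'k ^ 'n" assume x: "\<forall>i. vge \<rho> (x $ i)"
  have "h x * g x - 1 = (h x - 1) + (g x - 1) + (h x - 1) * (g x - 1)" by (simp add: algebra_simps)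
  moreover have "vge \<rho> ((h x - 1) * (g x - 1))"
    by (rule vge_mono[OF vge_mult[OF unit_expansion_near_1[OF h x] unit_expansion_near_1[OF g x]]])
       (use \<rho> in simp)
  ultimately show "vge \<rho> (h x * g x - 1)"
    using unit_expansion_near_1[OF h x] unit_expansion_near_1[OF g x] by (simp only: vge_add)
next
  fix x y :: "'k ^ 'n" and r
  assume xy: "\<forall>i. vge \<rho> (x $ i)" "\<forall>i. vge \<rho> (y $ i)" "\<forall>i. vge r (x $ i - y $ i)"
  let ?d = "\<lambda>L. \<Sum>i\<in>UNIV. of_int (L i) * (x $ i - y $ i)"
  have "?d (\<lambda>i. L i + M i) = ?d L + ?d M" by (simp add: distrib_right sum.distrib)
  \<comment> \<open>The last two summands collect the failure of the product rule; each pairs an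
    increment with the distance of a factor from 1.\<close>
  then have "h x * g x - h y * g y - ?d (\<lambda>i. L i + M i) =
      (h x - h y - ?d L) + (g x - g y - ?d M) + (h x - h y) * (g x - 1) + (g x - g y) * (h y - 1)"
    by (simp add: algebra_simps)
  moreover have "vge (r + \<rho>) ((h x - h y) * (g x - 1))" "vge (r + \<rho>) ((g x - g y) * (h y - 1))"
    by (intro vge_mult unit_expansion_lipschitz[OF h \<rho> xy] unit_expansion_lipschitz[OF g \<rho> xy]
        unit_expansion_near_1[OF h xy(2)] unit_expansion_near_1[OF g xy(1)])+
  ultimately show "vge (r + \<rho>) (h x * g x - h y * g y - ?d (\<lambda>i. L i + M i))"
    using unit_expansion_linear[OF h xy] unit_expansion_linear[OF g xy] by (simp only: vge_add)
qed

lemma vge_inverse_near_1: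
  assumes "vge \<rho> (a - 1)" and "\<rho> > 0"
  shows "a \<noteq> 0" and "v a = 0" and "vge \<rho> (inverse a - 1)"
proof -
  show a: "a \<noteq> 0" "v a = 0" using rval_eq_if_close[of 1 \<rho> a] assms by auto
  have "inverse a - 1 = - ((a - 1) / a)" using a by (simp add: field_simps)
  then show "vge \<rho> (inverse a - 1)" using vge_divide_unit[OF a] assms by simp
qed

lemma unit_expansion_inverse:
  fixes h :: "'k ^ 'n::finite \<Rightarrow> 'k"
  assumes h: "unit_expansion \<rho> h L" and \<rho>: "\<rho> > 0"
  shows "unit_expansion \<rho> (\<lambda>x. inverse (h x)) (\<lambda>i. - L i)"
  unfolding unit_expansion_def
proof (intro conjI allI impI)
  fix x :: "'k ^ 'n" assume x: "\<forall>i. vge \<rho> (x $ i)"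
  show "vge \<rho> (inverse (h x) - 1)"
    by (rule vge_inverse_near_1[OF unit_expansion_near_1[OF h x] \<rho>])
next
  fix x y :: "'k ^ 'n" and r
  assume xy: "\<forall>i. vge \<rho> (x $ i)" "\<forall>i. vge \<rho> (y $ i)" "\<forall>i. vge r (x $ i - y $ i)"
  let ?d = "\<lambda>L. \<Sum>i\<in>UNIV. of_int (L i) * (x $ i - y $ i)"
  note hx = vge_inverse_near_1[OF unit_expansion_near_1[OF h xy(1)] \<rho>]
  note hy = vge_inverse_near_1[OF unit_expansion_near_1[OF h xy(2)] \<rho>]
  have "?d (\<lambda>i. - L i) = - ?d L" by (simp add: sum_negf)
  then have "inverse (h x) - inverse (h y) - ?d (\<lambda>i. - L i) =
      - (h x - h y - ?d L) - (h x - h y) * ((inverse (h x) - 1) + inverse (h x) * (inverse (h y) - 1))"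
    using hx(1) hy(1) by (simp add: field_simps)
  moreover have "vge \<rho> ((inverse (h x) - 1) + inverse (h x) * (inverse (h y) - 1))"
    using hx hy by (intro vge_add vge_mult_left) (auto simp: vge_iff rval_inverse)
  then have "vge (r + \<rho>) ((h x - h y) * ((inverse (h x) - 1) + inverse (h x) * (inverse (h y) - 1)))"
    by (intro vge_mult unit_expansion_lipschitz[OF h \<rho> xy])
  moreover have "vge (r + \<rho>) (- (h x - h y - ?d L))"
    unfolding vge_uminus by (rule unit_expansion_linear[OF h xy])
  ultimately show "vge (r + \<rho>) (inverse (h x) - inverse (h y) - ?d (\<lambda>i. - L i))"
    by (simp only: vge_diff)
qed

lemma unit_expansion_power:
  assumes h: "unit_expansion \<rho> h L" and \<rho>: "\<rho> > 0"
  shows "unit_expansion \<rho> (\<lambda>x. h x ^ m) (\<lambda>i. int m * L i)"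
proof (induction m)
  case (Suc m)
  show ?case using unit_expansion_mult[OF h Suc \<rho>] by (simp add: algebra_simps)
qed (simp add: unit_expansion_one)

lemma unit_expansion_powi:
  assumes h: "unit_expansion \<rho> h L" and \<rho>: "\<rho> > 0"
  shows "unit_expansion \<rho> (\<lambda>x. h x powi m) (\<lambda>i. m * L i)"
proof (cases "m \<ge> 0")
  case True
  with unit_expansion_power[OF h \<rho>, of "nat m"] show ?thesis by (simp add: power_int_def)
next
  case False
  with unit_expansion_power[OF unit_expansion_inverse[OF h \<rho>] \<rho>, of "nat (- m)"]
  show ?thesis by (simp add: power_int_def)
qed

lemma unit_expansion_prod:
  assumes "\<And>j. j \<in> S \<Longrightarrow> unit_expansion \<rho> (h j) (L j)" and \<rho>: "\<rho> > 0"
  shows "unit_expansion \<rho> (\<lambda>x. \<Prod>j\<in>S. h j x) (\<lambda>i. \<Sum>j\<in>S. L j i)"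
  using assms(1)
  by (induction S rule: infinite_finite_induct)
     (auto simp: unit_expansion_one intro: unit_expansion_mult[OF _ _ \<rho>])

lemma unit_expansion_laurent_monomial:
  assumes \<rho>: "\<rho> > 0"
  shows "unit_expansion \<rho> (\<lambda>x. laurent_monomial (one_plus x) u) (\<lambda>i. u $ i)"
proof -
  have "unit_expansion \<rho> (\<lambda>x. \<Prod>j\<in>UNIV. (1 + x $ j) powi u $ j)
      (\<lambda>i. \<Sum>j\<in>UNIV. u $ j * (if i = j then 1 else 0))"
    by (intro unit_expansion_prod unit_expansion_powi unit_expansion_coord \<rho>)
  then show ?thesis
    by (simp add: laurent_monomial_def one_plus_def if_distrib[of "\<lambda>c. _ * c"] cong: if_cong)
qed

text \<open>Invertibility over the valuation ring without determinants: the second clause says that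
  the inverse is integral too. In this form it is stable under perturbation.\<close>

definition integral_isometry :: "'k ^ 'n::finite ^ 'n \<Rightarrow> bool" where
  "integral_isometry M \<longleftrightarrow> (\<forall>l i. vge 0 (M $ l $ i)) \<and>
     (\<forall>r x. (\<forall>l. vge r ((M *v x) $ l)) \<longrightarrow> (\<forall>i. vge r (x $ i)))"

lemma integral_isometryD:
  "integral_isometry M \<Longrightarrow> vge 0 (M $ l $ i)"
  "integral_isometry M \<Longrightarrow> (\<And>l. vge r ((M *v x) $ l)) \<Longrightarrow> vge r (x $ i)"
  by (auto simp: integral_isometry_def)

text \<open>From any lower bound \<open>t\<close> on the valuations of \<open>x\<close>, writing the
  image under \<open>M\<close> as the image under \<open>M'\<close> minus the image under
  \<open>M' - M\<close> improves the bound by \<open>\<rho>\<close>, unless \<open>r\<close> is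
  reached first.\<close>

lemma integral_isometry_perturb:
  fixes M M' :: "'k ^ 'n::finite ^ 'n"
  assumes M: "integral_isometry M" and diff: "\<And>l i. vge \<rho> (M' $ l $ i - M $ l $ i)" and \<rho>: "\<rho> > 0"
  shows "integral_isometry M'"
  unfolding integral_isometry_def
proof (intro conjI allI impI)
  fix l i
  have "vge 0 (M' $ l $ i - M $ l $ i)" by (rule vge_mono[OF diff]) (use \<rho> in simp)
  then show "vge 0 (M' $ l $ i)"
    using vge_add[OF _ integral_isometryD(1)[OF M, of l i], of "M' $ l $ i - M $ l $ i"] by simp
next
  fix r and x :: "'k ^ 'n" and i
  assume x: "\<forall>l. vge r ((M' *v x) $ l)"
  obtain t where t: "\<forall>i. vge t (x $ i)" using vge_min_vector by blast
  have iter: "\<forall>i. vge (min r (t + real j * \<rho>)) (x $ i)" for j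
  proof (induction j)
    case 0
    have "vge (min r t) (x $ i)" for i by (rule vge_mono[OF t[rule_format]]) simp
    then show ?case by simp
  next
    case (Suc j)
    have "vge (min r (t + real (Suc j) * \<rho>)) ((M *v x) $ l)" for l
    proof -
      have "M *v x = M' *v x - (M' - M) *v x"
        by (simp add: matrix_vector_mult_diff_rdistrib)
      then have eq: "(M *v x) $ l = (M' *v x) $ l - ((M' - M) *v x) $ l" by simp
      have "vge (\<rho> + min r (t + real j * \<rho>)) (((M' - M) *v x) $ l)"
        by (rule vge_matrix_vector) (use diff Suc in auto)
      then have "vge (min r (t + real (Suc j) * \<rho>)) (((M' - M) *v x) $ l)"
        by (rule vge_mono) (use \<rho> in \<open>auto simp: algebra_simps min_def\<close>)
      moreover have "vge (min r (t + real (Suc j) * \<rho>)) ((M' *v x) $ l)"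
        by (rule vge_mono[OF x[rule_format]]) simp
      ultimately show ?thesis unfolding eq by (intro vge_diff)
    qed
    then show ?case using integral_isometryD(2)[OF M] by blast
  qed
  obtain j :: nat where "r - t < real j * \<rho>" using reals_Archimedean3[OF \<rho>] by blast
  then show "vge r (x $ i)" using iter[of j] by (auto simp: min_def split: if_splits)
qed

text \<open>Vectors of the kernel satisfy every lower bound and hence vanish; the columns of the
  inverse are integral because \<open>M\<close> maps them to unit vectors.\<close>

lemma integral_isometry_inverse:
  fixes M :: "'k ^ 'n::finite ^ 'n"
  assumes M: "integral_isometry M"
  shows "\<exists>M'. M' ** M = mat 1 \<and> M ** M' = mat 1 \<and> (\<forall>l i. vge 0 (M' $ l $ i))"
proof -
  have ker: "x = 0" if "M *v x = 0" for x
  proof -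
    have "x $ i = 0" for i
      by (rule vge_all_imp_zero, rule integral_isometryD(2)[OF M]) (simp add: that)
    then show ?thesis by (simp add: vec_eq_iff)
  qed
  have "\<exists>M'. M' ** M = mat 1"
    unfolding matrix_left_invertible_ker by (intro allI impI) (rule ker)
  then obtain M' where M': "M' ** M = mat 1" by (rule exE)
  then have MM': "M ** M' = mat 1" using matrix_left_right_inverse by blast
  have "vge 0 (M' $ l $ i)" for l i
  proof -
    have "M *v (M' *v axis i 1) = axis i 1" by (simp add: matrix_vector_mul_assoc MM')
    then have "vge 0 ((M *v (M' *v axis i 1)) $ j)" for j by (simp add: axis_def)
    then have "vge 0 ((M' *v axis i 1) $ l)" by (rule integral_isometryD(2)[OF M])
    then show ?thesis by (simp add: matrix_vector_mult_def axis_def if_distrib[of "\<lambda>c. _ * c"] cong: if_cong)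
  qed
  with M' MM' show ?thesis by blast
qed

end

context alg_closed_valued
begin

text \<open>The given isometry is the Jacobian at \<open>z = 0\<close>; multiplying by its inverse
  brings the system into the form of \<open>hensel\<close>. Multiplying by a monomial to reach
  polynomials alters the linear part only by multiples of the sums in \<open>sum_t\<close>, which
  are already small, and is undone afterwards on the torus.\<close>

theorem laurent_hensel:
  fixes t :: "'n::finite \<Rightarrow> int ^ 'n \<Rightarrow> 'k" and U :: "'n \<Rightarrow> (int ^ 'n) set"
  assumes fin: "\<And>l. finite (U l)" and \<rho>: "\<rho> > 0"
    and t0: "\<And>l u. u \<in> U l \<Longrightarrow> vge 0 (t l u)"
    and sum_t: "\<And>l. vge \<rho> (\<Sum>u\<in>U l. t l u)"
    and isom: "integral_isometry (\<chi> l i. \<Sum>u\<in>U l. t l u * of_int (u $ i))"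
  shows "\<exists>z. (\<forall>i. vge \<rho> (z $ i)) \<and>
    (\<forall>l. (\<Sum>u\<in>U l. t l u * laurent_monomial (one_plus z) u) = 0)"
proof -
  define Q where "Q = (\<chi> l i. \<Sum>u\<in>U l. t l u * of_int (u $ i))"
  obtain Q' where Q': "Q' ** Q = mat 1" "Q ** Q' = mat 1" "\<And>l i. vge 0 (Q' $ l $ i)"
    using integral_isometry_inverse[OF isom] by (auto simp: Q_def)
  obtain N where N: "\<And>l u i. u \<in> U l \<Longrightarrow> 1 \<le> u $ i + int N"
    using ex_exponent_shift[of "\<Union>l. U l"] fin by (metis UN_I UNIV_I finite_UN_I finite)
  have N0: "0 \<le> u $ i + int N" if "u \<in> U l" for u l i using N[OF that, of i] by simp
  define h where "h = (\<lambda>u (x :: 'k ^ 'n). \<Prod>i\<in>UNIV. (1 + x $ i) ^ nat (u $ i + int N))"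
  have h: "unit_expansion \<rho> (h u) (\<lambda>i. u $ i + int N)" if "u \<in> U l" for u l
  proof -
    have "h u = (\<lambda>x. laurent_monomial (one_plus x) (\<chi> i. u $ i + int N))"
      using N0[OF that]
      by (intro ext) (auto simp: h_def laurent_monomial_def one_plus_def power_int_def intro!: prod.cong)
    then show ?thesis using unit_expansion_laurent_monomial[OF \<rho>, of "\<chi> i. u $ i + int N"] by simp
  qed
  define G where "G = (\<lambda>x. \<chi> m. \<Sum>u\<in>U m. t m u * h u x)"
  define F where "F = (\<lambda>x. Q' *v G x)"
  have "\<exists>x. (\<forall>i. vge \<rho> (x $ i)) \<and> F x = 0"
  proof (rule hensel[OF _ \<rho>])
    show "poly_fun (\<lambda>x. F x $ l)" for l
      unfolding F_def G_def h_def matrix_vector_mult_def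
      by (auto intro!: poly_fun_sum poly_fun_mult poly_fun_prod poly_fun_power poly_fun_add)
    show "vge \<rho> (F 0 $ l)" for l
    proof -
      have "vge (0 + \<rho>) (F 0 $ l)" unfolding F_def
        by (rule vge_matrix_vector[OF Q'(3)]) (simp add: G_def h_def sum_t)
      then show ?thesis by simp
    qed
    fix x y :: "'k ^ 'n" and r l
    assume xy: "\<forall>i. vge \<rho> (x $ i)" "\<forall>i. vge \<rho> (y $ i)" "\<forall>i. vge r (x $ i - y $ i)"
    let ?d = "x - y"
    have step: "vge (r + \<rho>) ((Q *v ?d - (G x - G y)) $ m)" for m
    proof -
      let ?e = "\<lambda>u. h u x - h u y - (\<Sum>i\<in>UNIV. of_int (u $ i + int N) * (x $ i - y $ i))"
      have "(\<Sum>u\<in>U m. t m u * ?e u) =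
          (\<Sum>u\<in>U m. t m u * h u x) - (\<Sum>u\<in>U m. t m u * h u y)
          - (\<Sum>u\<in>U m. t m u * (\<Sum>i\<in>UNIV. of_int (u $ i) * (x $ i - y $ i)))
          - (\<Sum>u\<in>U m. t m u * (of_nat N * (\<Sum>i\<in>UNIV. x $ i - y $ i)))"
        by (simp add: right_diff_distrib sum_subtractf distrib_right distrib_left sum.distrib
            flip: sum_distrib_left)
      also have "(\<Sum>u\<in>U m. t m u * (\<Sum>i\<in>UNIV. of_int (u $ i) * (x $ i - y $ i))) = (Q *v ?d) $ m"
        unfolding Q_def matrix_vector_mult_def
        by (simp add: sum_distrib_left sum_distrib_right mult.assoc) (rule sum.swap)
      also have "(\<Sum>u\<in>U m. t m u * (of_nat N * (\<Sum>i\<in>UNIV. x $ i - y $ i))) =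
          (\<Sum>u\<in>U m. t m u) * (of_nat N * (\<Sum>i\<in>UNIV. x $ i - y $ i))"
        by (simp add: sum_distrib_right)
      finally have "(Q *v ?d - (G x - G y)) $ m =
          - (\<Sum>u\<in>U m. t m u * ?e u) - (\<Sum>u\<in>U m. t m u) * (of_nat N * (\<Sum>i\<in>UNIV. x $ i - y $ i))"
        by (simp add: G_def)
      moreover have "vge (r + \<rho>) (\<Sum>u\<in>U m. t m u * ?e u)"
        by (intro vge_sum vge_mult_left t0 unit_expansion_linear[OF h xy])
      moreover have "vge (\<rho> + r) ((\<Sum>u\<in>U m. t m u) * (of_nat N * (\<Sum>i\<in>UNIV. x $ i - y $ i)))"
        using xy by (intro vge_mult sum_t vge_mult_left vge_sum) auto
      ultimately show ?thesis by (simp add: vge_diff add.commute)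
    qed
    have "Q' *v (Q *v ?d) = ?d" by (simp add: matrix_vector_mul_assoc Q')
    then have "?d - (F x - F y) = Q' *v (Q *v ?d - (G x - G y))"
      by (simp add: F_def matrix_vector_mult_diff_distrib)
    then have "(x $ l - y $ l) - (F x $ l - F y $ l) = (Q' *v (Q *v ?d - (G x - G y))) $ l"
      by (metis vector_minus_component)
    moreover have "vge (0 + (r + \<rho>)) \<dots>" by (rule vge_matrix_vector[OF Q'(3) step])
    ultimately show "vge (r + \<rho>) ((x $ l - y $ l) - (F x $ l - F y $ l))" by simp
  qed
  then obtain z where z: "\<forall>i. vge \<rho> (z $ i)" "F z = 0" by blast
  have "Q *v F z = G z" unfolding F_def by (simp add: matrix_vector_mul_assoc Q')
  with z have G0: "G z = 0" by simp
  have tor: "one_plus z \<in> torus" by (rule one_plus_torus[OF z(1) \<rho>])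
  have "(\<Sum>u\<in>U l. t l u * laurent_monomial (one_plus z) u) = 0" for l
  proof -
    have "h u z = laurent_monomial (one_plus z) u * (\<Prod>i\<in>UNIV. one_plus z $ i) ^ N" if "u \<in> U l" for u
      using laurent_monomial_shift[OF tor, of u N] N0[OF that] by (simp add: h_def one_plus_def)
    then have "G z $ l = (\<Sum>u\<in>U l. t l u * laurent_monomial (one_plus z) u) * (\<Prod>i\<in>UNIV. one_plus z $ i) ^ N"
      by (simp add: G_def sum_distrib_right mult.assoc)
    then show ?thesis using G0 tor by (auto simp: torus_def)
  qed
  with z show ?thesis by blast
qed

end

section \<open>Tangent spaces in logarithmic coordinates\<close>

lemma span_pair: "vec.span {p, q} = {a *s p + b *s q | a b. True}" for p q :: "'a::field ^ 'n::finite"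
proof -
  have "x \<in> vec.span {p, q} \<longleftrightarrow> (\<exists>a b. x = a *s p + b *s q)" for x
  proof -
    have "x \<in> vec.span {p, q} \<longleftrightarrow> (\<exists>a b. x - a *s p = b *s q)"
      by (simp add: vec.span_insert[of p "{q}"] vec.span_singleton image_iff)
    then show ?thesis by (simp add: algebra_simps)
  qed
  then show ?thesis by blast
qed

lemma pluecker_combination:
  "pluecker (a *s p + b *s q) (c *s p + d *s q) i j = (a * d - b * c) * pluecker p q i j"
  by (simp add: pluecker_def algebra_simps)

lemma dim_span_pair:
  fixes p q :: "'a::field ^ 'n::finite"
  assumes "pluecker p q i j \<noteq> 0"
  shows "vec.dim (vec.span {p, q}) = 2"
proof -
  have "p \<noteq> 0" "q \<noteq> 0" using assms by (auto simp: pluecker_def)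
  have "p \<notin> vec.span {q}"
    using assms by (auto simp: vec.span_singleton pluecker_def algebra_simps)
  moreover have "p \<noteq> q" using assms by (auto simp: pluecker_def)
  ultimately have "vec.independent {p, q}"
    using \<open>q \<noteq> 0\<close> by (simp add: vec.independent_insert)
  then have "vec.dim {p, q} = card {p, q}" by (rule vec.dim_eq_card_independent)
  then show ?thesis using \<open>p \<noteq> q\<close> by (simp add: vec.dim_span)
qed

text \<open>A change of basis multiplies all Pluecker coordinates by its determinant, which is
  nonzero because the change can be reversed. So the valuations are well defined up to a common
  constant.\<close>

lemma pluecker_proportional:
  fixes p q y z :: "'a::field ^ 'n::finite"
  assumes span: "vec.span {p, q} = vec.span {y, z}" and "pluecker p q i0 j0 \<noteq> 0"
  shows "\<exists>c. c \<noteq> 0 \<and> (\<forall>i j. pluecker y z i j = c * pluecker p q i j)"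
proof -
  have "y \<in> vec.span {p, q}" "z \<in> vec.span {p, q}" unfolding span by (auto intro: vec.span_base)
  then obtain a b c d where yz: "y = a *s p + b *s q" "z = c *s p + d *s q"
    unfolding span_pair by blast
  have "p \<in> vec.span {y, z}" "q \<in> vec.span {y, z}" unfolding span[symmetric] by (auto intro: vec.span_base)
  then obtain a' b' c' d' where pq: "p = a' *s y + b' *s z" "q = c' *s y + d' *s z"
    unfolding span_pair by blast
  have 1: "pluecker y z i j = (a * d - b * c) * pluecker p q i j" for i j
    unfolding yz by (rule pluecker_combination)
  have "pluecker p q i0 j0 = (a' * d' - b' * c') * pluecker y z i0 j0"
    by (subst pq(1), subst pq(2)) (rule pluecker_combination)
  then have "a * d - b * c \<noteq> 0" using 1[of i0 j0] assms(2) by auto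
  with 1 show ?thesis by blast
qed

definition mpoly_monomial :: "'a::field ^ 'n::finite \<Rightarrow> nat ^ 'n \<Rightarrow> 'a" where
  "mpoly_monomial x m = (\<Prod>i\<in>UNIV. x $ i ^ (m $ i))"

text \<open>The logarithmic derivative is diagonal on monomials. The truncated subtraction in
  \<open>m $ i - 1\<close> does no harm: at \<open>m $ i = 0\<close> the coefficient
  vanishes.\<close>

lemma mpoly_partial_mult:
  "mpoly_partial i F x * x $ i =
     (\<Sum>m\<in>Poly_Mapping.keys F. Poly_Mapping.lookup F m * of_nat (m $ i) * mpoly_monomial x m)"
proof -
  have "of_nat (m $ i) * (\<Prod>j\<in>UNIV. x $ j ^ (if j = i then m $ j - 1 else m $ j)) * x $ i =
      of_nat (m $ i) * mpoly_monomial x m" for m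
  proof (cases "m $ i")
    case (Suc r)
    have "(\<Prod>j\<in>UNIV. x $ j ^ (if j = i then m $ j - 1 else m $ j)) =
        x $ i ^ r * (\<Prod>j\<in>UNIV - {i}. x $ j ^ (m $ j))"
      using Suc by (subst prod.remove[of _ i]) (auto intro!: prod.cong)
    moreover have "mpoly_monomial x m = x $ i ^ Suc r * (\<Prod>j\<in>UNIV - {i}. x $ j ^ (m $ j))"
      unfolding mpoly_monomial_def using Suc by (subst prod.remove[of _ i]) auto
    ultimately show ?thesis by (simp add: mult_ac)
  qed simp
  then show ?thesis
    unfolding mpoly_partial_def sum_distrib_right by (intro sum.cong) (simp_all add: mult.assoc)
qed

lemma euler_identity:
  assumes "homogeneous F" and "mpoly_eval F x = 0"
  shows "(\<Sum>i\<in>UNIV. mpoly_partial i F x * x $ i) = 0"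
proof -
  obtain d where d: "\<And>m. m \<in> Poly_Mapping.keys F \<Longrightarrow> (\<Sum>i\<in>UNIV. m $ i) = d"
    using assms(1) by (auto simp: homogeneous_def)
  have "(\<Sum>i\<in>UNIV. mpoly_partial i F x * x $ i) = (\<Sum>m\<in>Poly_Mapping.keys F. \<Sum>i\<in>UNIV.
      Poly_Mapping.lookup F m * of_nat (m $ i) * mpoly_monomial x m)"
    unfolding mpoly_partial_mult by (rule sum.swap)
  also have "\<dots> = (\<Sum>m\<in>Poly_Mapping.keys F. of_nat d * (Poly_Mapping.lookup F m * mpoly_monomial x m))"
  proof (intro sum.cong refl)
    fix m assume "m \<in> Poly_Mapping.keys F"
    then have "of_nat d = (\<Sum>i\<in>UNIV. of_nat (m $ i) :: 'b)" using d by (metis of_nat_sum)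
    then show "(\<Sum>i\<in>UNIV. Poly_Mapping.lookup F m * of_nat (m $ i) * mpoly_monomial x m) =
        of_nat d * (Poly_Mapping.lookup F m * mpoly_monomial x m)"
      by (simp add: sum_distrib_left sum_distrib_right mult_ac)
  qed
  also have "\<dots> = of_nat d * mpoly_eval F x"
    by (simp add: mpoly_eval_def mpoly_monomial_def sum_distrib_left)
  finally show ?thesis using assms(2) by simp
qed

text \<open>Clearing denominators of a Laurent polynomial by \<open>N\<close>-th powers of all variables.\<close>

definition clear_denominators :: "nat \<Rightarrow> ((int ^ 'n::finite) \<Rightarrow>\<^sub>0 'k::zero) \<Rightarrow> (nat ^ 'n) \<Rightarrow>\<^sub>0 'k" where
  "clear_denominators N g = Poly_Mapping.map_key (\<lambda>m. \<chi> i. int (m $ i) - int N) g"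

text \<open>Vanishing outside the torus is what admits the cleared equation into
  \<open>tangent_space\<close>, which asks for polynomials vanishing on all of \<open>X\<close>. In
  the derivative the summand \<open>of_nat N\<close> multiplies the value of \<open>g\<close> and so
  drops out on the curve.\<close>

lemma
  fixes g :: "(int ^ 'n::finite) \<Rightarrow>\<^sub>0 'k::field"
  assumes N: "\<And>u i. u \<in> Poly_Mapping.keys g \<Longrightarrow> 1 \<le> u $ i + int N"
  shows homogeneous_clear_denominators:
      "Poly_Mapping.keys g \<subseteq> char_lattice \<Longrightarrow> homogeneous (clear_denominators N g)"
    and mpoly_eval_clear_denominators:
      "x \<in> torus \<Longrightarrow> mpoly_eval (clear_denominators N g) x = laurent_eval g x * (\<Prod>i\<in>UNIV. x $ i) ^ N"
    and mpoly_eval_clear_denominators_boundary: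
      "x \<notin> torus \<Longrightarrow> mpoly_eval (clear_denominators N g) x = 0"
    and mpoly_partial_clear_denominators:
      "x \<in> torus \<Longrightarrow> mpoly_partial i (clear_denominators N g) x * x $ i =
        (\<Prod>i\<in>UNIV. x $ i) ^ N * (\<Sum>u\<in>Poly_Mapping.keys g.
          Poly_Mapping.lookup g u * laurent_monomial x u * (of_int (u $ i) + of_nat N))"
proof -
  let ?s = "\<lambda>m :: nat ^ 'n. (\<chi> i. int (m $ i) - int N) :: int ^ 'n"
  let ?F = "clear_denominators N g"
  let ?t = "\<lambda>u :: int ^ 'n. (\<chi> i. nat (u $ i + int N)) :: nat ^ 'n"
  have inj: "inj ?s" by (auto simp: inj_def vec_eq_iff)
  have st: "?s (?t u) = u" if "u \<in> Poly_Mapping.keys g" for u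
  proof -
    have "0 \<le> u $ i + int N" for i using N[OF that, of i] by linarith
    then show ?thesis by (simp add: vec_eq_iff)
  qed
  have ts: "?t (?s m) = m" for m by (simp add: vec_eq_iff)
  have look: "Poly_Mapping.lookup ?F m = Poly_Mapping.lookup g (?s m)" for m
    unfolding clear_denominators_def using map_key.rep_eq[OF inj, of g] by simp
  have keys: "Poly_Mapping.keys ?F = ?t ` Poly_Mapping.keys g"
  proof -
    have "m \<in> Poly_Mapping.keys ?F \<longleftrightarrow> ?s m \<in> Poly_Mapping.keys g" for m
      by (simp add: in_keys_iff look)
    moreover have "?s m \<in> Poly_Mapping.keys g \<longleftrightarrow> m \<in> ?t ` Poly_Mapping.keys g" for m
    proof
      show "?s m \<in> Poly_Mapping.keys g \<Longrightarrow> m \<in> ?t ` Poly_Mapping.keys g"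
        using imageI[of "?s m" _ ?t] by (simp only: ts)
      show "m \<in> ?t ` Poly_Mapping.keys g \<Longrightarrow> ?s m \<in> Poly_Mapping.keys g"
        using st by (elim imageE) (simp only:)
    qed
    ultimately show ?thesis by blast
  qed
  have inj_t: "inj_on ?t (Poly_Mapping.keys g)"
    by (rule inj_on_inverseI[of _ ?s]) (rule st)
  have sum_F: "(\<Sum>m\<in>Poly_Mapping.keys ?F. h m) = (\<Sum>u\<in>Poly_Mapping.keys g. h (?t u))"
    for h :: "_ \<Rightarrow> 'k"
    unfolding keys by (simp add: sum.reindex[OF inj_t])
  have lookt: "Poly_Mapping.lookup ?F (?t u) = Poly_Mapping.lookup g u"
    if "u \<in> Poly_Mapping.keys g" for u unfolding look st[OF that] ..
  have mon: "mpoly_monomial x (?t u) = laurent_monomial x u * (\<Prod>i\<in>UNIV. x $ i) ^ N"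
    if "x \<in> torus" "u \<in> Poly_Mapping.keys g" for x u
  proof -
    have "0 \<le> u $ i + int N" for i using N[OF that(2), of i] by linarith
    then show ?thesis using laurent_monomial_shift[OF that(1)] by (simp add: mpoly_monomial_def)
  qed
  have eval: "mpoly_eval ?F x = (\<Sum>u\<in>Poly_Mapping.keys g. Poly_Mapping.lookup g u * mpoly_monomial x (?t u))" for x
    unfolding mpoly_eval_def mpoly_monomial_def[symmetric] sum_F by (intro sum.cong) (auto simp: lookt)

  show "homogeneous ?F" if lat: "Poly_Mapping.keys g \<subseteq> char_lattice"
  proof -
    have "(\<Sum>i\<in>UNIV. ?t u $ i) = CARD('n) * N" if "u \<in> Poly_Mapping.keys g" for u
    proof -
      have "int (\<Sum>i\<in>UNIV. ?t u $ i) = (\<Sum>i\<in>UNIV. u $ i + int N)"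
        using N[OF that] by (simp add: nat_0_le add_increasing2) (intro sum.cong refl; smt (verit))
      also have "\<dots> = int (CARD('n) * N)" using lat that by (auto simp: sum.distrib char_lattice_def)
      finally show ?thesis by linarith
    qed
    then show ?thesis unfolding homogeneous_def keys by blast
  qed
  show "mpoly_eval ?F x = laurent_eval g x * (\<Prod>i\<in>UNIV. x $ i) ^ N" if "x \<in> torus"
    unfolding eval laurent_eval_def sum_distrib_right laurent_monomial_def[symmetric]
    by (intro sum.cong) (auto simp: mon[OF that] mult_ac)
  show "mpoly_eval ?F x = 0" if x: "x \<notin> torus"
  proof -
    obtain i where i: "x $ i = 0" using x by (auto simp: torus_def)
    have "mpoly_monomial x (?t u) = 0" if "u \<in> Poly_Mapping.keys g" for u
      unfolding mpoly_monomial_def using N[OF that, of i] i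
      by (intro prod_zero) (auto intro!: exI[of _ i] simp: power_0_left)
    then show ?thesis unfolding eval by (intro sum.neutral) auto
  qed
  show "mpoly_partial i ?F x * x $ i =
      (\<Prod>i\<in>UNIV. x $ i) ^ N * (\<Sum>u\<in>Poly_Mapping.keys g.
          Poly_Mapping.lookup g u * laurent_monomial x u * (of_int (u $ i) + of_nat N))" if "x \<in> torus"
    unfolding mpoly_partial_mult sum_F sum_distrib_left
  proof (intro sum.cong refl)
    fix u assume u: "u \<in> Poly_Mapping.keys g"
    have "of_nat (?t u $ i) = (of_int (u $ i) + of_nat N :: 'k)"
      using N[OF u, of i] by (simp add: of_nat_nat)
    then show "Poly_Mapping.lookup ?F (?t u) * of_nat (?t u $ i) * mpoly_monomial x (?t u) =
       (\<Prod>i\<in>UNIV. x $ i) ^ N * (Poly_Mapping.lookup g u * laurent_monomial x u * (of_int (u $ i) + of_nat N))"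
      by (simp add: lookt[OF u] mon[OF that u])
  qed
qed

context nonarch_valued
begin

lemma vge_finite_family: "finite S \<Longrightarrow> \<exists>C. \<forall>s\<in>S. vge C (h s)"
proof (induction S rule: finite_induct)
  case (insert s S)
  then obtain C where C: "\<forall>s\<in>S. vge C (h s)" by blast
  obtain r where r: "vge r (h s)" using vge_exists by blast
  have "\<forall>t\<in>insert s S. vge (min C r) (h t)"
    using vge_mono[OF r, of "min C r"] C vge_mono[of C _ "min C r"] by auto
  then show ?case by blast
qed auto

text \<open>A unit expansion with both precisions equal to \<open>\<nu>\<close> is a second-order
  estimate, and multiplicative increments produce the logarithmic gradient as linear term.
  \<open>C\<close> depends on \<open>F\<close> and \<open>P\<close> only, so \<open>\<nu>\<close>
  may grow afterwards.\<close>

lemma mpoly_taylor: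
  fixes P :: "'k ^ 'n::finite"
  shows "\<exists>C. \<forall>\<nu> z. \<nu> > 0 \<longrightarrow> (\<forall>i. vge \<nu> (z $ i)) \<longrightarrow>
     vge (2 * \<nu> + C) (mpoly_eval F (\<chi> i. P $ i * one_plus z $ i) - mpoly_eval F P
       - (\<Sum>i\<in>UNIV. mpoly_partial i F P * P $ i * z $ i))"
proof -
  obtain C where C: "\<And>m. m \<in> Poly_Mapping.keys F \<Longrightarrow> vge C (Poly_Mapping.lookup F m * mpoly_monomial P m)"
    using vge_finite_family[of "Poly_Mapping.keys F" "\<lambda>m. Poly_Mapping.lookup F m * mpoly_monomial P m"]
    by auto
  have "vge (2 * \<nu> + C) (mpoly_eval F (\<chi> i. P $ i * one_plus z $ i) - mpoly_eval F P
       - (\<Sum>i\<in>UNIV. mpoly_partial i F P * P $ i * z $ i))"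
    if \<nu>: "\<nu> > 0" and z: "\<forall>i. vge \<nu> (z $ i)" for \<nu> z
  proof -
    let ?c = "\<lambda>m. Poly_Mapping.lookup F m * mpoly_monomial P m"
    let ?h = "\<lambda>m. laurent_monomial (one_plus z) (\<chi> i. int (m $ i))"
    have "mpoly_monomial (\<chi> i. P $ i * one_plus z $ i) m = mpoly_monomial P m * ?h m" for m
      by (simp add: mpoly_monomial_def laurent_monomial_def power_mult_distrib prod.distrib)
    then have 1: "mpoly_eval F (\<chi> i. P $ i * one_plus z $ i) = (\<Sum>m\<in>Poly_Mapping.keys F. ?c m * ?h m)"
      unfolding mpoly_eval_def mpoly_monomial_def[symmetric] by (simp add: mult_ac)
    have 2: "mpoly_eval F P = (\<Sum>m\<in>Poly_Mapping.keys F. ?c m)"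
      by (simp add: mpoly_eval_def mpoly_monomial_def)
    have "(\<Sum>i\<in>UNIV. mpoly_partial i F P * P $ i * z $ i) = (\<Sum>i\<in>UNIV. \<Sum>m\<in>Poly_Mapping.keys F.
        ?c m * (of_nat (m $ i) * z $ i))"
      unfolding mpoly_partial_mult sum_distrib_right by (simp add: mult_ac)
    also have "\<dots> = (\<Sum>m\<in>Poly_Mapping.keys F. ?c m * (\<Sum>i\<in>UNIV. of_nat (m $ i) * z $ i))"
      by (subst sum.swap) (simp add: sum_distrib_left)
    finally have 3: "mpoly_eval F (\<chi> i. P $ i * one_plus z $ i) - mpoly_eval F P
       - (\<Sum>i\<in>UNIV. mpoly_partial i F P * P $ i * z $ i) =
       (\<Sum>m\<in>Poly_Mapping.keys F. ?c m * (?h m - 1 - (\<Sum>i\<in>UNIV. of_nat (m $ i) * z $ i)))"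
      unfolding 1 2 by (simp add: right_diff_distrib sum_subtractf)
    have "vge (C + 2 * \<nu>) (?c m * (?h m - 1 - (\<Sum>i\<in>UNIV. of_nat (m $ i) * z $ i)))"
      if "m \<in> Poly_Mapping.keys F" for m
    proof (rule vge_mult[OF C[OF that]])
      have "one_plus (0 :: 'k ^ 'n) = (\<chi> i. 1)" by (simp add: one_plus_def vec_eq_iff)
      then have "laurent_monomial (one_plus (0 :: 'k ^ 'n)) u = 1" for u
        by (simp add: laurent_monomial_def)
      then show "vge (2 * \<nu>) (?h m - 1 - (\<Sum>i\<in>UNIV. of_nat (m $ i) * z $ i))"
        using unit_expansion_linear[OF unit_expansion_laurent_monomial[OF \<nu>], of z 0 \<nu> "\<chi> i. int (m $ i)"] z
        by simp
    qed
    then show ?thesis unfolding 3 by (intro vge_sum) (simp add: add.commute)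
  qed
  then show ?thesis by blast
qed

end

section \<open>The part of the curve in the torus, its logarithmic matrix and its tangent
  lines\<close>

definition vmult :: "'a::comm_ring_1 ^ 'n::finite \<Rightarrow> 'a ^ 'n \<Rightarrow> 'a ^ 'n" where
  "vmult x y = (\<chi> i. x $ i * y $ i)"

lemma vmult_component [simp]: "vmult x y $ i = x $ i * y $ i"
  by (simp add: vmult_def)

lemma laurent_monomial_vmult:
  "laurent_monomial (vmult x y) u = laurent_monomial x u * laurent_monomial y u"
  by (simp add: vmult_def laurent_monomial_mult)

lemma vmult_torus: "x \<in> torus \<Longrightarrow> y \<in> torus \<Longrightarrow> vmult x y \<in> torus" for x :: "'a::field ^ 'n::finite"
  by (simp add: torus_def)

lemma char_lattice_sum_of_int: "u \<in> char_lattice \<Longrightarrow> (\<Sum>i\<in>UNIV. of_int (u $ i) :: 'a::ring_1) = 0"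
  by (metis (mono_tags) char_lattice_def mem_Collect_eq of_int_0 of_int_sum)

text \<open>The \<open>n + 1\<close> coordinates also index the rows of square matrices through
  \<open>idx\<close>: row 0 belongs to the local parameter, rows 1 to \<open>n - 1\<close> to the
  equations, and row \<open>n\<close> to the normalization of \<open>i0\<close>.\<close>

locale torus_curve = alg_closed_valued val
  for val :: "'k::{alg_closed_field, field_char_0} \<Rightarrow> ereal" +
  fixes X :: "('k ^ 'n::finite) set"
    and f :: "nat \<Rightarrow> (int ^ 'n) \<Rightarrow>\<^sub>0 'k"
    and n :: nat
    and idx :: "'n \<Rightarrow> nat"
    and i0 :: 'n
  assumes idx: "bij_betw idx UNIV {0..n}" and n1: "n \<ge> 1"
    and lattice: "\<And>k. k \<in> {1..<n} \<Longrightarrow> Poly_Mapping.keys (f k) \<subseteq> char_lattice"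
    and X_torus: "X \<inter> torus = torus \<inter> (\<Inter>k\<in>{1..<n}. torus_hypersurface (f k))"
begin

definition "row_of k = inv_into UNIV idx k"

lemma idx_row: "k \<le> n \<Longrightarrow> idx (row_of k) = k"
  unfolding row_of_def using idx by (intro f_inv_into_f) (auto simp: bij_betw_def)

lemma row_idx [simp]: "row_of (idx l) = l"
  unfolding row_of_def using idx by (intro inv_into_f_f) (auto simp: bij_betw_def)

lemma idx_cases: obtains "idx l = 0" | "idx l = n" | "idx l \<in> {1..<n}"
proof -
  have "idx l \<le> n" using idx by (auto simp: bij_betw_def)
  then have "idx l = 0 \<or> idx l = n \<or> idx l \<in> {1..<n}" by auto
  then show thesis using that by blast
qed

definition coeff_term :: "nat \<Rightarrow> 'k ^ 'n \<Rightarrow> int ^ 'n \<Rightarrow> 'k" where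
  "coeff_term k P u = Poly_Mapping.lookup (f k) u * laurent_monomial P u"

abbreviation "supp k \<equiv> Poly_Mapping.keys (f k)"

lemma laurent_eval_terms: "laurent_eval (f k) P = (\<Sum>u\<in>supp k. coeff_term k P u)"
  by (simp add: laurent_eval_def coeff_term_def laurent_monomial_def)

lemma coeff_term_nonzero: "u \<in> supp k \<Longrightarrow> P \<in> torus \<Longrightarrow> coeff_term k P u \<noteq> 0"
  by (simp add: coeff_term_def laurent_monomial_nonzero in_keys_iff)

lemma coeff_term_vmult: "coeff_term k (vmult P x) u = coeff_term k P u * laurent_monomial x u"
  by (simp add: coeff_term_def laurent_monomial_vmult)

lemma on_curve_iff:
  "P \<in> torus \<Longrightarrow> P \<in> X \<longleftrightarrow> (\<forall>k\<in>{1..<n}. (\<Sum>u\<in>supp k. coeff_term k P u) = 0)"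
  using X_torus by (auto simp: torus_hypersurface_def laurent_eval_terms)

definition log_gradient :: "nat \<Rightarrow> 'k ^ 'n \<Rightarrow> 'n \<Rightarrow> 'k" where
  "log_gradient k P i = (\<Sum>u\<in>supp k. coeff_term k P u * of_int (u $ i))"

text \<open>Besides the rescaled logarithmic gradients of the equations, the matrix has a row for the
  monomial \<open>r\<close>, which serves as a local parameter, and one that normalizes the coordinate \<open>i0\<close>.\<close>

definition log_matrix :: "(nat \<Rightarrow> 'k) \<Rightarrow> int ^ 'n \<Rightarrow> 'k ^ 'n \<Rightarrow> 'k ^ 'n ^ 'n" where
  "log_matrix \<tau> r P = (\<chi> l i. if idx l = 0 then of_int (r $ i)
     else if idx l = n then (if i = i0 then 1 else 0)
     else log_gradient (idx l) P i / \<tau> (idx l))"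

lemma log_matrix_row_0:
  "idx l = 0 \<Longrightarrow> (log_matrix \<tau> r P *v w) $ l = (\<Sum>i\<in>UNIV. of_int (r $ i) * w $ i)"
  by (simp add: matrix_vector_mult_def log_matrix_def)

lemma log_matrix_row_n: "idx l = n \<Longrightarrow> (log_matrix \<tau> r P *v w) $ l = w $ i0"
  using n1 by (simp add: matrix_vector_mult_def log_matrix_def if_distrib[of "\<lambda>c. c * _"] cong: if_cong)

lemma log_matrix_row_k:
  "idx l \<in> {1..<n} \<Longrightarrow>
    (log_matrix \<tau> r P *v w) $ l = (\<Sum>i\<in>UNIV. log_gradient (idx l) P i * w $ i) / \<tau> (idx l)"
  by (simp add: matrix_vector_mult_def log_matrix_def sum_divide_distrib)

text \<open>The scalars \<open>\<tau> k\<close> make the terms of the equations at \<open>P\<close>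
  integral. \<open>P\<close> may lie off the curve, because frames also serve to correct approximate
  solutions.\<close>

definition integral_frame :: "(nat \<Rightarrow> 'k) \<Rightarrow> int ^ 'n \<Rightarrow> 'k ^ 'n \<Rightarrow> bool" where
  "integral_frame \<tau> r P \<longleftrightarrow> P \<in> torus \<and> r \<in> char_lattice \<and>
     (\<forall>k\<in>{1..<n}. \<tau> k \<noteq> 0 \<and> (\<forall>u\<in>supp k. vge 0 (coeff_term k P u / \<tau> k))) \<and>
     integral_isometry (log_matrix \<tau> r P)"

lemma ex_frame_vector:
  assumes "integral_frame \<tau> r P"
  shows "\<exists>w. log_matrix \<tau> r P *v w = axis (row_of 0) 1"
proof -
  have "integral_isometry (log_matrix \<tau> r P)" using assms by (simp add: integral_frame_def)
  then obtain M' where "log_matrix \<tau> r P ** M' = mat 1"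
    using integral_isometry_inverse by metis
  then have "log_matrix \<tau> r P *v (M' *v axis (row_of 0) 1) = axis (row_of 0) 1"
    by (simp add: matrix_vector_mul_assoc)
  then show ?thesis by blast
qed

lemma integral_frame_imp_r_nonzero:
  assumes "integral_frame \<tau> r P"
  shows "r \<noteq> 0"
proof
  assume "r = 0"
  obtain w where "log_matrix \<tau> r P *v w = axis (row_of 0) 1"
    using ex_frame_vector[OF assms] by blast
  then have "(log_matrix \<tau> r P *v w) $ row_of 0 = 1" by (simp add: axis_def)
  then show False using \<open>r = 0\<close> by (simp add: log_matrix_row_0 idx_row)
qed

text \<open>The unknown is the factor \<open>one_plus z\<close>. It satisfies the equations rescaled
  at \<open>P\<close>, a binomial prescribing the monomial \<open>r\<close> and a binomial fixing
  coordinate \<open>i0\<close>; the Jacobian of this system at 1 is \<open>log_matrix\<close>. With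
  \<open>e = 0\<close> an approximate point is corrected, with \<open>e \<noteq> 0\<close> a point
  moves along the curve.\<close>

lemma move:
  assumes frame: "integral_frame \<tau> r P" and \<rho>: "\<rho> > 0" and e: "vge \<rho> e"
    and approx: "\<And>k. k \<in> {1..<n} \<Longrightarrow> vge \<rho> (\<Sum>u\<in>supp k. coeff_term k P u / \<tau> k)"
  shows "\<exists>z. (\<forall>i. vge \<rho> (z $ i)) \<and> vmult P (one_plus z) \<in> X \<inter> torus \<and>
    laurent_monomial (one_plus z) r = 1 + e \<and> z $ i0 = 0"
proof -
  \<comment> \<open>Rows 0 and \<open>n\<close> are binomials whose second exponent is 0;
    \<open>r\<close> and \<open>axis i0 1\<close> are nonzero, so the two exponents are really
    distinct.\<close>
  define U where "U = (\<lambda>l. if idx l = 0 then {r, 0} else if idx l = n then {axis i0 1, 0} else supp (idx l))"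
  define t where "t = (\<lambda>l u. if idx l = 0 then if u = r then 1 else - (1 + e)
     else if idx l = n then if u = axis i0 1 then 1 else - 1
     else coeff_term (idx l) P u / \<tau> (idx l))"
  have P: "P \<in> torus" and \<tau>: "\<And>k. k \<in> {1..<n} \<Longrightarrow> \<tau> k \<noteq> 0"
    and terms: "\<And>k u. k \<in> {1..<n} \<Longrightarrow> u \<in> supp k \<Longrightarrow> vge 0 (coeff_term k P u / \<tau> k)"
    using frame by (auto simp: integral_frame_def)
  have r: "r \<noteq> 0" by (rule integral_frame_imp_r_nonzero[OF frame])
  have ax: "axis i0 1 \<noteq> (0 :: int ^ 'n)" by (simp add: axis_eq_0_iff)
  have e0: "vge 0 e" by (rule vge_mono[OF e]) (use \<rho> in simp)
  have n0: "n \<noteq> 0" using n1 by simp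
  have "(\<chi> l i. \<Sum>u\<in>U l. t l u * of_int (u $ i)) = log_matrix \<tau> r P"
  proof -
    have "(\<Sum>u\<in>U l. t l u * of_int (u $ i)) = log_matrix \<tau> r P $ l $ i" for l i
      using r ax n0
      by (cases l rule: idx_cases)
         (auto simp: U_def t_def log_matrix_def log_gradient_def sum_divide_distrib axis_def)
    then show ?thesis by (simp add: vec_eq_iff)
  qed
  then have isom: "integral_isometry (\<chi> l i. \<Sum>u\<in>U l. t l u * of_int (u $ i))"
    using frame by (simp add: integral_frame_def)
  obtain z where z: "\<forall>i. vge \<rho> (z $ i)"
    "\<And>l. (\<Sum>u\<in>U l. t l u * laurent_monomial (one_plus z) u) = 0"
  proof -
    have "vge 0 (t l u)" if "u \<in> U l" for l u
      using that e0 terms by (cases l rule: idx_cases) (auto simp: t_def U_def intro!: vge_add vge_diff)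
    moreover have "vge \<rho> (\<Sum>u\<in>U l. t l u)" for l
      using e approx r ax n0
      by (cases l rule: idx_cases) (auto simp: t_def U_def intro!: vge_add vge_diff)
    moreover have "finite (U l)" for l by (simp add: U_def)
    ultimately show thesis using that laurent_hensel[OF _ \<rho> _ _ isom] by blast
  qed
  have tor: "one_plus z \<in> torus" by (rule one_plus_torus[OF z(1) \<rho>])
  have "laurent_monomial (one_plus z) r + (- 1 - e) = 0"
    using z(2)[of "row_of 0"] r by (simp add: U_def t_def idx_row)
  then have "laurent_monomial (one_plus z) r = 1 + e" by algebra
  moreover have "z $ i0 = 0"
    using z(2)[of "row_of n"] ax n0 by (simp add: U_def t_def idx_row) (simp add: one_plus_def)
  moreover have "vmult P (one_plus z) \<in> X"
    unfolding on_curve_iff[OF vmult_torus[OF P tor]]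
  proof
    fix k assume k: "k \<in> {1..<n}"
    then have "(\<Sum>u\<in>supp k. coeff_term k P u / \<tau> k * laurent_monomial (one_plus z) u) = 0"
      using z(2)[of "row_of k"] by (auto simp: U_def t_def idx_row)
    then have "(\<Sum>u\<in>supp k. coeff_term k P u * laurent_monomial (one_plus z) u) / \<tau> k = 0"
      by (simp add: sum_divide_distrib)
    then show "(\<Sum>u\<in>supp k. coeff_term k (vmult P (one_plus z)) u) = 0"
      using \<tau>[OF k] by (simp add: coeff_term_vmult)
  qed
  ultimately show ?thesis using z(1) vmult_torus[OF P tor] by blast
qed

text \<open>After clearing denominators the equation vanishes on all of \<open>X\<close>, so it is
  one of the polynomials that cut out the tangent space. At a point of the curve its logarithmic
  gradient is that of \<open>f k\<close> up to a nonzero factor.\<close>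

lemma tangent_space_imp_log_gradient:
  assumes P: "P \<in> X" "P \<in> torus" and y: "y \<in> tangent_space X P" and k: "k \<in> {1..<n}"
  shows "(\<Sum>i\<in>UNIV. log_gradient k P i * (y $ i / P $ i)) = 0"
proof -
  obtain N where N: "\<And>u i. u \<in> supp k \<Longrightarrow> 1 \<le> u $ i + int N"
    using ex_exponent_shift[of "supp k"] by auto
  let ?F = "clear_denominators N (f k)"
  have fP: "laurent_eval (f k) x = 0" if "x \<in> X" "x \<in> torus" for x
    using on_curve_iff[OF that(2)] that k by (simp add: laurent_eval_terms)
  have "mpoly_eval ?F x = 0" if "x \<in> X" for x
    using mpoly_eval_clear_denominators[OF N] mpoly_eval_clear_denominators_boundary[OF N]
      fP[OF that] by (cases "x \<in> torus") auto
  moreover have "homogeneous ?F" by (rule homogeneous_clear_denominators[OF N lattice[OF k]])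
  ultimately have zero: "(\<Sum>i\<in>UNIV. mpoly_partial i ?F P * y $ i) = 0"
    using y by (auto simp: tangent_space_def)
  have "mpoly_partial i ?F P * y $ i =
      (\<Prod>i\<in>UNIV. P $ i) ^ N * (log_gradient k P i * (y $ i / P $ i))" for i
  proof -
    have "(\<Sum>u\<in>supp k. Poly_Mapping.lookup (f k) u * laurent_monomial P u * (of_int (u $ i) + of_nat N)) =
        log_gradient k P i + of_nat N * laurent_eval (f k) P"
      unfolding log_gradient_def laurent_eval_terms
      by (simp add: coeff_term_def distrib_left sum.distrib sum_distrib_left mult_ac)
    then have "mpoly_partial i ?F P * P $ i = (\<Prod>i\<in>UNIV. P $ i) ^ N * (log_gradient k P i
        + of_nat N * laurent_eval (f k) P)"
      using mpoly_partial_clear_denominators[OF N P(2), where i = i] by simp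
    then have *: "mpoly_partial i ?F P * P $ i = (\<Prod>i\<in>UNIV. P $ i) ^ N * log_gradient k P i"
      using fP[OF P] by simp
    have "mpoly_partial i ?F P * y $ i = (mpoly_partial i ?F P * P $ i) * (y $ i / P $ i)"
      using P(2) by (simp add: torus_def)
    then show ?thesis unfolding * by (simp add: mult.assoc)
  qed
  with zero have "(\<Prod>i\<in>UNIV. P $ i) ^ N * (\<Sum>i\<in>UNIV. log_gradient k P i * (y $ i / P $ i)) = 0"
    by (simp add: sum_distrib_left)
  then show ?thesis using P(2) by (auto simp: torus_def)
qed

text \<open>Characters have degree 0. So the all-ones vector, which is \<open>P\<close> itself in
  logarithmic coordinates, lies in the kernel.\<close>

lemma log_gradient_sum:
  assumes "k \<in> {1..<n}"
  shows "(\<Sum>i\<in>UNIV. log_gradient k P i) = 0"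
proof -
  have "(\<Sum>i\<in>UNIV. log_gradient k P i) = (\<Sum>u\<in>supp k. coeff_term k P u * (\<Sum>i\<in>UNIV. of_int (u $ i)))"
    unfolding log_gradient_def by (subst sum.swap) (simp add: sum_distrib_left)
  also have "\<dots> = 0"
    using lattice[OF assms] by (intro sum.neutral) (auto simp: char_lattice_sum_of_int)
  finally show ?thesis .
qed

text \<open>Differentiation along the curve by estimates: moving with parameter \<open>e\<close>
  gives a displacement \<open>z\<close> such that \<open>z - e *s w\<close> is of second order,
  while \<open>F\<close> vanishes at both ends. Hence \<open>e\<close> times the derivative of
  \<open>F\<close> in direction \<open>w\<close> is of second order; dividing by \<open>e\<close>
  leaves something as small as \<open>e\<close>, and \<open>e\<close> is arbitrary.\<close>

lemma frame_vector_in_tangent_space: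
  assumes frame: "integral_frame \<tau> r P" and P: "P \<in> X"
    and w: "log_matrix \<tau> r P *v w = axis (row_of 0) 1"
  shows "vmult P w \<in> tangent_space X P"
  unfolding tangent_space_def
proof (intro CollectI allI impI, elim conjE)
  fix F :: "nat ^ 'n \<Rightarrow>\<^sub>0 'k"
  assume F: "homogeneous F" "\<forall>x\<in>X. mpoly_eval F x = 0"
  have Pt: "P \<in> torus" and isom: "integral_isometry (log_matrix \<tau> r P)"
    and \<tau>: "\<And>k. k \<in> {1..<n} \<Longrightarrow> \<tau> k \<noteq> 0"
    and terms: "\<And>k u. k \<in> {1..<n} \<Longrightarrow> u \<in> supp k \<Longrightarrow> vge 0 (coeff_term k P u / \<tau> k)"
    using frame by (auto simp: integral_frame_def)
  have on: "(\<Sum>u\<in>supp k. coeff_term k P u) = 0" if "k \<in> {1..<n}" for k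
    using P on_curve_iff[OF Pt] that by blast
  let ?D = "\<lambda>z. \<Sum>i\<in>UNIV. mpoly_partial i F P * P $ i * z $ i"
  obtain C where C: "\<And>\<nu> z. \<nu> > 0 \<Longrightarrow> \<forall>i. vge \<nu> (z $ i) \<Longrightarrow>
      vge (2 * \<nu> + C) (mpoly_eval F (vmult P (one_plus z)) - mpoly_eval F P - ?D z)"
    using mpoly_taylor[of F P] by (auto simp: vmult_def)
  obtain B where B: "\<And>i. vge B (mpoly_partial i F P * P $ i)"
    using vge_finite_family[of UNIV "\<lambda>i. mpoly_partial i F P * P $ i"] by auto
  have D: "vge (B + s) (?D z)" if "\<And>i. vge s (z $ i)" for s z
    using that by (intro vge_sum vge_mult B)
  have bound: "vge (\<nu> + min B C) (?D w)" if e: "e \<noteq> 0" "v e = \<nu>" "\<nu> > 0" for e \<nu>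
  proof -
    have ve: "vge \<nu> e" using e by (simp add: vge_iff)
    obtain z where z: "\<forall>i. vge \<nu> (z $ i)" "vmult P (one_plus z) \<in> X" "z $ i0 = 0"
      and zr: "laurent_monomial (one_plus z) r = 1 + e"
      using move[OF frame \<open>\<nu> > 0\<close> ve] on by (auto simp flip: sum_divide_distrib)
    have tor: "one_plus z \<in> torus" by (rule one_plus_torus[OF z(1) \<open>\<nu> > 0\<close>])
    have one0: "laurent_monomial (one_plus (0 :: 'k ^ 'n)) u = 1" for u
      by (simp add: laurent_monomial_def one_plus_def)
    have quad: "vge (2 * \<nu>) (laurent_monomial (one_plus z) u - 1 - (\<Sum>i\<in>UNIV. of_int (u $ i) * z $ i))" for u
      using unit_expansion_linear[OF unit_expansion_laurent_monomial[OF \<open>\<nu> > 0\<close>], of z 0 \<nu> u] z(1) one0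
      by simp
    have Mz: "(log_matrix \<tau> r P *v (z - e *s w)) $ l =
        (log_matrix \<tau> r P *v z) $ l - e * (axis (row_of 0) 1 :: 'k ^ 'n) $ l" for l
      by (simp add: matrix_vector_mult_diff_distrib vector_scalar_commute w)
    \<comment> \<open>Every row sends \<open>z - e *s w\<close> to a second-order quantity: the
      parameter row by the choice of \<open>e\<close>, the row of \<open>i0\<close> to 0, the others
      because both \<open>P\<close> and the moved point lie on the curve.\<close>
    have "vge (2 * \<nu>) ((log_matrix \<tau> r P *v (z - e *s w)) $ l)" for l
    proof (cases l rule: idx_cases)
      case 1
      then have l: "l = row_of 0" by (metis row_idx)
      have "(log_matrix \<tau> r P *v (z - e *s w)) $ l = (\<Sum>i\<in>UNIV. of_int (r $ i) * z $ i) - e"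
        using Mz[of l] l unfolding log_matrix_row_0[OF 1] by (simp add: axis_def)
      moreover have "vge (2 * \<nu>) (e - (\<Sum>i\<in>UNIV. of_int (r $ i) * z $ i))"
        using quad[of r] zr by simp
      ultimately show ?thesis by (simp only: vge_diff_commute[of "2 * \<nu>" e])
    next
      case 2
      then have "l \<noteq> row_of 0" using n1 idx_row[of 0] by auto
      then have "(log_matrix \<tau> r P *v (z - e *s w)) $ l = 0"
        using Mz[of l] unfolding log_matrix_row_n[OF 2] by (simp add: axis_def z(3))
      then show ?thesis by simp
    next
      case 3
      then have "l \<noteq> row_of 0" using idx_row[of 0] by auto
      let ?k = "idx l"
      have "(log_matrix \<tau> r P *v (z - e *s w)) $ l = (\<Sum>i\<in>UNIV. log_gradient ?k P i * z $ i) / \<tau> ?k"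
        using \<open>l \<noteq> row_of 0\<close>
        using Mz[of l] unfolding log_matrix_row_k[OF 3] by (simp add: axis_def)
      also have "(\<Sum>i\<in>UNIV. log_gradient ?k P i * z $ i) =
          (\<Sum>u\<in>supp ?k. coeff_term ?k P u * (\<Sum>i\<in>UNIV. of_int (u $ i) * z $ i))"
        unfolding log_gradient_def sum_distrib_right
        by (subst sum.swap) (simp add: sum_distrib_left mult.assoc)
      also have "\<dots> = - (\<Sum>u\<in>supp ?k. coeff_term ?k P u *
          (laurent_monomial (one_plus z) u - 1 - (\<Sum>i\<in>UNIV. of_int (u $ i) * z $ i)))"
      proof -
        have "(\<Sum>u\<in>supp ?k. coeff_term ?k P u * laurent_monomial (one_plus z) u) = 0"
          using z(2) on_curve_iff[OF vmult_torus[OF Pt tor]] 3 by (simp add: coeff_term_vmult)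
        then show ?thesis using on[OF 3] by (simp add: right_diff_distrib sum_subtractf)
      qed
      finally have "(log_matrix \<tau> r P *v (z - e *s w)) $ l =
        - (\<Sum>u\<in>supp ?k. coeff_term ?k P u / \<tau> ?k *
          (laurent_monomial (one_plus z) u - 1 - (\<Sum>i\<in>UNIV. of_int (u $ i) * z $ i)))"
        by (simp add: sum_divide_distrib)
      moreover have "vge (2 * \<nu>) \<dots>"
        unfolding vge_uminus by (intro vge_sum vge_mult_left terms[OF 3] quad)
      ultimately show ?thesis by simp
    qed
    then have "vge (2 * \<nu>) ((z - e *s w) $ i)" for i by (rule integral_isometryD(2)[OF isom])
    then have "vge (B + 2 * \<nu>) (?D (z - e *s w))" by (rule D)
    then have 1: "vge (2 * \<nu> + min B C) (?D (z - e *s w))" by (rule vge_mono) simp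
    have "vge (2 * \<nu> + C) (?D z)"
      using C[OF \<open>\<nu> > 0\<close> z(1)] F(2) P z(2) by simp
    then have "vge (2 * \<nu> + min B C) (?D z)" by (rule vge_mono) simp
    moreover have "e * ?D w = ?D z - ?D (z - e *s w)"
      by (simp add: right_diff_distrib sum_subtractf sum_distrib_left mult_ac)
    ultimately have "vge (2 * \<nu> + min B C) (e * ?D w)" using 1 by (simp only: vge_diff)
    then have "vge (2 * \<nu> + min B C - v e) (e * ?D w / e)" by (rule vge_divide[OF e(1)])
    then show ?thesis using e by (simp add: algebra_simps)
  qed
  have "?D w = 0"
  proof (rule vge_all_imp_zero)
    fix s
    obtain e0 where e0: "e0 \<noteq> 0" "v e0 > 0" using ex_pos_val by blast
    obtain J where "\<forall>j\<ge>J. s - min B C \<le> real j * v e0" using ex_nat_mult_ge[OF e0(2)] by blast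
    then have le: "s - min B C \<le> v (e0 ^ Suc J)" using e0 by (simp add: rval_power del: power_Suc of_nat_Suc)
    have "vge (v (e0 ^ Suc J) + min B C) (?D w)"
      using e0 by (intro bound[of "e0 ^ Suc J"]) (auto simp: rval_power simp del: power_Suc)
    then show "vge s (?D w)" by (rule vge_mono) (use le in simp)
  qed
  then show "(\<Sum>i\<in>UNIV. mpoly_partial i F P * vmult P w $ i) = 0" by (simp add: mult.assoc)
qed

lemma log_gradient_frame_vector:
  assumes frame: "integral_frame \<tau> r P" and w: "log_matrix \<tau> r P *v w = axis (row_of 0) 1"
  shows "k \<in> {1..<n} \<Longrightarrow> (\<Sum>i\<in>UNIV. log_gradient k P i * w $ i) = 0"
    and "(\<Sum>i\<in>UNIV. of_int (r $ i) * w $ i) = 1" and "w $ i0 = 0"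
proof -
  show "(\<Sum>i\<in>UNIV. log_gradient k P i * w $ i) = 0" if k: "k \<in> {1..<n}"
  proof -
    have "row_of k \<noteq> row_of 0" using k idx_row[of k] idx_row[of 0] by auto
    then have "(\<Sum>i\<in>UNIV. log_gradient k P i * w $ i) / \<tau> k = 0"
      using log_matrix_row_k[of "row_of k" \<tau> r P w] k by (simp add: w idx_row axis_def)
    then show ?thesis using frame k by (auto simp: integral_frame_def)
  qed
  show "(\<Sum>i\<in>UNIV. of_int (r $ i) * w $ i) = 1"
    using log_matrix_row_0[of "row_of 0" \<tau> r P w] by (simp add: w idx_row)
  have "row_of n \<noteq> row_of 0" using n1 idx_row[of n] idx_row[of 0] by auto
  then show "w $ i0 = 0"
    using log_matrix_row_n[of "row_of n" \<tau> r P w] by (simp add: w idx_row axis_def)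
qed

text \<open>Euler's relation and the frame vector give one inclusion. For the other, divide
  \<open>y\<close> by \<open>P\<close> coordinatewise and subtract the value at \<open>i0\<close>
  and the multiple of \<open>w\<close> with the same pairing with \<open>r\<close>; the invertible
  matrix kills what remains.\<close>

lemma tangent_space_eq:
  assumes frame: "integral_frame \<tau> r P" and P: "P \<in> X"
    and w: "log_matrix \<tau> r P *v w = axis (row_of 0) 1"
  shows "tangent_space X P = vec.span {P, vmult P w}"
proof
  have Pt: "P \<in> torus" and isom: "integral_isometry (log_matrix \<tau> r P)"
    and r: "r \<in> char_lattice"
    using frame by (auto simp: integral_frame_def)
  have Pi: "P $ i \<noteq> 0" for i using Pt by (simp add: torus_def)
  show "vec.span {P, vmult P w} \<subseteq> tangent_space X P"
  proof
    fix y assume "y \<in> vec.span {P, vmult P w}"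
    then obtain a b where y: "y = a *s P + b *s vmult P w" unfolding span_pair by blast
    show "y \<in> tangent_space X P" unfolding tangent_space_def
    proof (intro CollectI allI impI)
      fix F :: "nat ^ 'n \<Rightarrow>\<^sub>0 'k"
      assume F: "homogeneous F \<and> (\<forall>x\<in>X. mpoly_eval F x = 0)"
      have "(\<Sum>i\<in>UNIV. mpoly_partial i F P * P $ i) = 0" using F P by (intro euler_identity) auto
      moreover have "(\<Sum>i\<in>UNIV. mpoly_partial i F P * vmult P w $ i) = 0"
        using frame_vector_in_tangent_space[OF frame P w] F by (auto simp: tangent_space_def)
      moreover have "(\<Sum>i\<in>UNIV. mpoly_partial i F P * y $ i) =
          a * (\<Sum>i\<in>UNIV. mpoly_partial i F P * P $ i) +
          b * (\<Sum>i\<in>UNIV. mpoly_partial i F P * vmult P w $ i)"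
        by (simp add: y sum_distrib_left sum.distrib algebra_simps)
      ultimately show "(\<Sum>i\<in>UNIV. mpoly_partial i F P * y $ i) = 0" by simp
    qed
  qed
  show "tangent_space X P \<subseteq> vec.span {P, vmult P w}"
  proof
    fix y assume y: "y \<in> tangent_space X P"
    define x where "x = (\<chi> i. y $ i / P $ i)"
    define b where "b = (\<Sum>i\<in>UNIV. of_int (r $ i) * x $ i)"
    define x' where "x' = (\<chi> i. x $ i - x $ i0 - b * w $ i)"
    note w' = log_gradient_frame_vector[OF frame w]
    have "(log_matrix \<tau> r P *v x') $ l = 0" for l
    proof (cases l rule: idx_cases)
      case 1
      have "(\<Sum>i\<in>UNIV. of_int (r $ i) * x' $ i) =
          (\<Sum>i\<in>UNIV. of_int (r $ i) * x $ i) - (\<Sum>i\<in>UNIV. of_int (r $ i)) * x $ i0 - b * (\<Sum>i\<in>UNIV. of_int (r $ i) * w $ i)"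
        by (simp add: x'_def right_diff_distrib sum_subtractf sum_distrib_left sum_distrib_right mult_ac)
      then show ?thesis using log_matrix_row_0[OF 1] w' r by (simp add: b_def char_lattice_sum_of_int)
    next
      case 2
      then show ?thesis using log_matrix_row_n[OF 2] w' by (simp add: x'_def)
    next
      case 3
      have "(\<Sum>i\<in>UNIV. log_gradient (idx l) P i * x' $ i) = (\<Sum>i\<in>UNIV. log_gradient (idx l) P i * x $ i)
          - (\<Sum>i\<in>UNIV. log_gradient (idx l) P i) * x $ i0 - b * (\<Sum>i\<in>UNIV. log_gradient (idx l) P i * w $ i)"
        by (simp add: x'_def right_diff_distrib sum_subtractf sum_distrib_left sum_distrib_right mult_ac)
      also have "\<dots> = 0"
        using tangent_space_imp_log_gradient[OF P Pt y 3] log_gradient_sum[OF 3] w'(1)[OF 3]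
        by (simp add: x_def)
      finally show ?thesis using log_matrix_row_k[OF 3] by simp
    qed
    then have "vge s ((log_matrix \<tau> r P *v x') $ l)" for s l by simp
    then have "vge s (x' $ i)" for s i by (rule integral_isometryD(2)[OF isom])
    then have x'0: "x' $ i = 0" for i by (rule vge_all_imp_zero)
    have xi: "x $ i = x $ i0 + b * w $ i" for i
    proof -
      have "x' $ i = x $ i - x $ i0 - b * w $ i" by (simp add: x'_def)
      then show ?thesis unfolding x'0 by (metis diff_diff_eq eq_iff_diff_eq_0)
    qed
    have yi: "y $ i = x $ i * P $ i" for i using Pi[of i] by (simp add: x_def)
    have "y $ i = x $ i0 * P $ i + b * (P $ i * w $ i)" for i
      unfolding yi by (subst xi) (simp add: algebra_simps)
    then have "y = x $ i0 *s P + b *s vmult P w" by (simp add: vec_eq_iff)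
    then show "y \<in> vec.span {P, vmult P w}" unfolding span_pair by blast
  qed
qed

lemma pluecker_tangent: "pluecker P (vmult P w) i j = P $ i * P $ j * (w $ j - w $ i)"
  by (simp add: pluecker_def algebra_simps)

text \<open>\<open>r\<close> has degree 0 and pairs to 1 with \<open>w\<close>, so \<open>w\<close>
  is not constant and the two spanning vectors are independent.\<close>

lemma smooth_and_pluecker:
  assumes frame: "integral_frame \<tau> r P" and P: "P \<in> X"
    and w: "log_matrix \<tau> r P *v w = axis (row_of 0) 1"
  shows "curve_smooth_at X P"
    and "tangent_space X P = vec.span {y, z} \<Longrightarrow>
      \<exists>c. c \<noteq> 0 \<and> (\<forall>i j. pluecker y z i j = c * (P $ i * P $ j * (w $ j - w $ i)))"
proof -
  have Pt: "P \<in> torus" and r: "r \<in> char_lattice"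
    using frame by (auto simp: integral_frame_def)
  note w' = log_gradient_frame_vector[OF frame w]
  have "\<exists>j. w $ j \<noteq> w $ i0"
  proof (rule ccontr)
    assume "\<not> ?thesis"
    then have "(\<Sum>i\<in>UNIV. of_int (r $ i) * w $ i) = 0" using w'(3) by simp
    then show False using w'(2) by simp
  qed
  then obtain j where j: "w $ j \<noteq> w $ i0" by blast
  then have pl: "pluecker P (vmult P w) i0 j \<noteq> 0"
    using Pt by (simp add: pluecker_tangent torus_def)
  show "curve_smooth_at X P"
    unfolding curve_smooth_at_def tangent_space_eq[OF assms] using dim_span_pair[OF pl] P by simp
  show "\<exists>c. c \<noteq> 0 \<and> (\<forall>i j. pluecker y z i j = c * (P $ i * P $ j * (w $ j - w $ i)))"
    if "tangent_space X P = vec.span {y, z}"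
    using pluecker_proportional[OF _ pl, of y z] that unfolding tangent_space_eq[OF assms] pluecker_tangent
    by simp
qed

end

section \<open>Leading terms and points with prescribed leading terms\<close>

definition of_int_matrix :: "int ^ 'n::finite ^ 'm::finite \<Rightarrow> 'a::ring_1 ^ 'n ^ 'm" where
  "of_int_matrix A = (\<chi> l i. of_int (A $ l $ i))"

definition of_rat_matrix :: "rat ^ 'n::finite ^ 'm::finite \<Rightarrow> 'a::field_char_0 ^ 'n ^ 'm" where
  "of_rat_matrix B = (\<chi> l i. of_rat (B $ l $ i))"

lemma of_rat_of_int_matrix_mult:
  fixes B :: "rat ^ 'n::finite ^ 'n"
  assumes "B ** of_int_matrix A = mat 1"
  shows "of_rat_matrix B ** of_int_matrix A = (mat 1 :: 'a::field_char_0 ^ 'n ^ 'n)"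
proof -
  have "(\<Sum>l\<in>UNIV. of_rat (B $ i $ l) * of_int (A $ l $ j)) = (if i = j then 1 else 0 :: 'a)" for i j
  proof -
    have "(B ** of_int_matrix A) $ i $ j = mat 1 $ i $ j" using assms by simp
    then have "(\<Sum>l\<in>UNIV. B $ i $ l * of_int (A $ l $ j)) = (if i = j then 1 else 0)"
      by (simp add: matrix_matrix_mult_def of_int_matrix_def mat_def)
    then have "of_rat (\<Sum>l\<in>UNIV. B $ i $ l * of_int (A $ l $ j)) = (if i = j then 1 else 0 :: 'a)"
      by simp
    then show ?thesis by (simp add: of_rat_sum of_rat_mult)
  qed
  then show ?thesis
    by (simp add: vec_eq_iff matrix_matrix_mult_def of_int_matrix_def of_rat_matrix_def mat_def)
qed

lemma prod_power_int: "(\<Prod>l\<in>S. h l :: 'a::field) powi m = (\<Prod>l\<in>S. h l powi m)"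
  by (induction S rule: infinite_finite_induct) (auto simp: power_int_mult_distrib)

lemma power_int_sum:
  "x \<noteq> 0 \<Longrightarrow> (x :: 'a::field) powi (\<Sum>l\<in>S. h l) = (\<Prod>l\<in>S. x powi h l)"
  by (induction S rule: infinite_finite_induct) (auto simp: power_int_add)

text \<open>Rows of a matrix that is invertible over the rationals pose a solvable monomial system
  over an algebraically closed field: clear the denominators of the inverse and extract roots.\<close>

lemma monomial_system:
  fixes A :: "int ^ 'n::finite ^ 'n" and B :: "rat ^ 'n ^ 'n" and \<kappa> :: "'n \<Rightarrow> 'a::alg_closed_field"
  assumes AB: "of_int_matrix A ** B = mat 1" and \<kappa>: "\<And>l. \<kappa> l \<noteq> 0"
  shows "\<exists>P\<in>torus. \<forall>l. laurent_monomial P (A $ l) = \<kappa> l"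
proof -
  define D where "D = (\<Prod>i\<in>UNIV. \<Prod>l\<in>UNIV. snd (quotient_of (B $ i $ l)))"
  have D0: "D > 0" unfolding D_def by (intro prod_pos ballI) (auto simp: quotient_of_denom_pos')
  have "\<exists>b. of_int b = of_int D * B $ i $ l" for i l
  proof -
    have "snd (quotient_of (B $ i $ l)) dvd D"
      unfolding D_def by (meson UNIV_I dvd_prodI dvd_trans finite)
    then obtain c where c: "D = snd (quotient_of (B $ i $ l)) * c" by (auto simp: dvd_def)
    have "B $ i $ l = of_int (fst (quotient_of (B $ i $ l))) / of_int (snd (quotient_of (B $ i $ l)))"
      by (metis prod.collapse quotient_of_div)
    moreover have "(of_int (snd (quotient_of (B $ i $ l))) :: rat) \<noteq> 0"
      using quotient_of_denom_pos'[of "B $ i $ l"] by simp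
    ultimately have "of_int (c * fst (quotient_of (B $ i $ l))) = of_int D * B $ i $ l"
      unfolding c by (simp add: field_simps)
    then show ?thesis by blast
  qed
  then obtain b where b: "\<And>i l. of_int (b i l) = of_int D * B $ i $ l" by metis
  have Ab: "(\<Sum>i\<in>UNIV. A $ m $ i * b i l) = (if m = l then D else 0)" for m l
  proof -
    have "(of_int_matrix A ** B) $ m $ l = mat 1 $ m $ l" using AB by simp
    then have "(\<Sum>i\<in>UNIV. of_int (A $ m $ i) * B $ i $ l) = (if m = l then 1 else 0)"
      by (simp add: matrix_matrix_mult_def of_int_matrix_def mat_def)
    then have "of_int D * (\<Sum>i\<in>UNIV. of_int (A $ m $ i) * B $ i $ l) = of_int (if m = l then D else 0)"
      by simp
    then have "(of_int (\<Sum>i\<in>UNIV. A $ m $ i * b i l) :: rat) = of_int (if m = l then D else 0)"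
      by (simp add: b sum_distrib_left mult_ac)
    then show ?thesis by (simp only: of_int_eq_iff)
  qed
  have "\<exists>x. x ^ nat D = \<kappa> l" for l using nth_root_exists[of "nat D"] D0 by simp
  then obtain x where x: "\<And>l. x l ^ nat D = \<kappa> l" by metis
  have x0: "x l \<noteq> 0" for l using x[of l] \<kappa>[of l] D0 by (auto simp: power_0_left)
  define P where "P = (\<chi> i. \<Prod>l\<in>UNIV. x l powi b i l)"
  have "P \<in> torus" using x0 by (simp add: torus_def P_def)
  moreover have "laurent_monomial P (A $ m) = \<kappa> m" for m
  proof -
    have "laurent_monomial P (A $ m) = (\<Prod>i\<in>UNIV. \<Prod>l\<in>UNIV. x l powi (A $ m $ i * b i l))"
      unfolding laurent_monomial_def P_def
      by (simp add: prod_power_int power_int_mult[symmetric] mult.commute)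
    also have "\<dots> = (\<Prod>l\<in>UNIV. \<Prod>i\<in>UNIV. x l powi (A $ m $ i * b i l))" by (rule prod.swap)
    also have "\<dots> = (\<Prod>l\<in>UNIV. x l powi (\<Sum>i\<in>UNIV. A $ m $ i * b i l))"
      using x0 by (simp add: power_int_sum)
    also have "\<dots> = (\<Prod>l\<in>UNIV. if l = m then x m powi D else 1)"
      by (intro prod.cong) (auto simp: Ab)
    also have "\<dots> = \<kappa> m" using x[of m] D0 by (simp add: power_int_def)
    finally show ?thesis .
  qed
  ultimately show ?thesis by blast
qed

context alg_closed_valued
begin

text \<open>Residue characteristic zero enters here: the entries of the rational inverse are
  integral.\<close>

lemma integral_isometry_of_int_matrix:
  fixes A :: "int ^ 'n::finite ^ 'n" and B :: "rat ^ 'n ^ 'n"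
  assumes "B ** of_int_matrix A = mat 1"
  shows "integral_isometry (of_int_matrix A)"
  unfolding integral_isometry_def
proof (intro conjI allI impI)
  show "vge 0 (of_int_matrix A $ l $ i)" for l i by (simp add: of_int_matrix_def)
  fix r and x :: "'k ^ 'n" and i
  assume x: "\<forall>l. vge r ((of_int_matrix A *v x) $ l)"
  have "of_rat_matrix B *v (of_int_matrix A *v x) = x"
    by (simp add: matrix_vector_mul_assoc of_rat_of_int_matrix_mult[OF assms])
  moreover have "vge (0 + r) ((of_rat_matrix B *v (of_int_matrix A *v x)) $ i)"
    by (rule vge_matrix_vector) (use x in \<open>simp_all add: of_rat_matrix_def\<close>)
  ultimately show "vge r (x $ i)" by simp
qed

lemma rval_laurent_monomial:
  "P \<in> torus \<Longrightarrow> v (laurent_monomial P u) = trop_point val P \<bullet> lattice_vec u"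
  by (simp add: laurent_monomial_def torus_def rval_prod rval_powi trop_point_def lattice_vec_def
      inner_vec_def mult.commute)

end

lemma lattice_vec_diff: "lattice_vec (u - w) = lattice_vec u - lattice_vec w"
  by (simp add: lattice_vec_def vec_eq_iff)

lemma inner_one_lattice_vec: "u \<in> char_lattice \<Longrightarrow> (1 :: real ^ 'n::finite) \<bullet> lattice_vec u = 0"
  by (simp add: inner_vec_def lattice_vec_def char_lattice_sum_of_int)

section \<open>Minimal terms at a tropical point and their control over the logarithmic
  matrix\<close>

context torus_curve
begin

definition over :: "real ^ 'n \<Rightarrow> 'k ^ 'n \<Rightarrow> bool" where
  "over \<alpha> P \<longleftrightarrow> P \<in> torus \<and> trop_eq \<alpha> (trop_point val P)"

abbreviation "tval k \<alpha> u \<equiv> term_val val (f k) \<alpha> u"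
abbreviation "M k \<alpha> \<equiv> min_terms val (f k) \<alpha>"

lemma M_supp: "u \<in> M k \<alpha> \<Longrightarrow> u \<in> supp k"
  and M_le: "u \<in> M k \<alpha> \<Longrightarrow> w \<in> supp k \<Longrightarrow> tval k \<alpha> u \<le> tval k \<alpha> w"
  by (auto simp: min_terms_def)

lemma M_lattice: "k \<in> {1..<n} \<Longrightarrow> u \<in> M k \<alpha> \<Longrightarrow> u \<in> char_lattice"
  using M_supp lattice by blast

lemma rval_coeff_term:
  assumes "over \<alpha> P" and "k \<in> {1..<n}" and "u \<in> supp k"
  shows "v (coeff_term k P u) = tval k \<alpha> u"
proof -
  have P: "P \<in> torus" using assms by (simp add: over_def)
  obtain t where t: "\<alpha> = trop_point val P + t *\<^sub>R 1" using assms by (auto simp: over_def trop_eq_def)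
  have "u \<in> char_lattice" using lattice assms by blast
  then have "\<alpha> \<bullet> lattice_vec u = trop_point val P \<bullet> lattice_vec u"
    unfolding t by (simp add: inner_add_left inner_one_lattice_vec)
  then show ?thesis
    using assms(3) laurent_monomial_nonzero[OF P]
    by (simp add: coeff_term_def term_val_def rval_mult rval_laurent_monomial[OF P] in_keys_iff)
qed

lemma over_vmult:
  assumes "over \<alpha> P" and "\<forall>i. vge \<rho> (z $ i)" and "\<rho> > 0"
  shows "over \<alpha> (vmult P (one_plus z))"
proof -
  have P: "P \<in> torus" using assms by (simp add: over_def)
  have "trop_point val (vmult P (one_plus z)) = trop_point val P"
  proof -
    have "1 + z $ i \<noteq> 0 \<and> v (1 + z $ i) = 0" for i using rval_one_plus assms by blast
    then show ?thesis using P
      by (simp add: trop_point_def vec_eq_iff one_plus_def torus_def rval_mult)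
  qed
  then show ?thesis using assms vmult_torus[OF P one_plus_torus[OF assms(2,3)]]
    by (simp add: over_def)
qed

text \<open>A distance between minimal and other terms that is common to all equations; it is the
  precision to which minimal terms determine everything over \<open>\<alpha>\<close>.\<close>

definition gap :: "real ^ 'n \<Rightarrow> real \<Rightarrow> bool" where
  "gap \<alpha> \<rho> \<longleftrightarrow> \<rho> > 0 \<and> (\<forall>k\<in>{1..<n}. \<forall>u\<in>supp k. \<forall>p\<in>M k \<alpha>. u \<notin> M k \<alpha> \<longrightarrow> tval k \<alpha> p + \<rho> \<le> tval k \<alpha> u)"

lemma ex_gap: "\<exists>\<rho>. gap \<alpha> \<rho>"
proof -
  define S where "S = (\<Union>k\<in>{1..<n}. (\<lambda>(u, p). tval k \<alpha> u - tval k \<alpha> p) ` ((supp k - M k \<alpha>) \<times> M k \<alpha>))"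
  have "finite (M k \<alpha>)" for k by (rule finite_subset[of _ "supp k"]) (auto simp: min_terms_def)
  then have fin: "finite S" by (simp add: S_def)
  have pos: "0 < s" if "s \<in> S" for s
    using that by (force simp: S_def min_terms_def)
  \<comment> \<open>The element 1 keeps the set nonempty when every term is minimal.\<close>
  define \<rho> where "\<rho> = Min (insert 1 S)"
  have "\<rho> > 0" unfolding \<rho>_def using fin pos by (subst Min_gr_iff) auto
  moreover have "\<rho> \<le> s" if "s \<in> S" for s unfolding \<rho>_def using fin that by (intro Min_le) auto
  then have "tval k \<alpha> p + \<rho> \<le> tval k \<alpha> u"
    if "k \<in> {1..<n}" "u \<in> supp k" "p \<in> M k \<alpha>" "u \<notin> M k \<alpha>" for k u p
    using that by (force simp: S_def algebra_simps)
  ultimately show ?thesis unfolding gap_def by blast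
qed

definition min_scaled :: "real ^ 'n \<Rightarrow> (nat \<Rightarrow> 'k) \<Rightarrow> bool" where
  "min_scaled \<alpha> \<tau> \<longleftrightarrow> (\<forall>k\<in>{1..<n}. \<tau> k \<noteq> 0 \<and> (\<exists>p\<in>M k \<alpha>. v (\<tau> k) = tval k \<alpha> p))"

lemma min_scaled_terms:
  assumes "over \<alpha> P" and "min_scaled \<alpha> \<tau>" and "k \<in> {1..<n}" and "u \<in> supp k"
  shows "vge 0 (coeff_term k P u / \<tau> k)"
    and "gap \<alpha> \<rho> \<Longrightarrow> u \<notin> M k \<alpha> \<Longrightarrow> vge \<rho> (coeff_term k P u / \<tau> k)"
proof -
  obtain p where p: "\<tau> k \<noteq> 0" "p \<in> M k \<alpha>" "v (\<tau> k) = tval k \<alpha> p"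
    using assms(2,3) unfolding min_scaled_def by blast
  have T: "coeff_term k P u \<noteq> 0" using assms by (intro coeff_term_nonzero) (auto simp: over_def)
  have eq: "v (coeff_term k P u / \<tau> k) = tval k \<alpha> u - tval k \<alpha> p"
    using p T by (simp add: rval_divide rval_coeff_term[OF assms(1,3,4)])
  show "vge 0 (coeff_term k P u / \<tau> k)"
    using T p eq M_le[OF p(2) assms(4)] by (subst vge_iff) auto
  show "vge \<rho> (coeff_term k P u / \<tau> k)" if "gap \<alpha> \<rho>" "u \<notin> M k \<alpha>"
  proof -
    have "tval k \<alpha> p + \<rho> \<le> tval k \<alpha> u" using that assms p by (auto simp: gap_def)
    then show ?thesis using T p eq by (subst vge_iff) auto
  qed
qed

lemma leading_sum:
  assumes "over \<alpha> P" and "min_scaled \<alpha> \<tau>" and "gap \<alpha> \<rho>" and "k \<in> {1..<n}"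
    and "\<And>u. vge 0 (a u)"
  shows "vge \<rho> ((\<Sum>u\<in>supp k. coeff_term k P u / \<tau> k * a u) - (\<Sum>u\<in>M k \<alpha>. coeff_term k P u / \<tau> k * a u))"
proof -
  have "M k \<alpha> \<subseteq> supp k" by (auto simp: min_terms_def)
  then have "(\<Sum>u\<in>supp k. coeff_term k P u / \<tau> k * a u) - (\<Sum>u\<in>M k \<alpha>. coeff_term k P u / \<tau> k * a u) =
      (\<Sum>u\<in>supp k - M k \<alpha>. coeff_term k P u / \<tau> k * a u)"
    by (simp add: sum_diff)
  then show ?thesis
    using min_scaled_terms(2)[OF assms(1,2,4) _ assms(3)] assms(5)
    by (simp only:) (intro vge_sum vge_mult_right, auto)
qed

text \<open>\<open>R\<close> is built from minimal terms alone, with exponents measured from a base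
  point \<open>q k\<close>. Changing the base point alters a row by a multiple of the sum of all
  scaled terms, which \<open>approx\<close> makes small. So the two matrices agree up to
  \<open>\<rho>\<close>, and invertibility passes from \<open>R\<close> to
  \<open>log_matrix\<close>.\<close>

lemma leading_frame:
  assumes P: "over \<alpha> P" and \<tau>: "min_scaled \<alpha> \<tau>" and \<rho>: "gap \<alpha> \<rho>" and r: "r \<in> char_lattice"
    and approx: "\<And>k. k \<in> {1..<n} \<Longrightarrow> vge \<rho> (\<Sum>u\<in>supp k. coeff_term k P u / \<tau> k)"
    and isom: "integral_isometry R"
    and R0: "\<And>i. R $ row_of 0 $ i = of_int (r $ i)"
    and Rn: "\<And>i. R $ row_of n $ i = (if i = i0 then 1 else 0)"
    and Rk: "\<And>k i. k \<in> {1..<n} \<Longrightarrow>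
      R $ row_of k $ i = (\<Sum>u\<in>M k \<alpha>. coeff_term k P u / \<tau> k * of_int (u $ i - q k $ i))"
  shows "integral_frame \<tau> r P" and "vge \<rho> (log_matrix \<tau> r P $ l $ i - R $ l $ i)"
proof -
  have close: "vge \<rho> (log_matrix \<tau> r P $ l $ i - R $ l $ i)" for l i
  proof (cases l rule: idx_cases)
    case 1
    then have "l = row_of 0" by (metis row_idx)
    then show ?thesis using R0[of i] 1 by (simp add: log_matrix_def)
  next
    case 2
    then have "l = row_of n" by (metis row_idx)
    then show ?thesis using Rn[of i] 2 n1 by (simp add: log_matrix_def)
  next
    case 3
    let ?k = "idx l"
    let ?t = "\<lambda>u. coeff_term ?k P u / \<tau> ?k"
    have "log_matrix \<tau> r P $ l $ i = (\<Sum>u\<in>supp ?k. ?t u * of_int (u $ i))"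
      using 3 by (simp add: log_matrix_def log_gradient_def sum_divide_distrib)
    also have "\<dots> = (\<Sum>u\<in>supp ?k. ?t u * of_int (u $ i - q ?k $ i)) + (\<Sum>u\<in>supp ?k. ?t u) * of_int (q ?k $ i)"
      by (simp add: right_diff_distrib sum_subtractf sum_distrib_right)
    finally have "log_matrix \<tau> r P $ l $ i - R $ l $ i =
        ((\<Sum>u\<in>supp ?k. ?t u * of_int (u $ i - q ?k $ i)) - (\<Sum>u\<in>M ?k \<alpha>. ?t u * of_int (u $ i - q ?k $ i)))
        + (\<Sum>u\<in>supp ?k. ?t u) * of_int (q ?k $ i)"
      using Rk[OF 3, of i] by simp
    moreover have "vge \<rho> ((\<Sum>u\<in>supp ?k. ?t u) * of_int (q ?k $ i))"
      by (intro vge_mult_right approx 3) simp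
    moreover have "vge \<rho> ((\<Sum>u\<in>supp ?k. ?t u * of_int (u $ i - q ?k $ i)) - (\<Sum>u\<in>M ?k \<alpha>. ?t u * of_int (u $ i - q ?k $ i)))"
      by (rule leading_sum[OF P \<tau> \<rho> 3]) (rule vge_of_int)
    ultimately show ?thesis by (simp only: vge_add)
  qed
  then show "vge \<rho> (log_matrix \<tau> r P $ l $ i - R $ l $ i)" .
  have "\<rho> > 0" using \<rho> by (simp add: gap_def)
  have "integral_isometry (log_matrix \<tau> r P)"
    by (rule integral_isometry_perturb[OF isom close \<open>\<rho> > 0\<close>])
  then show "integral_frame \<tau> r P"
    using P r \<tau> min_scaled_terms(1)[OF P \<tau>]
    by (auto simp: integral_frame_def over_def min_scaled_def)
qed

text \<open>Both vectors are mapped to the same unit vector, so the image of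
  \<open>w - \<omega>\<close> is the difference of the matrices applied to the integral vector
  \<open>\<omega>\<close>, up to sign.\<close>

lemma frame_vector_close:
  assumes frame: "integral_frame \<tau> r P" and w: "log_matrix \<tau> r P *v w = axis (row_of 0) 1"
    and isom: "integral_isometry R" and \<omega>: "R *v \<omega> = axis (row_of 0) 1"
    and close: "\<And>l i. vge \<rho> (log_matrix \<tau> r P $ l $ i - R $ l $ i)"
  shows "vge \<rho> (w $ i - \<omega> $ i)"
proof -
  have "vge 0 ((R *v \<omega>) $ l)" for l by (simp add: \<omega> axis_def)
  then have \<omega>0: "vge 0 (\<omega> $ i)" for i by (rule integral_isometryD(2)[OF isom])
  have eq: "log_matrix \<tau> r P *v (w - \<omega>) = - ((log_matrix \<tau> r P - R) *v \<omega>)"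
    by (simp add: matrix_vector_mult_diff_distrib matrix_vector_mult_diff_rdistrib w \<omega>)
  have "vge (\<rho> + 0) (((log_matrix \<tau> r P - R) *v \<omega>) $ l)" for l
    by (rule vge_matrix_vector) (use close \<omega>0 in auto)
  then have "vge \<rho> ((log_matrix \<tau> r P *v (w - \<omega>)) $ l)" for l by (simp add: eq)
  moreover have "integral_isometry (log_matrix \<tau> r P)" using frame by (simp add: integral_frame_def)
  ultimately have "vge \<rho> ((w - \<omega>) $ i)" using integral_isometryD(2) by blast
  then show ?thesis by simp
qed

definition lead_matrix :: "(nat \<Rightarrow> int ^ 'n) \<Rightarrow> int ^ 'n \<Rightarrow> int ^ 'n ^ 'n" where
  "lead_matrix d r = (\<chi> l. if idx l = 0 then r else if idx l = n then axis i0 1 else d (idx l))"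

lemma lead_matrix_row:
  "lead_matrix d r $ row_of 0 = r"
  "lead_matrix d r $ row_of n = axis i0 1"
  "k \<in> {1..<n} \<Longrightarrow> lead_matrix d r $ row_of k = d k"
  using n1 by (auto simp: lead_matrix_def idx_row)

text \<open>A system of monomial equations is solved exactly. The valuations of its right-hand sides
  are those dictated by \<open>\<alpha>\<close>, and since the matrix is injective over the reals
  the solution lies over \<open>\<alpha>\<close>. Row \<open>n\<close> sets coordinate
  \<open>i0\<close> to 1, which selects the lift \<open>\<alpha>'\<close> vanishing at
  \<open>i0\<close>.\<close>

lemma lead_point:
  fixes B :: "rat ^ 'n ^ 'n"
  assumes B: "B ** of_int_matrix (lead_matrix (\<lambda>k. p k - q k) r) = mat 1"
    and pq: "\<And>k. k \<in> {1..<n} \<Longrightarrow> p k \<in> M k \<alpha> \<and> q k \<in> M k \<alpha>"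
    and r: "r \<in> char_lattice" and \<kappa>: "\<kappa> \<noteq> 0" "v \<kappa> = \<alpha> \<bullet> lattice_vec r"
    and \<eta>: "\<And>k. k \<in> {1..<n} \<Longrightarrow> \<eta> k \<noteq> 0 \<and> v (\<eta> k) = 0"
  shows "\<exists>P. over \<alpha> P \<and> laurent_monomial P r = \<kappa> \<and>
    (\<forall>k\<in>{1..<n}. coeff_term k P (p k) / coeff_term k P (q k) = \<eta> k)"
proof -
  let ?A = "lead_matrix (\<lambda>k. p k - q k) r"
  let ?c = "\<lambda>k u. Poly_Mapping.lookup (f k) u"
  define \<alpha>' where "\<alpha>' = \<alpha> - (\<alpha> $ i0) *\<^sub>R 1"
  have \<alpha>': "\<alpha>' \<bullet> lattice_vec u = \<alpha> \<bullet> lattice_vec u" if "u \<in> char_lattice" for u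
    unfolding \<alpha>'_def by (simp add: inner_diff_left inner_one_lattice_vec[OF that])
  have c0: "?c k u \<noteq> 0" if "u \<in> M k \<alpha>" for k u using M_supp[OF that] by (simp add: in_keys_iff)
  define \<mu> where "\<mu> = (\<lambda>l. if idx l = 0 then \<kappa> else if idx l = n then 1
     else \<eta> (idx l) * ?c (idx l) (q (idx l)) / ?c (idx l) (p (idx l)))"
  have \<mu>0: "\<mu> l \<noteq> 0" for l
    using \<kappa> \<eta> c0 pq by (cases l rule: idx_cases) (auto simp: \<mu>_def)
  have \<mu>v: "v (\<mu> l) = \<alpha>' \<bullet> lattice_vec (?A $ l)" for l
  proof (cases l rule: idx_cases)
    case 1
    then show ?thesis using \<kappa>(2) \<alpha>'[OF r] by (simp add: \<mu>_def lead_matrix_def)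
  next
    case 2
    have "lattice_vec (axis i0 1) = (axis i0 1 :: real ^ 'n)"
      by (simp add: lattice_vec_def axis_def vec_eq_iff)
    then show ?thesis using 2 n1 by (simp add: \<mu>_def lead_matrix_def inner_axis \<alpha>'_def)
  next
    case 3
    let ?k = "idx l"
    have pqM: "p ?k \<in> M ?k \<alpha>" "q ?k \<in> M ?k \<alpha>" using pq[OF 3] by auto
    have "tval ?k \<alpha> (p ?k) = tval ?k \<alpha> (q ?k)"
      using M_le[OF pqM(1) M_supp[OF pqM(2)]] M_le[OF pqM(2) M_supp[OF pqM(1)]] by simp
    then have "v (?c ?k (q ?k)) - v (?c ?k (p ?k)) = \<alpha> \<bullet> lattice_vec (p ?k) - \<alpha> \<bullet> lattice_vec (q ?k)"
      by (simp add: term_val_def)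
    also have "\<dots> = \<alpha>' \<bullet> lattice_vec (p ?k - q ?k)"
      using \<alpha>'[OF M_lattice[OF 3 pqM(1)]] \<alpha>'[OF M_lattice[OF 3 pqM(2)]]
      by (simp add: lattice_vec_diff inner_diff_right)
    finally have "v (\<mu> l) = \<alpha>' \<bullet> lattice_vec (p ?k - q ?k)"
      using 3 \<eta>[OF 3] c0[OF pqM(1)] c0[OF pqM(2)] by (simp add: \<mu>_def rval_divide rval_mult)
    then show ?thesis using 3 by (simp add: lead_matrix_def)
  qed
  have "of_int_matrix ?A ** B = mat 1" using B matrix_left_right_inverse by blast
  from monomial_system[OF this, of \<mu>] \<mu>0 obtain P where
    P: "P \<in> torus" "\<And>l. laurent_monomial P (?A $ l) = \<mu> l" by blast
  have "of_int_matrix ?A *v (trop_point val P - \<alpha>') = 0"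
  proof -
    have "(of_int_matrix ?A *v x) $ l = x \<bullet> lattice_vec (?A $ l)" for l x
      by (simp add: matrix_vector_mult_def of_int_matrix_def lattice_vec_def inner_vec_def mult.commute)
    moreover have "trop_point val P \<bullet> lattice_vec (?A $ l) = \<alpha>' \<bullet> lattice_vec (?A $ l)" for l
      using \<mu>v[of l] rval_laurent_monomial[OF P(1), of "?A $ l"] P(2)[of l] by metis
    ultimately show ?thesis by (simp add: vec_eq_iff inner_diff_left)
  qed
  then have "of_rat_matrix B *v (of_int_matrix ?A *v (trop_point val P - \<alpha>')) = 0" by simp
  then have "trop_point val P = \<alpha>'"
    by (simp add: matrix_vector_mul_assoc of_rat_of_int_matrix_mult[OF B])
  then have "\<alpha> = trop_point val P + (\<alpha> $ i0) *\<^sub>R 1" by (simp add: \<alpha>'_def)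
  then have "over \<alpha> P" using P(1) by (auto simp: over_def trop_eq_def)
  moreover have "laurent_monomial P r = \<kappa>"
    using P(2)[of "row_of 0"] by (simp add: lead_matrix_row \<mu>_def idx_row)
  moreover have "coeff_term k P (p k) / coeff_term k P (q k) = \<eta> k" if k: "k \<in> {1..<n}" for k
  proof -
    have pqM: "p k \<in> M k \<alpha>" "q k \<in> M k \<alpha>" using pq[OF k] by auto
    have "laurent_monomial P (p k - q k) = \<eta> k * ?c k (q k) / ?c k (p k)"
      using P(2)[of "row_of k"] k by (auto simp: lead_matrix_row \<mu>_def idx_row)
    then have "laurent_monomial P (p k) / laurent_monomial P (q k) = \<eta> k * ?c k (q k) / ?c k (p k)"
      by (simp add: laurent_monomial_diff[OF P(1)])
    then show ?thesis
      using c0[OF pqM(1)] c0[OF pqM(2)] laurent_monomial_nonzero[OF P(1)]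
      by (simp add: coeff_term_def field_simps)
  qed
  ultimately show ?thesis by blast
qed

text \<open>This is \<open>move\<close> with \<open>e = 0\<close>, which keeps the monomial
  \<open>r\<close> fixed.\<close>

lemma lift:
  assumes "integral_frame \<tau> r P" and "over \<alpha> P" and "\<rho> > 0"
    and "\<And>k. k \<in> {1..<n} \<Longrightarrow> vge \<rho> (\<Sum>u\<in>supp k. coeff_term k P u / \<tau> k)"
  shows "\<exists>P'. over \<alpha> P' \<and> P' \<in> X \<and> laurent_monomial P' r = laurent_monomial P r"
proof -
  obtain z where z: "\<forall>i. vge \<rho> (z $ i)" "vmult P (one_plus z) \<in> X"
    "laurent_monomial (one_plus z) r = 1"
    using move[OF assms(1,3) vge_zero assms(4)] by auto
  then show ?thesis
    using over_vmult[OF assms(2) z(1) assms(3)] by (auto simp: laurent_monomial_vmult)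
qed

lemma finite_M: "finite (M k \<alpha>)"
  by (rule finite_subset[of _ "supp k"]) (auto simp: min_terms_def)

lemma M_eq: "u \<in> M k \<alpha> \<Longrightarrow> w \<in> M k \<alpha> \<Longrightarrow> tval k \<alpha> u = tval k \<alpha> w"
  using M_le M_supp by (meson order_antisym)

lemma min_scaled_coeff_term:
  assumes "over \<alpha> P" and "\<And>k. k \<in> {1..<n} \<Longrightarrow> p k \<in> M k \<alpha>"
  shows "min_scaled \<alpha> (\<lambda>k. coeff_term k P (p k))"
  unfolding min_scaled_def
proof (intro ballI conjI bexI)
  fix k assume k: "k \<in> {1..<n}"
  show "coeff_term k P (p k) \<noteq> 0"
    using assms M_supp k by (intro coeff_term_nonzero) (auto simp: over_def)
  show "v (coeff_term k P (p k)) = tval k \<alpha> (p k)"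
    by (rule rval_coeff_term[OF assms(1) k M_supp[OF assms(2)[OF k]]])
qed (use assms in auto)

lemma approx_if_leading_sum_zero:
  assumes "over \<alpha> P" and "min_scaled \<alpha> \<tau>" and "gap \<alpha> \<rho>" and "k \<in> {1..<n}"
    and "(\<Sum>u\<in>M k \<alpha>. coeff_term k P u / \<tau> k) = 0"
  shows "vge \<rho> (\<Sum>u\<in>supp k. coeff_term k P u / \<tau> k)"
  using leading_sum[OF assms(1-4), of "\<lambda>_. 1"] assms(5) by simp

lemma approx_on_curve:
  assumes "P \<in> X" and "P \<in> torus" and "k \<in> {1..<n}"
  shows "(\<Sum>u\<in>supp k. coeff_term k P u / c) = 0"
  using assms on_curve_iff by (simp flip: sum_divide_distrib)

section \<open>Points over an edge, and valuations of Pluecker coordinates\<close>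

definition edge_terms :: "real ^ 'n \<Rightarrow> (nat \<Rightarrow> int ^ 'n) \<Rightarrow> (nat \<Rightarrow> int ^ 'n) \<Rightarrow> bool" where
  "edge_terms \<alpha> p q \<longleftrightarrow> (\<forall>k\<in>{1..<n}. M k \<alpha> = {p k, q k} \<and> p k \<noteq> q k)"

lemma of_int_matrix_column:
  fixes B :: "rat ^ 'n ^ 'n"
  assumes "B ** of_int_matrix A = mat 1"
  shows "of_int_matrix A *v (\<chi> i. of_rat (B $ i $ l)) = (axis l 1 :: 'a::field_char_0 ^ 'n)"
proof -
  have "of_int_matrix A ** of_rat_matrix B = (mat 1 :: 'a ^ 'n ^ 'n)"
    using of_rat_of_int_matrix_mult[OF assms] matrix_left_right_inverse by blast
  then have "(of_int_matrix A ** of_rat_matrix B) $ i $ l = (mat 1 :: 'a ^ 'n ^ 'n) $ i $ l" for i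
    by simp
  then have "(\<Sum>m\<in>UNIV. of_int (A $ i $ m) * of_rat (B $ m $ l)) = (axis l 1 :: 'a ^ 'n) $ i" for i
    by (simp add: matrix_matrix_mult_def of_rat_matrix_def of_int_matrix_def mat_def axis_def)
  then show ?thesis
    by (simp add: vec_eq_iff matrix_vector_mult_def of_int_matrix_def)
qed

text \<open>With base point \<open>q k\<close> and scaling by the term of \<open>p k\<close>, the
  reduced row is exactly the integer vector \<open>p k - q k\<close>.\<close>

lemma edge_frame:
  fixes B :: "rat ^ 'n ^ 'n"
  assumes edge: "edge_terms \<alpha> p q" and P: "over \<alpha> P" and \<rho>: "gap \<alpha> \<rho>" and r: "r \<in> char_lattice"
    and B: "B ** of_int_matrix (lead_matrix (\<lambda>k. p k - q k) r) = mat 1"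
    and approx: "\<And>k. k \<in> {1..<n} \<Longrightarrow> vge \<rho> (\<Sum>u\<in>supp k. coeff_term k P u / coeff_term k P (p k))"
  shows "integral_frame (\<lambda>k. coeff_term k P (p k)) r P"
    and "vge \<rho> (log_matrix (\<lambda>k. coeff_term k P (p k)) r P $ l $ i -
      of_int_matrix (lead_matrix (\<lambda>k. p k - q k) r) $ l $ i)"
proof -
  let ?R = "of_int_matrix (lead_matrix (\<lambda>k. p k - q k) r) :: 'k ^ 'n ^ 'n"
  have M: "M k \<alpha> = {p k, q k}" "p k \<noteq> q k" if "k \<in> {1..<n}" for k
    using edge that by (auto simp: edge_terms_def)
  have ms: "min_scaled \<alpha> (\<lambda>k. coeff_term k P (p k))"
    by (rule min_scaled_coeff_term[OF P]) (use M in auto)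
  have "?R $ row_of k $ i = (\<Sum>u\<in>M k \<alpha>. coeff_term k P u / coeff_term k P (p k) * of_int (u $ i - q k $ i))"
    if "k \<in> {1..<n}" for k i
  proof -
    have "coeff_term k P (p k) \<noteq> 0" using ms that by (auto simp: min_scaled_def)
    then show ?thesis using M[OF that] that by (simp add: of_int_matrix_def lead_matrix_row)
  qed
  moreover have "?R $ row_of 0 $ i = of_int (r $ i)" "?R $ row_of n $ i = (if i = i0 then 1 else 0)" for i
    by (auto simp: of_int_matrix_def lead_matrix_row axis_def)
  ultimately show "integral_frame (\<lambda>k. coeff_term k P (p k)) r P"
    and "vge \<rho> (log_matrix (\<lambda>k. coeff_term k P (p k)) r P $ l $ i - ?R $ l $ i)"
    using leading_frame[OF P ms \<rho> r approx integral_isometry_of_int_matrix[OF B]] by blast+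
qed

lemma edge_lift:
  fixes B :: "rat ^ 'n ^ 'n"
  assumes edge: "edge_terms \<alpha> p q" and rat: "val_rational val \<alpha>"
    and r: "r = axis j 1 - axis i0 1"
    and B: "B ** of_int_matrix (lead_matrix (\<lambda>k. p k - q k) r) = mat 1"
  shows "\<exists>P. over \<alpha> P \<and> P \<in> X"
proof -
  have M: "M k \<alpha> = {p k, q k}" "p k \<noteq> q k" if "k \<in> {1..<n}" for k
    using edge that by (auto simp: edge_terms_def)
  have rl: "r \<in> char_lattice"
    by (simp add: r char_lattice_def sum_subtractf axis_def)
  obtain \<kappa> where \<kappa>: "\<kappa> \<noteq> 0" "v \<kappa> = \<alpha> $ j - \<alpha> $ i0"
    using rat by (auto simp: val_rational_def value_group_def) metis
  have "lattice_vec (axis i 1) = (axis i 1 :: real ^ 'n)" for i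
    by (simp add: lattice_vec_def axis_def vec_eq_iff)
  then have "v \<kappa> = \<alpha> \<bullet> lattice_vec r"
    by (simp add: \<kappa> r lattice_vec_diff inner_diff_right inner_axis)
  \<comment> \<open>The ratio -1 makes the two minimal terms of each equation cancel, so the point
    solves the system up to the gap.\<close>
  from lead_point[OF B _ rl \<kappa>(1) this, where \<eta> = "\<lambda>_. - 1"] M obtain P where
    P: "over \<alpha> P" "\<And>k. k \<in> {1..<n} \<Longrightarrow> coeff_term k P (p k) / coeff_term k P (q k) = - 1" by auto
  obtain \<rho> where \<rho>: "gap \<alpha> \<rho>" using ex_gap by blast
  have ms: "min_scaled \<alpha> (\<lambda>k. coeff_term k P (p k))"
    by (rule min_scaled_coeff_term[OF P(1)]) (use M in auto)
  have approx: "vge \<rho> (\<Sum>u\<in>supp k. coeff_term k P u / coeff_term k P (p k))" if k: "k \<in> {1..<n}" for k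
  proof (rule approx_if_leading_sum_zero[OF P(1) ms \<rho> k])
    have "coeff_term k P (p k) \<noteq> 0" using ms k by (auto simp: min_scaled_def)
    then show "(\<Sum>u\<in>M k \<alpha>. coeff_term k P u / coeff_term k P (p k)) = 0"
      using M[OF k] P(2)[OF k] by (auto simp: divide_eq_eq split: if_splits)
  qed
  show ?thesis
    using lift[OF edge_frame(1)[OF edge P(1) \<rho> rl B approx] P(1) _ approx] \<rho>
    by (auto simp: gap_def)
qed

text \<open>The factor in front of \<open>w_j - w_i\<close> has valuation
  \<open>\<alpha>_i + \<alpha>_j\<close> up to a constant; subtracting the sum of all coordinates of
  \<open>\<alpha>\<close> turns this into the sum over the complement of the pair. What is left is
  the valuation of \<open>w_i - w_j\<close>.\<close>

lemma tangent_rval: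
  assumes frame: "integral_frame \<tau> r P" and P: "P \<in> X" "over \<alpha> P"
    and w: "log_matrix \<tau> r P *v w = axis (row_of 0) 1"
    and yz: "tangent_space X P = vec.span {y, z}"
  shows "\<exists>c. \<forall>i j. i \<noteq> j \<longrightarrow> (pluecker y z i j \<noteq> 0 \<longleftrightarrow> w $ i \<noteq> w $ j) \<and>
    (w $ i \<noteq> w $ j \<longrightarrow> v (pluecker y z i j) = v (w $ i - w $ j) + (\<Sum>m\<in>-{i, j}. - \<alpha> $ m) + c)"
proof -
  have Pt: "P \<in> torus" using P by (simp add: over_def)
  then have Pi: "P $ i \<noteq> 0" for i by (simp add: torus_def)
  obtain t where t: "\<alpha> = trop_point val P + t *\<^sub>R 1" using P by (auto simp: over_def trop_eq_def)
  have vP: "v (P $ i) = \<alpha> $ i - t" for i by (simp add: t trop_point_def)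
  obtain c where c: "c \<noteq> 0" "\<And>i j. pluecker y z i j = c * (P $ i * P $ j * (w $ j - w $ i))"
    using smooth_and_pluecker(2)[OF frame P(1) w yz] by blast
  define c' where "c' = v c - 2 * t + (\<Sum>m\<in>UNIV. \<alpha> $ m)"
  have "v (pluecker y z i j) = v (w $ i - w $ j) + (\<Sum>m\<in>-{i, j}. - \<alpha> $ m) + c'"
    if "i \<noteq> j" "w $ i \<noteq> w $ j" for i j
  proof -
    have "(\<Sum>m\<in>UNIV. \<alpha> $ m) = (\<Sum>m\<in>-{i, j}. \<alpha> $ m) + (\<Sum>m\<in>{i, j}. \<alpha> $ m)"
    proof -
      have "insert i (insert j (- {i, j})) = UNIV" by auto
      then show ?thesis using sum.union_disjoint[of "- {i, j}" "{i, j}" "\<lambda>m. \<alpha> $ m"] by simp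
    qed
    then have 1: "(\<Sum>m\<in>-{i, j}. - \<alpha> $ m) = \<alpha> $ i + \<alpha> $ j - (\<Sum>m\<in>UNIV. \<alpha> $ m)"
      using that(1) by (simp add: sum_negf)
    have "v (w $ j - w $ i) = v (w $ i - w $ j)" using rval_minus[of "w $ i - w $ j"] by simp
    then have "v (pluecker y z i j) = v c + (v (P $ i) + v (P $ j) + v (w $ i - w $ j))"
      using c Pi that(2) by (simp add: rval_mult)
    then show ?thesis unfolding 1 vP c'_def by simp
  qed
  then show ?thesis using c Pi by (intro exI[of _ c']) auto
qed

lemma tropical_tangentI:
  assumes frame: "integral_frame \<tau> r P" and P: "P \<in> X" "over \<alpha> P"
    and w: "log_matrix \<tau> r P *v w = axis (row_of 0) 1"
    and \<beta>: "\<And>i j. i \<noteq> j \<Longrightarrow> w $ i \<noteq> w $ j \<and> \<beta> {i, j} = v (w $ i - w $ j) + (\<Sum>m\<in>-{i, j}. - \<alpha> $ m) + c"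
  shows "tropical_tangent val X \<alpha> \<beta>"
proof -
  have span: "tangent_space X P = vec.span {P, vmult P w}"
    by (rule tangent_space_eq[OF frame P(1) w])
  obtain c' where c': "\<And>i j. i \<noteq> j \<Longrightarrow> (pluecker P (vmult P w) i j \<noteq> 0 \<longleftrightarrow> w $ i \<noteq> w $ j) \<and>
    (w $ i \<noteq> w $ j \<longrightarrow> v (pluecker P (vmult P w) i j) = v (w $ i - w $ j) + (\<Sum>m\<in>-{i, j}. - \<alpha> $ m) + c')"
    using tangent_rval[OF frame P w span] by blast
  have "pluecker P (vmult P w) i j \<noteq> 0 \<and> \<beta> {i, j} = v (pluecker P (vmult P w) i j) + (c - c')"
    if "i \<noteq> j" for i j
    using c'[OF that] \<beta>[OF that] by auto
  then show ?thesis unfolding tropical_tangent_def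
    using smooth_and_pluecker(1)[OF frame P(1) w] span P(2) unfolding over_def by metis
qed

lemma not_gauss_vanishing_if_frame_vector:
  assumes frame: "integral_frame \<tau> r P" and P: "P \<in> X"
    and w: "log_matrix \<tau> r P *v w = axis (row_of 0) 1" and "w $ i \<noteq> w $ j"
  shows "\<not> gauss_vanishing X i j"
proof -
  have "P \<in> torus" using frame by (simp add: integral_frame_def)
  then have "pluecker P (vmult P w) i j \<noteq> 0"
    using assms(4) by (auto simp: pluecker_tangent torus_def)
  then show ?thesis
    unfolding gauss_vanishing_def
    using smooth_and_pluecker(1)[OF frame P w] tangent_space_eq[OF frame P w] by blast
qed

text \<open>Modulo \<open>\<rho>\<close> the frame vector is a column of the rational inverse.
  Distinct entries differ by nonzero rationals, which have valuation 0.\<close>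

lemma edge_frame_vector:
  fixes B :: "rat ^ 'n ^ 'n"
  assumes edge: "edge_terms \<alpha> p q" and r: "r \<in> char_lattice"
    and B: "B ** of_int_matrix (lead_matrix (\<lambda>k. p k - q k) r) = mat 1"
    and distinct: "\<And>i j. i \<noteq> j \<Longrightarrow> B $ i $ row_of 0 \<noteq> B $ j $ row_of 0"
    and P: "P \<in> X" "over \<alpha> P"
  shows "\<exists>\<tau> w. integral_frame \<tau> r P \<and> log_matrix \<tau> r P *v w = axis (row_of 0) 1 \<and>
    (\<forall>i j. i \<noteq> j \<longrightarrow> w $ i \<noteq> w $ j \<and> v (w $ i - w $ j) = 0)"
proof -
  obtain \<rho> where \<rho>: "gap \<alpha> \<rho>" using ex_gap by blast
  then have \<rho>0: "\<rho> > 0" by (simp add: gap_def)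
  let ?\<tau> = "\<lambda>k. coeff_term k P (p k)"
  have Pt: "P \<in> torus" using P by (simp add: over_def)
  have approx: "vge \<rho> (\<Sum>u\<in>supp k. coeff_term k P u / coeff_term k P (p k))" if k: "k \<in> {1..<n}" for k
    by (simp add: approx_on_curve[OF P(1) Pt k])
  note fr = edge_frame[OF edge P(2) \<rho> r B approx]
  obtain w where w: "log_matrix ?\<tau> r P *v w = axis (row_of 0) 1"
    using ex_frame_vector[OF fr(1)] by blast
  let ?\<omega> = "(\<chi> i. of_rat (B $ i $ row_of 0)) :: 'k ^ 'n"
  have close: "vge \<rho> (w $ i - ?\<omega> $ i)" for i
    by (rule frame_vector_close[OF fr(1) w integral_isometry_of_int_matrix[OF B] of_int_matrix_column[OF B] fr(2)])
  have "w $ i \<noteq> w $ j \<and> v (w $ i - w $ j) = 0" if "i \<noteq> j" for i j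
  proof -
    have "vge \<rho> ((w $ i - ?\<omega> $ i) - (w $ j - ?\<omega> $ j))" by (intro vge_diff close)
    then have "vge \<rho> ((w $ i - w $ j) - of_rat (B $ i $ row_of 0 - B $ j $ row_of 0))"
      by (simp add: of_rat_diff algebra_simps)
    then show ?thesis
      using rval_eq_if_close[of "of_rat (B $ i $ row_of 0 - B $ j $ row_of 0)" \<rho> "w $ i - w $ j"]
        distinct[OF that] \<rho>0 by (simp add: rval_of_rat del: of_rat_diff)
  qed
  with fr(1) w show ?thesis by blast
qed

end

section \<open>Points over a vertex\<close>

text \<open>\<open>k0\<close> is the equation with three minimal terms. Setting \<open>p k0\<close>
  and \<open>q k0\<close> to two of them lets the leading matrix of the edge case be reused: the
  parameter row is \<open>u1 - u2\<close> and the row of \<open>k0\<close> is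
  \<open>u2 - u3\<close>.\<close>

locale vertex_setup = torus_curve val X f n idx i0
  for val :: "'k::{alg_closed_field, field_char_0} \<Rightarrow> ereal"
    and X :: "('k ^ 'n::finite) set" and f n idx i0 +
  fixes \<alpha> :: "real ^ 'n" and k0 :: nat and u1 u2 u3 :: "int ^ 'n" and p q :: "nat \<Rightarrow> int ^ 'n"
    and B :: "rat ^ 'n ^ 'n" and \<rho> :: real
  assumes k0: "k0 \<in> {1..<n}" and M0: "M k0 \<alpha> = {u1, u2, u3}"
    and u_distinct: "u1 \<noteq> u2" "u1 \<noteq> u3" "u2 \<noteq> u3"
    and pq0: "p k0 = u2" "q k0 = u3"
    and Mk: "\<And>k. k \<in> {1..<n} \<Longrightarrow> k \<noteq> k0 \<Longrightarrow> M k \<alpha> = {p k, q k} \<and> p k \<noteq> q k"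
    and B: "B ** of_int_matrix (lead_matrix (\<lambda>k. p k - q k) (u1 - u2)) = mat 1"
    and \<rho>: "gap \<alpha> \<rho>"
begin

abbreviation "r \<equiv> u1 - u2"
abbreviation "A \<equiv> lead_matrix (\<lambda>k. p k - q k) r"

definition "T1 P = coeff_term k0 P u1"
definition "T2 P = coeff_term k0 P u2"
definition "T3 P = coeff_term k0 P u3"

text \<open>The equation forces \<open>T1 + T2\<close> close to \<open>- T3\<close>, of the same
  valuation as each term; hence \<open>\<theta>\<close> and \<open>1 - \<theta>\<close> are units.
  Dividing by \<open>T1 + T2\<close> instead of a single term makes the leading matrix affine in
  \<open>\<theta>\<close>.\<close>

definition "\<theta> P = T1 P / (T1 P + T2 P)"

definition "\<tau> P k = (if k = k0 then T1 P + T2 P else coeff_term k P (p k))"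

text \<open>Dual vectors: \<open>om1\<close> pairs to 1 with \<open>u1 - u2\<close>,
  \<open>om2\<close> to 1 with \<open>u2 - u3\<close>, and both pair to 0 with the other
  rows.\<close>

definition om1 :: "'n \<Rightarrow> rat" where "om1 i = B $ i $ row_of 0"
definition om2 :: "'n \<Rightarrow> rat" where "om2 i = B $ i $ row_of k0"

definition "a i j = om1 i - om1 j"
definition "b i j = om2 i - om2 j"

definition "good P \<longleftrightarrow> P \<in> X \<and> over \<alpha> P"

definition "approx P \<longleftrightarrow> over \<alpha> P \<and>
  (\<forall>k\<in>{1..<n}. vge \<rho> (\<Sum>u\<in>supp k. coeff_term k P u / coeff_term k P (p k)))"

text \<open>The row of \<open>k0\<close> is \<open>t * u1 + (1 - t) * u2 - u3\<close>, written as
  \<open>u2 - u3\<close> plus \<open>t\<close> times the parameter row, so that \<open>R t\<close>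
  comes from \<open>A\<close> by one row operation.\<close>

definition R :: "'k \<Rightarrow> 'k ^ 'n ^ 'n" where
  "R t = (\<chi> l i. of_int (A $ l $ i) + (if l = row_of k0 then t * of_int (r $ i) else 0))"

lemma \<rho>_pos: "\<rho> > 0"
  using \<rho> by (simp add: gap_def)

lemma r_lattice: "r \<in> char_lattice"
  using M_lattice[OF k0, of u1 \<alpha>] M_lattice[OF k0, of u2 \<alpha>] M0
  by (simp add: char_lattice_def sum_subtractf)

lemma row_neq: "row_of k0 \<noteq> row_of 0" "row_of k0 \<noteq> row_of n"
  using k0 idx_row[of k0] idx_row[of 0] idx_row[of n] by auto

lemma pq_M: "k \<in> {1..<n} \<Longrightarrow> p k \<in> M k \<alpha> \<and> q k \<in> M k \<alpha>"
  using Mk M0 pq0 by (cases "k = k0") auto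

lemma goodD: "good P \<Longrightarrow> P \<in> X" "good P \<Longrightarrow> over \<alpha> P" "good P \<Longrightarrow> P \<in> torus"
  by (auto simp: good_def over_def)

lemma good_approx: "good P \<Longrightarrow> approx P"
  unfolding approx_def using goodD[of P] by (auto simp: approx_on_curve)

lemma T_nonzero:
  assumes "over \<alpha> P"
  shows "T1 P \<noteq> 0" "T2 P \<noteq> 0" "T3 P \<noteq> 0" "v (T1 P) = v (T2 P)" "v (T3 P) = v (T2 P)"
proof -
  have u: "u1 \<in> M k0 \<alpha>" "u2 \<in> M k0 \<alpha>" "u3 \<in> M k0 \<alpha>" using M0 by auto
  show "T1 P \<noteq> 0" "T2 P \<noteq> 0" "T3 P \<noteq> 0"
    using coeff_term_nonzero[OF M_supp[OF u(1)]] coeff_term_nonzero[OF M_supp[OF u(2)]]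
      coeff_term_nonzero[OF M_supp[OF u(3)]] assms
    by (auto simp: T1_def T2_def T3_def over_def)
  show "v (T1 P) = v (T2 P)" "v (T3 P) = v (T2 P)"
    using rval_coeff_term[OF assms k0 u(1)[THEN M_supp]] rval_coeff_term[OF assms k0 u(2)[THEN M_supp]]
      rval_coeff_term[OF assms k0 u(3)[THEN M_supp]] M_eq[OF u(1,2)] M_eq[OF u(3,2)]
    by (simp_all add: T1_def T2_def T3_def)
qed

text \<open>Divided by \<open>T2\<close>, the three minimal terms sum to 0 up to
  \<open>\<rho>\<close>; so \<open>(T1 + T2) / T2\<close> is close to the unit
  \<open>- T3 / T2\<close>.\<close>

lemma approx_sum_T:
  assumes P: "approx P"
  shows "T1 P + T2 P \<noteq> 0" and "v (T1 P + T2 P) = v (T2 P)"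
proof -
  have ov: "over \<alpha> P" and ap: "vge \<rho> (\<Sum>u\<in>supp k0. coeff_term k0 P u / coeff_term k0 P (p k0))"
    using P k0 by (auto simp: approx_def)
  note T = T_nonzero[OF ov]
  have ms: "min_scaled \<alpha> (\<lambda>k. coeff_term k P (p k))"
    by (rule min_scaled_coeff_term[OF ov]) (use pq_M in blast)
  have "(\<Sum>u\<in>M k0 \<alpha>. coeff_term k0 P u / coeff_term k0 P (p k0)) = (T1 P + T2 P + T3 P) / T2 P"
    unfolding M0 using u_distinct by (simp add: T1_def T2_def T3_def pq0 add_divide_distrib)
  then have "vge \<rho> ((T1 P + T2 P + T3 P) / T2 P)"
    using vge_diff[OF ap leading_sum[OF ov ms \<rho> k0, of "\<lambda>_. 1"]] by simp
  then have "vge \<rho> ((T1 P + T2 P) / T2 P - (- T3 P / T2 P))"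
    using T by (simp add: add_divide_distrib)
  moreover have "- T3 P / T2 P \<noteq> 0" "v (- T3 P / T2 P) = 0"
    using T by (auto simp: rval_divide)
  ultimately have "(T1 P + T2 P) / T2 P \<noteq> 0" "v ((T1 P + T2 P) / T2 P) = 0"
    using rval_eq_if_close[of "- T3 P / T2 P" \<rho> "(T1 P + T2 P) / T2 P"] \<rho>_pos by auto
  then show "T1 P + T2 P \<noteq> 0" "v (T1 P + T2 P) = v (T2 P)"
    using T by (auto simp: rval_divide)
qed

lemma theta_unit:
  assumes P: "approx P"
  shows "\<theta> P \<noteq> 0" "v (\<theta> P) = 0" "1 - \<theta> P \<noteq> 0" "v (1 - \<theta> P) = 0" "1 - \<theta> P = T2 P / (T1 P + T2 P)"
    "T1 P / T2 P = \<theta> P / (1 - \<theta> P)"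
proof -
  have ov: "over \<alpha> P" using P by (simp add: approx_def)
  note T = T_nonzero[OF ov] approx_sum_T[OF P]
  show eq: "1 - \<theta> P = T2 P / (T1 P + T2 P)" using T by (simp add: \<theta>_def field_simps)
  show "\<theta> P \<noteq> 0" "v (\<theta> P) = 0" using T by (auto simp: \<theta>_def rval_divide)
  show "1 - \<theta> P \<noteq> 0" "v (1 - \<theta> P) = 0" using T by (auto simp: eq rval_divide)
  show "T1 P / T2 P = \<theta> P / (1 - \<theta> P)" using T unfolding eq by (simp add: \<theta>_def)
qed

lemma tau_min_scaled:
  assumes P: "approx P"
  shows "min_scaled \<alpha> (\<tau> P)"
proof -
  have ov: "over \<alpha> P" using P by (simp add: approx_def)
  have ms: "min_scaled \<alpha> (\<lambda>k. coeff_term k P (p k))"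
    by (rule min_scaled_coeff_term[OF ov]) (use pq_M in blast)
  then have "\<exists>u\<in>M k0 \<alpha>. v (T2 P) = tval k0 \<alpha> u"
    using k0 pq0(1) unfolding min_scaled_def T2_def by metis
  then have "\<tau> P k0 \<noteq> 0 \<and> (\<exists>u\<in>M k0 \<alpha>. v (\<tau> P k0) = tval k0 \<alpha> u)"
    using approx_sum_T[OF P] by (simp add: \<tau>_def)
  with ms show ?thesis by (auto simp: min_scaled_def \<tau>_def)
qed

lemma tau_ratio:
  assumes P: "approx P" and k: "k \<in> {1..<n}"
  shows "coeff_term k P (p k) / \<tau> P k = (if k = k0 then 1 - \<theta> P else 1)"
proof -
  have "over \<alpha> P" using P by (simp add: approx_def)
  moreover have "p k \<in> supp k" using pq_M[OF k] M_supp by blast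
  ultimately have "coeff_term k P (p k) \<noteq> 0" by (intro coeff_term_nonzero) (auto simp: over_def)
  then show ?thesis using theta_unit(5)[OF P] by (simp add: \<tau>_def pq0 T2_def)
qed

lemma tau_approx:
  assumes P: "approx P" and k: "k \<in> {1..<n}"
  shows "vge \<rho> (\<Sum>u\<in>supp k. coeff_term k P u / \<tau> P k)"
proof -
  have ov: "over \<alpha> P" using P by (simp add: approx_def)
  have "p k \<in> supp k" using pq_M[OF k] M_supp by blast
  then have c: "coeff_term k P (p k) \<noteq> 0" using ov by (intro coeff_term_nonzero) (auto simp: over_def)
  have "(\<Sum>u\<in>supp k. coeff_term k P u / \<tau> P k) =
      (coeff_term k P (p k) / \<tau> P k) * (\<Sum>u\<in>supp k. coeff_term k P u / coeff_term k P (p k))"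
    using c by (simp add: sum_distrib_left)
  moreover have "vge 0 (coeff_term k P (p k) / \<tau> P k)"
    unfolding tau_ratio[OF P k] using theta_unit[OF P] by (simp add: vge_iff)
  moreover have "vge \<rho> (\<Sum>u\<in>supp k. coeff_term k P u / coeff_term k P (p k))"
    using P k by (simp add: approx_def)
  ultimately show ?thesis by (simp only: vge_mult_left)
qed

lemma R_mult:
  "(R t *v x) $ l = (of_int_matrix A *v x) $ l + (if l = row_of k0 then t * (of_int_matrix A *v x) $ row_of 0 else 0)"
proof -
  have "A $ row_of 0 = r" by (simp add: lead_matrix_row)
  then show ?thesis
    by (simp add: R_def matrix_vector_mult_def of_int_matrix_def distrib_right sum.distrib sum_distrib_left mult.assoc)
qed

text \<open>An integral row operation applied to the isometry \<open>A\<close> can be undone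
  integrally.\<close>

lemma R_isometry:
  assumes "vge 0 t"
  shows "integral_isometry (R t)"
  unfolding integral_isometry_def
proof (intro conjI allI impI)
  show "vge 0 (R t $ l $ i)" for l i
    unfolding R_def using assms by (auto intro!: vge_add vge_mult_left vge_diff)
  fix s and x :: "'k ^ 'n" and i
  assume x: "\<forall>l. vge s ((R t *v x) $ l)"
  have 0: "vge s ((of_int_matrix A *v x) $ row_of 0)"
    using x[rule_format, of "row_of 0"] row_neq by (simp add: R_mult)
  have "vge s ((of_int_matrix A *v x) $ l)" for l
  proof (cases "l = row_of k0")
    case True
    have "vge s ((of_int_matrix A *v x) $ l + t * (of_int_matrix A *v x) $ row_of 0)"
      using x[rule_format, of l] True by (simp add: R_mult)
    from vge_diff[OF this vge_mult_left[OF assms 0]] show ?thesis by simp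
  next
    case False
    then show ?thesis using x[rule_format, of l] by (simp add: R_mult)
  qed
  then show "vge s (x $ i)"
    by (rule integral_isometryD(2)[OF integral_isometry_of_int_matrix[OF B]])
qed

text \<open>After scaling by \<open>T1 + T2\<close>, the exponents \<open>u1\<close> and
  \<open>u2\<close> have weights \<open>\<theta>\<close> and \<open>1 - \<theta>\<close>, while
  \<open>u3\<close> is the base point and contributes nothing.\<close>

lemma vertex_frame:
  assumes P: "approx P"
  shows "integral_frame (\<tau> P) r P"
    and "vge \<rho> (log_matrix (\<tau> P) r P $ l $ i - R (\<theta> P) $ l $ i)"
proof -
  have ov: "over \<alpha> P" using P by (simp add: approx_def)
  note T = T_nonzero[OF ov] approx_sum_T[OF P]
  have "R (\<theta> P) $ row_of k $ i = (\<Sum>u\<in>M k \<alpha>. coeff_term k P u / \<tau> P k * of_int (u $ i - q k $ i))"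
    if k: "k \<in> {1..<n}" for k i
  proof (cases "k = k0")
    case True
    have "(\<Sum>u\<in>M k \<alpha>. coeff_term k P u / \<tau> P k * of_int (u $ i - q k $ i)) =
        \<theta> P * of_int (u1 $ i - u3 $ i) + (1 - \<theta> P) * of_int (u2 $ i - u3 $ i)"
      unfolding True M0 theta_unit(5)[OF P] using u_distinct
      by (simp add: \<tau>_def \<theta>_def pq0 T1_def T2_def)
    also have "\<dots> = R (\<theta> P) $ row_of k $ i"
      using k True by (simp add: R_def lead_matrix_row pq0 algebra_simps)
    finally show ?thesis by simp
  next
    case False
    then have "row_of k \<noteq> row_of k0" using k k0 idx_row[of k] idx_row[of k0] by auto
    moreover have "coeff_term k P (p k) \<noteq> 0"
      using bspec[OF tau_min_scaled[OF P, unfolded min_scaled_def] k] False by (simp add: \<tau>_def)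
    ultimately show ?thesis using Mk[OF k False] False k by (simp add: R_def lead_matrix_row \<tau>_def)
  qed
  moreover have "R (\<theta> P) $ row_of 0 $ i = of_int (r $ i)" "R (\<theta> P) $ row_of n $ i = (if i = i0 then 1 else 0)" for i
    using row_neq by (auto simp: R_def lead_matrix_row axis_def)
  moreover have "integral_isometry (R (\<theta> P))"
    using theta_unit[OF P] by (intro R_isometry) (simp add: vge_iff)
  ultimately show "integral_frame (\<tau> P) r P"
    and "vge \<rho> (log_matrix (\<tau> P) r P $ l $ i - R (\<theta> P) $ l $ i)"
    using leading_frame[OF ov tau_min_scaled[OF P] \<rho> r_lattice tau_approx[OF P]] by blast+
qed

definition "frame_vec P w \<longleftrightarrow> log_matrix (\<tau> P) r P *v w = axis (row_of 0) 1"

lemma ex_frame_vec: "good P \<Longrightarrow> \<exists>w. frame_vec P w"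
  unfolding frame_vec_def by (rule ex_frame_vector[OF vertex_frame(1)[OF good_approx]])

definition \<omega>1 :: "'k ^ 'n" where "\<omega>1 = (\<chi> i. of_rat (om1 i))"
definition \<omega>2 :: "'k ^ 'n" where "\<omega>2 = (\<chi> i. of_rat (om2 i))"

lemma A_omega: "of_int_matrix A *v \<omega>1 = axis (row_of 0) 1" "of_int_matrix A *v \<omega>2 = axis (row_of k0) 1"
  unfolding \<omega>1_def \<omega>2_def om1_def om2_def by (rule of_int_matrix_column[OF B])+

text \<open>\<open>A\<close> sends the vector to the unit vector of row 0 minus \<open>t\<close>
  times that of row \<open>k0\<close>; the row operation in \<open>R t\<close> cancels the second
  part.\<close>

lemma R_omega: "R t *v (\<omega>1 - t *s \<omega>2) = axis (row_of 0) 1"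
proof -
  have A: "of_int_matrix A *v (\<omega>1 - t *s \<omega>2) = axis (row_of 0) 1 - t *s axis (row_of k0) 1"
    by (simp add: matrix_vector_mult_diff_distrib vector_scalar_commute A_omega)
  have "(R t *v (\<omega>1 - t *s \<omega>2)) $ l = axis (row_of 0) 1 $ l" for l
    unfolding R_mult A using row_neq by (auto simp: axis_def)
  then show ?thesis by (simp add: vec_eq_iff)
qed

lemma frame_vec_close:
  assumes P: "good P" and w: "frame_vec P w"
  shows "vge \<rho> ((w $ i - w $ j) - (of_rat (a i j) - \<theta> P * of_rat (b i j)))"
proof -
  note ap = good_approx[OF P]
  have "vge 0 (\<theta> P)" using theta_unit[OF ap] by (simp add: vge_iff)
  then have "vge \<rho> (w $ i - (\<omega>1 - \<theta> P *s \<omega>2) $ i)" for i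
    using frame_vector_close[OF vertex_frame(1)[OF ap] _ R_isometry R_omega vertex_frame(2)[OF ap]] w
    by (simp add: frame_vec_def)
  from vge_diff[OF this[of i] this[of j]] show ?thesis
    by (simp add: \<omega>1_def \<omega>2_def a_def b_def of_rat_diff algebra_simps)
qed

lemma log_matrix_on_curve:
  assumes P: "good P" and k: "k \<in> {1..<n}"
  shows "log_matrix (\<tau> P) r P $ row_of k $ i =
    (\<Sum>u\<in>supp k. coeff_term k P u / \<tau> P k * of_int (u $ i - q k $ i))"
proof -
  have "log_matrix (\<tau> P) r P $ row_of k $ i = (\<Sum>u\<in>supp k. coeff_term k P u / \<tau> P k * of_int (u $ i))"
    using k by (auto simp: log_matrix_def log_gradient_def sum_divide_distrib idx_row)
  moreover have "(\<Sum>u\<in>supp k. coeff_term k P u / \<tau> P k) * of_int (q k $ i) = 0"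
    by (simp add: approx_on_curve[OF goodD(1)[OF P] goodD(3)[OF P] k])
  ultimately show ?thesis
    by (simp add: right_diff_distrib sum_subtractf sum_distrib_right)
qed

text \<open>\<open>frame_vec_close\<close> knows \<open>w_i - w_j\<close> only up to valuation
  \<open>\<rho>\<close>, too coarse to prescribe larger valuations. Here the increment is known
  relatively: when \<open>\<theta>\<close> changes by an amount of valuation at least
  \<open>\<nu>\<close>, the difference changes with slope \<open>- b i j\<close> up to valuation
  \<open>\<nu> + \<rho>\<close>.\<close>

lemma vertex_move:
  assumes P: "good P" and \<nu>: "\<nu> > 0" and t: "vge \<nu> (t - \<theta> P)"
  shows "\<exists>P'. good P' \<and> \<theta> P' = t \<and> (\<forall>w w' i j. frame_vec P w \<longrightarrow> frame_vec P' w' \<longrightarrow>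
    vge (\<nu> + \<rho>) ((w' $ i - w' $ j) - (w $ i - w $ j) + (t - \<theta> P) * of_rat (b i j)))"
proof -
  note ap = good_approx[OF P]
  note ov = goodD(2)[OF P]
  note \<theta> = theta_unit[OF ap]
  note T = T_nonzero[OF ov]
  have t0: "t \<noteq> 0" "v t = 0" using rval_eq_if_close[OF \<theta>(1) t] \<theta>(2) \<nu> by auto
  have t1: "1 - t \<noteq> 0" "v (1 - t) = 0"
    using rval_eq_if_close[OF \<theta>(3), of \<nu> "1 - t"] t \<theta>(4) \<nu> by (auto simp: vge_diff_commute)
  \<comment> \<open>Chosen so that the factor \<open>1 + e\<close> takes \<open>T1 / T2\<close> from
    \<open>\<theta> / (1 - \<theta>)\<close> to \<open>t / (1 - t)\<close>.\<close>
  define e where "e = (t - \<theta> P) / (\<theta> P * (1 - t))"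
  have "v (\<theta> P * (1 - t)) = 0" using \<theta> t1 by (simp add: rval_mult)
  then have e: "vge \<nu> e" unfolding e_def using t \<theta> t1 by (subst vge_divide_unit) auto
  have se: "\<theta> P / (1 - \<theta> P) * (1 + e) = t / (1 - t)"
    using \<theta>(1,3) t1(1) unfolding e_def by (simp add: divide_simps) (simp add: algebra_simps)
  obtain z where z: "\<forall>i. vge \<nu> (z $ i)" "vmult P (one_plus z) \<in> X" "laurent_monomial (one_plus z) r = 1 + e"
    using move[OF vertex_frame(1)[OF ap] \<nu> e] approx_on_curve[OF goodD(1)[OF P] goodD(3)[OF P]] by auto
  define P' where "P' = vmult P (one_plus z)"
  have tor: "one_plus z \<in> torus" by (rule one_plus_torus[OF z(1) \<nu>])
  have P': "good P'" using z(2) over_vmult[OF ov z(1) \<nu>] by (simp add: good_def P'_def)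
  note ap' = good_approx[OF P']
  note T' = T_nonzero[OF goodD(2)[OF P']]
  have "T1 P' / T2 P' = T1 P / T2 P * (1 + e)"
    unfolding z(3)[symmetric] laurent_monomial_diff[OF tor]
    by (simp add: P'_def T1_def T2_def coeff_term_vmult)
  then have "\<theta> P' / (1 - \<theta> P') = t / (1 - t)"
    using se theta_unit(6)[OF ap'] \<theta>(6) by simp
  then have \<theta>': "\<theta> P' = t"
    using theta_unit(3)[OF ap'] t1(1) by (simp add: divide_simps) (simp add: algebra_simps)
  have lm: "vge \<nu> (laurent_monomial (one_plus z) u - 1)" for u
    by (rule unit_expansion_near_1[OF unit_expansion_laurent_monomial[OF \<nu>] z(1)])
  let ?L = "log_matrix (\<tau> P) r P" and ?L' = "log_matrix (\<tau> P') r P'"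
  \<comment> \<open>The matrix changes as its leading part does, up to
    \<open>\<nu> + \<rho>\<close>. Minimal terms change exactly as in \<open>R\<close>; each other
    term has valuation at least \<open>\<rho>\<close> and undergoes a relative change of valuation
    at least \<open>\<nu>\<close>.\<close>
  have diff: "vge (\<nu> + \<rho>) (?L' $ l $ i - ?L $ l $ i - (R t $ l $ i - R (\<theta> P) $ l $ i))" for l i
  proof (cases l rule: idx_cases)
    case 1
    then have "l \<noteq> row_of k0" using k0 idx_row[of k0] by auto
    then show ?thesis using 1 by (simp add: log_matrix_def R_def)
  next
    case 2
    then have "l \<noteq> row_of k0" using k0 idx_row[of k0] by auto
    then show ?thesis using 2 n1 by (simp add: log_matrix_def R_def)
  next
    case 3
    define k where "k = idx l"
    have k: "k \<in> {1..<n}" and l: "l = row_of k" using 3 by (auto simp: k_def)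
    define \<sigma> where "\<sigma> = (\<lambda>P. if k = k0 then 1 - \<theta> P else 1)"
    have pk: "p k \<in> supp k" using pq_M[OF k] M_supp by blast
    have c: "coeff_term k P (p k) \<noteq> 0" "coeff_term k P' (p k) \<noteq> 0"
      using coeff_term_nonzero[OF pk] goodD(3)[OF P] goodD(3)[OF P'] by auto
    have tu: "coeff_term k P u / \<tau> P k = coeff_term k P u / coeff_term k P (p k) * \<sigma> P" for u
      using c by (simp add: \<sigma>_def flip: tau_ratio[OF ap k])
    have tu': "coeff_term k P' u / \<tau> P' k =
        coeff_term k P u / coeff_term k P (p k) * (laurent_monomial (one_plus z) (u - p k) * \<sigma> P')" for u
    proof -
      have "coeff_term k P' u / \<tau> P' k = coeff_term k P' u / coeff_term k P' (p k) * \<sigma> P'"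
        using c by (simp add: \<sigma>_def flip: tau_ratio[OF ap' k])
      then show ?thesis
        by (simp add: P'_def coeff_term_vmult laurent_monomial_diff[OF tor])
    qed
    define D where "D = (\<lambda>u. coeff_term k P' u / \<tau> P' k - coeff_term k P u / \<tau> P k)"
    have D: "D u = coeff_term k P u / coeff_term k P (p k) *
        ((laurent_monomial (one_plus z) (u - p k) - 1) * \<sigma> P' + (\<sigma> P' - \<sigma> P))" for u
      unfolding D_def tu tu' by (simp add: algebra_simps)
    have ms: "min_scaled \<alpha> (\<lambda>k. coeff_term k P (p k))"
      by (rule min_scaled_coeff_term[OF ov]) (use pq_M in blast)
    have "vge \<nu> (\<sigma> P' - \<sigma> P)" using t by (auto simp: \<sigma>_def \<theta>' vge_diff_commute)
    moreover have "vge 0 (\<sigma> P')" using t1 by (auto simp: \<sigma>_def \<theta>' vge_iff)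
    ultimately have small: "vge (\<nu> + \<rho>) (D u)" if "u \<in> supp k" "u \<notin> M k \<alpha>" for u
      unfolding D add.commute[of \<nu>]
      by (intro vge_mult vge_add vge_mult_right lm min_scaled_terms(2)[OF ov ms k that(1) \<rho> that(2)])
    have Msub: "M k \<alpha> \<subseteq> supp k" by (auto simp: min_terms_def)
    have "?L' $ l $ i - ?L $ l $ i = (\<Sum>u\<in>supp k. D u * of_int (u $ i - q k $ i))"
      unfolding l log_matrix_on_curve[OF P' k] log_matrix_on_curve[OF P k] D_def
      by (simp add: left_diff_distrib sum_subtractf)
    also have "\<dots> = (\<Sum>u\<in>supp k - M k \<alpha>. D u * of_int (u $ i - q k $ i)) +
        (\<Sum>u\<in>M k \<alpha>. D u * of_int (u $ i - q k $ i))"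
      by (rule sum.subset_diff[OF Msub]) simp
    also have "(\<Sum>u\<in>M k \<alpha>. D u * of_int (u $ i - q k $ i)) = R t $ l $ i - R (\<theta> P) $ l $ i"
    proof (cases "k = k0")
      case True
      have "D u1 = \<theta> P' - \<theta> P" using True by (simp add: D_def \<tau>_def \<theta>_def T1_def)
      moreover have "D u2 = (1 - \<theta> P') - (1 - \<theta> P)"
        unfolding theta_unit(5)[OF ap] theta_unit(5)[OF ap'] using True
        by (simp add: D_def \<tau>_def T2_def)
      ultimately have D12: "D u1 = t - \<theta> P" "D u2 = - (t - \<theta> P)" by (simp_all add: \<theta>')
      have "(\<Sum>u\<in>M k \<alpha>. D u * of_int (u $ i - q k $ i)) =
          D u1 * of_int (u1 $ i - u3 $ i) + D u2 * of_int (u2 $ i - u3 $ i)"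
        unfolding True M0 using u_distinct by (simp add: pq0)
      also have "\<dots> = (t - \<theta> P) * of_int (r $ i)"
        unfolding D12 by (simp add: algebra_simps)
      finally have "(\<Sum>u\<in>M k \<alpha>. D u * of_int (u $ i - q k $ i)) = (t - \<theta> P) * of_int (r $ i)" .
      then show ?thesis using True by (simp add: R_def l algebra_simps)
    next
      case False
      then have "row_of k \<noteq> row_of k0" using k k0 idx_row[of k] idx_row[of k0] by auto
      moreover have "D (p k) = 0" using False by (simp add: D \<sigma>_def)
      ultimately show ?thesis using Mk[OF k False] by (simp add: R_def l)
    qed
    finally have "?L' $ l $ i - ?L $ l $ i - (R t $ l $ i - R (\<theta> P) $ l $ i) =
      (\<Sum>u\<in>supp k - M k \<alpha>. D u * of_int (u $ i - q k $ i))" by simp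
    then show ?thesis using small by (auto intro!: vge_sum vge_mult_right vge_diff[of 0])
  qed
  have "vge (\<nu> + \<rho>) ((w' $ i - w' $ j) - (w $ i - w $ j) + (t - \<theta> P) * of_rat (b i j))"
    if w: "frame_vec P w" "frame_vec P' w'" for w w' i j
  proof -
    note fr = vertex_frame[OF ap] and fr' = vertex_frame[OF ap']
    have isom: "integral_isometry ?L" "integral_isometry ?L'"
      using fr(1) fr'(1) by (auto simp: integral_frame_def)
    have Lw: "?L *v w = axis (row_of 0) 1" "?L' *v w' = axis (row_of 0) 1"
      using w by (auto simp: frame_vec_def)
    have "vge 0 ((?L' *v w') $ l)" for l by (simp add: Lw axis_def)
    then have w'0: "vge 0 (w' $ i)" for i by (rule integral_isometryD(2)[OF isom(2)])
    have rw': "(\<Sum>i\<in>UNIV. of_int (r $ i) * w' $ i) = 1"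
      by (rule log_gradient_frame_vector(2)[OF fr'(1) Lw(2)])
    have Rdiff: "((R t - R (\<theta> P)) *v w') $ l = (t - \<theta> P) * (axis (row_of k0) 1 :: 'k ^ 'n) $ l" for l
    proof -
      have "((R t - R (\<theta> P)) *v w') $ l =
          (if l = row_of k0 then (t - \<theta> P) * (\<Sum>i\<in>UNIV. of_int (r $ i) * w' $ i) else 0)"
        by (simp add: matrix_vector_mult_def R_def sum_distrib_left algebra_simps)
      then show ?thesis unfolding rw' by (simp add: axis_def)
    qed
    \<comment> \<open>Deviation from the predicted increment
      \<open>- (t - \<theta> P) *s \<omega>2\<close>. Its image under \<open>?L\<close> is shown to
      be small; the unit vectors hit by \<open>w\<close> and \<open>w'\<close> cancel there.\<close>
    let ?x = "w' - w + (t - \<theta> P) *s \<omega>2"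
    have R2: "R (\<theta> P) *v \<omega>2 = axis (row_of k0) 1"
      using row_neq by (auto simp: vec_eq_iff R_mult A_omega axis_def)
    have "vge (\<nu> + \<rho>) ((?L *v ?x) $ l)" for l
    proof -
      let ?E = "?L' - ?L - (R t - R (\<theta> P))"
      have "?L *v ?x = (t - \<theta> P) *s ((?L - R (\<theta> P)) *v \<omega>2) - ?E *v w'"
      proof -
        have "?L *v ?x = ?L *v w' - axis (row_of 0) 1 + (t - \<theta> P) *s (?L *v \<omega>2)"
          by (simp add: matrix_vector_right_distrib matrix_vector_mult_diff_distrib vector_scalar_commute Lw)
        also have "?L *v w' = axis (row_of 0) 1 - (R t - R (\<theta> P)) *v w' - ?E *v w'"
          by (simp add: matrix_vector_mult_diff_rdistrib Lw)
        also have "(R t - R (\<theta> P)) *v w' = (t - \<theta> P) *s (R (\<theta> P) *v \<omega>2)"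
          using Rdiff by (simp only: vec_eq_iff R2 vector_smult_component simp_thms)
        also have "axis (row_of 0) 1 - (t - \<theta> P) *s (R (\<theta> P) *v \<omega>2) - ?E *v w' - axis (row_of 0) 1
            + (t - \<theta> P) *s (?L *v \<omega>2) = (t - \<theta> P) *s ((?L - R (\<theta> P)) *v \<omega>2) - ?E *v w'"
          by (simp add: matrix_vector_mult_diff_rdistrib[of ?L "R (\<theta> P)"] vec_eq_iff algebra_simps)
        finally show ?thesis .
      qed
      then have "(?L *v ?x) $ l = (t - \<theta> P) * ((?L - R (\<theta> P)) *v \<omega>2) $ l - (?E *v w') $ l"
        by (simp only: vector_minus_component vector_smult_component)
      moreover have "vge (\<rho> + 0) (((?L - R (\<theta> P)) *v \<omega>2) $ l)"
        by (rule vge_matrix_vector) (use fr(2) in \<open>simp_all add: \<omega>2_def\<close>)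
      then have "vge (\<nu> + \<rho>) ((t - \<theta> P) * ((?L - R (\<theta> P)) *v \<omega>2) $ l)"
        by (intro vge_mult t) simp
      moreover have "vge (\<nu> + \<rho> + 0) ((?E *v w') $ l)"
        by (rule vge_matrix_vector) (use diff w'0 in simp_all)
      ultimately show ?thesis by (simp add: vge_diff)
    qed
    then have x: "vge (\<nu> + \<rho>) (?x $ i)" for i by (rule integral_isometryD(2)[OF isom(1)])
    from vge_diff[OF x[of i] x[of j]] show ?thesis
      by (simp add: \<omega>2_def b_def of_rat_diff algebra_simps)
  qed
  with P' \<theta>' show ?thesis by blast
qed

text \<open>The ratios \<open>T1 / T2 = s\<close> and \<open>T2 / T3 = - 1 / (1 + s)\<close> make
  the three minimal terms sum to 0. The values 0 and 1 of \<open>t\<close> would make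
  \<open>s\<close> zero or undefined. Correcting the point by \<open>lift\<close> preserves the
  monomial \<open>r\<close>, hence \<open>T1 / T2\<close> and \<open>\<theta>\<close>.\<close>

lemma vertex_lift:
  assumes "t \<noteq> 0" and "t \<noteq> 1"
  shows "\<exists>P. good P \<and> \<theta> P = of_rat t"
proof -
  define s where "s = (of_rat (t / (1 - t)) :: 'k)"
  have s: "s \<noteq> 0" "v s = 0" using assms by (auto simp: s_def rval_of_rat)
  have s1: "1 + s = of_rat (1 / (1 - t))"
  proof -
    have "1 + t / (1 - t) = 1 / (1 - t)" using assms by (simp add: field_simps)
    then show ?thesis unfolding s_def by (metis of_rat_1 of_rat_add)
  qed
  then have s1': "1 + s \<noteq> 0" "v (1 + s) = 0" using assms by (auto simp: rval_of_rat)
  let ?c = "Poly_Mapping.lookup (f k0)"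
  have uM: "u1 \<in> M k0 \<alpha>" "u2 \<in> M k0 \<alpha>" using M0 by auto
  have c0: "?c u1 \<noteq> 0" "?c u2 \<noteq> 0" using uM[THEN M_supp] by (auto simp: in_keys_iff)
  define \<kappa> where "\<kappa> = s * ?c u2 / ?c u1"
  have "v \<kappa> = \<alpha> \<bullet> lattice_vec r"
    using M_eq[OF uM] c0 s
    by (simp add: \<kappa>_def rval_divide rval_mult term_val_def lattice_vec_diff inner_diff_right)
  moreover have "\<kappa> \<noteq> 0" using c0 s by (simp add: \<kappa>_def)
  moreover define \<eta> where "\<eta> = (\<lambda>k. if k = k0 then - 1 / (1 + s) else - 1)"
  have "\<eta> k \<noteq> 0 \<and> v (\<eta> k) = 0" for k using s1' by (auto simp: \<eta>_def rval_divide)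
  ultimately obtain P where P: "over \<alpha> P" "laurent_monomial P r = \<kappa>"
    and ratio: "\<And>k. k \<in> {1..<n} \<Longrightarrow> coeff_term k P (p k) / coeff_term k P (q k) = \<eta> k"
    using lead_point[OF B pq_M r_lattice, of \<kappa> \<eta>] by blast
  note T = T_nonzero[OF P(1)]
  have Pt: "P \<in> torus" using P by (simp add: over_def)
  have "laurent_monomial P u1 / laurent_monomial P u2 = s * ?c u2 / ?c u1"
    using P(2) laurent_monomial_diff[OF Pt, of u1 u2] by (simp add: \<kappa>_def)
  then have T12: "T1 P = s * T2 P"
    using c0 laurent_monomial_nonzero[OF Pt] by (simp add: T1_def T2_def coeff_term_def field_simps)
  have T23: "T2 P / T3 P = - 1 / (1 + s)"
    using ratio[OF k0] by (simp add: T2_def T3_def \<eta>_def pq0)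
  then have "T2 P * (1 + s) = - T3 P" using T s1' by (simp add: field_simps)
  then have "T3 P = - (T2 P * (1 + s))" by simp
  also have "\<dots> = - (s * T2 P) - T2 P" by (simp add: algebra_simps)
  finally have T3: "T3 P = - (s * T2 P) - T2 P" .
  have ms: "min_scaled \<alpha> (\<lambda>k. coeff_term k P (p k))"
    by (rule min_scaled_coeff_term[OF P(1)]) (use pq_M in blast)
  have "approx P"
    unfolding approx_def
  proof (intro conjI ballI P(1))
    fix k assume k: "k \<in> {1..<n}"
    have "coeff_term k P (p k) \<noteq> 0" using bspec[OF ms[unfolded min_scaled_def] k] by simp
    then have "(\<Sum>u\<in>M k \<alpha>. coeff_term k P u / coeff_term k P (p k)) = 0"
    proof (cases "k = k0")
      case True
      have "(\<Sum>u\<in>M k \<alpha>. coeff_term k P u / coeff_term k P (p k)) = (T1 P + T2 P + T3 P) / T2 P"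
        unfolding True M0 using u_distinct by (simp add: T1_def T2_def T3_def pq0 add_divide_distrib)
      then show ?thesis by (simp add: T12 T3)
    next
      case False
      assume c: "coeff_term k P (p k) \<noteq> 0"
      have "coeff_term k P (p k) / coeff_term k P (q k) = - 1" using ratio[OF k] False by (simp add: \<eta>_def)
      then show ?thesis using Mk[OF k False] c by (auto simp: divide_eq_eq split: if_splits)
    qed
    then show "vge \<rho> (\<Sum>u\<in>supp k. coeff_term k P u / coeff_term k P (p k))"
      by (rule approx_if_leading_sum_zero[OF P(1) ms \<rho> k])
  qed
  then obtain P' where P': "over \<alpha> P'" "P' \<in> X" "laurent_monomial P' r = laurent_monomial P r"
    using lift[OF vertex_frame(1) P(1) \<rho>_pos tau_approx] by blast
  then have good: "good P'" by (simp add: good_def)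
  note th = theta_unit[OF good_approx[OF good]] and T' = T_nonzero[OF P'(1)]
  have Pt': "P' \<in> torus" using P' by (simp add: over_def)
  have "laurent_monomial P' u1 / laurent_monomial P' u2 = s * ?c u2 / ?c u1"
    using P'(3) P(2) laurent_monomial_diff[OF Pt', of u1 u2] by (simp add: \<kappa>_def)
  then have "T1 P' / T2 P' = s"
    using c0 laurent_monomial_nonzero[OF Pt'] by (simp add: T1_def T2_def coeff_term_def field_simps)
  then have "\<theta> P' / (1 - \<theta> P') = s" using th(6) by simp
  then have "\<theta> P' = s * (1 - \<theta> P')" using th(3) by (simp add: divide_eq_eq)
  then have "\<theta> P' * (1 + s) = s" by algebra
  then have "\<theta> P' = s / (1 + s)" using s1' by (simp add: field_simps)
  also have "\<dots> = of_rat t"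
    unfolding s1 unfolding s_def using assms by (simp add: of_rat_divide[symmetric])
  finally show ?thesis using good by blast
qed

lemma frame_vec_integral:
  assumes "good P" and "frame_vec P w"
  shows "vge 0 (w $ i - w $ j)"
proof -
  have "integral_isometry (log_matrix (\<tau> P) r P)"
    using vertex_frame(1)[OF good_approx[OF assms(1)]] by (simp add: integral_frame_def)
  moreover have "vge 0 ((log_matrix (\<tau> P) r P *v w) $ l)" for l
    using assms(2) by (simp add: frame_vec_def axis_def)
  ultimately have "vge 0 (w $ i)" for i using integral_isometryD(2) by blast
  then show ?thesis by (intro vge_diff)
qed

text \<open>Newton iteration in \<open>\<theta>\<close> for the equation
  \<open>w_i - w_j = \<delta>\<close>, with slope \<open>- b i j\<close> taken from
  \<open>vertex_move\<close> and a gain of \<open>\<rho>\<close> per step. At the critical value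
  \<open>a / b\<close> the difference is small enough to start; once the error lies beyond
  \<open>v \<delta>\<close>, the valuation is fixed.\<close>

lemma vertex_adjust:
  assumes P: "good P" and bij: "b i j \<noteq> 0" and start: "\<theta> P = of_rat (a i j / b i j)"
    and \<delta>: "\<delta> \<noteq> 0" "v \<delta> > 0"
  shows "\<exists>P'. good P' \<and> (\<forall>w. frame_vec P' w \<longrightarrow> w $ i \<noteq> w $ j \<and> v (w $ i - w $ j) = v \<delta>)"
proof -
  \<comment> \<open>Initial precision: at the starting point both \<open>w_i - w_j\<close> and
    \<open>\<delta>\<close> have at least this valuation.\<close>
  define \<mu> where "\<mu> = min \<rho> (v \<delta>)"
  have \<mu>: "\<mu> > 0" "\<mu> \<le> \<rho>" "\<mu> \<le> v \<delta>" using \<rho>_pos \<delta> by (auto simp: \<mu>_def)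
  have "\<exists>P'. good P' \<and> (\<forall>w. frame_vec P' w \<longrightarrow> vge (\<mu> + real m * \<rho>) (w $ i - w $ j - \<delta>))" for m
  proof (induction m)
    case 0
    have "vge \<mu> (w $ i - w $ j - \<delta>)" if w: "frame_vec P w" for w
    proof -
      have "of_rat (a i j) - \<theta> P * of_rat (b i j) = 0"
        unfolding start using bij by (simp add: of_rat_divide)
      then have "vge \<rho> (w $ i - w $ j)" using frame_vec_close[OF P w, of i j] by simp
      then have "vge \<mu> (w $ i - w $ j)" using \<mu>(2) by (rule vge_mono)
      moreover have "vge \<mu> \<delta>" using \<mu> \<delta> by (simp add: vge_iff)
      ultimately show ?thesis by (rule vge_diff)
    qed
    then show ?case using P by auto
  next
    case (Suc m)
    then obtain Q where Q: "good Q"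
      and small: "\<And>w. frame_vec Q w \<Longrightarrow> vge (\<mu> + real m * \<rho>) (w $ i - w $ j - \<delta>)" by blast
    obtain w where w: "frame_vec Q w" using ex_frame_vec[OF Q] by blast
    let ?\<nu> = "\<mu> + real m * \<rho>"
    have \<nu>: "?\<nu> > 0" using \<mu> \<rho>_pos by (simp add: add_pos_nonneg)
    define t where "t = \<theta> Q + (w $ i - w $ j - \<delta>) / of_rat (b i j)"
    have bn: "(of_rat (b i j) :: 'k) \<noteq> 0" using bij by simp
    have "vge ?\<nu> (t - \<theta> Q)"
      unfolding t_def using small[OF w] vge_divide_unit[OF bn rval_of_rat] by simp
    then obtain Q' where Q': "good Q'" and diff: "\<And>w'. frame_vec Q' w' \<Longrightarrow>
        vge (?\<nu> + \<rho>) ((w' $ i - w' $ j) - (w $ i - w $ j) + (t - \<theta> Q) * of_rat (b i j))"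
      using vertex_move[OF Q \<nu>, of t] w by blast
    have tb: "(t - \<theta> Q) * of_rat (b i j) = w $ i - w $ j - \<delta>" unfolding t_def using bn by simp
    have "vge (\<mu> + real (Suc m) * \<rho>) (w' $ i - w' $ j - \<delta>)" if "frame_vec Q' w'" for w'
      using diff[OF that] unfolding tb by (simp add: algebra_simps)
    then show ?case using Q' by blast
  qed
  moreover obtain m :: nat where m: "v \<delta> < real m * \<rho>" using reals_Archimedean3[OF \<rho>_pos] by blast
  ultimately obtain P' where P': "good P'"
    "\<And>w. frame_vec P' w \<Longrightarrow> vge (\<mu> + real m * \<rho>) (w $ i - w $ j - \<delta>)" by blast
  have lt: "v \<delta> < \<mu> + real m * \<rho>" using m \<mu> by simp
  have "w $ i \<noteq> w $ j \<and> v (w $ i - w $ j) = v \<delta>" if "frame_vec P' w" for w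
    using rval_eq_if_close[OF \<delta>(1) P'(2)[OF that] lt] by simp
  then show ?thesis using P'(1) by blast
qed

text \<open>A small difference makes \<open>\<theta>\<close> congruent to \<open>a / b\<close>. As
  \<open>\<theta>\<close> and \<open>1 - \<theta>\<close> are units, \<open>a / b\<close> is neither
  0 nor 1; and if \<open>b\<close> were 0, then \<open>a\<close> would be a nonzero rational of
  positive valuation.\<close>

lemma small_difference:
  assumes P: "good P" and w: "frame_vec P w" and small: "vge \<mu> (w $ i - w $ j)" "\<mu> > 0"
    and ab: "a i j \<noteq> 0 \<or> b i j \<noteq> 0"
  shows "b i j \<noteq> 0" and "\<exists>\<mu>'>0. vge \<mu>' (\<theta> P - of_rat (a i j / b i j))"
    and "a i j \<noteq> 0" and "a i j \<noteq> b i j"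
proof -
  define \<mu>' where "\<mu>' = min \<mu> \<rho>"
  have \<mu>': "\<mu>' > 0" using small \<rho>_pos by (simp add: \<mu>'_def)
  have "vge \<mu>' ((w $ i - w $ j) - ((w $ i - w $ j) - (of_rat (a i j) - \<theta> P * of_rat (b i j))))"
    by (intro vge_diff[of _ "w $ i - w $ j"] vge_mono[OF small(1)] vge_mono[OF frame_vec_close[OF P w]])
       (auto simp: \<mu>'_def)
  then have s: "vge \<mu>' (of_rat (a i j) - \<theta> P * of_rat (b i j))" by simp
  note th = theta_unit[OF good_approx[OF P]]
  show b0: "b i j \<noteq> 0"
  proof
    assume "b i j = 0"
    then show False using s ab of_rat_small_imp_zero[of \<mu>' "a i j"] \<mu>' by simp
  qed
  have "vge \<mu>' (- ((of_rat (a i j) - \<theta> P * of_rat (b i j)) / of_rat (b i j)))"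
    unfolding vge_uminus using s b0 by (subst vge_divide_unit) (auto simp: rval_of_rat)
  then have c: "vge \<mu>' (\<theta> P - of_rat (a i j / b i j))"
    using b0 by (simp add: of_rat_divide diff_divide_distrib)
  then show "\<exists>\<mu>'>0. vge \<mu>' (\<theta> P - of_rat (a i j / b i j))" using \<mu>' by blast
  show "a i j \<noteq> 0" using c th \<mu>' by (auto simp: vge_iff)
  show "a i j \<noteq> b i j"
  proof
    assume "a i j = b i j"
    then have "vge \<mu>' (\<theta> P - 1)" using c b0 by simp
    then have "vge \<mu>' (1 - \<theta> P)" by (simp only: vge_diff_commute[of _ 1])
    then show False using th \<mu>' by (auto simp: vge_iff)
  qed
qed

end

text \<open>Combinatorial form of the two genericity hypotheses. The variable \<open>t\<close> in
  \<open>generic2\<close> is a common critical value of two pairs, stated without dividing by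
  \<open>b\<close>.\<close>

locale generic_vertex = vertex_setup val X f n idx i0 \<alpha> k0 u1 u2 u3 p q B \<rho>
  for val :: "'k::{alg_closed_field, field_char_0} \<Rightarrow> ereal"
    and X :: "('k ^ 'n::finite) set" and f n idx i0 \<alpha> k0 u1 u2 u3 p q B \<rho> +
  assumes generic1: "\<And>i j. i \<noteq> j \<Longrightarrow> a i j \<noteq> 0 \<or> b i j \<noteq> 0"
    and generic2: "\<And>i j i' j' t. i \<noteq> j \<Longrightarrow> i' \<noteq> j' \<Longrightarrow> a i j = t * b i j \<Longrightarrow> a i' j' = t * b i' j' \<Longrightarrow>
      {i, j} = {i', j'}"
begin

text \<open>Two small differences give two rational critical values congruent to the same
  \<open>\<theta>\<close>, hence equal.\<close>

lemma small_unique: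
  assumes P: "good P" and w: "frame_vec P w"
    and 1: "i \<noteq> j" "vge \<mu> (w $ i - w $ j)" and 2: "i' \<noteq> j'" "vge \<mu> (w $ i' - w $ j')" and \<mu>: "\<mu> > 0"
  shows "{i, j} = {i', j'}"
proof -
  note s1 = small_difference[OF P w 1(2) \<mu> generic1[OF 1(1)]]
  note s2 = small_difference[OF P w 2(2) \<mu> generic1[OF 2(1)]]
  obtain \<mu>1 \<mu>2 where m: "\<mu>1 > 0" "vge \<mu>1 (\<theta> P - of_rat (a i j / b i j))"
      "\<mu>2 > 0" "vge \<mu>2 (\<theta> P - of_rat (a i' j' / b i' j'))"
    using s1(2) s2(2) by blast
  have "vge (min \<mu>1 \<mu>2) ((\<theta> P - of_rat (a i j / b i j)) - (\<theta> P - of_rat (a i' j' / b i' j')))"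
    by (intro vge_diff vge_mono[OF m(2)] vge_mono[OF m(4)]) auto
  then have "vge (min \<mu>1 \<mu>2) (of_rat (a i' j' / b i' j' - a i j / b i j))"
    by (simp only: of_rat_diff) (simp add: algebra_simps)
  then have "a i' j' / b i' j' - a i j / b i j = 0"
    by (rule of_rat_small_imp_zero) (use m in simp)
  then have "a i' j' = a i j / b i j * b i' j'" using s2(1) by (simp add: field_simps)
  moreover have "a i j = a i j / b i j * b i j" using s1(1) by simp
  ultimately show ?thesis using generic2[OF 1(1) 2(1)] by blast
qed

text \<open>A rational parameter different from 0, 1 and the finitely many critical values makes
  every difference reduce to a nonzero rational.\<close>

lemma ex_generic_point:
  "\<exists>P w. good P \<and> frame_vec P w \<and> (\<forall>i j. i \<noteq> j \<longrightarrow> w $ i \<noteq> w $ j \<and> v (w $ i - w $ j) = 0)"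
proof -
  have "finite ({0, 1} \<union> (\<lambda>(i, j). a i j / b i j) ` UNIV)" by simp
  from ex_new_if_finite[OF infinite_UNIV_char_0 this]
  obtain t where t: "t \<notin> {0, 1} \<union> (\<lambda>(i, j). a i j / b i j) ` UNIV" by (rule exE)
  obtain P where P: "good P" "\<theta> P = of_rat t" using vertex_lift[of t] t by auto
  obtain w where w: "frame_vec P w" using ex_frame_vec[OF P(1)] by blast
  have "w $ i \<noteq> w $ j \<and> v (w $ i - w $ j) = 0" if "i \<noteq> j" for i j
  proof -
    have "a i j - t * b i j \<noteq> 0"
    proof
      assume eq: "a i j - t * b i j = 0"
      then have "b i j \<noteq> 0" using generic1[OF that] by auto
      then have "t = a i j / b i j" using eq by (simp add: field_simps)
      then have "t \<in> (\<lambda>(i, j). a i j / b i j) ` UNIV" by (intro image_eqI[of _ _ "(i, j)"]) auto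
      then show False using t by blast
    qed
    then have "(of_rat (a i j - t * b i j) :: 'k) \<noteq> 0" by (simp only: of_rat_eq_0_iff) simp
    moreover have "vge \<rho> ((w $ i - w $ j) - of_rat (a i j - t * b i j))"
      using frame_vec_close[OF P(1) w, of i j] by (simp add: P(2) of_rat_diff of_rat_mult)
    ultimately show ?thesis
      using rval_eq_if_close[of "of_rat (a i j - t * b i j)" \<rho> "w $ i - w $ j"] \<rho>_pos
      by (auto simp only: rval_of_rat right_minus_eq)
  qed
  then show ?thesis using P w by blast
qed

lemma not_gauss_vanishing:
  assumes "i \<noteq> j"
  shows "\<not> gauss_vanishing X i j"
proof -
  obtain P w where P: "good P" "frame_vec P w" "w $ i \<noteq> w $ j" using ex_generic_point assms by blast
  show ?thesis
    by (rule not_gauss_vanishing_if_frame_vector[where w = w and i = i and j = j])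
       (use P vertex_frame(1)[OF good_approx[OF P(1)]] goodD(1)[OF P(1)] in \<open>simp_all add: frame_vec_def\<close>)
qed

text \<open>From left to right, \<open>l {i, j}\<close> is the valuation of \<open>w_i - w_j\<close>
  at the given point. From right to left, start at the critical value of the distinguished pair and
  adjust, or take a generic parameter if there is no such pair; \<open>small_unique\<close> gives
  all other differences valuation 0.\<close>

lemma vertex_tangents:
  "tropical_tangent val X \<alpha> \<beta> \<longleftrightarrow> (\<exists>l c.
     (\<forall>I. card I = 2 \<longrightarrow> \<beta> I = l I + (\<Sum>j\<in>-I. - \<alpha> $ j) + c) \<and>
     (\<forall>I. card I = 2 \<longrightarrow> l I \<ge> 0 \<and> l I \<in> value_group val) \<and>
     (\<forall>I I'. card I = 2 \<and> card I' = 2 \<and> l I \<noteq> 0 \<and> l I' \<noteq> 0 \<longrightarrow> I = I') \<and>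
     (\<forall>i j. i \<noteq> j \<and> (a i j = 0 \<or> b i j = 0 \<or> a i j = b i j) \<longrightarrow> l {i, j} = 0))"
  (is "_ \<longleftrightarrow> ?rhs")
proof
  assume "tropical_tangent val X \<alpha> \<beta>"
  then obtain P y z c where P: "P \<in> torus" "curve_smooth_at X P" "trop_eq \<alpha> (trop_point val P)"
    and yz: "tangent_space X P = vec.span {y, z}"
    and \<beta>': "\<forall>i j. i \<noteq> j \<and> \<not> gauss_vanishing X i j \<longrightarrow>
       pluecker y z i j \<noteq> 0 \<and> \<beta> {i, j} = v (pluecker y z i j) + c"
    unfolding tropical_tangent_def by (elim exE conjE) (rule that)
  have \<beta>: "pluecker y z i j \<noteq> 0 \<and> \<beta> {i, j} = v (pluecker y z i j) + c" if "i \<noteq> j" for i j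
    using \<beta>' not_gauss_vanishing[OF that] that by simp
  have good: "good P" using P by (simp add: good_def over_def curve_smooth_at_def)
  obtain w where w: "frame_vec P w" using ex_frame_vec[OF good] by blast
  obtain c' where c': "\<And>i j. i \<noteq> j \<Longrightarrow> (pluecker y z i j \<noteq> 0 \<longleftrightarrow> w $ i \<noteq> w $ j) \<and>
    (w $ i \<noteq> w $ j \<longrightarrow> v (pluecker y z i j) = v (w $ i - w $ j) + (\<Sum>m\<in>-{i, j}. - \<alpha> $ m) + c')"
    using tangent_rval[OF vertex_frame(1)[OF good_approx[OF good]] goodD(1)[OF good] goodD(2)[OF good]
        w[unfolded frame_vec_def] yz] by (elim exE) blast
  define l where "l = (\<lambda>I. \<beta> I - (\<Sum>j\<in>-I. - \<alpha> $ j) - (c + c'))"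
  have neq: "w $ i \<noteq> w $ j" and l: "l {i, j} = v (w $ i - w $ j)" if "i \<noteq> j" for i j
    using \<beta>[OF that] c'[OF that] by (auto simp: l_def)
  have small: "vge (v (w $ i - w $ j)) (w $ i - w $ j)" if "i \<noteq> j" for i j
    using neq[OF that] by (simp add: vge_iff)
  have nonneg: "v (w $ i - w $ j) \<ge> 0" if "i \<noteq> j" for i j
    using frame_vec_integral[OF good w, of i j] neq[OF that] by (simp add: vge_iff)
  show ?rhs
  proof (intro exI[of _ l] exI[of _ "c + c'"] conjI allI impI)
    show "\<beta> I = l I + (\<Sum>j\<in>-I. - \<alpha> $ j) + (c + c')" for I by (simp add: l_def)
    show "l I \<ge> 0" "l I \<in> value_group val" if "card I = 2" for I
      using that nonneg neq by (auto simp: card_2_iff l value_group_def)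
    show "I = I'" if "card I = 2 \<and> card I' = 2 \<and> l I \<noteq> 0 \<and> l I' \<noteq> 0" for I I'
    proof -
      have "\<exists>i j. I = {i, j} \<and> i \<noteq> j" "\<exists>i' j'. I' = {i', j'} \<and> i' \<noteq> j'"
        using that by (simp_all only: card_2_iff[symmetric])
      then obtain i j i' j' where I: "I = {i, j}" "i \<noteq> j" "I' = {i', j'}" "i' \<noteq> j'"
        by (elim exE conjE)
      define \<mu> where "\<mu> = min (v (w $ i - w $ j)) (v (w $ i' - w $ j'))"
      have "v (w $ i - w $ j) \<noteq> 0" "v (w $ i' - w $ j') \<noteq> 0" using that I l by auto
      then have "\<mu> > 0" using nonneg[OF I(2)] nonneg[OF I(4)] by (auto simp: \<mu>_def)
      moreover have "vge \<mu> (w $ i - w $ j)" "vge \<mu> (w $ i' - w $ j')"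
        using vge_mono[OF small[OF I(2)], of \<mu>] vge_mono[OF small[OF I(4)], of \<mu>] by (auto simp: \<mu>_def)
      ultimately show ?thesis using small_unique[OF good w I(2) _ I(4)] I by blast
    qed
    show "l {i, j} = 0" if ij: "i \<noteq> j \<and> (a i j = 0 \<or> b i j = 0 \<or> a i j = b i j)" for i j
    proof (rule ccontr)
      assume "l {i, j} \<noteq> 0"
      then have "v (w $ i - w $ j) > 0" using l nonneg[of i j] ij by auto
      from small_difference[OF good w small this generic1] ij show False by auto
    qed
  qed
next
  assume ?rhs
  then obtain l c where rhs: "\<forall>I. card I = 2 \<longrightarrow> \<beta> I = l I + (\<Sum>j\<in>-I. - \<alpha> $ j) + c"
    "\<forall>I. card I = 2 \<longrightarrow> l I \<ge> 0 \<and> l I \<in> value_group val"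
    "\<forall>I I'. card I = 2 \<and> card I' = 2 \<and> l I \<noteq> 0 \<and> l I' \<noteq> 0 \<longrightarrow> I = I'"
    "\<forall>i j. i \<noteq> j \<and> (a i j = 0 \<or> b i j = 0 \<or> a i j = b i j) \<longrightarrow> l {i, j} = 0"
    by (elim exE conjE)
  then have \<beta>: "\<And>I. card I = 2 \<Longrightarrow> \<beta> I = l I + (\<Sum>j\<in>-I. - \<alpha> $ j) + c"
    and l: "\<And>I. card I = 2 \<Longrightarrow> l I \<ge> 0 \<and> l I \<in> value_group val"
    and unique: "\<And>I I'. card I = 2 \<Longrightarrow> card I' = 2 \<Longrightarrow> l I \<noteq> 0 \<Longrightarrow> l I' \<noteq> 0 \<Longrightarrow> I = I'"
    and edges: "\<And>i j. i \<noteq> j \<Longrightarrow> a i j = 0 \<or> b i j = 0 \<or> a i j = b i j \<Longrightarrow> l {i, j} = 0"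
    by simp_all
  have card2: "card {i, j} = 2" if "i \<noteq> j" for i j :: 'n using that by simp
  have "\<exists>P w. good P \<and> frame_vec P w \<and> (\<forall>i j. i \<noteq> j \<longrightarrow> w $ i \<noteq> w $ j \<and> v (w $ i - w $ j) = l {i, j})"
  proof (cases "\<exists>i j. i \<noteq> j \<and> l {i, j} \<noteq> 0")
    case False
    then show ?thesis using ex_generic_point by metis
  next
    case True
    then obtain i j where ij: "i \<noteq> j" "l {i, j} \<noteq> 0" by blast
    have lpos: "l {i, j} > 0" using l[OF card2[OF ij(1)]] ij(2) by auto
    have ab: "a i j \<noteq> 0" "b i j \<noteq> 0" "a i j \<noteq> b i j" using edges[OF ij(1)] ij(2) by auto
    obtain \<delta> where \<delta>: "\<delta> \<noteq> 0" "v \<delta> = l {i, j}" using l[OF card2[OF ij(1)]] by (auto simp: value_group_def)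
    obtain P0 where P0: "good P0" "\<theta> P0 = of_rat (a i j / b i j)"
      using vertex_lift[of "a i j / b i j"] ab by auto
    obtain P where P: "good P" "\<And>w. frame_vec P w \<Longrightarrow> w $ i \<noteq> w $ j \<and> v (w $ i - w $ j) = v \<delta>"
      using vertex_adjust[OF P0(1) ab(2) P0(2) \<delta>(1)] lpos \<delta>(2) by auto
    obtain w where w: "frame_vec P w" using ex_frame_vec[OF P(1)] by blast
    have main: "w $ i \<noteq> w $ j" "v (w $ i - w $ j) = l {i, j}" using P(2)[OF w] \<delta> by auto
    have smallij: "vge (l {i, j}) (w $ i - w $ j)" using main by (simp add: vge_iff)
    have "w $ i' \<noteq> w $ j' \<and> v (w $ i' - w $ j') = l {i', j'}" if "i' \<noteq> j'" for i' j'
    proof (cases "{i', j'} = {i, j}")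
      case True
      then have "i' = i \<and> j' = j \<or> i' = j \<and> j' = i" by (auto simp: doubleton_eq_iff)
      moreover have "v (w $ j - w $ i) = v (w $ i - w $ j)" using rval_minus[of "w $ i - w $ j"] by simp
      ultimately show ?thesis using main by (auto simp: insert_commute)
    next
      case False
      have "l {i', j'} = 0" using unique[OF card2[OF that] card2[OF ij(1)] _ ij(2)] False by blast
      have not_small: "\<not> vge \<mu> (w $ i' - w $ j')" if "\<mu> > 0" "\<mu> \<le> l {i, j}" for \<mu>
        using small_unique[OF P(1) w ij(1) vge_mono[OF smallij] \<open>i' \<noteq> j'\<close> _ that(1)] that False by blast
      have ne: "w $ i' \<noteq> w $ j'" using not_small[OF lpos] by auto
      have "v (w $ i' - w $ j') \<ge> 0"
        using frame_vec_integral[OF P(1) w, of i' j'] ne by (simp add: vge_iff)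
      moreover have "\<not> v (w $ i' - w $ j') > 0"
        using not_small[of "min (l {i, j}) (v (w $ i' - w $ j'))"] lpos ne by (auto simp: vge_iff)
      ultimately show ?thesis using ne \<open>l {i', j'} = 0\<close> by simp
    qed
    then show ?thesis using P(1) w by blast
  qed
  then obtain P w where P: "good P" and w: "frame_vec P w"
    and wl: "\<And>i j. i \<noteq> j \<Longrightarrow> w $ i \<noteq> w $ j \<and> v (w $ i - w $ j) = l {i, j}" by blast
  show "tropical_tangent val X \<alpha> \<beta>"
    by (rule tropical_tangentI[OF vertex_frame(1)[OF good_approx[OF P]] goodD(1)[OF P] goodD(2)[OF P] w[unfolded frame_vec_def]])
       (use wl \<beta> card2 in auto)
qed

end

section \<open>Cells of tropical hypersurfaces\<close>

lemma inj_lattice_vec: "inj lattice_vec"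
  by (auto simp: inj_def lattice_vec_def vec_eq_iff)

lemma affine_hull_lattice_coefficients_unique:
  fixes C :: "(int ^ 'n::finite) set" and s t :: "int ^ 'n \<Rightarrow> real"
  assumes "finite C" and "\<not> affine_dependent (lattice_vec ` C)"
    and "sum s C = 1" and "sum t C = 1"
    and "(\<Sum>u\<in>C. s u *\<^sub>R lattice_vec u) = (\<Sum>u\<in>C. t u *\<^sub>R lattice_vec u)" and "u \<in> C"
  shows "s u = t u"
proof (rule ccontr)
  assume neq: "s u \<noteq> t u"
  define U where "U = (\<lambda>x. s (inv_into C lattice_vec x) - t (inv_into C lattice_vec x))"
  have inj: "inj_on lattice_vec C" using inj_lattice_vec by (rule inj_on_subset) simp
  have U: "U (lattice_vec w) = s w - t w" if "w \<in> C" for w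
    unfolding U_def using that inj by simp
  have "sum U (lattice_vec ` C) = 0"
    using assms by (simp add: sum.reindex[OF inj] U sum_subtractf)
  moreover have "(\<Sum>x\<in>lattice_vec ` C. U x *\<^sub>R x) = 0"
    using assms by (simp add: sum.reindex[OF inj] U scaleR_left_diff_distrib sum_subtractf)
  moreover have "U (lattice_vec u) \<noteq> 0" using U[OF assms(6)] neq by simp
  ultimately have "affine_dependent (lattice_vec ` C)"
    unfolding affine_dependent_explicit_finite[OF finite_imageI[OF assms(1)]] using assms(6) by blast
  then show False using assms(2) by blast
qed

text \<open>A lattice point of a unimodular simplex has integral barycentric coordinates in [0, 1], so
  it is a vertex.\<close>

lemma lattice_point_of_unimodular_simplex:
  assumes "C \<subseteq> char_lattice" and fin: "finite C" and ind: "\<not> affine_dependent (lattice_vec ` C)"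
    and uni: "\<forall>w\<in>char_lattice. lattice_vec w \<in> affine hull (lattice_vec ` C) \<longrightarrow>
           (\<exists>a :: int ^ 'n::finite \<Rightarrow> int. (\<Sum>u\<in>C. a u) = 1 \<and> w = (\<Sum>u\<in>C. a u *s u))"
    and w: "w \<in> char_lattice" "lattice_vec w \<in> convex hull (lattice_vec ` C)"
  shows "w \<in> C"
proof -
  have inj: "inj_on lattice_vec C" using inj_lattice_vec by (rule inj_on_subset) simp
  have "lattice_vec w \<in> affine hull (lattice_vec ` C)"
    using w(2) convex_hull_subset_affine_hull by blast
  then obtain c where c: "(\<Sum>u\<in>C. c u) = 1" "w = (\<Sum>u\<in>C. c u *s u)" using uni w(1) by blast
  obtain b where b: "\<And>x. x \<in> lattice_vec ` C \<Longrightarrow> 0 \<le> b x" "sum b (lattice_vec ` C) = 1"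
    "(\<Sum>x\<in>lattice_vec ` C. b x *\<^sub>R x) = lattice_vec w"
    using w(2) unfolding convex_hull_finite[OF finite_imageI[OF fin]] by auto
  have "lattice_vec w = (\<Sum>u\<in>C. real_of_int (c u) *\<^sub>R lattice_vec u)"
    by (subst c(2)) (simp add: lattice_vec_def vec_eq_iff)
  also have "lattice_vec w = (\<Sum>u\<in>C. b (lattice_vec u) *\<^sub>R lattice_vec u)"
    using b(3) by (simp add: sum.reindex[OF inj])
  finally have eq: "(\<Sum>u\<in>C. b (lattice_vec u) *\<^sub>R lattice_vec u) = (\<Sum>u\<in>C. real_of_int (c u) *\<^sub>R lattice_vec u)" .
  have "(\<Sum>u\<in>C. real_of_int (c u)) = 1" using c(1) by (metis of_int_1 of_int_sum)
  moreover have "(\<Sum>u\<in>C. b (lattice_vec u)) = 1" using b(2) by (simp add: sum.reindex[OF inj])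
  ultimately have "b (lattice_vec u) = real_of_int (c u)" if "u \<in> C" for u
    using affine_hull_lattice_coefficients_unique[OF fin ind _ _ eq that] by simp
  then have nonneg: "0 \<le> c u" if "u \<in> C" for u using b(1) that by force
  \<comment> \<open>Nonnegative integers with sum 1: one of them is 1 and the others vanish.\<close>
  obtain u where u: "u \<in> C" "c u \<noteq> 0" using c(1) by (metis sum.neutral zero_neq_one)
  have "c u + sum c (C - {u}) = 1" using c(1) fin u(1) by (simp add: sum.remove)
  moreover have "sum c (C - {u}) \<ge> 0" using nonneg by (intro sum_nonneg) auto
  ultimately have cu: "c u = 1" "sum c (C - {u}) = 0" using nonneg[OF u(1)] u(2) by linarith+
  have "c x = 0" if "x \<in> C - {u}" for x
    using cu(2) nonneg that fin by (subst (asm) sum_nonneg_eq_0_iff) auto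
  then have "w = c u *s u"
    unfolding c(2) using fin u(1) by (simp add: sum.remove)
  then show ?thesis using cu(1) u(1) by simp
qed

text \<open>The subdivision remembers only the convex hull of the minimal exponents. Since all
  lattice points of a unimodular simplex are vertices, no minimal exponent is hidden in the hull of
  the others.\<close>

lemma min_terms_affine_independent:
  fixes g :: "(int ^ 'n::finite) \<Rightarrow>\<^sub>0 'k::zero"
  assumes smooth: "tropically_smooth val g" and lat: "Poly_Mapping.keys g \<subseteq> char_lattice"
  shows "\<not> affine_dependent (lattice_vec ` min_terms val g \<alpha>)"
proof -
  let ?M = "min_terms val g \<alpha>"
  have "convex hull (lattice_vec ` ?M) \<in> regular_subdivision val g"
    by (auto simp: regular_subdivision_def)
  then have "unimodular_simplex (convex hull (lattice_vec ` ?M))"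
    using smooth by (simp add: tropically_smooth_def)
  then obtain C where C: "C \<subseteq> char_lattice" "finite C" "\<not> affine_dependent (lattice_vec ` C)"
    "convex hull (lattice_vec ` ?M) = convex hull (lattice_vec ` C)"
    "\<forall>w\<in>char_lattice. lattice_vec w \<in> affine hull (lattice_vec ` C) \<longrightarrow>
           (\<exists>a :: int ^ 'n \<Rightarrow> int. (\<Sum>u\<in>C. a u) = 1 \<and> w = (\<Sum>u\<in>C. a u *s u))"
    unfolding unimodular_simplex_def by auto
  have "?M \<subseteq> C"
  proof
    fix w assume w: "w \<in> ?M"
    then have "w \<in> char_lattice" using lat by (auto simp: min_terms_def)
    moreover have "lattice_vec w \<in> convex hull (lattice_vec ` C)"
      unfolding C(4)[symmetric] using w by (intro hull_inc) simp
    ultimately show "w \<in> C" by (rule lattice_point_of_unimodular_simplex[OF C(1-3,5)])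
  qed
  then show ?thesis
    using C(3) affine_dependent_subset[of "lattice_vec ` ?M" "lattice_vec ` C"] by auto
qed

section \<open>Minimal terms near a given point\<close>

lemma min_terms_nonempty:
  assumes "Poly_Mapping.keys g \<noteq> {}"
  shows "min_terms val g \<alpha> \<noteq> {}"
proof -
  obtain u where "u \<in> Poly_Mapping.keys g"
    "\<And>w. w \<in> Poly_Mapping.keys g \<Longrightarrow> term_val val g \<alpha> u \<le> term_val val g \<alpha> w"
    using arg_min_if_finite[OF finite_keys assms, of "term_val val g \<alpha>"] by (metis not_less)
  then show ?thesis by (auto simp: min_terms_def)
qed

lemma finite_min_terms [simp]: "finite (min_terms val g \<alpha>)"
  by (rule finite_subset[of _ "Poly_Mapping.keys g"]) (auto simp: min_terms_def)

text \<open>Finitely many terms are strictly above the minimum at \<open>\<alpha>\<close>, and by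
  continuity they stay above it nearby.\<close>

lemma min_terms_local:
  "\<exists>\<delta>>0. \<forall>\<gamma>\<in>ball \<alpha> \<delta>. min_terms val g \<gamma> \<subseteq> min_terms val g \<alpha>"
proof (cases "Poly_Mapping.keys g = {}")
  case True
  then show ?thesis by (intro exI[of _ 1]) (auto simp: min_terms_def)
next
  case False
  then obtain p where p: "p \<in> min_terms val g \<alpha>" using min_terms_nonempty by blast
  have cont: "continuous (at \<alpha>) (\<lambda>\<gamma>. term_val val g \<gamma> u)" for u
    unfolding term_val_def by (intro continuous_intros)
  have "\<forall>\<^sub>F \<gamma> in nhds \<alpha>. term_val val g \<gamma> p < term_val val g \<gamma> u"
    if "u \<in> Poly_Mapping.keys g - min_terms val g \<alpha>" for u
  proof -
    have "term_val val g \<alpha> p < term_val val g \<alpha> u"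
    proof (rule ccontr)
      assume "\<not> term_val val g \<alpha> p < term_val val g \<alpha> u"
      then have "u \<in> min_terms val g \<alpha>" using p that by (auto simp: min_terms_def)
      then show False using that by blast
    qed
    moreover have "((\<lambda>\<gamma>. term_val val g \<gamma> u - term_val val g \<gamma> p) \<longlongrightarrow>
        term_val val g \<alpha> u - term_val val g \<alpha> p) (nhds \<alpha>)"
      unfolding term_val_def by (intro tendsto_intros tendsto_ident_at filterlim_ident)
    ultimately have "\<forall>\<^sub>F \<gamma> in nhds \<alpha>. 0 < term_val val g \<gamma> u - term_val val g \<gamma> p"
      by (intro order_tendstoD(1)) auto
    then show ?thesis by (rule eventually_mono) simp
  qed
  then have "\<forall>\<^sub>F \<gamma> in nhds \<alpha>. \<forall>u\<in>Poly_Mapping.keys g - min_terms val g \<alpha>.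
      term_val val g \<gamma> p < term_val val g \<gamma> u"
    by (intro eventually_ball_finite) auto
  then obtain \<delta> where \<delta>: "\<delta> > 0" "\<And>\<gamma>. dist \<gamma> \<alpha> < \<delta> \<Longrightarrow>
      \<forall>u\<in>Poly_Mapping.keys g - min_terms val g \<alpha>. term_val val g \<gamma> p < term_val val g \<gamma> u"
    unfolding eventually_nhds_metric by blast
  have "min_terms val g \<gamma> \<subseteq> min_terms val g \<alpha>" if "\<gamma> \<in> ball \<alpha> \<delta>" for \<gamma>
  proof
    fix u assume u: "u \<in> min_terms val g \<gamma>"
    have "dist \<gamma> \<alpha> < \<delta>" using that by (simp add: dist_commute)
    moreover have "term_val val g \<gamma> u \<le> term_val val g \<gamma> p" "u \<in> Poly_Mapping.keys g"
      using u p by (auto simp: min_terms_def)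
    ultimately show "u \<in> min_terms val g \<alpha>" using \<delta>(2)[of \<gamma>] by (meson Diff_iff not_less)
  qed
  with \<delta>(1) show ?thesis by blast
qed

lemma min_terms_local_finite:
  assumes "finite K"
  shows "\<exists>\<delta>>0. \<forall>\<gamma>\<in>ball \<alpha> \<delta>. \<forall>k\<in>K. min_terms val (f k) \<gamma> \<subseteq> min_terms val (f k) \<alpha>"
  using assms
proof (induction K rule: finite_induct)
  case empty
  show ?case by (intro exI[of _ 1]) simp
next
  case (insert k K)
  then obtain \<delta> where \<delta>: "\<delta> > 0" "\<forall>\<gamma>\<in>ball \<alpha> \<delta>. \<forall>k\<in>K. min_terms val (f k) \<gamma> \<subseteq> min_terms val (f k) \<alpha>"
    by blast
  obtain \<delta>' where \<delta>': "\<delta>' > 0" "\<forall>\<gamma>\<in>ball \<alpha> \<delta>'. min_terms val (f k) \<gamma> \<subseteq> min_terms val (f k) \<alpha>"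
    using min_terms_local by blast
  show ?case using \<delta> \<delta>' by (intro exI[of _ "min \<delta> \<delta>'"]) auto
qed

lemma term_val_add: "term_val val g (\<alpha> + x) u = term_val val g \<alpha> u + x \<bullet> lattice_vec u"
  by (simp add: term_val_def inner_add_left)

lemma min_terms_eq:
  "u \<in> min_terms val g \<alpha> \<Longrightarrow> w \<in> min_terms val g \<alpha> \<Longrightarrow> term_val val g \<alpha> u = term_val val g \<alpha> w"
  by (auto simp: min_terms_def intro: antisym)

text \<open>Close to \<open>\<alpha>\<close> only the terms minimal at \<open>\<alpha>\<close>
  compete, and the direction \<open>\<omega>\<close> decides among them: these are the exponents of
  an initial form.\<close>

lemma min_terms_perturb:
  assumes "finite K" and "\<And>k. k \<in> K \<Longrightarrow> Poly_Mapping.keys (f k) \<noteq> {}"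
  shows "\<exists>\<delta>>0. \<forall>\<epsilon>. 0 < \<epsilon> \<and> \<epsilon> < \<delta> \<longrightarrow> (\<forall>k\<in>K. min_terms val (f k) (\<alpha> + \<epsilon> *\<^sub>R \<omega>) =
    {u \<in> min_terms val (f k) \<alpha>. \<forall>w\<in>min_terms val (f k) \<alpha>. \<omega> \<bullet> lattice_vec u \<le> \<omega> \<bullet> lattice_vec w})"
proof -
  obtain \<delta> where \<delta>: "\<delta> > 0" "\<forall>\<gamma>\<in>ball \<alpha> \<delta>. \<forall>k\<in>K. min_terms val (f k) \<gamma> \<subseteq> min_terms val (f k) \<alpha>"
    using min_terms_local_finite[OF assms(1)] by blast
  have "min_terms val (f k) (\<alpha> + \<epsilon> *\<^sub>R \<omega>) =
    {u \<in> min_terms val (f k) \<alpha>. \<forall>w\<in>min_terms val (f k) \<alpha>. \<omega> \<bullet> lattice_vec u \<le> \<omega> \<bullet> lattice_vec w}"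
    if \<epsilon>: "0 < \<epsilon>" "\<epsilon> < \<delta> / (norm \<omega> + 1)" and k: "k \<in> K" for \<epsilon> k
  proof -
    let ?M = "min_terms val (f k) \<alpha>" and ?M' = "min_terms val (f k) (\<alpha> + \<epsilon> *\<^sub>R \<omega>)"
    let ?v = "term_val val (f k)"
    \<comment> \<open>The summand 1 keeps the denominator positive for
      \<open>\<omega> = 0\<close>.\<close>
    have "\<epsilon> * (norm \<omega> + 1) < \<delta>" using \<epsilon> by (simp add: pos_less_divide_eq add_nonneg_pos)
    then have "\<epsilon> * norm \<omega> < \<delta>" using \<epsilon>(1) by (simp add: distrib_left)
    then have "\<alpha> + \<epsilon> *\<^sub>R \<omega> \<in> ball \<alpha> \<delta>" using \<epsilon>(1) by (simp add: dist_norm)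
    then have sub: "?M' \<subseteq> ?M" using \<delta>(2) k by blast
    have val: "?v (\<alpha> + \<epsilon> *\<^sub>R \<omega>) u = ?v \<alpha> u + \<epsilon> * (\<omega> \<bullet> lattice_vec u)" for u
      by (simp add: term_val_add)
    obtain m where m: "m \<in> ?M'" using min_terms_nonempty[OF assms(2)[OF k]] by blast
    show ?thesis
    proof (intro equalityI subsetI CollectI conjI ballI)
      fix u w assume u: "u \<in> ?M'" and w: "w \<in> ?M"
      have "?v (\<alpha> + \<epsilon> *\<^sub>R \<omega>) u \<le> ?v (\<alpha> + \<epsilon> *\<^sub>R \<omega>) w" using u w by (auto simp: min_terms_def)
      moreover have "?v \<alpha> u = ?v \<alpha> w" using u w sub by (intro min_terms_eq) auto
      ultimately show "\<omega> \<bullet> lattice_vec u \<le> \<omega> \<bullet> lattice_vec w" using \<epsilon>(1) by (simp add: val)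
    next
      fix u assume u: "u \<in> {u \<in> ?M. \<forall>w\<in>?M. \<omega> \<bullet> lattice_vec u \<le> \<omega> \<bullet> lattice_vec w}"
      have "m \<in> ?M" using m sub by blast
      then have "?v (\<alpha> + \<epsilon> *\<^sub>R \<omega>) u \<le> ?v (\<alpha> + \<epsilon> *\<^sub>R \<omega>) m"
        unfolding val using u min_terms_eq[of u val "f k" \<alpha> m] \<epsilon>(1) by auto
      then show "u \<in> ?M'" using m u by (auto simp: min_terms_def intro: order_trans)
    qed (use sub in auto)
  qed
  moreover have "\<delta> / (norm \<omega> + 1) > 0" using \<delta>(1) by (simp add: add_nonneg_pos)
  ultimately show ?thesis by (intro exI[of _ "\<delta> / (norm \<omega> + 1)"]) simp
qed

text \<open>Linear space of directions for an intersection of cells. The base point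
  \<open>\<gamma> k\<close> depends on \<open>k\<close> because each hypersurface contributes a cell
  of its own.\<close>

definition cell_directions ::
  "('k::zero \<Rightarrow> ereal) \<Rightarrow> nat set \<Rightarrow> (nat \<Rightarrow> (int ^ 'n::finite) \<Rightarrow>\<^sub>0 'k) \<Rightarrow> (nat \<Rightarrow> real ^ 'n) \<Rightarrow> (real ^ 'n) set" where
  "cell_directions val K f \<gamma> = {x. \<forall>k\<in>K. \<forall>u\<in>min_terms val (f k) (\<gamma> k). \<forall>w\<in>min_terms val (f k) (\<gamma> k).
     x \<bullet> lattice_vec u = x \<bullet> lattice_vec w}"

abbreviation cell_of :: "('k::zero \<Rightarrow> ereal) \<Rightarrow> ((int ^ 'n::finite) \<Rightarrow>\<^sub>0 'k) \<Rightarrow> real ^ 'n \<Rightarrow> (real ^ 'n) set" where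
  "cell_of val g \<alpha> \<equiv> {\<gamma>. min_terms val g \<alpha> \<subseteq> min_terms val g \<gamma>}"

lemma cell_directionsD:
  "x \<in> cell_directions val K f \<gamma> \<Longrightarrow> k \<in> K \<Longrightarrow> u \<in> min_terms val (f k) (\<gamma> k) \<Longrightarrow>
    w \<in> min_terms val (f k) (\<gamma> k) \<Longrightarrow> x \<bullet> lattice_vec u = x \<bullet> lattice_vec w"
  unfolding cell_directions_def by blast

lemma cell_directionsI:
  "(\<And>k u w. k \<in> K \<Longrightarrow> u \<in> min_terms val (f k) (\<gamma> k) \<Longrightarrow> w \<in> min_terms val (f k) (\<gamma> k) \<Longrightarrow>
    x \<bullet> lattice_vec u = x \<bullet> lattice_vec w) \<Longrightarrow> x \<in> cell_directions val K f \<gamma>"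
  unfolding cell_directions_def by blast

lemma subspace_cell_directions: "subspace (cell_directions val K f \<gamma>)"
proof (rule subspaceI)
  show "0 \<in> cell_directions val K f \<gamma>" by (rule cell_directionsI) simp
  show "x + y \<in> cell_directions val K f \<gamma>"
    if x: "x \<in> cell_directions val K f \<gamma>" and y: "y \<in> cell_directions val K f \<gamma>" for x y
  proof (rule cell_directionsI)
    fix k u w assume "k \<in> K" "u \<in> min_terms val (f k) (\<gamma> k)" "w \<in> min_terms val (f k) (\<gamma> k)"
    from cell_directionsD[OF x this] cell_directionsD[OF y this]
    show "(x + y) \<bullet> lattice_vec u = (x + y) \<bullet> lattice_vec w" by (simp add: inner_add_left)
  qed
  show "c *\<^sub>R x \<in> cell_directions val K f \<gamma>" if x: "x \<in> cell_directions val K f \<gamma>" for c x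
  proof (rule cell_directionsI)
    fix k u w assume "k \<in> K" "u \<in> min_terms val (f k) (\<gamma> k)" "w \<in> min_terms val (f k) (\<gamma> k)"
    from cell_directionsD[OF x this]
    show "(c *\<^sub>R x) \<bullet> lattice_vec u = (c *\<^sub>R x) \<bullet> lattice_vec w" by simp
  qed
qed

lemma cell_difference:
  assumes "x \<in> (\<Inter>k\<in>K. cell_of val (f k) (\<gamma> k))" and "y \<in> (\<Inter>k\<in>K. cell_of val (f k) (\<gamma> k))"
  shows "x - y \<in> cell_directions val K f \<gamma>"
proof (rule cell_directionsI)
  fix k u w assume k: "k \<in> K" and uw: "u \<in> min_terms val (f k) (\<gamma> k)" "w \<in> min_terms val (f k) (\<gamma> k)"
  then have "term_val val (f k) x u = term_val val (f k) x w" "term_val val (f k) y u = term_val val (f k) y w"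
    using assms by (auto intro!: min_terms_eq)
  then show "(x - y) \<bullet> lattice_vec u = (x - y) \<bullet> lattice_vec w"
    by (simp add: term_val_def inner_diff_left)
qed

text \<open>Inside a small ball around \<open>\<alpha>\<close> the intersection of cells coincides
  with \<open>\<alpha>\<close> plus its direction space, and cutting an affine space with an open
  ball does not lower its dimension.\<close>

lemma aff_dim_cell:
  assumes fin: "finite K" and ne: "\<And>k. k \<in> K \<Longrightarrow> Poly_Mapping.keys (f k) \<noteq> {}"
  shows "aff_dim (\<Inter>k\<in>K. cell_of val (f k) \<alpha>) = int (dim (cell_directions val K f (\<lambda>_. \<alpha>)))"
proof (rule antisym)
  let ?E = "\<Inter>k\<in>K. cell_of val (f k) \<alpha>" and ?L = "cell_directions val K f (\<lambda>_. \<alpha>)"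
  have dimL: "aff_dim ((+) \<alpha> ` ?L) = int (dim ?L)"
    by (simp add: aff_dim_translation_eq aff_dim_subspace subspace_cell_directions)
  have "?E \<subseteq> (+) \<alpha> ` ?L"
  proof
    fix x assume x: "x \<in> ?E"
    have "\<alpha> \<in> ?E" by simp
    from cell_difference[OF x this] have "x - \<alpha> \<in> ?L" .
    then show "x \<in> (+) \<alpha> ` ?L" by (rule image_eqI[rotated]) simp
  qed
  from aff_dim_subset[OF this] show "aff_dim ?E \<le> int (dim ?L)" unfolding dimL .
  obtain \<delta> where \<delta>: "\<delta> > 0" "\<forall>\<gamma>\<in>ball \<alpha> \<delta>. \<forall>k\<in>K. min_terms val (f k) \<gamma> \<subseteq> min_terms val (f k) \<alpha>"
    using min_terms_local_finite[OF fin] by blast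
  have sub: "(+) \<alpha> ` ?L \<inter> ball \<alpha> \<delta> \<subseteq> ?E"
  proof
    fix y assume y: "y \<in> (+) \<alpha> ` ?L \<inter> ball \<alpha> \<delta>"
    then obtain x where x: "x \<in> ?L" "y = \<alpha> + x" by blast
    have "min_terms val (f k) \<alpha> \<subseteq> min_terms val (f k) y" if k: "k \<in> K" for k
    proof
      fix u assume u: "u \<in> min_terms val (f k) \<alpha>"
      obtain m where m: "m \<in> min_terms val (f k) y" using min_terms_nonempty[OF ne[OF k]] by blast
      then have m': "m \<in> min_terms val (f k) \<alpha>" using \<delta>(2) y k by blast
      have "term_val val (f k) y u = term_val val (f k) y m"
        using cell_directionsD[OF x(1) k u m'] min_terms_eq[OF u m'] by (simp add: x(2) term_val_add)
      then show "u \<in> min_terms val (f k) y" using m u by (auto simp: min_terms_def)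
    qed
    then show "y \<in> ?E" by simp
  qed
  have conv: "convex ((+) \<alpha> ` ?L)"
    by (intro convex_translation subspace_imp_convex subspace_cell_directions)
  have "\<alpha> \<in> (+) \<alpha> ` ?L \<inter> ball \<alpha> \<delta>"
    using imageI[OF subspace_0[OF subspace_cell_directions], of "(+) \<alpha>" val K f "\<lambda>_. \<alpha>"] \<delta>(1) by simp
  then have "aff_dim ((+) \<alpha> ` ?L \<inter> ball \<alpha> \<delta>) = aff_dim ((+) \<alpha> ` ?L)"
    by (intro aff_dim_convex_Int_open[OF conv]) auto
  then show "int (dim ?L) \<le> aff_dim ?E" using aff_dim_subset[OF sub] unfolding dimL by (simp only:)
qed

text \<open>The directions of a cell form the orthogonal complement of the differences of its
  exponents, and smoothness makes these differences independent.\<close>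

lemma codim_cell:
  fixes g :: "(int ^ 'n::finite) \<Rightarrow>\<^sub>0 'k::zero"
  assumes smooth: "tropically_smooth val g" and lat: "Poly_Mapping.keys g \<subseteq> char_lattice"
    and ne: "Poly_Mapping.keys g \<noteq> {}"
  shows "codim (cell_of val g \<alpha>) = int (card (min_terms val g \<alpha>)) - 1"
proof -
  let ?M = "min_terms val g \<alpha>"
  let ?L = "cell_directions val {0} (\<lambda>_. g) (\<lambda>_. \<alpha>)"
  obtain p where p: "p \<in> ?M" using min_terms_nonempty[OF ne] by blast
  define D where "D = (\<lambda>x. - lattice_vec p + x) ` (lattice_vec ` ?M - {lattice_vec p})"
  have "\<not> dependent D"
    unfolding D_def using min_terms_affine_independent[OF smooth lat, of \<alpha>] p
    by (subst affine_dependent_iff_dependent2[symmetric]) auto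
  moreover have "finite D" by (simp add: D_def)
  ultimately have "dim (span D) = card D" by (simp add: dim_span dim_eq_card_independent)
  moreover have "card D = card ?M - 1"
  proof -
    have "card (lattice_vec ` ?M) = card ?M"
      using inj_lattice_vec by (intro card_image) (rule inj_on_subset, auto)
    moreover have "card D = card (lattice_vec ` ?M - {lattice_vec p})"
      unfolding D_def by (intro card_image) (auto simp: inj_on_def)
    ultimately show ?thesis using p by (simp add: card_Diff_singleton)
  qed
  moreover have "?L = {y \<in> UNIV. \<forall>x\<in>span D. orthogonal x y}"
  proof (intro equalityI subsetI)
    fix y assume y: "y \<in> ?L"
    have "orthogonal y x" if "x \<in> span D" for x
    proof (rule orthogonal_to_span[OF that])
      fix z assume "z \<in> D"
      then obtain u where "u \<in> ?M" "z = - lattice_vec p + lattice_vec u" by (auto simp: D_def)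
      then show "orthogonal y z"
        using cell_directionsD[OF y, of 0 u p] p by (simp add: orthogonal_def inner_add_right inner_diff_right)
    qed
    then show "y \<in> {y \<in> UNIV. \<forall>x\<in>span D. orthogonal x y}" by (auto simp: orthogonal_commute)
  next
    fix y assume y: "y \<in> {y \<in> UNIV. \<forall>x\<in>span D. orthogonal x y}"
    have "y \<bullet> lattice_vec u = y \<bullet> lattice_vec p" if "u \<in> ?M" for u
    proof (cases "lattice_vec u = lattice_vec p")
      case False
      then have "- lattice_vec p + lattice_vec u \<in> D" unfolding D_def using that by auto
      then have "orthogonal (- lattice_vec p + lattice_vec u) y" using y span_base by blast
      then show ?thesis by (simp add: orthogonal_def inner_diff_right inner_commute inner_diff_left)
    qed simp
    then show "y \<in> ?L" by (intro cell_directionsI) metis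
  qed
  then have "dim ?L + dim (span D) = dim (UNIV :: (real ^ 'n) set)"
    using dim_subspace_orthogonal_to_vectors[of "span D" UNIV] by simp
  moreover have "card ?M \<ge> 1" using p by (metis card_0_eq empty_iff finite_min_terms less_one not_le)
  ultimately have "int (dim ?L) = int CARD('n) - (int (card ?M) - 1)" by simp
  moreover have "aff_dim (cell_of val g \<alpha>) = int (dim ?L)"
    using aff_dim_cell[of "{0}" "\<lambda>_. g" val \<alpha>] ne by simp
  ultimately show ?thesis by (simp add: codim_def)
qed

section \<open>The tropical curve near an edge point\<close>

lemma coord_spanI:
  fixes x :: "real ^ 'n::finite"
  assumes "\<And>m. m \<notin> J \<Longrightarrow> x $ m = t"
  shows "x \<in> coord_span J"
proof -
  have "x = t *\<^sub>R 1 + (\<Sum>m\<in>J. (x $ m - t) *\<^sub>R axis m 1)"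
  proof -
    have "(\<Sum>m\<in>J. (x $ m - t) * (axis m 1 :: real ^ 'n) $ i) = (if i \<in> J then x $ i - t else 0)" for i
    proof -
      have "(\<Sum>m\<in>J. (x $ m - t) * (axis m 1 :: real ^ 'n) $ i) = (\<Sum>m\<in>J. if m = i then x $ i - t else 0)"
        by (intro sum.cong) (auto simp: axis_def)
      then show ?thesis by simp
    qed
    then show ?thesis using assms by (simp add: vec_eq_iff)
  qed
  moreover have "t *\<^sub>R 1 + (\<Sum>m\<in>J. (x $ m - t) *\<^sub>R axis m 1) \<in> coord_span J"
    unfolding coord_span_def tspan_def
    by (intro span_add span_sum span_mul) (auto intro: span_base)
  ultimately show ?thesis by simp
qed

text \<open>Translates the hypothesis on index sets with \<open>n - 1\<close> elements into one on
  pairs: modulo the all-ones vector, being supported off \<open>{i, j}\<close> means having equal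
  coordinates there.\<close>

lemma coord_span_compl_pair:
  fixes x :: "real ^ 'n::finite"
  shows "x \<in> coord_span (- {i, j}) \<longleftrightarrow> x $ i = x $ j"
proof
  have "subspace {x :: real ^ 'n. x $ i = x $ j}" by (auto simp: subspace_def)
  then have "coord_span (- {i, j}) \<subseteq> {x. x $ i = x $ j}"
    unfolding coord_span_def tspan_def by (intro span_minimal) (auto simp: axis_def)
  then show "x \<in> coord_span (- {i, j}) \<Longrightarrow> x $ i = x $ j" by blast
  show "x $ i = x $ j \<Longrightarrow> x \<in> coord_span (- {i, j})" by (rule coord_spanI[of _ _ "x $ i"]) auto
qed

lemma tspan_empty: "tspan {} = {x :: real ^ 'n::finite. \<forall>i j. x $ i = x $ j}"
proof (intro equalityI subsetI)
  fix x :: "real ^ 'n" assume "x \<in> tspan {}"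
  then obtain t where "x = t *\<^sub>R 1" unfolding tspan_def by (auto simp: span_singleton)
  then show "x \<in> {x. \<forall>i j. x $ i = x $ j}" by simp
next
  fix x :: "real ^ 'n" assume "x \<in> {x. \<forall>i j. x $ i = x $ j}"
  then have "x = (x $ undefined) *\<^sub>R 1" by (simp add: vec_eq_iff)
  then show "x \<in> tspan {}" unfolding tspan_def span_singleton by (rule range_eqI)
qed

text \<open>A rational kernel vector is a real one, so tropical information over the reals yields an
  inverse over the rationals.\<close>

lemma int_matrix_invertible:
  fixes A :: "int ^ 'n::finite ^ 'n"
  assumes "\<And>x :: real ^ 'n. of_int_matrix A *v x = 0 \<Longrightarrow> x = 0"
  shows "\<exists>B :: rat ^ 'n ^ 'n. B ** of_int_matrix A = mat 1"
  unfolding matrix_left_invertible_ker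
proof (intro allI impI)
  fix x :: "rat ^ 'n" assume x: "of_int_matrix A *v x = 0"
  have "(\<Sum>j\<in>UNIV. of_int (A $ i $ j) * (of_rat (x $ j) :: real)) = 0" for i
  proof -
    have "(of_int_matrix A *v x) $ i = 0" by (simp add: x)
    then have "(\<Sum>j\<in>UNIV. of_int (A $ i $ j) * x $ j) = 0"
      by (simp add: matrix_vector_mult_def of_int_matrix_def)
    then have "(of_rat (\<Sum>j\<in>UNIV. of_int (A $ i $ j) * x $ j) :: real) = 0" by simp
    then show ?thesis by (simp add: of_rat_sum of_rat_mult)
  qed
  then have "of_int_matrix A *v ((\<chi> j. of_rat (x $ j)) :: real ^ 'n) = 0"
    by (simp add: vec_eq_iff matrix_vector_mult_def of_int_matrix_def)
  from assms[OF this] show "x = 0" by (simp add: vec_eq_iff)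
qed

lemma of_int_matrix_mult_real:
  "(of_int_matrix A *v x) $ l = x \<bullet> lattice_vec (A $ l)" for x :: "real ^ 'n::finite"
  by (simp add: matrix_vector_mult_def of_int_matrix_def lattice_vec_def inner_vec_def mult.commute)

context torus_curve
begin

lemma card_UNIV_n: "CARD('n) = n + 1"
  using bij_betw_same_card[OF idx] by simp

lemma lead_matrix_kernel:
  fixes x :: "real ^ 'n"
  shows "of_int_matrix (lead_matrix d r) *v x = 0 \<longleftrightarrow>
    (\<forall>k\<in>{1..<n}. x \<bullet> lattice_vec (d k) = 0) \<and> x \<bullet> lattice_vec r = 0 \<and> x $ i0 = 0"
proof -
  have "lattice_vec (axis i0 1) = (axis i0 1 :: real ^ 'n)"
    by (simp add: lattice_vec_def axis_def vec_eq_iff)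
  then have ax: "x \<bullet> lattice_vec (axis i0 1) = x $ i0" by (simp add: inner_axis)
  have "of_int_matrix (lead_matrix d r) *v x = 0 \<longleftrightarrow> (\<forall>l. x \<bullet> lattice_vec (lead_matrix d r $ l) = 0)"
    by (simp add: vec_eq_iff of_int_matrix_mult_real)
  also have "\<dots> \<longleftrightarrow> (\<forall>k\<in>{1..<n}. x \<bullet> lattice_vec (d k) = 0) \<and> x \<bullet> lattice_vec r = 0 \<and> x $ i0 = 0"
  proof (intro iffI conjI ballI allI)
    assume all: "\<forall>l. x \<bullet> lattice_vec (lead_matrix d r $ l) = 0"
    show "x \<bullet> lattice_vec (d k) = 0" if "k \<in> {1..<n}" for k
      using all[rule_format, of "row_of k"] unfolding lead_matrix_row(3)[OF that] .
    show "x \<bullet> lattice_vec r = 0" using all[rule_format, of "row_of 0"] by (simp add: lead_matrix_row)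
    show "x $ i0 = 0" using all[rule_format, of "row_of n"] ax by (simp add: lead_matrix_row)
  next
    fix l
    assume "(\<forall>k\<in>{1..<n}. x \<bullet> lattice_vec (d k) = 0) \<and> x \<bullet> lattice_vec r = 0 \<and> x $ i0 = 0"
    then show "x \<bullet> lattice_vec (lead_matrix d r $ l) = 0"
      using ax n1 by (cases l rule: idx_cases) (auto simp: lead_matrix_def)
  qed
  finally show ?thesis .
qed

text \<open>A single minimal term could not be cancelled by the others, so the equation would not
  vanish: the easy inclusion in Kapranov's theorem.\<close>

lemma on_curve_card_M:
  assumes P: "over \<gamma> P" "P \<in> X" and k: "k \<in> {1..<n}" and ne: "\<And>k. k \<in> {1..<n} \<Longrightarrow> supp k \<noteq> {}"
  shows "card (M k \<gamma>) \<ge> 2"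
proof (rule ccontr)
  assume "\<not> card (M k \<gamma>) \<ge> 2"
  moreover have "card (M k \<gamma>) \<noteq> 0" using min_terms_nonempty[OF ne[OF k]] finite_M by simp
  ultimately have "card (M k \<gamma>) = 1" by linarith
  then obtain m where m: "M k \<gamma> = {m}" using card_1_singletonE by blast
  define p where "p = (\<lambda>k. SOME u. u \<in> M k \<gamma>)"
  have p: "p k \<in> M k \<gamma>" if "k \<in> {1..<n}" for k
    unfolding p_def using min_terms_nonempty[OF ne[OF that]] by (simp add: some_in_eq)
  then have pk: "p k = m" using m k by auto
  have ms: "min_scaled \<gamma> (\<lambda>k. coeff_term k P (p k))" by (rule min_scaled_coeff_term[OF P(1) p])
  obtain \<rho> where \<rho>: "gap \<gamma> \<rho>" using ex_gap by blast
  have Pt: "P \<in> torus" using P by (simp add: over_def)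
  have "coeff_term k P (p k) \<noteq> 0" using bspec[OF ms[unfolded min_scaled_def] k] by simp
  then have "vge \<rho> (0 - 1)"
    using leading_sum[OF P(1) ms \<rho> k, of "\<lambda>_. 1"] m pk approx_on_curve[OF P(2) Pt k] by simp
  then show False using \<rho> by (simp add: vge_iff gap_def)
qed

lemma over_in_Trop: "over \<gamma> P \<Longrightarrow> P \<in> X \<Longrightarrow> \<gamma> \<in> Trop val X"
  unfolding Trop_def over_def by (intro subsetD[OF closure_subset]) blast

text \<open>The translate of \<open>W\<close> through \<open>\<alpha>\<close> is closed and affine,
  so it absorbs first the closure in \<open>Trop\<close> and then the affine hull.\<close>

lemma direction_span_subset:
  assumes W: "subspace W" and one: "1 \<in> W" and \<delta>: "\<delta> > 0"
    and local: "\<And>\<gamma> P. over \<gamma> P \<Longrightarrow> P \<in> X \<Longrightarrow> \<gamma> \<in> ball \<alpha> \<delta> \<Longrightarrow> \<gamma> - \<alpha> \<in> W"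
  shows "direction_span (affine_tangent_space (Trop val X) \<alpha>) \<subseteq> W"
proof -
  let ?A = "(+) \<alpha> ` W"
  let ?S = "{\<gamma>. \<exists>x\<in>X \<inter> torus. trop_eq \<gamma> (trop_point val x)}"
  have closed: "closed ?A" by (intro closed_translation closed_subspace W)
  have aff: "affine ?A" by (intro affine_translation[THEN iffD1] subspace_imp_affine W)
  have mem: "x \<in> ?A \<longleftrightarrow> x - \<alpha> \<in> W" for x
  proof
    assume "x - \<alpha> \<in> W"
    then have "\<alpha> + (x - \<alpha>) \<in> ?A" by (rule imageI)
    then show "x \<in> ?A" by simp
  qed auto
  have "ball \<alpha> \<delta> \<inter> ?S \<subseteq> ?A"
  proof
    fix \<gamma> assume \<gamma>: "\<gamma> \<in> ball \<alpha> \<delta> \<inter> ?S"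
    then obtain P where "over \<gamma> P" "P \<in> X" by (auto simp: over_def)
    then show "\<gamma> \<in> ?A" unfolding mem using local \<gamma> by blast
  qed
  then have "closure (ball \<alpha> \<delta> \<inter> ?S) \<subseteq> ?A" using closed by (rule closure_minimal)
  then have "ball \<alpha> \<delta> \<inter> Trop val X \<subseteq> ?A"
    unfolding Trop_def using open_Int_closure_subset[of "ball \<alpha> \<delta>" ?S] by blast
  then have "affine hull (Trop val X \<inter> ball \<alpha> \<delta>) \<subseteq> ?A" using aff by (intro hull_minimal) auto
  then have "affine_tangent_space (Trop val X) \<alpha> \<subseteq> ?A"
    unfolding affine_tangent_space_def using \<delta> by (intro INF_lower2[of \<delta>]) auto
  then have "x - y \<in> W" if "x \<in> affine_tangent_space (Trop val X) \<alpha>" "y \<in> affine_tangent_space (Trop val X) \<alpha>" for x y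
    using subspace_diff[OF W, of "x - \<alpha>" "y - \<alpha>"] that mem by auto
  then show ?thesis
    unfolding direction_span_def tspan_def using one by (intro span_minimal W) auto
qed

definition pair_kernel :: "(nat \<Rightarrow> int ^ 'n) \<Rightarrow> (nat \<Rightarrow> int ^ 'n) \<Rightarrow> (real ^ 'n) set" where
  "pair_kernel p q = {x. \<forall>k\<in>{1..<n}. x \<bullet> lattice_vec (p k) = x \<bullet> lattice_vec (q k)}"

lemma subspace_pair_kernel: "subspace (pair_kernel p q)"
  by (simp add: subspace_def pair_kernel_def inner_add_left)

lemma edge_terms_lattice: "edge_terms \<alpha> p q \<Longrightarrow> k \<in> {1..<n} \<Longrightarrow> p k \<in> char_lattice \<and> q k \<in> char_lattice"
  using M_lattice[of k "p k" \<alpha>] M_lattice[of k "q k" \<alpha>] by (auto simp: edge_terms_def)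

lemma one_in_pair_kernel: "edge_terms \<alpha> p q \<Longrightarrow> 1 \<in> pair_kernel p q"
  by (auto simp: pair_kernel_def edge_terms_lattice inner_one_lattice_vec)

text \<open>The kernel is spanned by the all-ones vector and an edge direction \<open>y\<close>;
  choosing \<open>j\<close> with \<open>y_j\<close> different from \<open>y_i0\<close> makes the
  parameter row independent of the others. The column at \<open>row_of 0\<close> of the inverse is
  again an edge direction, so coordinates that agree on it agree on the whole kernel.\<close>

lemma edge_matrix:
  assumes edge: "edge_terms \<alpha> p q" and dim: "dim (pair_kernel p q) = 2"
  shows "\<exists>j (B :: rat ^ 'n ^ 'n). B ** of_int_matrix (lead_matrix (\<lambda>k. p k - q k) (axis j 1 - axis i0 1)) = mat 1 \<and>
    (\<forall>i i'. B $ i $ row_of 0 = B $ i' $ row_of 0 \<longrightarrow> (\<forall>x\<in>pair_kernel p q. x $ i = x $ i'))"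
proof -
  let ?L = "pair_kernel p q"
  have "\<exists>y\<in>?L. \<exists>j. y $ j \<noteq> y $ i0"
  proof (rule ccontr)
    assume const: "\<not> ?thesis"
    have "?L \<subseteq> span {1}"
    proof
      fix y assume y: "y \<in> ?L"
      have "y $ j = y $ i0" for j using const y by blast
      then have "y = (y $ i0) *\<^sub>R 1" by (simp only: vec_eq_iff vector_scaleR_component one_index) simp
      then show "y \<in> span {1}" unfolding span_singleton by (rule range_eqI)
    qed
    then have "dim ?L \<le> card {1 :: real ^ 'n}" by (intro dim_le_card) auto
    then show False using dim by simp
  qed
  then obtain y j where y: "y \<in> ?L" "y $ j \<noteq> y $ i0" by blast
  have y1: "y \<notin> span {1}" using y(2) by (auto simp: span_singleton)
  have "independent {y, 1}" using y1 by (simp add: independent_insert)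
  then have ind: "independent {1, y}" by (subst insert_commute)
  have "y \<noteq> 1" using y1 span_base[of 1 "{1 :: real ^ 'n}"] by auto
  then have card2: "card {1, y} = 2" by simp
  have L: "?L \<subseteq> span {1, y}"
  proof (rule card_ge_dim_independent[OF _ ind])
    show "{1, y} \<subseteq> ?L" using one_in_pair_kernel[OF edge] y(1) by simp
    show "dim ?L \<le> card {1, y}" using dim card2 by simp
  qed
  have comb: "\<exists>a b. x = a *\<^sub>R 1 + b *\<^sub>R y" if "x \<in> ?L" for x
  proof -
    have "x \<in> span {1, y}" using L that by blast
    then obtain a where "x - a *\<^sub>R 1 \<in> span {y}" by (auto simp: span_insert)
    then obtain b where "x - a *\<^sub>R 1 = b *\<^sub>R y" by (auto simp: span_singleton)
    then show ?thesis by (metis add.commute diff_add_cancel)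
  qed
  let ?r = "axis j 1 - axis i0 1 :: int ^ 'n"
  have lax: "lattice_vec (axis i 1) = (axis i 1 :: real ^ 'n)" for i
    by (simp add: lattice_vec_def axis_def vec_eq_iff)
  have rx: "x \<bullet> lattice_vec ?r = x $ j - x $ i0" for x
    by (simp add: lattice_vec_diff inner_diff_right lax inner_axis)
  have inL: "x \<in> ?L \<longleftrightarrow> (\<forall>k\<in>{1..<n}. x \<bullet> lattice_vec (p k - q k) = 0)" for x
    by (auto simp: pair_kernel_def lattice_vec_diff inner_diff_right)
  have "x = 0" if x: "of_int_matrix (lead_matrix (\<lambda>k. p k - q k) ?r) *v x = 0" for x :: "real ^ 'n"
  proof -
    have xL: "x \<in> ?L" "x $ j = x $ i0" "x $ i0 = 0"
      using x unfolding lead_matrix_kernel inL rx by auto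
    obtain a b where ab: "x = a *\<^sub>R 1 + b *\<^sub>R y" using comb[OF xL(1)] by blast
    have "b * (y $ j - y $ i0) = 0" using xL(2) unfolding ab by (simp add: algebra_simps)
    then have "b = 0" using y(2) by simp
    then show ?thesis using xL(3) ab by simp
  qed
  then obtain B :: "rat ^ 'n ^ 'n" where
    B: "B ** of_int_matrix (lead_matrix (\<lambda>k. p k - q k) ?r) = mat 1"
    using int_matrix_invertible by blast
  have "\<forall>x\<in>?L. x $ i = x $ i'" if eq: "B $ i $ row_of 0 = B $ i' $ row_of 0" for i i'
  proof -
    define \<omega> :: "real ^ 'n" where "\<omega> = (\<chi> i. of_rat (B $ i $ row_of 0))"
    have A\<omega>: "of_int_matrix (lead_matrix (\<lambda>k. p k - q k) ?r) *v \<omega> = axis (row_of 0) 1"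
      unfolding \<omega>_def by (rule of_int_matrix_column[OF B])
    have val: "\<omega> \<bullet> lattice_vec (lead_matrix (\<lambda>k. p k - q k) ?r $ l) = axis (row_of 0) 1 $ l" for l
      unfolding of_int_matrix_mult_real[symmetric] A\<omega> ..
    have "\<omega> \<bullet> lattice_vec (p k - q k) = 0" if k: "k \<in> {1..<n}" for k
    proof -
      have "row_of k \<noteq> row_of 0" using k idx_row[of k] idx_row[of 0] by auto
      then show ?thesis using val[of "row_of k"] k by (simp add: lead_matrix_row axis_def)
    qed
    then have \<omega>L: "\<omega> \<in> ?L" using inL by blast
    have \<omega>r: "\<omega> $ j - \<omega> $ i0 = 1" using val[of "row_of 0"] by (simp add: lead_matrix_row rx)
    obtain a b where ab: "\<omega> = a *\<^sub>R 1 + b *\<^sub>R y" using comb[OF \<omega>L] by blast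
    have "b \<noteq> 0" using \<omega>r unfolding ab by auto
    moreover have "\<omega> $ i = \<omega> $ i'" using eq by (simp add: \<omega>_def)
    ultimately have "y $ i = y $ i'" unfolding ab by simp
    then show ?thesis using comb by (metis vector_add_component vector_scaleR_component one_index)
  qed
  with B show ?thesis by blast
qed

lemma edge_point_in_Trop:
  assumes edge: "edge_terms \<gamma> p q" and dim: "dim (pair_kernel p q) = 2" and rat: "val_rational val \<gamma>"
  shows "\<exists>P. over \<gamma> P \<and> P \<in> X"
proof -
  obtain j and B :: "rat ^ 'n ^ 'n" where "B ** of_int_matrix (lead_matrix (\<lambda>k. p k - q k) (axis j 1 - axis i0 1)) = mat 1"
    using edge_matrix[OF edge dim] by blast
  from edge_lift[OF edge rat refl this] show ?thesis .
qed

text \<open>Near \<open>\<alpha>\<close> all points of the tropical curve lie in the direction of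
  the edge. Applied to complements of pairs, hypothesis \<open>gen\<close> therefore says that the
  coordinates of the edge direction are pairwise distinct, as \<open>edge_frame_vector\<close>
  requires.\<close>

lemma edge_case:
  assumes edge: "edge_terms \<alpha> p q" and dim: "dim (pair_kernel p q) = 2"
    and ne: "\<And>k. k \<in> {1..<n} \<Longrightarrow> supp k \<noteq> {}"
    and gen: "\<And>J :: 'n set. card J + 1 = n \<Longrightarrow>
      \<not> direction_span (affine_tangent_space (Trop val X) \<alpha>) \<subseteq> coord_span J"
  shows "val_rational val \<alpha> \<longrightarrow> (\<exists>\<beta>. tropical_tangent val X \<alpha> \<beta>)"
    and "tropical_tangent val X \<alpha> \<beta> \<Longrightarrow> \<exists>c. \<forall>I. card I = 2 \<longrightarrow> \<beta> I = (\<Sum>j\<in>-I. - \<alpha> $ j) + c"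
proof -
  obtain j and B :: "rat ^ 'n ^ 'n" where
    B: "B ** of_int_matrix (lead_matrix (\<lambda>k. p k - q k) (axis j 1 - axis i0 1)) = mat 1"
    and eqB: "\<And>i i' x. B $ i $ row_of 0 = B $ i' $ row_of 0 \<Longrightarrow> x \<in> pair_kernel p q \<Longrightarrow> x $ i = x $ i'"
    using edge_matrix[OF edge dim] by blast
  let ?r = "axis j 1 - axis i0 1 :: int ^ 'n"
  have r: "?r \<in> char_lattice" by (simp add: char_lattice_def sum_subtractf axis_def)
  obtain \<delta> where \<delta>: "\<delta> > 0" "\<forall>\<gamma>\<in>ball \<alpha> \<delta>. \<forall>k\<in>{1..<n}. M k \<gamma> \<subseteq> M k \<alpha>"
    using min_terms_local_finite[of "{1..<n}"] by blast
  have dirs: "direction_span (affine_tangent_space (Trop val X) \<alpha>) \<subseteq> pair_kernel p q"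
  proof (rule direction_span_subset[OF subspace_pair_kernel one_in_pair_kernel[OF edge] \<delta>(1)])
    fix \<gamma> P assume P: "over \<gamma> P" "P \<in> X" and \<gamma>: "\<gamma> \<in> ball \<alpha> \<delta>"
    have "(\<gamma> - \<alpha>) \<bullet> lattice_vec (p k) = (\<gamma> - \<alpha>) \<bullet> lattice_vec (q k)" if k: "k \<in> {1..<n}" for k
    proof -
      have M\<alpha>: "M k \<alpha> = {p k, q k}" "p k \<noteq> q k" using edge k by (auto simp: edge_terms_def)
      have "M k \<gamma> \<subseteq> {p k, q k}" using \<delta>(2) \<gamma> k M\<alpha> by blast
      moreover have "card (M k \<gamma>) \<ge> 2" by (rule on_curve_card_M[OF P k ne])
      moreover have "card {p k, q k} = 2" using M\<alpha>(2) by simp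
      ultimately have "M k \<gamma> = {p k, q k}" by (intro card_seteq) auto
      then have "tval k \<gamma> (p k) = tval k \<gamma> (q k)" by (intro M_eq) auto
      moreover have "tval k \<alpha> (p k) = tval k \<alpha> (q k)" using M\<alpha>(1) by (intro M_eq) auto
      ultimately show ?thesis by (simp add: term_val_def inner_diff_left)
    qed
    then show "\<gamma> - \<alpha> \<in> pair_kernel p q" by (simp add: pair_kernel_def)
  qed
  have distinct: "B $ i $ row_of 0 \<noteq> B $ i' $ row_of 0" if "i \<noteq> i'" for i i'
  proof
    assume "B $ i $ row_of 0 = B $ i' $ row_of 0"
    then have "pair_kernel p q \<subseteq> coord_span (- {i, i'})"
      using eqB coord_span_compl_pair by blast
    moreover have "card (- {i, i'}) + 1 = n"
      using that card_UNIV_n n1 by (simp add: Compl_eq_Diff_UNIV card_Diff_subset)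
    ultimately show False using gen[of "- {i, i'}"] dirs by blast
  qed
  note frame_vector = edge_frame_vector[OF edge r B distinct]
  show "\<exists>c. \<forall>I. card I = 2 \<longrightarrow> \<beta> I = (\<Sum>j\<in>-I. - \<alpha> $ j) + c" if "tropical_tangent val X \<alpha> \<beta>"
  proof -
    from that obtain P y z c where P: "P \<in> torus" "curve_smooth_at X P" "trop_eq \<alpha> (trop_point val P)"
      "tangent_space X P = vec.span {y, z}"
      and \<beta>: "\<forall>i j. i \<noteq> j \<and> \<not> gauss_vanishing X i j \<longrightarrow>
           pluecker y z i j \<noteq> 0 \<and> \<beta> {i, j} = v (pluecker y z i j) + c"
      unfolding tropical_tangent_def by (elim exE conjE) (rule that)
    have P': "P \<in> X" "over \<alpha> P" using P by (auto simp: over_def curve_smooth_at_def)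
    obtain \<tau> w where fr: "integral_frame \<tau> ?r P" and w: "log_matrix \<tau> ?r P *v w = axis (row_of 0) 1"
      and unit: "\<And>i j. i \<noteq> j \<Longrightarrow> w $ i \<noteq> w $ j \<and> v (w $ i - w $ j) = 0"
      using frame_vector[OF _ P'] by blast
    obtain c' where c': "\<And>i j. i \<noteq> j \<Longrightarrow> w $ i \<noteq> w $ j \<longrightarrow>
        v (pluecker y z i j) = v (w $ i - w $ j) + (\<Sum>m\<in>-{i, j}. - \<alpha> $ m) + c'"
      using tangent_rval[OF fr P' w P(4)] by blast
    have "\<beta> I = (\<Sum>j\<in>-I. - \<alpha> $ j) + (c' + c)" if "card I = 2" for I
    proof -
      obtain i j where I: "I = {i, j}" "i \<noteq> j" using \<open>card I = 2\<close> by (meson card_2_iff)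
      have "\<not> gauss_vanishing X i j"
        using not_gauss_vanishing_if_frame_vector[OF fr P'(1) w] unit[OF I(2)] by blast
      then show ?thesis using \<beta> c'[OF I(2)] unit[OF I(2)] I by simp
    qed
    then show ?thesis by blast
  qed
  show "val_rational val \<alpha> \<longrightarrow> (\<exists>\<beta>. tropical_tangent val X \<alpha> \<beta>)"
  proof
    assume rat: "val_rational val \<alpha>"
    obtain P where P: "P \<in> X" "over \<alpha> P" using edge_lift[OF edge rat refl B] by blast
    obtain \<tau> w where fr: "integral_frame \<tau> ?r P" and w: "log_matrix \<tau> ?r P *v w = axis (row_of 0) 1"
      and unit: "\<And>i j. i \<noteq> j \<Longrightarrow> w $ i \<noteq> w $ j \<and> v (w $ i - w $ j) = 0"
      using frame_vector[OF _ P] by blast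
    have "tropical_tangent val X \<alpha> (\<lambda>I. (\<Sum>m\<in>-I. - \<alpha> $ m))"
      by (rule tropical_tangentI[OF fr P w, where c = 0]) (use unit in simp)
    then show "\<exists>\<beta>. tropical_tangent val X \<alpha> \<beta>" by blast
  qed
qed

end

section \<open>Counting minimal terms through codimensions\<close>

lemma sum_eq_card_imp_one:
  fixes c :: "'a \<Rightarrow> int"
  assumes "finite K" and "\<And>k. k \<in> K \<Longrightarrow> c k \<ge> 1" and "sum c K = int (card K)" and "k \<in> K"
  shows "c k = 1"
proof -
  have "(\<Sum>k\<in>K. c k - 1) = 0" using assms(3) by (simp add: sum_subtractf)
  then have "c k - 1 = 0"
    using sum_nonneg_eq_0_iff[OF assms(1), of "\<lambda>k. c k - 1"] assms(2,4) by force
  then show ?thesis by simp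
qed

text \<open>The excesses \<open>c k - 1\<close> are nonnegative integers with sum 1.\<close>

lemma sum_eq_Suc_card_imp:
  fixes c :: "'a \<Rightarrow> int"
  assumes fin: "finite K" and ge: "\<And>k. k \<in> K \<Longrightarrow> c k \<ge> 1" and sum: "sum c K = int (card K) + 1"
  shows "\<exists>k0\<in>K. c k0 = 2 \<and> (\<forall>k\<in>K. k \<noteq> k0 \<longrightarrow> c k = 1)"
proof -
  have 1: "(\<Sum>k\<in>K. c k - 1) = 1" using sum by (simp add: sum_subtractf)
  have "\<exists>k0\<in>K. c k0 - 1 \<noteq> 0"
  proof (rule ccontr)
    assume "\<not> ?thesis"
    then have "(\<Sum>k\<in>K. c k - 1) = 0" by (intro sum.neutral) blast
    then show False using 1 by simp
  qed
  then obtain k0 where k0: "k0 \<in> K" "c k0 - 1 \<noteq> 0" by blast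
  have "c k0 - 1 + (\<Sum>k\<in>K - {k0}. c k - 1) = 1" using 1 fin k0(1) by (simp add: sum.remove)
  moreover have "(\<Sum>k\<in>K - {k0}. c k - 1) \<ge> 0"
    using ge by (intro sum_nonneg) (metis DiffD1 diff_ge_0_iff_ge)
  ultimately have "c k0 = 2" and 0: "(\<Sum>k\<in>K - {k0}. c k - 1) = 0" using ge[OF k0(1)] k0(2) by linarith+
  have nn: "c k - 1 \<ge> 0" if "k \<in> K - {k0}" for k using ge[of k] that by simp
  have "\<forall>k\<in>K - {k0}. c k - 1 = 0"
    by (rule iffD1[OF sum_nonneg_eq_0_iff[of "K - {k0}" "\<lambda>k. c k - 1"] 0]) (use fin nn in blast)+
  then have "c k = 1" if "k \<in> K" "k \<noteq> k0" for k using that by fastforce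
  with \<open>c k0 = 2\<close> k0(1) show ?thesis by blast
qed

context torus_curve
begin

abbreviation "L \<alpha> \<equiv> cell_directions val {1..<n} f (\<lambda>_. \<alpha>)"

lemma edge_terms_kernel:
  assumes "\<And>k. k \<in> {1..<n} \<Longrightarrow> M k (\<gamma> k) = {p k, q k}"
  shows "cell_directions val {1..<n} f \<gamma> = pair_kernel p q"
proof (intro equalityI subsetI)
  fix x assume x: "x \<in> cell_directions val {1..<n} f \<gamma>"
  have "x \<bullet> lattice_vec (p k) = x \<bullet> lattice_vec (q k)" if k: "k \<in> {1..<n}" for k
    using cell_directionsD[OF x k, of "p k" "q k"] assms[OF k] by simp
  then show "x \<in> pair_kernel p q" by (simp add: pair_kernel_def)
next
  fix x assume x: "x \<in> pair_kernel p q"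
  show "x \<in> cell_directions val {1..<n} f \<gamma>"
  proof (rule cell_directionsI)
    fix k u w assume k: "k \<in> {1..<n}" and uw: "u \<in> M k (\<gamma> k)" "w \<in> M k (\<gamma> k)"
    have "x \<bullet> lattice_vec (p k) = x \<bullet> lattice_vec (q k)" using x k by (simp add: pair_kernel_def)
    then show "x \<bullet> lattice_vec u = x \<bullet> lattice_vec w" using uw assms[OF k] by auto
  qed
qed

lemma one_in_L: "1 \<in> cell_directions val {1..<n} f \<gamma>"
  by (rule cell_directionsI) (simp add: inner_one_lattice_vec[OF M_lattice])

end

locale trop_setup = torus_curve val X f n idx i0
  for val :: "'k::{alg_closed_field, field_char_0} \<Rightarrow> ereal"
    and X :: "('k ^ 'n::finite) set" and f n idx i0 +
  assumes ne: "\<And>k. k \<in> {1..<n} \<Longrightarrow> supp k \<noteq> {}"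
    and smooth: "\<And>k. k \<in> {1..<n} \<Longrightarrow> tropically_smooth val (f k)"
    and tci: "tropical_complete_intersection val {1..<n} f"
begin

lemma codim_intersection:
  assumes \<beta>: "\<And>k. k \<in> {1..<n} \<Longrightarrow> card (M k (\<beta> k)) \<ge> 2"
    and nonempty: "(\<Inter>k\<in>{1..<n}. cell_of val (f k) (\<beta> k)) \<noteq> {}"
  shows "codim (\<Inter>k\<in>{1..<n}. cell_of val (f k) (\<beta> k)) = (\<Sum>k\<in>{1..<n}. int (card (M k (\<beta> k))) - 1)"
proof -
  have cells: "\<forall>k\<in>{1..<n}. cell_of val (f k) (\<beta> k) \<in> hypersurface_cells val (f k)"
    using \<beta> by (auto simp: hypersurface_cells_def trop_hypersurface_def)
  have "(\<Inter>k\<in>{1..<n}. cell_of val (f k) (\<beta> k)) = {} \<or>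
      codim (\<Inter>k\<in>{1..<n}. cell_of val (f k) (\<beta> k)) = (\<Sum>k\<in>{1..<n}. codim (cell_of val (f k) (\<beta> k)))"
    by (rule mp[OF spec[OF tci[unfolded tropical_complete_intersection_def]] cells])
  with nonempty have "codim (\<Inter>k\<in>{1..<n}. cell_of val (f k) (\<beta> k)) = (\<Sum>k\<in>{1..<n}. codim (cell_of val (f k) (\<beta> k)))"
    by satx
  also have "\<dots> = (\<Sum>k\<in>{1..<n}. int (card (M k (\<beta> k))) - 1)"
    by (intro sum.cong refl codim_cell smooth lattice ne)
  finally show ?thesis .
qed

lemma dim_L:
  assumes "\<And>k. k \<in> {1..<n} \<Longrightarrow> card (M k \<alpha>) \<ge> 2"
  shows "int n + 1 - int (dim (L \<alpha>)) = (\<Sum>k\<in>{1..<n}. int (card (M k \<alpha>)) - 1)"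
proof -
  have "\<alpha> \<in> (\<Inter>k\<in>{1..<n}. cell_of val (f k) \<alpha>)" by simp
  then have nonempty: "(\<Inter>k\<in>{1..<n}. cell_of val (f k) \<alpha>) \<noteq> {}"
    by (rule ex_in_conv[THEN iffD1, OF exI])
  have "codim (\<Inter>k\<in>{1..<n}. cell_of val (f k) \<alpha>) = (\<Sum>k\<in>{1..<n}. int (card (M k \<alpha>)) - 1)"
    by (rule codim_intersection[OF assms nonempty])
  then show ?thesis
    using aff_dim_cell[of "{1..<n}" f val \<alpha>] ne by (simp add: codim_def card_UNIV_n)
qed

lemma intersection_cellE:
  assumes "E \<in> intersection_cells val {1..<n} f" and "\<alpha> \<in> E"
  obtains \<beta> where "E = (\<Inter>k\<in>{1..<n}. cell_of val (f k) (\<beta> k))"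
    and "\<And>k. k \<in> {1..<n} \<Longrightarrow> card (M k (\<beta> k)) \<ge> 2"
    and "\<And>k. k \<in> {1..<n} \<Longrightarrow> M k (\<beta> k) \<subseteq> M k \<alpha>"
    and "\<And>k. k \<in> {1..<n} \<Longrightarrow> card (M k \<alpha>) \<ge> 2"
    and "codim E = (\<Sum>k\<in>{1..<n}. int (card (M k (\<beta> k))) - 1)"
proof -
  obtain C where C: "E = (\<Inter>k\<in>{1..<n}. C k)" "\<forall>k\<in>{1..<n}. C k \<in> hypersurface_cells val (f k)"
    using assms(1) by (auto simp: intersection_cells_def)
  have "\<forall>k\<in>{1..<n}. \<exists>b. card (M k b) \<ge> 2 \<and> C k = cell_of val (f k) b"
    using C(2) by (auto simp: hypersurface_cells_def trop_hypersurface_def)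
  from bchoice[OF this] obtain \<beta> where
    \<beta>: "\<forall>k\<in>{1..<n}. card (M k (\<beta> k)) \<ge> 2 \<and> C k = cell_of val (f k) (\<beta> k)" by (rule exE)
  have E: "E = (\<Inter>k\<in>{1..<n}. cell_of val (f k) (\<beta> k))" unfolding C(1) using \<beta> by (intro INF_cong) auto
  have sub: "M k (\<beta> k) \<subseteq> M k \<alpha>" if "k \<in> {1..<n}" for k using assms(2) that unfolding E by blast
  have "card (M k \<alpha>) \<ge> 2" if "k \<in> {1..<n}" for k
    using card_mono[OF finite_M sub[OF that]] \<beta> that by fastforce
  moreover have "codim E = (\<Sum>k\<in>{1..<n}. int (card (M k (\<beta> k))) - 1)"
  proof -
    have "(\<Inter>k\<in>{1..<n}. cell_of val (f k) (\<beta> k)) \<noteq> {}"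
      using assms(2) unfolding E by (rule ex_in_conv[THEN iffD1, OF exI])
    then show ?thesis unfolding E using \<beta> by (intro codim_intersection) simp_all
  qed
  ultimately show thesis using that[OF E _ sub] \<beta> by blast
qed

text \<open>From a relative interior point one can step away from any \<open>\<gamma>\<close> in the
  edge without leaving it. As terms are affine along this line, those minimal at
  \<open>\<alpha>\<close> remain minimal at \<open>\<gamma>\<close>; so the edge is the closed cell
  of \<open>\<alpha>\<close>.\<close>

lemma edge_interior:
  assumes E: "E \<in> trop_edges val {1..<n} f" and \<alpha>: "\<alpha> \<in> rel_interior E"
  shows "\<exists>p q. edge_terms \<alpha> p q \<and> dim (pair_kernel p q) = 2"
proof -
  have Ei: "E \<in> intersection_cells val {1..<n} f" and dimE: "aff_dim E = 2"
    using E by (auto simp: trop_edges_def)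
  obtain e where e: "\<alpha> \<in> E" "e > 0" "ball \<alpha> e \<inter> affine hull E \<subseteq> E"
    using \<alpha> unfolding mem_rel_interior_ball by blast
  obtain \<beta> where \<beta>: "E = (\<Inter>k\<in>{1..<n}. cell_of val (f k) (\<beta> k))"
    "\<And>k. k \<in> {1..<n} \<Longrightarrow> card (M k (\<beta> k)) \<ge> 2"
    "\<And>k. k \<in> {1..<n} \<Longrightarrow> M k (\<beta> k) \<subseteq> M k \<alpha>"
    and card: "\<And>k. k \<in> {1..<n} \<Longrightarrow> card (M k \<alpha>) \<ge> 2"
    by (rule intersection_cellE[OF Ei e(1)]) (rule that)
  have sup: "M k \<alpha> \<subseteq> M k \<gamma>" if \<gamma>: "\<gamma> \<in> E" and k: "k \<in> {1..<n}" for \<gamma> k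
  proof
    fix u assume u: "u \<in> M k \<alpha>"
    have "M k (\<beta> k) \<noteq> {}" using \<beta>(2)[OF k] by auto
    then obtain w where w: "w \<in> M k (\<beta> k)" by blast
    then have w\<gamma>: "w \<in> M k \<gamma>" "w \<in> M k \<alpha>" using \<gamma> k \<beta>(1,3) by auto
    define N where "N = norm (\<gamma> - \<alpha>) + 1"
    have N: "N > 0" by (simp add: N_def add_nonneg_pos)
    define t where "t = e / (2 * N)"
    have t: "t > 0" using e(2) N by (simp add: t_def)
    \<comment> \<open>The point slightly beyond \<open>\<alpha>\<close> as seen from
      \<open>\<gamma>\<close>; \<open>t\<close> keeps it inside the ball of radius
      \<open>e\<close>.\<close>
    define y where "y = \<alpha> + (- t) *\<^sub>R (\<gamma> - \<alpha>)"
    have "t * norm (\<gamma> - \<alpha>) < e"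
    proof -
      have "t * norm (\<gamma> - \<alpha>) \<le> t * N" using t by (simp add: N_def)
      also have "\<dots> = e / 2" using N by (simp add: t_def)
      finally show ?thesis using e(2) by simp
    qed
    then have "y \<in> ball \<alpha> e" using t by (simp add: y_def dist_norm)
    moreover have "y \<in> affine hull E"
    proof -
      have "(1 + t) *\<^sub>R \<alpha> + (- t) *\<^sub>R \<gamma> \<in> affine hull E"
        using \<gamma> e(1) by (intro mem_affine[OF affine_affine_hull]) (auto intro: hull_inc)
      then show ?thesis by (simp add: y_def algebra_simps)
    qed
    ultimately have "y \<in> E" using e(3) by blast
    then have "w \<in> M k y" using w k \<beta>(1) by auto
    then have "tval k y w \<le> tval k y u" using M_le M_supp[OF u] by blast
    moreover have "tval k y s = tval k \<alpha> s - t * ((\<gamma> - \<alpha>) \<bullet> lattice_vec s)" for s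
      unfolding y_def term_val_add inner_scaleR_left by simp
    ultimately have "t * ((\<gamma> - \<alpha>) \<bullet> lattice_vec u) \<le> t * ((\<gamma> - \<alpha>) \<bullet> lattice_vec w)"
      using M_eq[OF u w\<gamma>(2)] by simp
    then have "(\<gamma> - \<alpha>) \<bullet> lattice_vec u \<le> (\<gamma> - \<alpha>) \<bullet> lattice_vec w" using t by simp
    then have "tval k \<gamma> u \<le> tval k \<gamma> w"
      using M_eq[OF u w\<gamma>(2)] by (simp add: term_val_def inner_diff_left)
    then show "u \<in> M k \<gamma>"
      using w\<gamma>(1) M_supp[OF u] by (auto simp: min_terms_def intro: order_trans)
  qed
  have "E = (\<Inter>k\<in>{1..<n}. cell_of val (f k) \<alpha>)"
  proof
    show "E \<subseteq> (\<Inter>k\<in>{1..<n}. cell_of val (f k) \<alpha>)" using sup by blast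
    show "(\<Inter>k\<in>{1..<n}. cell_of val (f k) \<alpha>) \<subseteq> E" unfolding \<beta>(1) using \<beta>(3) by blast
  qed
  then have dim2: "dim (L \<alpha>) = 2"
    using aff_dim_cell[of "{1..<n}" f val \<alpha>] ne dimE by simp
  \<comment> \<open>Codimension \<open>n - 1\<close> is shared by \<open>n - 1\<close> equations
    that contribute at least 1 each.\<close>
  have "(\<Sum>k\<in>{1..<n}. int (card (M k \<alpha>)) - 1) = int (card {1..<n})"
    using dim_L[OF card] dim2 n1 by simp
  then have one: "int (card (M k \<alpha>)) - 1 = 1" if "k \<in> {1..<n}" for k
    by (rule sum_eq_card_imp_one[OF _ _ _ that, rotated 2]) (use card in force)+
  have "\<forall>k\<in>{1..<n}. \<exists>p q. M k \<alpha> = {p, q} \<and> p \<noteq> q"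
  proof
    fix k assume "k \<in> {1..<n}"
    then have "card (M k \<alpha>) = 2" using one[of k] by simp
    then show "\<exists>p q. M k \<alpha> = {p, q} \<and> p \<noteq> q" by (simp only: card_2_iff)
  qed
  then obtain p q where pq: "\<forall>k\<in>{1..<n}. M k \<alpha> = {p k, q k} \<and> p k \<noteq> q k" by metis
  then have "edge_terms \<alpha> p q" by (simp add: edge_terms_def)
  moreover have "L \<alpha> = pair_kernel p q" using pq by (intro edge_terms_kernel) auto
  ultimately show ?thesis using dim2 by (intro exI[of _ p] exI[of _ q]) simp
qed

text \<open>Codimension \<open>n\<close> is shared by \<open>n - 1\<close> equations that contribute
  at least 1 each, so exactly one contributes 2 and has three minimal terms.\<close>

lemma vertex_data:
  assumes V: "V \<in> trop_vertices val {1..<n} f" and \<alpha>: "\<alpha> \<in> V"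
  shows "\<exists>k0 u1 u2 u3 p q B \<rho>. vertex_setup val X f n idx i0 \<alpha> k0 u1 u2 u3 p q B \<rho>"
proof -
  have Vi: "V \<in> intersection_cells val {1..<n} f" and dimV: "aff_dim V = 1"
    using V by (auto simp: trop_vertices_def)
  obtain \<beta> where \<beta>: "V = (\<Inter>k\<in>{1..<n}. cell_of val (f k) (\<beta> k))"
    "\<And>k. k \<in> {1..<n} \<Longrightarrow> M k (\<beta> k) \<subseteq> M k \<alpha>"
    and card: "\<And>k. k \<in> {1..<n} \<Longrightarrow> card (M k \<alpha>) \<ge> 2"
    by (rule intersection_cellE[OF Vi \<alpha>]) (rule that)
  have "(\<Inter>k\<in>{1..<n}. cell_of val (f k) \<alpha>) \<subseteq> V" unfolding \<beta>(1) using \<beta>(2) by blast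
  from aff_dim_subset[OF this] have le: "dim (L \<alpha>) \<le> 1"
    using aff_dim_cell[of "{1..<n}" f val \<alpha>] ne dimV by simp
  have one: "1 \<in> L \<alpha>" by (rule one_in_L)
  have "(1 :: real ^ 'n) \<noteq> 0" by (simp add: vec_eq_iff)
  then have ind: "independent {1 :: real ^ 'n}" by simp
  have L1: "L \<alpha> \<subseteq> span {1}"
  proof (rule card_ge_dim_independent[OF _ ind])
    show "{1} \<subseteq> L \<alpha>" using one by simp
    show "dim (L \<alpha>) \<le> card {1 :: real ^ 'n}" using le by simp
  qed
  have "dim (L \<alpha>) \<ge> 1"
    using independent_card_le_dim[of "{1}" "L \<alpha>"] one ind by simp
  with le have "dim (L \<alpha>) = 1" by simp
  then have "(\<Sum>k\<in>{1..<n}. int (card (M k \<alpha>)) - 1) = int (card {1..<n}) + 1"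
    using dim_L[OF card] n1 by simp
  then obtain k0 where k0: "k0 \<in> {1..<n}" "int (card (M k0 \<alpha>)) - 1 = 2"
    and others: "\<And>k. k \<in> {1..<n} \<Longrightarrow> k \<noteq> k0 \<Longrightarrow> int (card (M k \<alpha>)) - 1 = 1"
    using sum_eq_Suc_card_imp[of "{1..<n}" "\<lambda>k. int (card (M k \<alpha>)) - 1"] card by force
  have "card (M k0 \<alpha>) = 3" using k0(2) by simp
  then obtain u1 u2 u3 where u: "M k0 \<alpha> = {u1, u2, u3}" "u1 \<noteq> u2" "u2 \<noteq> u3" "u1 \<noteq> u3"
    by (metis card_3_iff)
  have "\<forall>k\<in>{1..<n} - {k0}. \<exists>p q. M k \<alpha> = {p, q} \<and> p \<noteq> q"
  proof
    fix k assume "k \<in> {1..<n} - {k0}"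
    then have "card (M k \<alpha>) = 2" using others[of k] by simp
    then show "\<exists>p q. M k \<alpha> = {p, q} \<and> p \<noteq> q" by (simp only: card_2_iff)
  qed
  then obtain p' q' where pq': "\<forall>k\<in>{1..<n} - {k0}. M k \<alpha> = {p' k, q' k} \<and> p' k \<noteq> q' k" by metis
  define p where "p = p'(k0 := u2)"
  define q where "q = q'(k0 := u3)"
  have pq: "M k \<alpha> = {p k, q k} \<and> p k \<noteq> q k" if "k \<in> {1..<n}" "k \<noteq> k0" for k
    using pq' that by (simp add: p_def q_def)
  have pq0: "p k0 = u2" "q k0 = u3" by (auto simp: p_def q_def)
  \<comment> \<open>A kernel vector preserves all ties at the vertex, hence is a multiple of the
    all-ones vector; the row of \<open>i0\<close> then makes it zero.\<close>
  have "x = 0" if x: "of_int_matrix (lead_matrix (\<lambda>k. p k - q k) (u1 - u2)) *v x = 0" for x :: "real ^ 'n"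
  proof -
    have x1: "x \<bullet> lattice_vec (p k) = x \<bullet> lattice_vec (q k)" if "k \<in> {1..<n}" for k
      using x that unfolding lead_matrix_kernel by (auto simp: lattice_vec_diff inner_diff_right)
    have x2: "x \<bullet> lattice_vec u1 = x \<bullet> lattice_vec u2" "x $ i0 = 0"
      using x unfolding lead_matrix_kernel by (auto simp: lattice_vec_diff inner_diff_right)
    have "x \<in> L \<alpha>"
    proof (rule cell_directionsI)
      fix k s t assume k: "k \<in> {1..<n}" and st: "s \<in> M k \<alpha>" "t \<in> M k \<alpha>"
      show "x \<bullet> lattice_vec s = x \<bullet> lattice_vec t"
        using x1[OF k] x1[OF k0(1)] x2(1) pq[OF k] pq0 u(1) st by (cases "k = k0") auto
    qed
    then obtain t where "x = t *\<^sub>R 1" using L1 by (auto simp: span_singleton)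
    then show ?thesis using x2(2) by simp
  qed
  then obtain B :: "rat ^ 'n ^ 'n" where
    B: "B ** of_int_matrix (lead_matrix (\<lambda>k. p k - q k) (u1 - u2)) = mat 1"
    using int_matrix_invertible by blast
  obtain \<rho> where \<rho>: "gap \<alpha> \<rho>" using ex_gap by blast
  have "vertex_setup val X f n idx i0 \<alpha> k0 u1 u2 u3 p q B \<rho>"
    by unfold_locales (use k0 u pq pq0 B \<rho> in auto)
  then show ?thesis by blast
qed

end

section \<open>The tropical curve near a vertex\<close>

context alg_closed_valued
begin

lemma value_group_diff: "g \<in> value_group val \<Longrightarrow> h \<in> value_group val \<Longrightarrow> g - h \<in> value_group val"
proof -
  assume "g \<in> value_group val" "h \<in> value_group val"
  then obtain x y where "x \<noteq> 0" "g = v x" "y \<noteq> 0" "h = v y" by (auto simp: value_group_def)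
  then have "g - h = v (x / y)" "x / y \<noteq> 0" by (auto simp: rval_divide)
  then show ?thesis unfolding value_group_def by blast
qed

lemma value_group_add: "g \<in> value_group val \<Longrightarrow> h \<in> value_group val \<Longrightarrow> g + h \<in> value_group val"
proof -
  assume "g \<in> value_group val" "h \<in> value_group val"
  then obtain x y where "x \<noteq> 0" "g = v x" "y \<noteq> 0" "h = v y" by (auto simp: value_group_def)
  then have "g + h = v (x * y)" "x * y \<noteq> 0" by (auto simp: rval_mult)
  then show ?thesis unfolding value_group_def by blast
qed

text \<open>Roots exist in an algebraically closed field, so the value group is divisible.\<close>

lemma value_group_rat_mult:
  assumes "g \<in> value_group val"
  shows "of_rat q * g \<in> value_group val"
proof -
  obtain x where x: "x \<noteq> 0" "g = v x" using assms by (auto simp: value_group_def)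
  obtain a b where q: "q = Rat.Fract a b" "b > 0" by (cases q) auto
  obtain y where y: "y ^ nat b = x powi a" using nth_root_exists[of "nat b" "x powi a"] q(2) by auto
  have y0: "y \<noteq> 0"
  proof
    assume "y = 0"
    then have "x powi a = 0" using y q(2) by (simp add: power_0_left)
    then show False using x(1) by simp
  qed
  have "of_int b * v y = of_int a * v x"
    using arg_cong[OF y, of v] q(2) x(1) y0 by (simp add: rval_power rval_powi)
  then have "of_rat q * g = v y" using q x(2) by (simp add: of_rat_rat field_simps)
  then show ?thesis using y0 unfolding value_group_def by blast
qed

end

locale trop_vertex = trop_setup val X f n idx i0 + vertex_setup val X f n idx i0 \<alpha> k0 u1 u2 u3 p q B \<rho>
  for val :: "'k::{alg_closed_field, field_char_0} \<Rightarrow> ereal"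
    and X :: "('k ^ 'n::finite) set" and f n idx i0 \<alpha> k0 u1 u2 u3 p q B \<rho>
begin

definition of_rat_vec :: "('n \<Rightarrow> rat) \<Rightarrow> real ^ 'n" where
  "of_rat_vec w = (\<chi> i. of_rat (w i))"

definition "\<Omega>1 = of_rat_vec om1"
definition "\<Omega>2 = of_rat_vec om2"

text \<open>Only the equations with two minimal terms impose conditions. Modulo the all-ones vector
  this is a plane, the one that contains the three edges at the vertex.\<close>

definition W :: "(real ^ 'n) set" where
  "W = {x. \<forall>k\<in>{1..<n}. k \<noteq> k0 \<longrightarrow> x \<bullet> lattice_vec (p k) = x \<bullet> lattice_vec (q k)}"

lemma Omega_eval:
  "\<Omega>1 \<bullet> lattice_vec (A $ l) = axis (row_of 0) 1 $ l"
  "\<Omega>2 \<bullet> lattice_vec (A $ l) = axis (row_of k0) 1 $ l"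
proof -
  have "of_int_matrix A *v \<Omega>1 = axis (row_of 0) 1" "of_int_matrix A *v \<Omega>2 = axis (row_of k0) 1"
    unfolding \<Omega>1_def \<Omega>2_def of_rat_vec_def om1_def om2_def by (rule of_int_matrix_column[OF B])+
  then show "\<Omega>1 \<bullet> lattice_vec (A $ l) = axis (row_of 0) 1 $ l"
    "\<Omega>2 \<bullet> lattice_vec (A $ l) = axis (row_of k0) 1 $ l"
    by (simp_all only: of_int_matrix_mult_real[symmetric])
qed

lemma Omega_props:
  "\<Omega>1 \<bullet> lattice_vec u1 = \<Omega>1 \<bullet> lattice_vec u2 + 1" "\<Omega>1 \<bullet> lattice_vec u2 = \<Omega>1 \<bullet> lattice_vec u3"
  "\<Omega>2 \<bullet> lattice_vec u1 = \<Omega>2 \<bullet> lattice_vec u2" "\<Omega>2 \<bullet> lattice_vec u2 = \<Omega>2 \<bullet> lattice_vec u3 + 1"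
  "\<Omega>1 \<in> W" "\<Omega>2 \<in> W" "\<Omega>1 $ i0 = 0" "\<Omega>2 $ i0 = 0"
proof -
  have ax: "x \<bullet> lattice_vec (axis i0 1) = x $ i0" for x :: "real ^ 'n"
  proof -
    have "lattice_vec (axis i0 1) = (axis i0 1 :: real ^ 'n)"
      by (simp add: lattice_vec_def axis_def vec_eq_iff)
    then show ?thesis by (simp add: inner_axis)
  qed
  have r0: "row_of n \<noteq> row_of 0" using n1 idx_row[of n] idx_row[of 0] by auto
  show "\<Omega>1 \<bullet> lattice_vec u1 = \<Omega>1 \<bullet> lattice_vec u2 + 1" "\<Omega>2 \<bullet> lattice_vec u1 = \<Omega>2 \<bullet> lattice_vec u2"
    using Omega_eval[of "row_of 0"] row_neq
    by (simp_all add: lead_matrix_row lattice_vec_diff inner_diff_right axis_def)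
  show "\<Omega>1 \<bullet> lattice_vec u2 = \<Omega>1 \<bullet> lattice_vec u3" "\<Omega>2 \<bullet> lattice_vec u2 = \<Omega>2 \<bullet> lattice_vec u3 + 1"
    using Omega_eval[of "row_of k0"] row_neq lead_matrix_row(3)[OF k0, of "\<lambda>k. p k - q k" r]
    by (simp_all add: pq0 lattice_vec_diff inner_diff_right axis_def)
  show "\<Omega>1 $ i0 = 0" "\<Omega>2 $ i0 = 0"
    using Omega_eval[of "row_of n", unfolded lead_matrix_row ax] row_neq r0 by (simp_all add: axis_def)
  have "\<Omega>1 \<bullet> lattice_vec (p k) = \<Omega>1 \<bullet> lattice_vec (q k) \<and> \<Omega>2 \<bullet> lattice_vec (p k) = \<Omega>2 \<bullet> lattice_vec (q k)"
    if k: "k \<in> {1..<n}" "k \<noteq> k0" for k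
  proof -
    have "row_of k \<noteq> row_of 0" "row_of k \<noteq> row_of k0"
      using k k0 idx_row[of k] idx_row[of 0] idx_row[of k0] by auto
    then show ?thesis
      using Omega_eval[of "row_of k"] lead_matrix_row(3)[OF k(1), of "\<lambda>k. p k - q k" r]
      by (simp add: lattice_vec_diff inner_diff_right axis_def)
  qed
  then show "\<Omega>1 \<in> W" "\<Omega>2 \<in> W" by (auto simp: W_def)
qed

lemma subspace_W: "subspace W"
  by (simp add: subspace_def W_def inner_add_left)

lemma u_lattice: "u1 \<in> char_lattice" "u2 \<in> char_lattice" "u3 \<in> char_lattice"
  using M_lattice[OF k0, of _ \<alpha>] M0 by auto

lemma one_in_W: "1 \<in> W"
  using M_lattice[of _ _ \<alpha>] pq_M by (auto simp: W_def inner_one_lattice_vec)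

text \<open>\<open>\<Omega>1\<close> and \<open>\<Omega>2\<close> are dual to \<open>u1 - u2\<close>
  and \<open>u2 - u3\<close> and vanish at \<open>i0\<close>, so the difference of both sides is
  annihilated by the invertible matrix \<open>A\<close>.\<close>

lemma W_decomposition:
  assumes x: "x \<in> W"
  shows "x = (x $ i0) *\<^sub>R 1 + (x \<bullet> lattice_vec u1 - x \<bullet> lattice_vec u2) *\<^sub>R \<Omega>1
    + (x \<bullet> lattice_vec u2 - x \<bullet> lattice_vec u3) *\<^sub>R \<Omega>2" (is "x = ?y")
proof -
  have y: "?y \<in> W"
    by (intro subspace_add[OF subspace_W] subspace_scale[OF subspace_W] one_in_W Omega_props)
  have "of_int_matrix A *v (x - ?y) = 0"
    unfolding lead_matrix_kernel
  proof (intro conjI ballI)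
    fix k assume k: "k \<in> {1..<n}"
    show "(x - ?y) \<bullet> lattice_vec (p k - q k) = 0"
    proof (cases "k = k0")
      case True
      then show ?thesis
        by (simp add: pq0 lattice_vec_diff inner_diff_right inner_diff_left inner_add_left Omega_props
            inner_one_lattice_vec u_lattice algebra_simps)
    next
      case False
      have "x - ?y \<in> W" by (rule subspace_diff[OF subspace_W x y])
      then show ?thesis using k False by (simp add: W_def lattice_vec_diff inner_diff_right)
    qed
  next
    show "(x - ?y) \<bullet> lattice_vec r = 0"
      by (simp add: lattice_vec_diff inner_diff_right inner_diff_left inner_add_left Omega_props
          inner_one_lattice_vec u_lattice algebra_simps)
    show "(x - ?y) $ i0 = 0" by (simp add: Omega_props)
  qed
  then have "of_rat_matrix B *v (of_int_matrix A *v (x - ?y)) = 0" by simp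
  then have "x - ?y = 0" by (simp add: matrix_vector_mul_assoc of_rat_of_int_matrix_mult[OF B])
  then show ?thesis by simp
qed

text \<open>The edges at the vertex drop one of the three terms of the equation \<open>k0\<close>: here \<open>s\<close> and \<open>s'\<close>
  are kept and \<open>s''\<close> is dropped, and \<open>w\<close> points along the edge.\<close>

definition edge_dir :: "int ^ 'n \<Rightarrow> int ^ 'n \<Rightarrow> int ^ 'n \<Rightarrow> ('n \<Rightarrow> rat) \<Rightarrow> bool" where
  "edge_dir s s' s'' w \<longleftrightarrow> {s, s', s''} = {u1, u2, u3} \<and> s \<noteq> s' \<and> of_rat_vec w \<in> W \<and>
     of_rat_vec w \<bullet> lattice_vec s = of_rat_vec w \<bullet> lattice_vec s' \<and>
     of_rat_vec w \<bullet> lattice_vec s < of_rat_vec w \<bullet> lattice_vec s'' \<and>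
     (\<forall>x\<in>W. x \<bullet> lattice_vec s = x \<bullet> lattice_vec s' \<longrightarrow> (\<exists>a c. x = a *\<^sub>R 1 + c *\<^sub>R of_rat_vec w))"

text \<open>The edges match the values excluded for \<open>\<theta>\<close>: dropping
  \<open>u1\<close>, \<open>u3\<close> and \<open>u2\<close> belongs to 0, infinity and 1. The signs
  are such that the dropped term grows along the edge.\<close>

lemma edge_dirs:
  "edge_dir u2 u3 u1 om1"
  "edge_dir u1 u2 u3 (\<lambda>i. - om2 i)"
  "edge_dir u1 u3 u2 (\<lambda>i. om2 i - om1 i)"
proof -
  have o: "of_rat_vec om1 = \<Omega>1" "of_rat_vec (\<lambda>i. - om2 i) = - \<Omega>2"
    "of_rat_vec (\<lambda>i. om2 i - om1 i) = \<Omega>2 - \<Omega>1"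
    by (simp_all add: \<Omega>1_def \<Omega>2_def of_rat_vec_def vec_eq_iff of_rat_minus of_rat_diff)
  have "\<exists>a c. x = a *\<^sub>R 1 + c *\<^sub>R \<Omega>1"
    if "x \<in> W" "x \<bullet> lattice_vec u2 = x \<bullet> lattice_vec u3" for x
    using W_decomposition[OF that(1)] that(2) by auto
  then show "edge_dir u2 u3 u1 om1"
    unfolding edge_dir_def o using u_distinct Omega_props by auto
  have "\<exists>a c. x = a *\<^sub>R 1 + c *\<^sub>R - \<Omega>2"
    if "x \<in> W" "x \<bullet> lattice_vec u1 = x \<bullet> lattice_vec u2" for x
  proof -
    let ?c = "x \<bullet> lattice_vec u2 - x \<bullet> lattice_vec u3"
    have "x = (x $ i0) *\<^sub>R 1 + ?c *\<^sub>R \<Omega>2"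
      using W_decomposition[OF that(1)] that(2) by simp
    also have "?c *\<^sub>R \<Omega>2 = (- ?c) *\<^sub>R - \<Omega>2" by (simp only: scaleR_minus_left scaleR_minus_right minus_minus)
    finally show ?thesis by (intro exI)
  qed
  moreover have "- \<Omega>2 \<in> W" using subspace_neg[OF subspace_W] Omega_props by blast
  ultimately show "edge_dir u1 u2 u3 (\<lambda>i. - om2 i)"
    unfolding edge_dir_def o using u_distinct Omega_props by auto
  have "\<exists>a c. x = a *\<^sub>R 1 + c *\<^sub>R (\<Omega>2 - \<Omega>1)"
    if "x \<in> W" "x \<bullet> lattice_vec u1 = x \<bullet> lattice_vec u3" for x
  proof -
    have "x = (x $ i0) *\<^sub>R 1 + (x \<bullet> lattice_vec u2 - x \<bullet> lattice_vec u3) *\<^sub>R (\<Omega>2 - \<Omega>1)"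
      using W_decomposition[OF that(1)] that(2) by (simp add: algebra_simps)
    then show ?thesis by blast
  qed
  moreover have "\<Omega>2 - \<Omega>1 \<in> W" using subspace_diff[OF subspace_W] Omega_props by blast
  ultimately show "edge_dir u1 u3 u2 (\<lambda>i. om2 i - om1 i)"
    unfolding edge_dir_def o using u_distinct Omega_props
    by (auto simp: inner_diff_left)
qed

abbreviation "pp s \<equiv> p(k0 := s)"
abbreviation "qq s \<equiv> q(k0 := s)"

lemma edge_dir_kernel:
  assumes "edge_dir s s' s'' w"
  shows "pair_kernel (pp s) (qq s') = {x \<in> W. x \<bullet> lattice_vec s = x \<bullet> lattice_vec s'}"
  using k0 by (auto simp: pair_kernel_def W_def)

lemma edge_dir_comb:
  assumes "edge_dir s s' s'' w" and "x \<in> pair_kernel (pp s) (qq s')"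
  shows "\<exists>a c. x = a *\<^sub>R 1 + c *\<^sub>R of_rat_vec w"
  using assms(2) unfolding edge_dir_kernel[OF assms(1)] using assms(1) unfolding edge_dir_def by blast

lemma edge_dir_mem:
  assumes "edge_dir s s' s'' w"
  shows "of_rat_vec w \<in> pair_kernel (pp s) (qq s')"
  unfolding edge_dir_kernel[OF assms] using assms by (simp add: edge_dir_def)

lemma edge_dir_terms:
  assumes e: "edge_dir s s' s'' w"
  shows "\<exists>\<delta>>0. \<forall>\<epsilon>. 0 < \<epsilon> \<and> \<epsilon> < \<delta> \<longrightarrow> edge_terms (\<alpha> + \<epsilon> *\<^sub>R of_rat_vec w) (pp s) (qq s')"
proof -
  let ?w = "of_rat_vec w"
  have s: "{s, s', s''} = {u1, u2, u3}" "s \<noteq> s'" "?w \<in> W" "?w \<bullet> lattice_vec s = ?w \<bullet> lattice_vec s'"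
    "?w \<bullet> lattice_vec s < ?w \<bullet> lattice_vec s''"
    using e unfolding edge_dir_def by blast+
  obtain \<delta> where \<delta>: "\<delta> > 0" "\<forall>\<epsilon>. 0 < \<epsilon> \<and> \<epsilon> < \<delta> \<longrightarrow> (\<forall>k\<in>{1..<n}. M k (\<alpha> + \<epsilon> *\<^sub>R ?w) =
    {u \<in> M k \<alpha>. \<forall>t\<in>M k \<alpha>. ?w \<bullet> lattice_vec u \<le> ?w \<bullet> lattice_vec t})"
    using min_terms_perturb[of "{1..<n}" f val \<alpha> ?w] ne by auto
  have "edge_terms (\<alpha> + \<epsilon> *\<^sub>R ?w) (pp s) (qq s')" if \<epsilon>: "0 < \<epsilon>" "\<epsilon> < \<delta>" for \<epsilon>
    unfolding edge_terms_def
  proof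
    fix k assume k: "k \<in> {1..<n}"
    have Mk': "M k (\<alpha> + \<epsilon> *\<^sub>R ?w) = {u \<in> M k \<alpha>. \<forall>t\<in>M k \<alpha>. ?w \<bullet> lattice_vec u \<le> ?w \<bullet> lattice_vec t}"
      using \<delta>(2) \<epsilon> k by blast
    show "M k (\<alpha> + \<epsilon> *\<^sub>R ?w) = {pp s k, qq s' k} \<and> pp s k \<noteq> qq s' k"
    proof (cases "k = k0")
      case True
      have "{u \<in> {u1, u2, u3}. \<forall>t\<in>{u1, u2, u3}. ?w \<bullet> lattice_vec u \<le> ?w \<bullet> lattice_vec t} = {s, s'}"
        unfolding s(1)[symmetric] using s(4,5) by auto
      with Mk'[unfolded True M0] have "M k0 (\<alpha> + \<epsilon> *\<^sub>R ?w) = {s, s'}" by (rule trans)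
      then show ?thesis using True s(2) by simp
    next
      case False
      have "?w \<bullet> lattice_vec (p k) = ?w \<bullet> lattice_vec (q k)" using s(3) k False by (simp add: W_def)
      then have "{u \<in> {p k, q k}. \<forall>t\<in>{p k, q k}. ?w \<bullet> lattice_vec u \<le> ?w \<bullet> lattice_vec t} = {p k, q k}"
        by auto
      then show ?thesis unfolding Mk' using Mk[OF k False] False by simp
    qed
  qed
  with \<delta>(1) show ?thesis by blast
qed

lemma dim_edge_dir:
  assumes e: "edge_dir s s' s'' w"
  shows "dim (pair_kernel (pp s) (qq s')) = 2"
proof -
  let ?w = "of_rat_vec w" and ?L = "pair_kernel (pp s) (qq s')"
  have one: "1 \<in> ?L"
  proof -
    have "s \<in> {u1, u2, u3}" "s' \<in> {u1, u2, u3}" using e unfolding edge_dir_def by blast+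
    then have "s \<in> char_lattice" "s' \<in> char_lattice" using u_lattice by auto
    then show ?thesis unfolding edge_dir_kernel[OF e] using one_in_W by (simp add: inner_one_lattice_vec)
  qed
  have w1: "?w \<notin> span {1}"
  proof
    assume "?w \<in> span {1}"
    then obtain c where c: "?w = c *\<^sub>R 1" by (auto simp: span_singleton)
    have "s \<in> {u1, u2, u3}" "s'' \<in> {u1, u2, u3}" using e unfolding edge_dir_def by blast+
    then have "s \<in> char_lattice" "s'' \<in> char_lattice" using u_lattice by auto
    then show False using e unfolding edge_dir_def c by (simp add: inner_one_lattice_vec)
  qed
  have "(1 :: real ^ 'n) \<noteq> 0" by (simp add: vec_eq_iff)
  then have ind: "independent {?w, 1}" using w1 by (simp add: independent_insert)
  have "?w \<noteq> 1" using w1 span_base[of 1 "{1 :: real ^ 'n}"] by auto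
  then have card: "card {?w, 1} = 2" by simp
  have "?L = span {?w, 1}"
  proof
    show "span {?w, 1} \<subseteq> ?L" using one edge_dir_mem[OF e] by (intro span_minimal subspace_pair_kernel) auto
    show "?L \<subseteq> span {?w, 1}"
    proof
      fix x assume "x \<in> ?L"
      then obtain a c where "x = a *\<^sub>R 1 + c *\<^sub>R ?w" using edge_dir_comb[OF e] by blast
      then show "x \<in> span {?w, 1}" by (simp add: span_add span_mul span_base)
    qed
  qed
  then show ?thesis using dim_eq_card_independent[OF ind] card by (simp only: dim_span)
qed

lemma over_vertex: "\<exists>P. over \<alpha> P \<and> P \<in> X"
  using vertex_lift[of "1/2"] by (auto simp: good_def)

text \<open>A vertex always lies under a point of the curve, by \<open>vertex_lift\<close>, so its
  coordinates differ by elements of the value group.\<close>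

lemma value_group_vertex: "\<alpha> $ i - \<alpha> $ j \<in> value_group val"
proof -
  obtain P where P: "over \<alpha> P" using over_vertex by blast
  then obtain t where t: "\<alpha> = trop_point val P + t *\<^sub>R 1" by (auto simp: over_def trop_eq_def)
  have "P $ i \<noteq> 0" "P $ j \<noteq> 0" using P by (auto simp: over_def torus_def)
  then have "v (P $ i) - v (P $ j) \<in> value_group val"
    by (intro value_group_diff) (auto simp: value_group_def)
  then show ?thesis by (simp add: t trop_point_def)
qed

text \<open>A point of the edge lifts to the curve if its coordinates differ by elements of the
  value group. The vertex is of this kind, the edge direction is rational and the value group is
  divisible, so such points accumulate at the vertex.\<close>

lemma edge_dir_in_Trop:
  assumes e: "edge_dir s s' s'' w" and "\<delta> > 0"
  shows "\<exists>\<epsilon>. 0 < \<epsilon> \<and> \<epsilon> < \<delta> \<and> \<alpha> + \<epsilon> *\<^sub>R of_rat_vec w \<in> Trop val X"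
proof -
  obtain \<delta>' where \<delta>': "\<delta>' > 0"
    "\<And>\<epsilon>. 0 < \<epsilon> \<Longrightarrow> \<epsilon> < \<delta>' \<Longrightarrow> edge_terms (\<alpha> + \<epsilon> *\<^sub>R of_rat_vec w) (pp s) (qq s')"
    using edge_dir_terms[OF e] by blast
  obtain x where x: "x \<noteq> 0" "v x > 0" using ex_pos_val by blast
  have "min \<delta> \<delta>' > 0" using assms(2) \<delta>'(1) by simp
  then obtain m :: nat where m: "v x < real m * min \<delta> \<delta>'" using reals_Archimedean3 by blast
  then have m0: "m > 0" using x(2) by (cases m) auto
  \<comment> \<open>An \<open>m\<close>-th part of a positive value: still in the value group, and
    below both bounds by the choice of \<open>m\<close>.\<close>
  define \<epsilon> where "\<epsilon> = of_rat (1 / of_nat m) * v x"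
  have \<epsilon>eq: "\<epsilon> = v x / real m" by (simp add: \<epsilon>_def of_rat_divide)
  have "v x < min \<delta> \<delta>' * real m" using m by (subst mult.commute)
  then have "\<epsilon> < min \<delta> \<delta>'"
    unfolding \<epsilon>eq by (rule iffD2[OF pos_divide_less_eq, rotated]) (use m0 in simp)
  then have \<epsilon>: "0 < \<epsilon>" "\<epsilon> < \<delta>" "\<epsilon> < \<delta>'" using x(2) m0 by (auto simp: \<epsilon>eq)
  have \<epsilon>G: "\<epsilon> \<in> value_group val"
    unfolding \<epsilon>_def using x(1) by (intro value_group_rat_mult) (auto simp: value_group_def)
  have "val_rational val (\<alpha> + \<epsilon> *\<^sub>R of_rat_vec w)"
    unfolding val_rational_def
  proof (intro allI)
    fix i j
    have "(\<alpha> + \<epsilon> *\<^sub>R of_rat_vec w) $ i - (\<alpha> + \<epsilon> *\<^sub>R of_rat_vec w) $ j =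
        (\<alpha> $ i - \<alpha> $ j) + of_rat (w i - w j) * \<epsilon>"
      by (simp add: of_rat_vec_def of_rat_diff algebra_simps)
    then show "(\<alpha> + \<epsilon> *\<^sub>R of_rat_vec w) $ i - (\<alpha> + \<epsilon> *\<^sub>R of_rat_vec w) $ j \<in> value_group val"
      by (simp only: value_group_add value_group_vertex value_group_rat_mult \<epsilon>G)
  qed
  from edge_point_in_Trop[OF \<delta>'(2)[OF \<epsilon>(1,3)] dim_edge_dir[OF e] this]
  have "\<alpha> + \<epsilon> *\<^sub>R of_rat_vec w \<in> Trop val X" using over_in_Trop by blast
  with \<epsilon> show ?thesis by blast
qed

abbreviation "\<Lambda> \<equiv> affine_tangent_space (Trop val X) \<alpha>"

section \<open>The tangent space at the vertex and the edges through it\<close>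

lemma affine_hull_directions:
  fixes S :: "(real ^ 'n) set"
  assumes "\<alpha> \<in> S" and "\<alpha> + c *\<^sub>R x \<in> S" and "c \<noteq> 0"
  shows "x \<in> span {y - \<alpha> | y. y \<in> S - {\<alpha>}}"
proof (cases "x = 0")
  case False
  then have "\<alpha> + c *\<^sub>R x \<in> S - {\<alpha>}" using assms by simp
  then have "(\<alpha> + c *\<^sub>R x) - \<alpha> \<in> span {y - \<alpha> | y. y \<in> S - {\<alpha>}}" by (intro span_base) blast
  then have "c *\<^sub>R x \<in> span {y - \<alpha> | y. y \<in> S - {\<alpha>}}" by simp
  then have "(1 / c) *\<^sub>R (c *\<^sub>R x) \<in> span {y - \<alpha> | y. y \<in> S - {\<alpha>}}" by (rule span_mul)
  moreover have "(1 / c) *\<^sub>R (c *\<^sub>R x) = x" using assms(3) by simp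
  ultimately show ?thesis by (simp only:)
qed (simp add: span_zero)

text \<open>Two of the edge directions span \<open>W\<close> together with the all-ones vector, and
  each edge carries points of the tropical curve arbitrarily close to
  \<open>\<alpha>\<close>.\<close>

lemma W_subset: "W \<subseteq> direction_span \<Lambda>"
proof
  fix x assume x: "x \<in> W"
  have \<alpha>T: "\<alpha> + t *\<^sub>R 1 \<in> Trop val X" for t
  proof -
    obtain P where P: "over \<alpha> P" "P \<in> X" using over_vertex by blast
    then obtain s where s: "\<alpha> = trop_point val P + s *\<^sub>R 1" by (auto simp: over_def trop_eq_def)
    then have "\<alpha> + t *\<^sub>R 1 = trop_point val P + (s + t) *\<^sub>R 1" by (simp add: algebra_simps)
    then have "over (\<alpha> + t *\<^sub>R 1) P" using P(1) by (auto simp: over_def trop_eq_def)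
    then show ?thesis by (rule over_in_Trop[OF _ P(2)])
  qed
  have "\<alpha> + x \<in> affine hull (Trop val X \<inter> ball \<alpha> e)" if e: "e > 0" for e
  proof -
    let ?S = "Trop val X \<inter> ball \<alpha> e" and ?D = "span {y - \<alpha> | y. y \<in> Trop val X \<inter> ball \<alpha> e - {\<alpha>}}"
    have \<alpha>S: "\<alpha> \<in> ?S" using \<alpha>T[of 0] e by simp
    have "1 \<in> ?D"
    proof (rule affine_hull_directions[OF \<alpha>S])
      define N where "N = norm (1 :: real ^ 'n) + 1"
      have N: "N > 0" by (simp add: N_def add_nonneg_pos)
      define c where "c = e / (2 * N)"
      have c: "c > 0" using e N by (simp add: c_def)
      have "c * norm (1 :: real ^ 'n) \<le> c * N" using c by (simp add: N_def)
      also have "\<dots> < e" using e N by (simp add: c_def)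
      finally have "\<alpha> + c *\<^sub>R 1 \<in> ball \<alpha> e" using c by (simp add: dist_norm)
      then show "\<alpha> + c *\<^sub>R 1 \<in> ?S" using \<alpha>T[of c] by simp
      show "c \<noteq> 0" using c by simp
    qed
    moreover have dir: "of_rat_vec w \<in> ?D" if ed: "edge_dir s s' s'' w" for s s' s'' w
    proof -
      have "e / (norm (of_rat_vec w) + 1) > 0" using e by (simp add: add_nonneg_pos)
      then obtain \<epsilon> where \<epsilon>: "0 < \<epsilon>" "\<epsilon> < e / (norm (of_rat_vec w) + 1)" "\<alpha> + \<epsilon> *\<^sub>R of_rat_vec w \<in> Trop val X"
        using edge_dir_in_Trop[OF ed] by blast
      have "\<epsilon> * (norm (of_rat_vec w) + 1) < e" using \<epsilon>(2) by (simp add: pos_less_divide_eq add_nonneg_pos)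
      then have "\<epsilon> * norm (of_rat_vec w) < e" using \<epsilon>(1) by (simp add: distrib_left)
      then have "\<alpha> + \<epsilon> *\<^sub>R of_rat_vec w \<in> ?S" using \<epsilon> by (simp add: dist_norm)
      then show ?thesis using \<epsilon>(1) by (intro affine_hull_directions[OF \<alpha>S]) auto
    qed
    moreover have "\<Omega>1 \<in> ?D" using dir[OF edge_dirs(1)] by (simp add: \<Omega>1_def)
    moreover have "\<Omega>2 \<in> ?D"
    proof -
      have "of_rat_vec (\<lambda>i. - om2 i) = - \<Omega>2" by (simp add: \<Omega>2_def of_rat_vec_def vec_eq_iff of_rat_minus)
      then show ?thesis using span_neg[OF dir[OF edge_dirs(2)]] by simp
    qed
    ultimately have "x \<in> ?D"
      by (subst W_decomposition[OF x]) (intro span_add span_mul)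
    then show ?thesis unfolding affine_hull_span[OF \<alpha>S] by blast
  qed
  then have "\<alpha> + x \<in> \<Lambda>" by (simp add: affine_tangent_space_def)
  moreover have "\<alpha> \<in> \<Lambda>"
    unfolding affine_tangent_space_def using \<alpha>T[of 0] by (auto intro!: hull_inc)
  ultimately have "(\<alpha> + x) - \<alpha> \<in> direction_span \<Lambda>"
    unfolding direction_span_def tspan_def by (intro span_base) blast
  then show "x \<in> direction_span \<Lambda>" by simp
qed

text \<open>At nearby points of the curve an equation with two minimal terms at
  \<open>\<alpha>\<close> must keep both.\<close>

lemma direction_span_subset_W: "direction_span \<Lambda> \<subseteq> W"
proof -
  obtain \<delta> where \<delta>: "\<delta> > 0" "\<forall>\<gamma>\<in>ball \<alpha> \<delta>. \<forall>k\<in>{1..<n}. M k \<gamma> \<subseteq> M k \<alpha>"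
    using min_terms_local_finite[of "{1..<n}"] by blast
  show ?thesis
  proof (rule direction_span_subset[OF subspace_W one_in_W \<delta>(1)])
    fix \<gamma> P assume P: "over \<gamma> P" "P \<in> X" and \<gamma>: "\<gamma> \<in> ball \<alpha> \<delta>"
    have "(\<gamma> - \<alpha>) \<bullet> lattice_vec (p k) = (\<gamma> - \<alpha>) \<bullet> lattice_vec (q k)" if k: "k \<in> {1..<n}" "k \<noteq> k0" for k
    proof -
      have M\<alpha>: "M k \<alpha> = {p k, q k}" "p k \<noteq> q k" using Mk[OF k] by auto
      have "M k \<gamma> \<subseteq> {p k, q k}" using \<delta>(2) \<gamma> k(1) M\<alpha> by blast
      moreover have "card (M k \<gamma>) \<ge> 2" by (rule on_curve_card_M[OF P k(1) ne])
      moreover have "card {p k, q k} = 2" using M\<alpha>(2) by simp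
      ultimately have "M k \<gamma> = {p k, q k}" by (intro card_seteq) auto
      then have "tval k \<gamma> (p k) = tval k \<gamma> (q k)" by (intro M_eq) auto
      moreover have "tval k \<alpha> (p k) = tval k \<alpha> (q k)" using M\<alpha>(1) by (intro M_eq) auto
      ultimately show ?thesis by (simp add: term_val_def inner_diff_left)
    qed
    then show "\<gamma> - \<alpha> \<in> W" by (simp add: W_def)
  qed
qed

lemma direction_span_cell:
  "direction_span (\<Inter>k\<in>{1..<n}. cell_of val (f k) (\<beta> k)) \<subseteq> cell_directions val {1..<n} f \<beta>"
proof -
  have "{x - y | x y. x \<in> (\<Inter>k\<in>{1..<n}. cell_of val (f k) (\<beta> k)) \<and>
      y \<in> (\<Inter>k\<in>{1..<n}. cell_of val (f k) (\<beta> k))} \<subseteq> cell_directions val {1..<n} f \<beta>"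
    by (intro subsetI, elim CollectE exE conjE) (simp only: cell_difference)
  then show ?thesis
    unfolding direction_span_def tspan_def using one_in_L
    by (intro span_minimal subspace_cell_directions) simp
qed

text \<open>A point slightly along the ray has exactly two minimal terms in each equation; its
  closed cell is an edge that contains the vertex, and its directions are combinations of the
  all-ones vector and \<open>w\<close>.\<close>

lemma edge_through_vertex:
  assumes e: "edge_dir s s' s'' w" and ij: "w i = w j"
  shows "\<exists>E \<in> trop_edges val {1..<n} f. \<alpha> \<in> E \<and> direction_span E \<subseteq> coord_span (- {i, j})"
proof -
  obtain \<delta> where \<delta>: "\<delta> > 0"
    "\<And>\<epsilon>. 0 < \<epsilon> \<Longrightarrow> \<epsilon> < \<delta> \<Longrightarrow> edge_terms (\<alpha> + \<epsilon> *\<^sub>R of_rat_vec w) (pp s) (qq s')"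
    using edge_dir_terms[OF e] by blast
  define \<gamma> where "\<gamma> = \<alpha> + (\<delta> / 2) *\<^sub>R of_rat_vec w"
  have edge: "edge_terms \<gamma> (pp s) (qq s')" unfolding \<gamma>_def using \<delta>(1) by (intro \<delta>(2)) auto
  let ?E = "\<Inter>k\<in>{1..<n}. cell_of val (f k) \<gamma>"
  have L: "L \<gamma> = pair_kernel (pp s) (qq s')"
    using edge by (intro edge_terms_kernel) (auto simp: edge_terms_def)
  have "aff_dim ?E = int (dim (L \<gamma>))" by (rule aff_dim_cell) (use ne in auto)
  then have "aff_dim ?E = 2" unfolding L dim_edge_dir[OF e] by simp
  moreover have "\<alpha> \<in> ?E"
  proof
    fix k assume k: "k \<in> {1..<n}"
    have "{s, s', s''} = {u1, u2, u3}" using e by (simp add: edge_dir_def)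
    then have "{s, s'} \<subseteq> {u1, u2, u3}" by blast
    then have "{pp s k, qq s' k} \<subseteq> M k \<alpha>" using M0 Mk[OF k] by (cases "k = k0") auto
    then show "\<alpha> \<in> cell_of val (f k) \<gamma>" using edge k by (simp add: edge_terms_def)
  qed
  moreover have "?E \<in> intersection_cells val {1..<n} f"
  proof -
    have "cell_of val (f k) \<gamma> \<in> hypersurface_cells val (f k)" if "k \<in> {1..<n}" for k
    proof -
      have "M k \<gamma> = {pp s k, qq s' k}" "pp s k \<noteq> qq s' k" using edge that by (auto simp: edge_terms_def)
      then have "card (M k \<gamma>) = 2" by simp
      then show ?thesis by (auto simp: hypersurface_cells_def trop_hypersurface_def)
    qed
    moreover have "?E \<noteq> {}" using \<open>\<alpha> \<in> ?E\<close> by (rule ex_in_conv[THEN iffD1, OF exI])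
    ultimately show ?thesis
      unfolding intersection_cells_def by (intro CollectI exI[of _ "\<lambda>k. cell_of val (f k) \<gamma>"]) simp
  qed
  moreover have "direction_span ?E \<subseteq> coord_span (- {i, j})"
  proof -
    have "direction_span ?E \<subseteq> L \<gamma>" by (rule direction_span_cell)
    also have "\<dots> \<subseteq> coord_span (- {i, j})"
    proof
      fix x assume "x \<in> L \<gamma>"
      then obtain a c where "x = a *\<^sub>R 1 + c *\<^sub>R of_rat_vec w" using edge_dir_comb[OF e] unfolding L by blast
      then show "x \<in> coord_span (- {i, j})"
        unfolding coord_span_compl_pair using ij by (simp add: of_rat_vec_def)
    qed
    finally show ?thesis .
  qed
  ultimately show ?thesis unfolding trop_edges_def by blast
qed

text \<open>By the codimension count an edge has two minimal terms in every equation, so at the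
  vertex it drops one of the three terms of \<open>k0\<close>. Its direction space has the dimension
  of the corresponding kernel and hence contains the vector of that \<open>edge_dir\<close>.\<close>

lemma edge_through_vertex_converse:
  assumes E: "E \<in> trop_edges val {1..<n} f" "\<alpha> \<in> E" "direction_span E \<subseteq> coord_span (- {i, j})"
  shows "a i j = 0 \<or> b i j = 0 \<or> a i j = b i j"
proof -
  have Ei: "E \<in> intersection_cells val {1..<n} f" and dimE: "aff_dim E = 2"
    using E(1) by (auto simp: trop_edges_def)
  obtain \<beta> where \<beta>: "E = (\<Inter>k\<in>{1..<n}. cell_of val (f k) (\<beta> k))"
    "\<And>k. k \<in> {1..<n} \<Longrightarrow> card (M k (\<beta> k)) \<ge> 2"
    "\<And>k. k \<in> {1..<n} \<Longrightarrow> M k (\<beta> k) \<subseteq> M k \<alpha>"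
    "codim E = (\<Sum>k\<in>{1..<n}. int (card (M k (\<beta> k))) - 1)"
    by (rule intersection_cellE[OF Ei E(2)]) (rule that)
  have sum: "(\<Sum>k\<in>{1..<n}. int (card (M k (\<beta> k))) - 1) = int (card {1..<n})"
    using \<beta>(4) dimE n1 by (simp add: codim_def card_UNIV_n)
  have card: "card (M k (\<beta> k)) = 2" if k: "k \<in> {1..<n}" for k
  proof -
    have "int (card (M k (\<beta> k))) - 1 = 1"
      by (rule sum_eq_card_imp_one[OF _ _ sum k]) (use \<beta>(2) in force)+
    then show ?thesis by simp
  qed
  have "card (M k0 (\<beta> k0)) = 2" "M k0 (\<beta> k0) \<subseteq> {u1, u2, u3}"
    using card[OF k0] \<beta>(3)[OF k0] M0 by auto
  then obtain s t where st: "M k0 (\<beta> k0) = {s, t}" "s \<noteq> t" "s \<in> {u1, u2, u3}" "t \<in> {u1, u2, u3}"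
    unfolding card_2_iff by blast
  have "\<exists>s s' s'' w. edge_dir s s' s'' w \<and> M k0 (\<beta> k0) = {s, s'} \<and>
      (w i = w j \<longrightarrow> a i j = 0 \<or> b i j = 0 \<or> a i j = b i j)"
  proof -
    have "M k0 (\<beta> k0) = {u2, u3} \<or> M k0 (\<beta> k0) = {u1, u2} \<or> M k0 (\<beta> k0) = {u1, u3}"
      unfolding st(1) using st(2-4) by auto
    moreover have "om1 i = om1 j \<longrightarrow> a i j = 0" "- om2 i = - om2 j \<longrightarrow> b i j = 0"
      "om2 i - om1 i = om2 j - om1 j \<longrightarrow> a i j = b i j"
      by (auto simp: a_def b_def)
    ultimately show ?thesis using edge_dirs by (elim disjE) blast+
  qed
  then obtain s s' s'' w where e: "edge_dir s s' s'' w" and M0': "M k0 (\<beta> k0) = {s, s'}"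
    and concl: "w i = w j \<Longrightarrow> a i j = 0 \<or> b i j = 0 \<or> a i j = b i j" by blast
  have Mb: "M k (\<beta> k) = {pp s k, qq s' k}" if k: "k \<in> {1..<n}" for k
  proof (cases "k = k0")
    case False
    have "M k (\<beta> k) \<subseteq> {p k, q k}" using \<beta>(3)[OF k] Mk[OF k False] by simp
    moreover have "card {p k, q k} \<le> card (M k (\<beta> k))" using card[OF k] Mk[OF k False] by simp
    ultimately have "M k (\<beta> k) = {p k, q k}" by (intro card_seteq) auto
    then show ?thesis using False by simp
  qed (use M0' in simp)
  have LE: "cell_directions val {1..<n} f \<beta> = pair_kernel (pp s) (qq s')"
    by (rule edge_terms_kernel) (rule Mb)
  have sub: "direction_span E \<subseteq> pair_kernel (pp s) (qq s')"
    unfolding LE[symmetric] \<beta>(1) by (rule direction_span_cell)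
  have "(2 :: int) = int (dim ((\<lambda>x. x - \<alpha>) ` E))"
    using aff_dim_eq_dim_subtract[of \<alpha> E] E(2) dimE by (simp add: hull_inc)
  moreover have "(\<lambda>x. x - \<alpha>) ` E \<subseteq> direction_span E"
    unfolding direction_span_def tspan_def using E(2) by (auto intro!: span_base)
  then have "dim ((\<lambda>x. x - \<alpha>) ` E) \<le> dim (direction_span E)" by (rule dim_subset)
  ultimately have "dim (pair_kernel (pp s) (qq s')) \<le> dim (direction_span E)"
    using dim_edge_dir[OF e] by simp
  moreover have "subspace (direction_span E)" by (simp add: direction_span_def tspan_def)
  ultimately have "direction_span E = pair_kernel (pp s) (qq s')"
    using sub subspace_pair_kernel by (intro subspace_dim_equal)
  then have "of_rat_vec w \<in> coord_span (- {i, j})" using edge_dir_mem[OF e] E(3) by blast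
  then have "w i = w j" unfolding coord_span_compl_pair by (simp add: of_rat_vec_def)
  then show ?thesis by (rule concl)
qed

text \<open>If \<open>a\<close> and \<open>b\<close> both vanish at a pair, all of \<open>W\<close>
  has equal coordinates there. If two pairs share a critical value \<open>t\<close>, then
  \<open>\<Omega>1 - t \<Omega>2\<close> has two coincidences among its coordinates, and a multiple
  of some \<open>e_i + e_j\<close> can be subtracted to make it constant on four indices,
  contradicting \<open>gen2\<close>.\<close>

lemma generic_vertexI:
  assumes gen1: "\<And>J :: 'n set. card J + 1 = n \<Longrightarrow> \<not> direction_span \<Lambda> \<subseteq> coord_span J"
    and gen2: "\<And>i j. \<And>J' :: 'n set. card J' + 3 = n \<Longrightarrow>
      direction_span \<Lambda> \<inter> {a + b | a b. a \<in> tspan {axis i 1 + axis j 1} \<and> b \<in> coord_span J'} = tspan {}"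
  shows "generic_vertex val X f n idx i0 \<alpha> k0 u1 u2 u3 p q B \<rho>"
proof unfold_locales
  show "a i j \<noteq> 0 \<or> b i j \<noteq> 0" if "i \<noteq> j" for i j
  proof (rule ccontr)
    assume "\<not> ?thesis"
    then have O: "\<Omega>1 $ i = \<Omega>1 $ j" "\<Omega>2 $ i = \<Omega>2 $ j"
      by (auto simp: a_def b_def \<Omega>1_def \<Omega>2_def of_rat_vec_def)
    have "W \<subseteq> coord_span (- {i, j})"
    proof
      fix x assume "x \<in> W"
      from W_decomposition[OF this] obtain c d e where "x = c *\<^sub>R 1 + d *\<^sub>R \<Omega>1 + e *\<^sub>R \<Omega>2" by blast
      then show "x \<in> coord_span (- {i, j})" unfolding coord_span_compl_pair using O by simp
    qed
    moreover have "card (- {i, j}) + 1 = n"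
      using that card_UNIV_n n1 by (simp add: Compl_eq_Diff_UNIV card_Diff_subset)
    ultimately show False using gen1 direction_span_subset_W by blast
  qed
next
  fix i j i' j' t
  assume ij: "i \<noteq> j" and ij': "i' \<noteq> j'" and eq: "a i j = t * b i j" "a i' j' = t * b i' j'"
  show "{i, j} = {i', j'}"
  proof (rule ccontr)
    assume neq: "{i, j} \<noteq> {i', j'}"
    define x where "x = \<Omega>1 - of_rat t *\<^sub>R \<Omega>2"
    have xW: "x \<in> W" unfolding x_def
      by (intro subspace_diff[OF subspace_W] subspace_scale[OF subspace_W] Omega_props)
    have xdiff: "x $ k - x $ l = of_rat (a k l - t * b k l)" for k l
      unfolding a_def b_def of_rat_diff of_rat_mult
      by (simp add: x_def \<Omega>1_def \<Omega>2_def of_rat_vec_def algebra_simps)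
    have xi: "x $ i = x $ j" "x $ i' = x $ j'" using xdiff[of i j] xdiff[of i' j'] eq by auto
    have not_const: "\<not> (\<forall>k l. x $ k = x $ l)"
    proof
      assume "\<forall>k l. x $ k = x $ l"
      then have "x = (x $ i0) *\<^sub>R 1" by (simp add: vec_eq_iff)
      then have "x \<bullet> lattice_vec u = 0" if "u \<in> char_lattice" for u
        using inner_one_lattice_vec[OF that] by (metis inner_scaleR_left mult_zero_right)
      then have "x \<bullet> lattice_vec u1 = x \<bullet> lattice_vec u2" using u_lattice by simp
      then show False by (simp add: x_def inner_diff_left Omega_props)
    qed
    have in_dir: "x \<in> direction_span \<Lambda>" using W_subset xW by blast
    have contra: False if "card J' + 3 = n" "y \<in> tspan {axis k 1 + axis l 1}" "x - y \<in> coord_span J'"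
      for J' k l y
    proof -
      have "x \<in> {a + b | a b. a \<in> tspan {axis k 1 + axis l 1} \<and> b \<in> coord_span J'}"
        using that(2,3) by (intro CollectI exI[of _ y] exI[of _ "x - y"]) simp
      then have "x \<in> tspan {}" using gen2[OF that(1), of k l] in_dir by blast
      then show False using not_const unfolding tspan_empty by blast
    qed
    let ?S = "{i, j, i', j'}"
    show False
    proof (cases "card ?S = 4")
      case True
      then have d: "i \<noteq> i'" "i \<noteq> j'" "j \<noteq> i'" "j \<noteq> j'" using ij ij' by (auto simp: card_insert_if split: if_splits)
      \<comment> \<open>Coordinates \<open>i\<close> and \<open>j\<close> agree and must be lowered
        by the same amount to reach those at \<open>i'\<close> and \<open>j'\<close>; this is where
        \<open>e_i + e_j\<close> comes from.\<close>
      let ?y = "(x $ i - x $ i') *\<^sub>R (axis i 1 + axis j 1) :: real ^ 'n"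
      show False
      proof (rule contra)
        have "card ?S \<le> CARD('n)" by (intro card_mono) auto
        then show "card (- ?S) + 3 = n"
          using True card_UNIV_n by (simp add: Compl_eq_Diff_UNIV card_Diff_subset)
        show "?y \<in> tspan {axis i 1 + axis j 1}"
          unfolding tspan_def by (intro span_mul span_base) simp
        show "x - ?y \<in> coord_span (- ?S)"
          using xi d ij by (intro coord_spanI[of _ _ "x $ i'"]) (auto simp: axis_def)
      qed
    next
      case False
      then have "i = i' \<or> i = j' \<or> j = i' \<or> j = j'" using ij ij' by (auto simp: card_insert_if split: if_splits)
      then have all_eq: "x $ m = x $ i" if "m \<in> ?S" for m using xi that by auto
      have card3: "card ?S = 3"
        using \<open>i = i' \<or> i = j' \<or> j = i' \<or> j = j'\<close> ij ij' neq
        by (auto simp: card_insert_if doubleton_eq_iff split: if_splits)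
      have "?S \<noteq> UNIV"
      proof
        assume U: "?S = UNIV"
        have "x $ m = x $ i" for m using all_eq[of m] U by blast
        then show False using not_const by metis
      qed
      \<comment> \<open>The pairs share an index, so three coordinates already agree. A fourth index
        exists because \<open>x\<close> is not constant, and it is treated by the case of equal
        indices in \<open>gen2\<close>.\<close>
      then obtain m where m: "m \<notin> ?S" by blast
      let ?J = "- insert m ?S"
      \<comment> \<open>Half of the difference, since \<open>axis m 1 + axis m 1\<close> is twice a
        basis vector.\<close>
      let ?y = "((x $ m - x $ i) / 2) *\<^sub>R (axis m 1 + axis m 1) :: real ^ 'n"
      have y: "?y $ k = (if k = m then x $ m - x $ i else 0)" for k by (simp add: axis_def)
      show False
      proof (rule contra)
        have c: "card (insert m ?S) = 4" using card3 m by (subst card_insert_disjoint) auto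
        have "card (insert m ?S) \<le> CARD('n)" by (intro card_mono) auto
        then show "card ?J + 3 = n"
          using c card_UNIV_n by (simp only: Compl_eq_Diff_UNIV card_Diff_subset finite subset_UNIV)
        show "?y \<in> tspan {axis m 1 + axis m 1}"
          unfolding tspan_def by (intro span_mul span_base) simp
        show "x - ?y \<in> coord_span ?J"
        proof (rule coord_spanI)
          fix l assume "l \<notin> ?J"
          then have "l = m \<or> l \<in> ?S" by blast
          then show "(x - ?y) $ l = x $ i"
            using all_eq[of l] m unfolding vector_minus_component y by auto
        qed
      qed
    qed
  qed
qed

end

text \<open>The numbers \<open>l I\<close> arise as valuations of \<open>w_i - w_j\<close>, which is
  why they range over the value group. An edge point is assumed rational for existence, whereas a
  vertex is rational automatically.\<close>

theorem theorem1p2p1: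
  fixes val :: "'k::{alg_closed_field, field_char_0} \<Rightarrow> ereal"
    and X :: "('k ^ 'n::finite) set"
    and f :: "nat \<Rightarrow> (int ^ 'n) \<Rightarrow>\<^sub>0 'k"
    and \<alpha> :: "real ^ 'n"
    and \<Lambda> :: "(real ^ 'n) set"
    and n :: nat
  assumes "nonarch_valuation val" and "nontrivial_valuation val"
    and "\<And>m :: int. m \<noteq> 0 \<Longrightarrow> val (of_int m) = 0"
    and "CARD('n) = n + 1" and "n \<ge> 1"
    and "proj_curve X"
    and "\<And>k. k \<in> {1..<n} \<Longrightarrow> Poly_Mapping.keys (f k) \<noteq> {}"
    and "\<And>k. k \<in> {1..<n} \<Longrightarrow> Poly_Mapping.keys (f k) \<subseteq> char_lattice"
    and "\<And>k. k \<in> {1..<n} \<Longrightarrow> tropically_smooth val (f k)"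
    and "tropical_complete_intersection val {1..<n} f"
    and "X \<inter> torus = torus \<inter> (\<Inter>k\<in>{1..<n}. torus_hypersurface (f k))"
    and "\<alpha> \<in> Trop val X"
    and "\<Lambda> = affine_tangent_space (Trop val X) \<alpha>"
    and "\<And>J :: 'n set. card J + 1 = n \<Longrightarrow> \<not> direction_span \<Lambda> \<subseteq> coord_span J"
  shows
    "((\<exists>E \<in> trop_edges val {1..<n} f. \<alpha> \<in> rel_interior E) \<longrightarrow>
       (val_rational val \<alpha> \<longrightarrow> (\<exists>\<beta>. tropical_tangent val X \<alpha> \<beta>)) \<and>
       (\<forall>\<beta>. tropical_tangent val X \<alpha> \<beta> \<longrightarrow>
          (\<exists>c. \<forall>I. card I = 2 \<longrightarrow> \<beta> I = (\<Sum>j\<in>-I. - \<alpha> $ j) + c)))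
     \<and>
     ((\<exists>V \<in> trop_vertices val {1..<n} f. \<alpha> \<in> V) \<and>
      (\<forall>i j. \<forall>J' :: 'n set. card J' + 3 = n \<longrightarrow>
         direction_span \<Lambda> \<inter> {a + b | a b. a \<in> tspan {axis i 1 + axis j 1} \<and> b \<in> coord_span J'}
           = tspan {}) \<longrightarrow>
       (\<forall>\<beta>. tropical_tangent val X \<alpha> \<beta> \<longleftrightarrow>
          (\<exists>l c.
             (\<forall>I. card I = 2 \<longrightarrow> \<beta> I = l I + (\<Sum>j\<in>-I. - \<alpha> $ j) + c) \<and>
             (\<forall>I. card I = 2 \<longrightarrow> l I \<ge> 0 \<and> l I \<in> value_group val) \<and>
             (\<forall>I I'. card I = 2 \<and> card I' = 2 \<and> l I \<noteq> 0 \<and> l I' \<noteq> 0 \<longrightarrow> I = I') \<and>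
             (\<forall>I. card I = 2 \<and>
                (\<exists>E \<in> trop_edges val {1..<n} f. \<alpha> \<in> E \<and> direction_span E \<subseteq> coord_span (-I)) \<longrightarrow>
                l I = 0))))"
proof -
  obtain idx :: "'n \<Rightarrow> nat" where idx: "bij_betw idx UNIV {0..n}"
    using finite_same_card_bij[of "UNIV :: 'n set" "{0..n}"] assms(4) by auto
  \<comment> \<open>\<open>undefined\<close> serves as an arbitrary coordinate \<open>i0\<close> to
    be normalized.\<close>
  interpret trop_setup val X f n idx undefined
    by unfold_locales (use assms idx in auto)
  let ?\<Lambda> = "affine_tangent_space (Trop val X) \<alpha>"
  have \<Lambda>: "direction_span ?\<Lambda> = direction_span \<Lambda>" by (simp only: assms(13))
  have gen1: "\<not> direction_span ?\<Lambda> \<subseteq> coord_span J" if "card J + 1 = n" for J :: "'n set"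
    unfolding \<Lambda> by (rule assms(14)[OF that])
  show ?thesis
  proof (intro conjI impI)
    assume "\<exists>E \<in> trop_edges val {1..<n} f. \<alpha> \<in> rel_interior E"
    then obtain p q where edge: "edge_terms \<alpha> p q" "dim (pair_kernel p q) = 2"
      using edge_interior by blast
    note case1 = edge_case[OF edge ne gen1]
    show "\<exists>\<beta>. tropical_tangent val X \<alpha> \<beta>" if "val_rational val \<alpha>"
      using case1(1) that by simp
    show "\<forall>\<beta>. tropical_tangent val X \<alpha> \<beta> \<longrightarrow>
          (\<exists>c. \<forall>I. card I = 2 \<longrightarrow> \<beta> I = (\<Sum>j\<in>-I. - \<alpha> $ j) + c)"
      by (intro allI impI) (rule case1(2))
  next
    assume H: "(\<exists>V \<in> trop_vertices val {1..<n} f. \<alpha> \<in> V) \<and>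
      (\<forall>i j. \<forall>J' :: 'n set. card J' + 3 = n \<longrightarrow>
         direction_span \<Lambda> \<inter> {a + b | a b. a \<in> tspan {axis i 1 + axis j 1} \<and> b \<in> coord_span J'}
           = tspan {})"
    then obtain V where V: "V \<in> trop_vertices val {1..<n} f" "\<alpha> \<in> V" by blast
    obtain k0 u1 u2 u3 p q B \<rho> where vs: "vertex_setup val X f n idx undefined \<alpha> k0 u1 u2 u3 p q B \<rho>"
      using vertex_data[OF V] by (elim exE)
    interpret vertex: vertex_setup val X f n idx undefined \<alpha> k0 u1 u2 u3 p q B \<rho> by (rule vs)
    interpret vertex: trop_vertex val X f n idx undefined \<alpha> k0 u1 u2 u3 p q B \<rho> by unfold_locales
    have gen2: "direction_span ?\<Lambda> \<inter> {a + b | a b. a \<in> tspan {axis i 1 + axis j 1} \<and> b \<in> coord_span J'} = tspan {}"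
      if "card J' + 3 = n" for i j and J' :: "'n set"
      unfolding \<Lambda> using H that by blast
    interpret vertex: generic_vertex val X f n idx undefined \<alpha> k0 u1 u2 u3 p q B \<rho>
      by (rule vertex.generic_vertexI[OF gen1 gen2])
    have edges: "(\<exists>E \<in> trop_edges val {1..<n} f. \<alpha> \<in> E \<and> direction_span E \<subseteq> coord_span (- {i, j})) \<longleftrightarrow>
        vertex.a i j = 0 \<or> vertex.b i j = 0 \<or> vertex.a i j = vertex.b i j" for i j
    proof
      show "\<exists>E \<in> trop_edges val {1..<n} f. \<alpha> \<in> E \<and> direction_span E \<subseteq> coord_span (- {i, j}) \<Longrightarrow>
        vertex.a i j = 0 \<or> vertex.b i j = 0 \<or> vertex.a i j = vertex.b i j"
        using vertex.edge_through_vertex_converse by blast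
      assume "vertex.a i j = 0 \<or> vertex.b i j = 0 \<or> vertex.a i j = vertex.b i j"
      then consider "vertex.om1 i = vertex.om1 j" | "- vertex.om2 i = - vertex.om2 j"
        | "vertex.om2 i - vertex.om1 i = vertex.om2 j - vertex.om1 j"
        unfolding vertex.a_def vertex.b_def by (auto simp: algebra_simps)
      then show "\<exists>E \<in> trop_edges val {1..<n} f. \<alpha> \<in> E \<and> direction_span E \<subseteq> coord_span (- {i, j})"
        by cases (rule vertex.edge_through_vertex[OF vertex.edge_dirs(1)]
          vertex.edge_through_vertex[OF vertex.edge_dirs(2)]
          vertex.edge_through_vertex[OF vertex.edge_dirs(3)], assumption)+
    qed
    have cond: "(\<forall>i j. i \<noteq> j \<and> (vertex.a i j = 0 \<or> vertex.b i j = 0 \<or> vertex.a i j = vertex.b i j) \<longrightarrow> l {i, j} = 0) \<longleftrightarrow>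
        (\<forall>I. card I = 2 \<and> (\<exists>E \<in> trop_edges val {1..<n} f. \<alpha> \<in> E \<and> direction_span E \<subseteq> coord_span (-I)) \<longrightarrow>
          l I = 0)" for l :: "'n set \<Rightarrow> real"
    proof (intro iffI allI impI)
      fix I :: "'n set"
      assume l: "\<forall>i j. i \<noteq> j \<and> (vertex.a i j = 0 \<or> vertex.b i j = 0 \<or> vertex.a i j = vertex.b i j) \<longrightarrow> l {i, j} = 0"
        and I: "card I = 2 \<and> (\<exists>E \<in> trop_edges val {1..<n} f. \<alpha> \<in> E \<and> direction_span E \<subseteq> coord_span (-I))"
      then have "\<exists>i j. I = {i, j} \<and> i \<noteq> j" by (simp only: card_2_iff)
      then obtain i j where ij: "I = {i, j}" "i \<noteq> j" by (elim exE conjE)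
      then show "l I = 0" using l I edges[of i j] by simp
    next
      fix i j
      assume l: "\<forall>I. card I = 2 \<and> (\<exists>E \<in> trop_edges val {1..<n} f. \<alpha> \<in> E \<and> direction_span E \<subseteq> coord_span (-I)) \<longrightarrow>
          l I = 0" and ij: "i \<noteq> j \<and> (vertex.a i j = 0 \<or> vertex.b i j = 0 \<or> vertex.a i j = vertex.b i j)"
      have "card {i, j} = 2" using ij by simp
      then show "l {i, j} = 0" using l edges[of i j] ij by blast
    qed
    show "\<forall>\<beta>. tropical_tangent val X \<alpha> \<beta> \<longleftrightarrow>
          (\<exists>l c.
             (\<forall>I. card I = 2 \<longrightarrow> \<beta> I = l I + (\<Sum>j\<in>-I. - \<alpha> $ j) + c) \<and>
             (\<forall>I. card I = 2 \<longrightarrow> l I \<ge> 0 \<and> l I \<in> value_group val) \<and>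
             (\<forall>I I'. card I = 2 \<and> card I' = 2 \<and> l I \<noteq> 0 \<and> l I' \<noteq> 0 \<longrightarrow> I = I') \<and>
             (\<forall>I. card I = 2 \<and>
                (\<exists>E \<in> trop_edges val {1..<n} f. \<alpha> \<in> E \<and> direction_span E \<subseteq> coord_span (-I)) \<longrightarrow>
                l I = 0))"
      unfolding vertex.vertex_tangents cond by (rule allI) (rule refl)
  qed
qed

end
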